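(* Let $\Omega\subset B_1\subset\mathbb{R}^d$ be an open set with $0\in\partial\Omega$ and let $\phi:B_1\to\mathbb{R}$ be a continuous function such that: (a) $\phi>0$ on $\Omega$ and $\phi\equiv 0$ on $B_1\setminus\Omega$; (b) $\phi$ is $L$-Lipschitz continuous on $B_1$, where $L>0$ is a given constant; (c) there is a constant $\kappa>0$ such that $\phi\ge\kappa\,\mathrm{dist}_{B_1\setminus\Omega}$ in $B_{1/2}$; (d) $\Delta\phi\ge 0$ in the sense of distributions in $B_1$; (e) there is a constant $\mu>0$ such that for every $x_0\in\partial\Omega\cap B_1$ we have $|B_r(x_0)\setminus\Omega|\ge\mu|B_r(x_0)|$ for every $r\in(0,1-|x_0|)$; (f) there is a constant $\Lambda>0$ such that for every $x_0\in\partial\Omega\cap B_1$ and every $r\in(0,1-|x_0|)$ we have $\big|\{0<\phi<rt\}\cap B_r(x_0)\big|\le\Lambda t|B_r|$ for every $t>0$; (g) there is a constant $\eta>0$ such that for every $x_0\in\partial\Omega\cap B_1$ and every $r\in(0,1-|x_0|)$ we have $\sup_{B_r(x_0)}\phi\ge\eta r$. Then there are constants $M>0$, $\delta\in(0,\eta]$ and $0<\rho<R\le 1$, depending only on the dimension $d$ and the constants $L,\kappa,\mu,\Lambda,\eta$, such that the following holds. If $u,v:B_1\to\mathbb{R}$ are nonnegative continuous functions satisfying $$\begin{cases}\Delta u=\Delta v=0\quad\text{in }\Omega\cap B_1,\\ u=v=0\quad\text{on }B_1\setminus\Omega,\\ u(P)=v(P)\quad\text{for some point }P\in B_R\cap\{\phi>\delta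 R\},\end{cases}$$ then $$\frac1M v\le u\le Mv\quad\text{in }B_\rho.$$
   Context: $B_r(x_0)$ is the open ball of radius $r$ centered at $x_0$ in $\mathbb{R}^d$, $B_r=B_r(0)$; $|E|$ is the Lebesgue measure of $E$; $\mathrm{dist}_{B_1\setminus\Omega}(x)$ is the distance from $x$ to the set $B_1\setminus\Omega$. *)

theory Defs
  imports "HOL-Analysis.Analysis"
begin

definition partial_deriv :: "'a::euclidean_space \<Rightarrow> ('a \<Rightarrow> real) \<Rightarrow> 'a \<Rightarrow> real" where
  "partial_deriv b f x = frechet_derivative f (at x) b"

(* Used for open S only: there differentiability within S is differentiability at the point,
   and this is the usual class of k times continuously differentiable functions. *)
primrec Ck_on :: "nat \<Rightarrow> ('a::euclidean_space \<Rightarrow> real) \<Rightarrow> 'a set \<Rightarrow> bool" where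
  "Ck_on 0 f S \<longleftrightarrow> continuous_on S f"
| "Ck_on (Suc k) f S \<longleftrightarrow>
     f differentiable_on S \<and> (\<forall>b\<in>Basis. Ck_on k (partial_deriv b f) S)"

definition laplacian :: "('a::euclidean_space \<Rightarrow> real) \<Rightarrow> 'a \<Rightarrow> real" where
  "laplacian f x = (\<Sum>b\<in>Basis. partial_deriv b (partial_deriv b f) x)"

definition harmonic_on :: "('a::euclidean_space \<Rightarrow> real) \<Rightarrow> 'a set \<Rightarrow> bool" where
  "harmonic_on f S \<longleftrightarrow> Ck_on 2 f S \<and> (\<forall>x\<in>S. laplacian f x = 0)"

definition test_function :: "'a::euclidean_space set \<Rightarrow> ('a \<Rightarrow> real) \<Rightarrow> bool" where
  "test_function S \<psi> \<longleftrightarrow> (\<forall>k. Ck_on k \<psi> UNIV) \<and>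
     compact (closure {x. \<psi> x \<noteq> 0}) \<and> closure {x. \<psi> x \<noteq> 0} \<subseteq> S"

(* The Laplacian of f is nonnegative on S in the sense of distributions.  Meant for open S and
   f locally integrable on S (here: continuous); the integrand is then integrable. *)
definition distr_laplacian_nonneg_on :: "('a::euclidean_space \<Rightarrow> real) \<Rightarrow> 'a set \<Rightarrow> bool" where
  "distr_laplacian_nonneg_on f S \<longleftrightarrow>
     (\<forall>\<psi>. test_function S \<psi> \<and> (\<forall>x. 0 \<le> \<psi> x) \<longrightarrow>
        0 \<le> (LINT x:S|lebesgue. f x * laplacian \<psi> x))"

end

theory Submission
  imports Defs
begin

text \<open>The proof uses only averages against a smooth radial kernel, in three ways.

  First, at a maximum of \<open>f x * g y / (norm (x - y) + a)\<^sup>2\<close>, where \<open>f\<close> and \<open>g\<close> are subharmonic where positive,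
  average \<open>f\<close> around \<open>x\<close> and \<open>g\<close> around \<open>y\<close> with increments that are mirror images of each other in the
  hyperplane between \<open>x\<close> and \<open>y\<close>. The exponent 2 is borderline for this second order test, and a barrier built
  from a ball on which \<open>f\<close> vanishes makes it strict. Two components of \<open>{\<phi> > \<tau>}\<close> that come close to each other
  therefore admit better and better pairs of points, against the Lipschitz bound. This replaces the
  monotonicity formula of Alt, Caffarelli and Friedman: near the origin \<open>{\<phi> > \<nu> R}\<close> lies in one component.

  Secondly, comparison with \<open>exp (- \<alpha> * (norm (y - z))\<^sup>2)\<close> shows that from any point of \<open>\<Omega>\<close> one reaches, at
  distance comparable to \<open>\<phi>\<close> and inside \<open>\<Omega>\<close>, a point where \<open>\<phi>\<close> is larger by a factor, so that Harnack chains
  exist, and that nonnegative subsolutions decay at the boundary because of exterior balls.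

  Thirdly, these facts give the Carleson estimate, and the iteration of De Silva and Savin applied to
  \<open>M v - u\<close> gives the comparison.\<close>

section \<open>Averages against a smooth radial kernel\<close>

text \<open>The borderline case has a model: for a unit vector \<open>e\<close> the functions
  \<open>max 0 (x \<bullet> e)\<close> and \<open>max 0 (- (x \<bullet> e))\<close> satisfy
  \<open>f x * g y \<le> (norm (x - y))\<^sup>2 / 4\<close>, with equality at all pairs mirrored in
  the hyperplane with \<open>x\<close> on the positive side. A test with exponent 2 can exclude two
  separate pieces only if something breaks this configuration. Here it is the density of the
  complement of \<Omega>, which provides a ball where both functions vanish. The barrier perturbs
  the weight by a parameter \<open>b\<close>; the gain is linear in \<open>b\<close> and the losses
  are quadratic, so a small \<open>b\<close> wins.

  The obstacle behind this is that \<Omega> need not be connected: Harnack chains compare values of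
  \<open>u\<close> within one component, and \<open>u P = v P\<close> is a normalisation in that
  component. What must be excluded is a second piece that comes near 0 with values of \<phi>
  proportional to the scale.

  The constants of each estimate are quantified before the domain and the functions, so they depend
  on the given numbers only. This also orders the choices: \<open>\<nu>\<close>, which becomes
  \<delta>, is fixed before the radius on which connectedness holds.\<close>

text \<open>The index \<open>k\<close> makes the family closed under differentiation.\<close>

definition flat_exp :: "nat \<Rightarrow> real \<Rightarrow> real" where
  "flat_exp k t = (if t > 0 then exp (- 1 / t) / t ^ k else 0)"

lemma flat_exp_nonneg: "0 \<le> flat_exp k t"
  by (simp add: flat_exp_def)

lemma flat_exp_pos: "0 < t \<Longrightarrow> 0 < flat_exp k t"
  by (simp add: flat_exp_def)

lemma flat_exp_nonpos_arg [simp]: "t \<le> 0 \<Longrightarrow> flat_exp k t = 0"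
  by (simp add: flat_exp_def)

text \<open>The term of index \<open>k + 2\<close> of the exponential series at \<open>1 / t\<close>
  already suffices. The two spare powers of \<open>t\<close> make the difference quotient at 0 tend
  to 0, for every \<open>k\<close>.\<close>

lemma flat_exp_le: "flat_exp k t \<le> fact (k + 2) * t\<^sup>2"
proof (cases "t > 0")
  case True
  have "(1 / t) ^ (k + 2) / fact (k + 2) \<le> exp (1 / t)"
  proof -
    have "(\<Sum>i\<in>{k + 2}. (1 / t) ^ i /\<^sub>R fact i) \<le> (\<Sum>i. (1 / t) ^ i /\<^sub>R fact i)"
      using True by (intro sum_le_suminf summable_exp_generic) auto
    then have "(1 / t) ^ (k + 2) /\<^sub>R fact (k + 2) \<le> exp (1 / t)"
      by (simp only: exp_def sum.insert finite.emptyI sum.empty) simp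
    then show ?thesis by (simp only: real_scaleR_def divide_inverse mult.commute)
  qed
  then have "1 / (t ^ (k + 2) * F) \<le> exp (1 / t)" if "F = fact (k + 2)" for F
    using that by (simp add: power_divide del: fact_Suc)
  then have "exp (- 1 / t) \<le> fact (k + 2) * t ^ (k + 2)"
    using True
    by (auto simp: exp_minus field_simps simp del: fact_Suc power_Suc power_add)
  then have "exp (- 1 / t) / t ^ k \<le> fact (k + 2) * t\<^sup>2"
    using True by (simp add: field_simps power_add power2_eq_square)
  then show ?thesis using True by (simp add: flat_exp_def)
qed simp

lemma DERIV_flat_exp:
  "(flat_exp k has_real_derivative (flat_exp (k + 2) t - real k * flat_exp (k + 1) t)) (at t)"
proof -
  consider "t > 0" | "t < 0" | "t = 0" by linarith
  then show ?thesis
  proof cases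
    case 1
    have "((\<lambda>t. exp (- 1 / t) / t ^ k) has_real_derivative
        (flat_exp (k + 2) t - real k * flat_exp (k + 1) t)) (at t)"
      using 1
      apply (cases k)
       apply (auto intro!: derivative_eq_intros simp: flat_exp_def field_simps power2_eq_square)
      subgoal for n by (cases n) auto
      done
    moreover have "eventually (\<lambda>s. s \<in> {0<..}) (nhds t)"
      using 1 by (intro eventually_nhds_in_open) auto
    then have "eventually (\<lambda>s. flat_exp k s = exp (- 1 / s) / s ^ k) (nhds t)"
      by (auto elim!: eventually_mono simp: flat_exp_def)
    ultimately show ?thesis
      by (subst DERIV_cong_ev) auto
  next
    case 2
    have "eventually (\<lambda>s. s \<in> {..<0}) (nhds t)"
      using 2 by (intro eventually_nhds_in_open) auto
    then have "eventually (\<lambda>s. flat_exp k s = 0) (nhds t)"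
      by (auto elim!: eventually_mono simp: flat_exp_def)
    then show ?thesis
      using 2 by (subst DERIV_cong_ev[where g="\<lambda>_. 0"]) auto
  next
    case 3
    have "(flat_exp k has_real_derivative 0) (at 0)"
      unfolding DERIV_def
    proof (rule Lim_null_comparison)
      show "eventually (\<lambda>h. norm ((flat_exp k (0 + h) - flat_exp k 0) / h) \<le> fact (k + 2) * \<bar>h\<bar>) (at 0)"
      proof (intro always_eventually allI)
        fix h :: real
        have "\<bar>flat_exp k h\<bar> \<le> (fact (k + 2) * \<bar>h\<bar>) * \<bar>h\<bar>"
          using flat_exp_le[of k h] flat_exp_nonneg[of k h]
          by (simp add: power2_eq_square mult.assoc)
        then show "norm ((flat_exp k (0 + h) - flat_exp k 0) / h) \<le> fact (k + 2) * \<bar>h\<bar>"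
          by (cases "h = 0") (auto simp: abs_divide divide_le_eq)
      qed
      show "((\<lambda>h. fact (k + 2) * \<bar>h\<bar>) \<longlongrightarrow> (0::real)) (at 0)"
        by (rule tendsto_eq_intros | simp)+
    qed
    then show ?thesis using 3 by simp
  qed
qed

lemma flat_exp_has_derivative [derivative_intros]:
  assumes "(f has_derivative f') (at x within S)"
  shows "((\<lambda>x. flat_exp k (f x)) has_derivative
           (\<lambda>h. f' h * (flat_exp (k + 2) (f x) - real k * flat_exp (k + 1) (f x)))) (at x within S)"
  using has_derivative_compose[OF assms DERIV_flat_exp[THEN has_field_derivative_imp_has_derivative]]
  by (simp add: mult.commute)

lemma continuous_on_flat_exp [continuous_intros]:
  assumes "continuous_on S f"
  shows "continuous_on S (\<lambda>x. flat_exp k (f x))"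
proof -
  have "continuous_on UNIV (flat_exp k)"
    using DERIV_flat_exp by (intro DERIV_continuous_on) auto
  then show ?thesis
    using assms continuous_on_compose2 by blast
qed

section \<open>Smooth bump functions and their Laplacians\<close>

text \<open>Closure under partial derivatives is the point of these rules: smoothness of every order
  then follows by one induction on the order. Coordinates appear as factors when
  \<open>(norm (w - a))\<^sup>2\<close> is differentiated.\<close>

inductive smooth_bump :: "('a::euclidean_space \<Rightarrow> real) \<Rightarrow> bool" where
  base: "smooth_bump (\<lambda>w. flat_exp k (1 - s * (norm (w - a))\<^sup>2))"
| cmul: "smooth_bump f \<Longrightarrow> smooth_bump (\<lambda>w. c * f w)"
| coord: "smooth_bump f \<Longrightarrow> smooth_bump (\<lambda>w. (w \<bullet> b) * f w)"
| add: "smooth_bump f \<Longrightarrow> smooth_bump g \<Longrightarrow> smooth_bump (\<lambda>w. f w + g w)"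

lemma has_derivative_dist_square:
  "((\<lambda>w::'a::euclidean_space. (norm (w - a))\<^sup>2) has_derivative (\<lambda>h. 2 * ((w - a) \<bullet> h))) (at w within S)"
  unfolding power2_norm_eq_inner
  by (auto intro!: derivative_eq_intros simp: inner_commute)

lemma has_derivative_bump_base:
  "((\<lambda>w::'a::euclidean_space. flat_exp k (1 - s * (norm (w - a))\<^sup>2)) has_derivative
     (\<lambda>h. - 2 * s * ((w - a) \<bullet> h) * (flat_exp (k + 2) (1 - s * (norm (w - a))\<^sup>2)
        - real k * flat_exp (k + 1) (1 - s * (norm (w - a))\<^sup>2)))) (at w within S)"
  by (rule derivative_eq_intros has_derivative_dist_square refl | simp add: fun_eq_iff algebra_simps)+

lemma partial_deriv_eq:
  "(f has_derivative f') (at x) \<Longrightarrow> partial_deriv b f x = f' b"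
  unfolding partial_deriv_def by (metis frechet_derivative_at)

lemma smooth_bump_deriv:
  assumes "smooth_bump f"
  shows "(\<forall>x. f differentiable (at x)) \<and> (\<forall>b. smooth_bump (partial_deriv b f))"
  using assms
proof (induction)
  case (base k s a)
  let ?F = "\<lambda>j w. flat_exp j (1 - s * (norm (w - a))\<^sup>2)"
  \<comment> \<open>The factor \<open>(w - a) \<bullet> b\<close> is expanded into
    \<open>w \<bullet> b\<close> and \<open>a \<bullet> b\<close>, so that the right side is
    literally built by the rules \<open>coord\<close>, \<open>cmul\<close> and
    \<open>add\<close>.\<close>
  have "partial_deriv b (?F k) =
     (\<lambda>w. (w \<bullet> b) * ((-2 * s) * ?F (k + 2) w + (2 * s * real k) * ?F (k + 1) w)
        + ((2 * s * (a \<bullet> b)) * ?F (k + 2) w + (- 2 * s * real k * (a \<bullet> b)) * ?F (k + 1) w))" for b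
    by (rule ext, subst partial_deriv_eq[OF has_derivative_bump_base])
       (simp add: algebra_simps)
  moreover have "smooth_bump (\<lambda>w. (w \<bullet> b) * ((-2 * s) * ?F (k + 2) w + (2 * s * real k) * ?F (k + 1) w)
        + ((2 * s * (a \<bullet> b)) * ?F (k + 2) w + (- 2 * s * real k * (a \<bullet> b)) * ?F (k + 1) w))" for b
    by (rule smooth_bump.add smooth_bump.coord smooth_bump.cmul smooth_bump.base)+
  ultimately have "smooth_bump (partial_deriv b (?F k))" for b
    by (simp only:)
  moreover have "?F k differentiable (at x)" for x
    using has_derivative_bump_base differentiable_def by blast
  ultimately show ?case by blast
next
  case (cmul f c)
  then have "(f has_derivative frechet_derivative f (at x)) (at x)" for x
    by (simp add: frechet_derivative_works[symmetric])
  then have d: "((\<lambda>w. c * f w) has_derivative (\<lambda>h. c * frechet_derivative f (at x) h)) (at x)" for x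
    by (auto intro!: derivative_eq_intros)
  then have "partial_deriv b (\<lambda>w. c * f w) = (\<lambda>w. c * partial_deriv b f w)" for b
    using partial_deriv_eq[OF d] by (auto simp: partial_deriv_def)
  then show ?case
    using differentiableI[OF d] cmul.IH by (auto intro!: smooth_bump.intros(2-4))
next
  case (coord f b')
  then have "(f has_derivative frechet_derivative f (at x)) (at x)" for x
    by (simp add: frechet_derivative_works[symmetric])
  then have d: "((\<lambda>w. (w \<bullet> b') * f w) has_derivative
      (\<lambda>h. (x \<bullet> b') * frechet_derivative f (at x) h + (h \<bullet> b') * f x)) (at x)" for x
    by (auto intro!: derivative_eq_intros)
  then have "partial_deriv b (\<lambda>w. (w \<bullet> b') * f w)
      = (\<lambda>w. (w \<bullet> b') * partial_deriv b f w + (b \<bullet> b') * f w)" for b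
    using partial_deriv_eq[OF d] by (auto simp: partial_deriv_def)
  then show ?case
    using differentiableI[OF d] coord.IH coord.hyps by (auto intro!: smooth_bump.intros(2-4))
next
  case (add f g)
  then have "(f has_derivative frechet_derivative f (at x)) (at x)"
    "(g has_derivative frechet_derivative g (at x)) (at x)" for x
    by (simp_all add: frechet_derivative_works[symmetric])
  then have d: "((\<lambda>w. f w + g w) has_derivative
      (\<lambda>h. frechet_derivative f (at x) h + frechet_derivative g (at x) h)) (at x)" for x
    by (auto intro!: derivative_eq_intros)
  then have "partial_deriv b (\<lambda>w. f w + g w)
      = (\<lambda>w. partial_deriv b f w + partial_deriv b g w)" for b
    using partial_deriv_eq[OF d] by (auto simp: partial_deriv_def)
  then show ?case
    using differentiableI[OF d] add.IH by (auto intro!: smooth_bump.intros(2-4))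
qed

lemma Ck_on_smooth_bump: "smooth_bump f \<Longrightarrow> Ck_on k f S"
proof (induction k arbitrary: f)
  case 0
  then show ?case
    using smooth_bump_deriv[of f] differentiable_at_imp_differentiable_on[of S f]
    by (auto intro!: differentiable_imp_continuous_on)
next
  case (Suc k)
  then show ?case
    using smooth_bump_deriv[of f] differentiable_at_imp_differentiable_on[of S f] by auto
qed

definition bump :: "'a::euclidean_space \<Rightarrow> real \<Rightarrow> 'a \<Rightarrow> real" where
  "bump a t w = flat_exp 0 (1 - (norm (w - a))\<^sup>2 / t\<^sup>2)"

lemma smooth_bump_bump: "smooth_bump (bump a t)"
  using smooth_bump.base[of 0 "1 / t\<^sup>2" a] by (simp add: bump_def[abs_def])

lemma smooth_bump_continuous_on: "smooth_bump f \<Longrightarrow> continuous_on S f"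
  using Ck_on_smooth_bump[of f 0] by simp

lemma bump_eq_0: "t > 0 \<Longrightarrow> t \<le> norm (w - a) \<Longrightarrow> bump a t w = 0"
  by (simp add: bump_def divide_simps power_mono)

lemma bump_nonneg: "0 \<le> bump a t w"
  by (simp add: bump_def flat_exp_nonneg)

text \<open>The gradient is a multiple of \<open>w - a\<close> times the profile
  \<open>flat_exp 2\<close>; it is this profile that reappears as the averaging kernel.\<close>

lemma partial_deriv_bump:
  "partial_deriv b (bump a t) w = - (2 / t\<^sup>2) * ((w - a) \<bullet> b) * flat_exp 2 (1 - (norm (w - a))\<^sup>2 / t\<^sup>2)"
proof -
  have "bump a t = (\<lambda>w. flat_exp 0 (1 - (1 / t\<^sup>2) * (norm (w - a))\<^sup>2))"
    by (simp add: bump_def[abs_def])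
  then show ?thesis
    using partial_deriv_eq[OF has_derivative_bump_base[of 0 "1 / t\<^sup>2" a w], of b]
    by (simp add: numeral_2_eq_2[symmetric])
qed

lemma laplacian_bump:
  fixes a w :: "'a::euclidean_space" and t :: real
  defines "\<rho> \<equiv> 1 - (norm (w - a))\<^sup>2 / t\<^sup>2"
  shows "laplacian (bump a t) w =
    - (2 * real DIM('a) / t\<^sup>2) * flat_exp 2 \<rho>
    + 4 * (norm (w - a))\<^sup>2 / t ^ 4 * (flat_exp 4 \<rho> - 2 * flat_exp 3 \<rho>)"
proof -
  have "partial_deriv b (partial_deriv b (bump a t)) w =
     - 2 / t\<^sup>2 * flat_exp 2 \<rho> + 4 / t ^ 4 * ((w - a) \<bullet> b)\<^sup>2 * (flat_exp 4 \<rho> - 2 * flat_exp 3 \<rho>)"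
    if "b \<in> Basis" for b
  proof -
    have eq: "partial_deriv b (bump a t) =
       (\<lambda>w. (- (2 / t\<^sup>2) * ((w - a) \<bullet> b)) * flat_exp 2 (1 - (1 / t\<^sup>2) * (norm (w - a))\<^sup>2))"
      by (rule ext) (simp add: partial_deriv_bump)
    have "((\<lambda>w. (- (2 / t\<^sup>2) * ((w - a) \<bullet> b)) * flat_exp 2 (1 - (1 / t\<^sup>2) * (norm (w - a))\<^sup>2)) has_derivative
        (\<lambda>h. (- (2 / t\<^sup>2) * ((w - a) \<bullet> b)) * (- 2 * (1 / t\<^sup>2) * ((w - a) \<bullet> h) * (flat_exp 4 \<rho>
        - 2 * flat_exp 3 \<rho>)) + (- (2 / t\<^sup>2) * (h \<bullet> b)) * flat_exp 2 \<rho>)) (at w)"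
      by (rule derivative_eq_intros has_derivative_bump_base refl)+
         (auto simp: \<rho>_def fun_eq_iff)
    from partial_deriv_eq[OF this, of b] show ?thesis
      unfolding eq using that
      by (simp add: inner_Basis power2_eq_square power4_eq_xxxx field_simps)
  qed
  then have "laplacian (bump a t) w = (\<Sum>b\<in>Basis. - 2 / t\<^sup>2 * flat_exp 2 \<rho>
     + 4 / t ^ 4 * ((w - a) \<bullet> b)\<^sup>2 * (flat_exp 4 \<rho> - 2 * flat_exp 3 \<rho>))"
    unfolding laplacian_def by simp
  also have "\<dots> = - (2 * real DIM('a) / t\<^sup>2) * flat_exp 2 \<rho>
     + 4 / t ^ 4 * (\<Sum>b\<in>Basis. ((w - a) \<bullet> b)\<^sup>2) * (flat_exp 4 \<rho> - 2 * flat_exp 3 \<rho>)"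
    by (simp add: sum.distrib sum_subtractf sum_distrib_left sum_distrib_right sum_negf)
  also have "(\<Sum>b\<in>Basis. ((w - a) \<bullet> b)\<^sup>2) = (norm (w - a))\<^sup>2"
    unfolding power2_norm_eq_inner by (subst euclidean_inner) (simp add: power2_eq_square)
  finally show ?thesis by simp
qed

section \<open>Integration by parts and Green's identity\<close>

text \<open>The integral of \<open>F (x + s *\<^sub>R b)\<close> over the box is the same for all
  \<open>\<bar>s\<bar> \<le> 1\<close>, and its derivative at \<open>s = 0\<close> is the integral
  of \<open>F'\<close>. The margin \<open>norm b\<close> keeps the translated support inside the
  box.\<close>

lemma has_integral_0_partial_deriv:
  fixes F F' :: "'a::euclidean_space \<Rightarrow> real"
  assumes deriv: "\<And>x. ((\<lambda>s. F (x + s *\<^sub>R b)) has_real_derivative F' x) (at 0)"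
    and contF: "continuous_on UNIV F" and contF': "continuous_on UNIV F'"
    and supp: "\<And>x. norm x > R \<Longrightarrow> F x = 0"
    and box: "cball 0 (R + norm b) \<subseteq> cbox c d"
  shows "integral (cbox c d) F' = 0"
proof -
  have F_int: "(F has_integral integral UNIV F) (cbox c' d')" if "cball 0 R \<subseteq> cbox c' d'" for c' d'
  proof -
    have "F integrable_on cbox c' d'"
      using contF continuous_on_subset by (intro integrable_continuous) blast
    moreover have out: "F x = 0" if "x \<notin> cbox c' d'" for x
      using that \<open>cball 0 R \<subseteq> cbox c' d'\<close> supp[of x] by force
    ultimately have "(F has_integral integral (cbox c' d') F) UNIV"
      using has_integral_on_superset[of F _ "cbox c' d'" UNIV] by (auto simp: integrable_integral)
    with \<open>F integrable_on cbox c' d'\<close> show ?thesis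
      by (metis integrable_integral integral_unique)
  qed
  have const: "integral (cbox c d) (\<lambda>x. F (x + s *\<^sub>R b)) = integral UNIV F" if "s \<in> {-1..1}" for s
  proof -
    have "cball 0 R \<subseteq> cbox (c + s *\<^sub>R b) (d + s *\<^sub>R b)"
    proof
      fix x :: 'a assume "x \<in> cball 0 R"
      have "norm (x - s *\<^sub>R b) \<le> norm x + \<bar>s\<bar> * norm b"
        using norm_triangle_ineq4[of x "s *\<^sub>R b"] by simp
      also have "\<dots> \<le> R + 1 * norm b"
        using \<open>x \<in> cball 0 R\<close> that by (intro add_mono mult_right_mono) auto
      finally have "x - s *\<^sub>R b \<in> cbox c d" using box by auto
      then show "x \<in> cbox (c + s *\<^sub>R b) (d + s *\<^sub>R b)"
        by (auto simp: mem_box algebra_simps)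
    qed
    from F_int[OF this] have "((F \<circ> ((+) (s *\<^sub>R b))) has_integral integral UNIV F) (cbox c d)"
      by (simp add: has_integral_shift_cbox_iff)
    then show ?thesis by (simp add: o_def add.commute integral_unique)
  qed
  have "((\<lambda>s. integral (cbox c d) (\<lambda>x. F (x + s *\<^sub>R b))) has_real_derivative
      integral (cbox c d) (\<lambda>x. F' (x + 0 *\<^sub>R b))) (at 0 within {-1..1})"
  proof (rule leibniz_rule_field_derivative)
    show "((\<lambda>s. F (x + s *\<^sub>R b)) has_real_derivative F' (x + s0 *\<^sub>R b)) (at s0 within {-1..1})" for x s0
    proof -
      have "((\<lambda>s. F ((x + s0 *\<^sub>R b) + s *\<^sub>R b)) has_real_derivative F' (x + s0 *\<^sub>R b)) (at (s0 - s0))"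
        using deriv[of "x + s0 *\<^sub>R b"] by simp
      then have "((\<lambda>s. F ((x + s0 *\<^sub>R b) + (s - s0) *\<^sub>R b)) has_real_derivative F' (x + s0 *\<^sub>R b)) (at s0)"
        using DERIV_shift[of "\<lambda>s. F ((x + s0 *\<^sub>R b) + (s - s0) *\<^sub>R b)" _ 0 s0] by simp
      then show ?thesis
        by (simp add: algebra_simps has_field_derivative_at_within)
    qed
    show "(\<lambda>x. F (x + s *\<^sub>R b)) integrable_on cbox c d" for s
      by (intro integrable_continuous continuous_on_compose2[OF contF] continuous_intros) auto
    show "continuous_on ({-1..1} \<times> cbox c d) (\<lambda>(s, x). F' (x + s *\<^sub>R b))"
      unfolding case_prod_beta
      by (intro continuous_on_compose2[OF contF'] continuous_intros) auto
  qed auto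
  moreover have "((\<lambda>s. integral (cbox c d) (\<lambda>x. F (x + s *\<^sub>R b))) has_real_derivative 0) (at 0 within {-1..1})"
    by (rule has_field_derivative_transform_within[of "\<lambda>_. integral UNIV F" _ _ _ 1])
       (use const in auto)
  moreover have "at 0 within {-1..1} = at (0::real)"
    by (rule at_within_interior) auto
  ultimately show ?thesis
    by (metis (no_types, lifting) DERIV_unique add.right_neutral integral_cong scaleR_zero_left)
qed

lemma integral_eq_integral_UNIV:
  fixes f :: "'a::euclidean_space \<Rightarrow> real"
  assumes "\<And>x. x \<notin> S \<Longrightarrow> f x = 0"
  shows "integral S f = integral UNIV f"
proof -
  have "(\<lambda>x. if x \<in> S then f x else 0) = f" using assms by auto
  then show ?thesis
    using Henstock_Kurzweil_Integration.integral_restrict_UNIV[of S f] by simp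
qed

lemma cball_subset_cube:
  fixes x :: "'a::euclidean_space"
  shows "cball x t \<subseteq> cbox (x - t *\<^sub>R One) (x + t *\<^sub>R One)"
proof
  fix y assume "y \<in> cball x t"
  then have "\<bar>(y - x) \<bullet> i\<bar> \<le> t" if "i \<in> Basis" for i
    using Basis_le_norm[OF that, of "y - x"] by (simp add: dist_norm norm_minus_commute)
  then show "y \<in> cbox (x - t *\<^sub>R One) (x + t *\<^sub>R One)"
    by (force simp: mem_box inner_diff_left inner_add_left abs_le_iff)
qed

lemma cube_subset_cball:
  fixes x :: "'a::euclidean_space"
  shows "cbox (x - t *\<^sub>R One) (x + t *\<^sub>R One) \<subseteq> cball x (t * DIM('a))"
proof
  fix y assume y: "y \<in> cbox (x - t *\<^sub>R One) (x + t *\<^sub>R One)"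
  have "norm (y - x) \<le> (\<Sum>i\<in>Basis. \<bar>(y - x) \<bullet> i\<bar>)"
    by (rule norm_le_l1)
  also have "\<dots> \<le> (\<Sum>i\<in>(Basis::'a set). t)"
    using y by (intro sum_mono) (force simp: mem_box inner_diff_left inner_add_left abs_le_iff)
  finally show "y \<in> cball x (t * DIM('a))"
    by (simp add: dist_norm norm_minus_commute mult.commute)
qed

text \<open>Green's identity: the functions \<open>G b\<close> are the components of
  \<open>u\<close> times the gradient of the bump minus the bump times the gradient of
  \<open>u\<close>, and the derivatives \<open>G' b\<close> add up to \<open>u\<close> times the
  Laplacian of the bump because \<open>u\<close> is harmonic.\<close>

lemma integral_bump_laplacian_harmonic:
  fixes u :: "'a::euclidean_space \<Rightarrow> real"
  assumes "open U" and u: "harmonic_on u U" and "t > 0" and "cball x t \<subseteq> U"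
    and C: "cball x t \<subseteq> cbox c d" "cbox c d \<subseteq> U"
  shows "integral (cbox c d) (\<lambda>w. u w * laplacian (bump x t) w) = 0"
proof -
  have du: "(u has_derivative frechet_derivative u (at y)) (at y)" if "y \<in> U" for y
    using u that \<open>open U\<close> unfolding harmonic_on_def numeral_2_eq_2 Ck_on.simps
    by (metis at_within_open differentiable_on_def frechet_derivative_works)
  have ddu: "(partial_deriv b u has_derivative frechet_derivative (partial_deriv b u) (at y)) (at y)"
    if "y \<in> U" "b \<in> Basis" for y b
    using u that \<open>open U\<close> unfolding harmonic_on_def numeral_2_eq_2 Ck_on.simps
    by (metis at_within_open differentiable_on_def frechet_derivative_works)
  have cont: "continuous_on U (partial_deriv b (partial_deriv b u))" if "b \<in> Basis" for b
    using u that unfolding harmonic_on_def numeral_2_eq_2 Ck_on.simps by auto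
  let ?\<psi> = "bump x t"
  have smooth: "smooth_bump (partial_deriv b ?\<psi>)" "smooth_bump (partial_deriv b (partial_deriv b ?\<psi>))" for b
    using smooth_bump_deriv smooth_bump_bump by blast+
  have d\<psi>: "(?\<psi> has_derivative frechet_derivative ?\<psi> (at y)) (at y)"
    "(partial_deriv b ?\<psi> has_derivative frechet_derivative (partial_deriv b ?\<psi>) (at y)) (at y)" for y b
    using smooth_bump_deriv[OF smooth_bump_bump] smooth_bump_deriv[OF smooth(1)]
    by (auto simp: frechet_derivative_works[symmetric])
  \<comment> \<open>Extended by 0, \<open>G b\<close> is defined on the whole space. It is regular
    there because it vanishes on the open set \<open>- cball x t\<close>, which together with
    \<open>U\<close> covers the space.\<close>
  define G where "G b y = (if y \<in> U then u y * partial_deriv b ?\<psi> y - ?\<psi> y * partial_deriv b u y else 0)" for b y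
  define G' where "G' b y = (if y \<in> U then u y * partial_deriv b (partial_deriv b ?\<psi>) y
      - ?\<psi> y * partial_deriv b (partial_deriv b u) y else 0)" for b y
  have dpsi0: "partial_deriv b ?\<psi> y = 0" if "y \<notin> cball x t" for b y
    using that \<open>t > 0\<close> by (simp add: partial_deriv_bump dist_norm norm_minus_commute divide_simps power_mono)
  have ddpsi0: "partial_deriv b (partial_deriv b ?\<psi>) y = 0" if "y \<notin> cball x t" for b y
  proof -
    have "(partial_deriv b ?\<psi> has_derivative (\<lambda>_. 0)) (at y)"
      by (rule has_derivative_transform_within_open[of "\<lambda>_. 0" "\<lambda>_. 0" y UNIV "- cball x t"])
         (use that dpsi0 in auto)
    then show ?thesis by (rule partial_deriv_eq)
  qed
  have psi0: "?\<psi> y = 0" if "y \<notin> cball x t" for y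
    using that \<open>t > 0\<close> bump_eq_0[of t y x] by (simp add: dist_norm norm_minus_commute)
  have G0: "G b y = 0" "G' b y = 0" if "y \<notin> cball x t" for b y
    using that dpsi0 ddpsi0 psi0 by (auto simp: G_def G'_def)
  have cover: "UNIV = U \<union> - cball x t" using assms by auto
  have contu: "continuous_on U u" "\<And>b. b \<in> Basis \<Longrightarrow> continuous_on U (partial_deriv b u)"
    using du ddu by (meson continuous_at_imp_continuous_on has_derivative_continuous)+
  note contp = smooth_bump_continuous_on[OF smooth_bump_bump] smooth_bump_continuous_on[OF smooth(1)]
    smooth_bump_continuous_on[OF smooth(2)]
  have contG: "continuous_on UNIV (G b)" "continuous_on UNIV (G' b)" if "b \<in> Basis" for b
  proof -
    have "continuous_on U (G b)"
      by (rule continuous_on_eq[of _ "\<lambda>y. u y * partial_deriv b ?\<psi> y - ?\<psi> y * partial_deriv b u y"])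
         (auto simp: G_def intro!: continuous_intros contu contp that)
    moreover have "continuous_on (- cball x t) (G b)"
      by (rule continuous_on_eq[of _ "\<lambda>_. 0"]) (auto simp: G0)
    ultimately show "continuous_on UNIV (G b)"
      unfolding cover using \<open>open U\<close> by (intro continuous_on_open_Un) auto
    have "continuous_on U (G' b)"
      by (rule continuous_on_eq[of _ "\<lambda>y. u y * partial_deriv b (partial_deriv b ?\<psi>) y
            - ?\<psi> y * partial_deriv b (partial_deriv b u) y"])
         (auto simp: G'_def intro!: continuous_intros contu cont contp that)
    moreover have "continuous_on (- cball x t) (G' b)"
      by (rule continuous_on_eq[of _ "\<lambda>_. 0"]) (auto simp: G0)
    ultimately show "continuous_on UNIV (G' b)"
      unfolding cover using \<open>open U\<close> by (intro continuous_on_open_Un) auto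
  qed
  have derG: "((\<lambda>s. G b (y + s *\<^sub>R b)) has_real_derivative G' b y) (at 0)" if b: "b \<in> Basis" for b y
  proof -
    have line: "((\<lambda>s. f (y + s *\<^sub>R b)) has_real_derivative D b) (at 0)"
      if "(f has_derivative D) (at y)" for f :: "'a \<Rightarrow> real" and D
    proof -
      have D: "(f has_derivative D) (at (y + 0 *\<^sub>R b))" using that by simp
      have "((\<lambda>s. f (y + s *\<^sub>R b)) has_derivative (\<lambda>s. D (s *\<^sub>R b))) (at 0)"
        by (rule has_derivative_compose[of "\<lambda>s. y + s *\<^sub>R b", OF _ D]) (auto intro!: derivative_eq_intros)
      moreover have "D (s *\<^sub>R b) = s * D b" for s
        using linear_scale[OF has_derivative_linear[OF that]] by simp
      ultimately show ?thesis
        by (simp add: has_field_derivative_def mult_commute_abs)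
    qed
    show ?thesis
    proof (cases "y \<in> U")
      case True
      have "((\<lambda>y. u y * partial_deriv b ?\<psi> y - ?\<psi> y * partial_deriv b u y) has_derivative
        (\<lambda>h. u y * frechet_derivative (partial_deriv b ?\<psi>) (at y) h
        + frechet_derivative u (at y) h * partial_deriv b ?\<psi> y
        - (?\<psi> y * frechet_derivative (partial_deriv b u) (at y) h
          + frechet_derivative ?\<psi> (at y) h * partial_deriv b u y))) (at y)"
        by (intro derivative_intros du ddu d\<psi> True b)
      then have "(G b has_derivative (\<lambda>h. u y * frechet_derivative (partial_deriv b ?\<psi>) (at y) h
        + frechet_derivative u (at y) h * partial_deriv b ?\<psi> y
        - (?\<psi> y * frechet_derivative (partial_deriv b u) (at y) h
          + frechet_derivative ?\<psi> (at y) h * partial_deriv b u y))) (at y)"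
        by (rule has_derivative_transform_within_open[OF _ \<open>open U\<close> True]) (simp add: G_def)
      from line[OF this] show ?thesis
        using True by (simp add: G'_def partial_deriv_def)
    next
      case False
      then have "y \<in> - cball x t" using assms by auto
      then have "(G b has_derivative (\<lambda>_. 0)) (at y)"
        by (intro has_derivative_transform_within_open[of "\<lambda>_. 0" "\<lambda>_. 0" y UNIV "- cball x t" "G b"])
           (auto simp: G0)
      from line[OF this] show ?thesis using False by (simp add: G'_def)
    qed
  qed
  define R where "R = norm x + t"
  obtain e where e: "cball 0 (R + 1) \<subseteq> cbox (- e) (e::'a)"
    using bounded_subset_cbox_symmetric[of "cball 0 (R + 1)"] by auto
  have zero: "integral (cbox (- e) e) (G' b) = 0" if "b \<in> Basis" for b
  proof (rule has_integral_0_partial_deriv[where F="G b" and b=b and R=R])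
    fix y :: 'a assume "norm y > R"
    then have "y \<notin> cball x t"
      using norm_triangle_ineq2[of y x] by (auto simp: R_def dist_norm norm_minus_commute)
    then show "G b y = 0" by (rule G0)
  qed (use that contG derG e in auto)
  have eq: "u w * laplacian ?\<psi> w = (\<Sum>b\<in>Basis. G' b w)" if "w \<in> U" for w
  proof -
    have "(\<Sum>b\<in>Basis. G' b w) = u w * laplacian ?\<psi> w - ?\<psi> w * laplacian u w"
      using that by (simp add: G'_def laplacian_def sum_subtractf sum_distrib_left)
    then show ?thesis using u that by (simp add: harmonic_on_def)
  qed
  have intG: "G' b integrable_on cbox c d" if "b \<in> Basis" for b
    by (rule integrable_continuous[OF continuous_on_subset[OF contG(2)[OF that] subset_UNIV]])
  have "integral (cbox c d) (\<lambda>w. u w * laplacian ?\<psi> w) = integral (cbox c d) (\<lambda>w. \<Sum>b\<in>Basis. G' b w)"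
    using C eq by (intro integral_cong) auto
  also have "\<dots> = (\<Sum>b\<in>Basis. integral (cbox c d) (G' b))"
    using intG by (intro integral_sum) auto
  also have "integral (cbox c d) (G' b) = 0" if "b \<in> Basis" for b
  proof -
    have out: "G' b w = 0" if "w \<notin> cball x t" for w using G0 that by auto
    have "integral (cbox c d) (G' b) = integral UNIV (G' b)"
      using C out by (intro integral_eq_integral_UNIV) blast
    also have "\<dots> = integral (cbox (- e) e) (G' b)"
    proof -
      have "cball x t \<subseteq> cbox (- e) e"
      proof
        fix y assume "y \<in> cball x t"
        then have "norm y \<le> R + 1"
          using norm_triangle_ineq2[of y x] by (auto simp: R_def dist_norm norm_minus_commute)
        then show "y \<in> cbox (- e) e" using e by auto
      qed
      then show ?thesis
        using out by (intro integral_eq_integral_UNIV[symmetric]) blast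
    qed
    finally show ?thesis using zero[OF that] by simp
  qed
  then have "(\<Sum>b\<in>Basis. integral (cbox c d) (G' b)) = 0" by simp
  finally show ?thesis .
qed

text \<open>The exponent 2 is chosen such that the derivative in \<open>t\<close> of the kernel rescaled to radius \<open>t\<close> is a
  positive multiple of the Laplacian of \<open>bump x t\<close>: averages of subharmonic functions increase with \<open>t\<close>.\<close>

definition kern :: "'a::euclidean_space \<Rightarrow> real" where
  "kern z = flat_exp 2 (1 - (norm z)\<^sup>2)
     / integral (cbox (- One) (One::'a)) (\<lambda>z. flat_exp 2 (1 - (norm z)\<^sup>2))"

definition avg :: "('a::euclidean_space \<Rightarrow> real) \<Rightarrow> 'a \<Rightarrow> real \<Rightarrow> real" where
  "avg f x t = integral (cbox (- One) One) (\<lambda>z. kern z * f (x + t *\<^sub>R z))"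

lemma integral_flat_exp_pos:
  "0 < integral (cbox (- One) (One::'a::euclidean_space)) (\<lambda>z. flat_exp k (1 - (norm z)\<^sup>2))" (is "0 < ?I")
proof -
  have cont: "continuous_on (cbox (- One) (One::'a)) (\<lambda>z. flat_exp k (1 - (norm z)\<^sup>2))"
    by (intro continuous_intros)
  have "0 \<le> ?I"
    by (intro integral_nonneg integrable_continuous cont) (simp add: flat_exp_nonneg)
  moreover have "?I \<noteq> 0"
  proof
    assume "?I = 0"
    then have "((\<lambda>z. flat_exp k (1 - (norm z)\<^sup>2)) has_integral 0) (cbox (- One) (One::'a))"
      using integrable_integral[OF integrable_continuous[OF cont]] by simp
    moreover have "box (- One) (One::'a) \<noteq> {}"
      by (auto simp: box_ne_empty)
    ultimately have "flat_exp k (1 - (norm (0::'a))\<^sup>2) = 0"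
      by (intro has_integral_0_cbox_imp_0[OF cont]) (auto simp: flat_exp_nonneg mem_box)
    then show False by (simp add: flat_exp_def)
  qed
  ultimately show ?thesis by linarith
qed

lemma kern_nonneg: "0 \<le> kern z"
  unfolding kern_def
  by (intro divide_nonneg_nonneg flat_exp_nonneg less_imp_le[OF integral_flat_exp_pos])

lemma kern_pos: "norm z < 1 \<Longrightarrow> 0 < kern z"
  using integral_flat_exp_pos by (auto simp: kern_def power_less_one_iff intro!: divide_pos_pos flat_exp_pos)

lemma kern_eq_0: "1 \<le> norm z \<Longrightarrow> kern z = 0"
  by (simp add: kern_def one_le_power)

lemma continuous_on_kern [continuous_intros]: "continuous_on S f \<Longrightarrow> continuous_on S (\<lambda>x. kern (f x))"
  unfolding kern_def using integral_flat_exp_pos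
  by (auto intro!: continuous_intros simp: less_imp_neq[OF integral_flat_exp_pos, symmetric])

lemma unit_cube_norm: "z \<in> cbox (- One) (One::'a::euclidean_space) \<Longrightarrow> norm z \<le> DIM('a)"
  using cube_subset_cball[of 0 1] by (auto simp: subset_eq dist_norm)

lemma unit_ball_cube: "norm z \<le> 1 \<Longrightarrow> z \<in> cbox (- One) (One::'a::euclidean_space)"
  using cball_subset_cube[of 0 1] by (auto simp: subset_eq dist_norm)

lemma integral_kern: "integral (cbox (- One) One) kern = 1"
  using integral_flat_exp_pos by (simp add: kern_def[abs_def] less_imp_neq[OF integral_flat_exp_pos, symmetric])

lemma avg_add_mem:
  fixes x z :: "'a::euclidean_space"
  assumes "0 \<le> t" "z \<in> cbox (- One) One"
  shows "x + t *\<^sub>R z \<in> cball x (t * real DIM('a))"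
  using assms unit_cube_norm[of z] by (auto simp: dist_norm intro!: mult_left_mono)

lemma continuous_on_avg_integrand:
  fixes f :: "'a::euclidean_space \<Rightarrow> real"
  assumes "continuous_on (cball x (t * real DIM('a))) f" "0 \<le> t"
  shows "continuous_on (cbox (- One) One) (\<lambda>z. kern z * f (x + t *\<^sub>R z))"
proof -
  have "continuous_on (cbox (- One) One) (\<lambda>z. f (x + t *\<^sub>R z))"
    by (rule continuous_on_compose2[OF assms(1)])
       (use avg_add_mem[OF assms(2)] in \<open>auto intro!: continuous_intros\<close>)
  then show ?thesis by (intro continuous_intros)
qed

lemma integrable_avg:
  fixes f :: "'a::euclidean_space \<Rightarrow> real"
  assumes "continuous_on (cball x (t * real DIM('a))) f" "0 \<le> t"
  shows "(\<lambda>z. kern z * f (x + t *\<^sub>R z)) integrable_on (cbox (- One) One)"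
  by (intro integrable_continuous continuous_on_avg_integrand assms)

section \<open>Monotonicity of averages and the mean value property\<close>

lemma deriv_scaled_kernel:
  fixes x w :: "'a::euclidean_space"
  assumes "t > 0"
  shows "((\<lambda>t. flat_exp 2 (1 - (norm (w - x))\<^sup>2 / t\<^sup>2) / t ^ DIM('a)) has_real_derivative
           (t / t ^ DIM('a)) / 2 * laplacian (bump x t) w) (at t within S)"
proof -
  obtain n where n: "DIM('a) = Suc n" using DIM_positive by (metis Suc_pred)
  have "((\<lambda>t. 1 - (norm (w - x))\<^sup>2 / t\<^sup>2) has_real_derivative 2 * (norm (w - x))\<^sup>2 / t ^ 3) (at t within S)"
    using assms by (auto intro!: derivative_eq_intros simp: field_simps power2_eq_square power3_eq_cube)
  from DERIV_chain2[OF DERIV_flat_exp[of 2] this]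
  have "((\<lambda>t. flat_exp 2 (1 - (norm (w - x))\<^sup>2 / t\<^sup>2)) has_real_derivative
      (flat_exp 4 (1 - (norm (w - x))\<^sup>2 / t\<^sup>2) - 2 * flat_exp 3 (1 - (norm (w - x))\<^sup>2 / t\<^sup>2))
      * (2 * (norm (w - x))\<^sup>2 / t ^ 3)) (at t within S)"
    by (simp add: eval_nat_numeral)
  moreover have "((\<lambda>t. t ^ DIM('a)) has_real_derivative real (Suc n) * t ^ n) (at t within S)"
    unfolding n using DERIV_pow[of "Suc n" t S] by simp
  moreover have "t ^ DIM('a) \<noteq> 0" using assms by simp
  ultimately have D: "((\<lambda>t. flat_exp 2 (1 - (norm (w - x))\<^sup>2 / t\<^sup>2) / t ^ DIM('a)) has_real_derivative
      ((flat_exp 4 (1 - (norm (w - x))\<^sup>2 / t\<^sup>2) - 2 * flat_exp 3 (1 - (norm (w - x))\<^sup>2 / t\<^sup>2))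
      * (2 * (norm (w - x))\<^sup>2 / t ^ 3) * t ^ DIM('a)
      - flat_exp 2 (1 - (norm (w - x))\<^sup>2 / t\<^sup>2) * (real (Suc n) * t ^ n)) / (t ^ DIM('a) * t ^ DIM('a)))
      (at t within S)"
    by (rule DERIV_divide)
  have alg: "(P * (2 * N / t ^ 3) * (t * a) - F * (m * a)) / (t * a * (t * a))
      = t / (t * a) / 2 * (- (2 * m / t\<^sup>2) * F + 4 * N / t ^ 4 * P)"
    if "a > 0" for P N F m a :: real
    using that assms by (simp add: divide_simps) (simp add: algebra_simps eval_nat_numeral)
  show ?thesis
    using alg[of "t ^ n"] assms
    by (intro DERIV_cong[OF D]) (simp only: laplacian_bump n power_Suc zero_less_power)
qed

text \<open>The average is nondecreasing in the radius and tends to \<open>f x\<close> as the radius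
  tends to 0. In \<open>lap\<close> the Laplacian falls on the bump, so that the hypothesis can be
  supplied both by Green's identity and by the distributional inequality.\<close>

lemma le_avg:
  fixes f :: "'a::euclidean_space \<Rightarrow> real"
  assumes "open U" and f: "continuous_on U f" and "T > 0" and sub: "cball x (T * real DIM('a)) \<subseteq> U"
    and lap: "\<And>t. 0 < t \<Longrightarrow> t < T \<Longrightarrow>
       0 \<le> integral (cbox (x - T *\<^sub>R One) (x + T *\<^sub>R One)) (\<lambda>w. f w * laplacian (bump x t) w)"
  shows "f x \<le> avg f x T"
proof -
  define C where "C = cbox (x - T *\<^sub>R One) (x + T *\<^sub>R One)"
  have CU: "C \<subseteq> U" using cube_subset_cball sub unfolding C_def by blast
  define k where "k t w = flat_exp 2 (1 - (norm (w - x))\<^sup>2 / t\<^sup>2)" for t w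
  define B where "B t = integral (cbox (- One) One) (\<lambda>z. flat_exp 2 (1 - (norm z)\<^sup>2) * f (x + t *\<^sub>R z))" for t
  have contB: "continuous_on {0..T} B"
    unfolding B_def
  proof (rule integral_continuous_on_param)
    show "continuous_on ({0..T} \<times> cbox (- One) One) (\<lambda>(t, z). flat_exp 2 (1 - (norm z)\<^sup>2) * f (x + t *\<^sub>R z))"
      unfolding case_prod_beta
    proof (rule continuous_on_mult)
      show "continuous_on ({0..T} \<times> cbox (- One) One) (\<lambda>p. flat_exp 2 (1 - (norm (snd p :: 'a))\<^sup>2))"
        by (intro continuous_intros)
      show "continuous_on ({0..T} \<times> cbox (- One) One) (\<lambda>p. f (x + fst p *\<^sub>R snd p))"
      proof (rule continuous_on_compose2[OF f])
        show "continuous_on ({0..T} \<times> cbox (- One) One) (\<lambda>p. x + fst p *\<^sub>R (snd p :: 'a))"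
          by (intro continuous_intros)
        show "(\<lambda>p. x + fst p *\<^sub>R snd p) ` ({0..T} \<times> cbox (- One) One) \<subseteq> U"
      proof safe
        fix t and z :: 'a assume tz: "t \<in> {0..T}" "z \<in> cbox (- One) One"
        then have "x + t *\<^sub>R z \<in> cball x (t * real DIM('a))" by (intro avg_add_mem) auto
        also have "\<dots> \<subseteq> cball x (T * real DIM('a))" using tz by (intro subset_cball mult_right_mono) auto
        finally show "x + fst (t, z) *\<^sub>R snd (t, z) \<in> U" using sub by auto
      qed
      qed
    qed
  qed
  have contf: "continuous_on C f" using f CU continuous_on_subset by blast
  \<comment> \<open>For positive \<open>t\<close> this is \<open>B t\<close>, written over a cube
    that does not move with \<open>t\<close>. Only the kernel depends on \<open>t\<close>, and
    differentiation under the integral does not touch \<open>f\<close>.\<close>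
  define A where "A t = integral C (\<lambda>w. f w * (k t w / t ^ DIM('a)))" for t
  have BA: "B t = A t" if t: "0 < t" "t \<le> T" for t
  proof -
    have sub': "cbox (x - t *\<^sub>R One) (x + t *\<^sub>R One) \<subseteq> C"
    proof -
      show ?thesis unfolding C_def using t by (simp add: subset_box inner_diff_left inner_add_left)
    qed
    have "(\<lambda>w. f w * k t w) integrable_on cbox (x - t *\<^sub>R One) (x + t *\<^sub>R One)"
      unfolding k_def by (intro integrable_continuous continuous_on_mult continuous_on_subset[OF contf sub'])
        (use t in \<open>auto intro!: continuous_intros\<close>)
    then obtain I where I: "((\<lambda>w. f w * k t w) has_integral I) (cbox (x - t *\<^sub>R One) (x + t *\<^sub>R One))"
      by blast
    have out: "f w * k t w = 0" if "w \<notin> cbox (x - t *\<^sub>R One) (x + t *\<^sub>R One)" for w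
    proof -
      have "t < norm (w - x)" using that cball_subset_cube[of x t] by (force simp: dist_norm norm_minus_commute)
      then have "k t w = 0" using t by (auto simp: k_def divide_simps power_mono)
      then show ?thesis by simp
    qed
    have "((\<lambda>w. f w * k t w) has_integral I) C"
      by (rule has_integral_on_superset[OF I _ sub']) (use out in auto)
    then have "((\<lambda>w. (f w * k t w) * (1 / t ^ DIM('a))) has_integral I * (1 / t ^ DIM('a))) C"
      by (rule has_integral_mult_left)
    then have "((\<lambda>w. f w * (k t w / t ^ DIM('a))) has_integral I / t ^ DIM('a)) C"
      by (simp add: mult.assoc)
    then have At: "A t = I / t ^ DIM('a)" unfolding A_def by (rule integral_unique)
    have "((\<lambda>z. f (t *\<^sub>R z + x) * k t (t *\<^sub>R z + x)) has_integral I /\<^sub>R t ^ DIM('a))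
      (cbox ((x - t *\<^sub>R One - x) /\<^sub>R t) ((x + t *\<^sub>R One - x) /\<^sub>R t))"
      by (rule has_integral_affinity'[OF I \<open>0 < t\<close>])
    moreover have "k t (t *\<^sub>R z + x) = flat_exp 2 (1 - (norm z)\<^sup>2)" for z
      using t by (simp add: k_def power_mult_distrib)
    ultimately have "((\<lambda>z. flat_exp 2 (1 - (norm z)\<^sup>2) * f (x + t *\<^sub>R z)) has_integral I / t ^ DIM('a)) (cbox (- One) One)"
      using t by (simp add: algebra_simps divide_inverse_commute)
    then show ?thesis unfolding At B_def by (rule integral_unique)
  qed
  have derA: "(A has_real_derivative (t / t ^ DIM('a)) / 2 * integral C (\<lambda>w. f w * laplacian (bump x t) w)) (at t)"
    if t: "0 < t" "t < T" for t
  proof -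
    have "(A has_real_derivative integral C (\<lambda>w. f w * ((t / t ^ DIM('a)) / 2 * laplacian (bump x t) w))) (at t within {t/2..T})"
      unfolding A_def
    proof (rule leibniz_rule_field_derivative[of _ "x - T *\<^sub>R One" "x + T *\<^sub>R One", folded C_def])
      fix s w assume "s \<in> {t/2..T}" "w \<in> C"
      then have "s > 0" using t by auto
      show "((\<lambda>s. f w * (k s w / s ^ DIM('a))) has_real_derivative f w * ((s / s ^ DIM('a)) / 2 * laplacian (bump x s) w)) (at s within {t/2..T})"
        unfolding k_def by (intro DERIV_cmult deriv_scaled_kernel \<open>s > 0\<close>)
    next
      fix s assume "s \<in> {t/2..T}"
      then show "(\<lambda>w. f w * (k s w / s ^ DIM('a))) integrable_on C"
        unfolding C_def k_def
        by (intro integrable_continuous continuous_on_mult contf[unfolded C_def])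
          (use t in \<open>auto intro!: continuous_intros\<close>)
    next
      show "continuous_on ({t/2..T} \<times> C) (\<lambda>(s, w). f w * ((s / s ^ DIM('a)) / 2 * laplacian (bump x s) w))"
      proof -
        have "continuous_on ({t/2..T} \<times> C) (\<lambda>p. f (snd p))"
          by (rule continuous_on_compose2[OF contf]) (auto intro!: continuous_intros)
        then show ?thesis
          unfolding case_prod_beta laplacian_bump by (intro continuous_intros) (use t in auto)
      qed
    qed (use t in auto)
    moreover have "at t within {t/2..T} = at t"
      by (rule at_within_interior) (use t in auto)
    moreover have "integral C (\<lambda>w. f w * ((t / t ^ DIM('a)) / 2 * laplacian (bump x t) w))
        = (t / t ^ DIM('a)) / 2 * integral C (\<lambda>w. f w * laplacian (bump x t) w)"
      by (subst integral_mult_right[symmetric]) (simp add: algebra_simps)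
    ultimately show ?thesis by (simp only:)
  qed
  have "B 0 \<le> B T"
  proof (rule DERIV_nonneg_imp_increasing_open[OF _ _ contB])
    fix t assume t: "0 < t" "t < T"
    have "(B has_real_derivative (t / t ^ DIM('a)) / 2 * integral C (\<lambda>w. f w * laplacian (bump x t) w)) (at t)"
      by (rule has_field_derivative_transform_within_open[OF derA[OF t], of "{0<..<T}"]) (use t BA in auto)
    moreover have "0 \<le> (t / t ^ DIM('a)) / 2 * integral C (\<lambda>w. f w * laplacian (bump x t) w)"
      using lap[OF t] t unfolding C_def by simp
    ultimately show "\<exists>y. (B has_real_derivative y) (at t) \<and> 0 \<le> y" by blast
  qed (use \<open>T > 0\<close> in simp)
  let ?I = "integral (cbox (- One) (One::'a)) (\<lambda>z. flat_exp 2 (1 - (norm z)\<^sup>2))"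
  have "B 0 = ?I * f x" by (simp add: B_def)
  moreover have "avg f x T = B T / ?I"
    unfolding avg_def kern_def B_def by (simp only: times_divide_eq_left integral_divide)
  ultimately show ?thesis
    using \<open>B 0 \<le> B T\<close> integral_flat_exp_pos[where 'a='a and k=2] by (simp add: pos_le_divide_eq mult.commute)
qed


lemma avg_harmonic:
  fixes u :: "'a::euclidean_space \<Rightarrow> real"
  assumes "open U" and u: "harmonic_on u U" and "T > 0" and sub: "cball x (T * real DIM('a)) \<subseteq> U"
  shows "avg u x T = u x"
proof -
  have cont: "continuous_on U u"
    using u unfolding harmonic_on_def numeral_2_eq_2 Ck_on.simps
    by (intro differentiable_imp_continuous_on) auto
  have cube: "cbox (x - T *\<^sub>R One) (x + T *\<^sub>R One) \<subseteq> U"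
    using cube_subset_cball[of x T] sub by blast
  have zero: "integral (cbox (x - T *\<^sub>R One) (x + T *\<^sub>R One)) (\<lambda>w. u w * laplacian (bump x t) w) = 0"
    if t: "0 < t" "t < T" for t
  proof (rule integral_bump_laplacian_harmonic[OF \<open>open U\<close> u \<open>0 < t\<close>])
    have "cball x t \<subseteq> cball x T" using t by auto
    then show "cball x t \<subseteq> cbox (x - T *\<^sub>R One) (x + T *\<^sub>R One)"
      using cball_subset_cube[of x T] by blast
    then show "cball x t \<subseteq> U" using cube by blast
  qed (fact cube)
  have "u x \<le> avg u x T"
    by (rule le_avg[OF \<open>open U\<close> cont \<open>T > 0\<close> sub]) (simp add: zero)
  moreover have "- u x \<le> avg (\<lambda>w. - u w) x T"
    by (rule le_avg[OF \<open>open U\<close> continuous_on_minus[OF cont] \<open>T > 0\<close> sub]) (simp add: zero)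
  ultimately show ?thesis by (simp add: avg_def)
qed

text \<open>\<open>bump x t\<close> is a nonnegative test function. Its Laplacian vanishes outside
  \<open>cball x t\<close>, so the Lebesgue integral over \<open>U\<close> reduces to the gauge
  integral over the cube that \<open>le_avg\<close> asks for.\<close>

lemma le_avg_distr:
  fixes f :: "'a::euclidean_space \<Rightarrow> real"
  assumes "open U" and f: "continuous_on U f" and lap: "distr_laplacian_nonneg_on f U"
    and "T > 0" and sub: "cball x (T * real DIM('a)) \<subseteq> U"
  shows "f x \<le> avg f x T"
proof (rule le_avg[OF \<open>open U\<close> f \<open>T > 0\<close> sub])
  fix t assume t: "0 < t" "t < T"
  define C where "C = cbox (x - T *\<^sub>R One) (x + T *\<^sub>R One)"
  have CU: "C \<subseteq> U" using cube_subset_cball[of x T] sub unfolding C_def by blast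
  have tC: "cball x t \<subseteq> C"
    using cball_subset_cube[of x T] t unfolding C_def by (meson dual_order.trans less_imp_le subset_cball)
  have lap0: "laplacian (bump x t) w = 0" if "w \<notin> cball x t" for w
  proof -
    have "1 - (norm (w - x))\<^sup>2 / t\<^sup>2 \<le> 0"
      using that t by (auto simp: dist_norm norm_minus_commute divide_simps power_mono)
    then show ?thesis by (simp add: laplacian_bump)
  qed
  have supp: "closure {w. bump x t w \<noteq> 0} \<subseteq> cball x t"
    using bump_eq_0[of t _ x] t
    by (intro closure_minimal) (auto simp: dist_norm norm_minus_commute not_le intro: ccontr)
  have "test_function U (bump x t)"
    unfolding test_function_def
  proof (intro conjI allI)
    show "Ck_on k (bump x t) UNIV" for k by (rule Ck_on_smooth_bump[OF smooth_bump_bump])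
    show "compact (closure {w. bump x t w \<noteq> 0})"
      using supp by (meson bounded_cball bounded_subset compact_eq_bounded_closed closed_closure)
    show "closure {w. bump x t w \<noteq> 0} \<subseteq> U" using supp tC CU by blast
  qed
  then have "0 \<le> (LINT w:U|lebesgue. f w * laplacian (bump x t) w)"
    using lap bump_nonneg unfolding distr_laplacian_nonneg_on_def by blast
  also have "\<dots> = (LINT w:C|lebesgue. f w * laplacian (bump x t) w)"
    unfolding set_lebesgue_integral_def
    by (rule Bochner_Integration.integral_cong) (use lap0 tC CU in \<open>auto simp: indicator_def subset_eq\<close>)
  also have "\<dots> = integral C (\<lambda>w. f w * laplacian (bump x t) w)"
  proof (rule set_lebesgue_integral_eq_integral)
    have "continuous_on C (\<lambda>w. f w * laplacian (bump x t) w)"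
      unfolding laplacian_bump
      by (rule continuous_on_mult[OF continuous_on_subset[OF f CU]])
         (use t in \<open>auto intro!: continuous_intros\<close>)
    then show "set_integrable lebesgue C (\<lambda>w. f w * laplacian (bump x t) w)"
      unfolding C_def by (rule absolutely_integrable_continuous)
  qed
  finally show "0 \<le> integral (cbox (x - T *\<^sub>R One) (x + T *\<^sub>R One)) (\<lambda>w. f w * laplacian (bump x t) w)"
    unfolding C_def .
qed

section \<open>Moments of the kernel\<close>

text \<open>Up to a constant factor the integrand is the derivative, in direction \<open>v\<close>,
  of the compactly supported function \<open>flat_exp 0 (1 - (norm z)\<^sup>2)\<close>.\<close>

lemma integral_kern_inner: "integral (cbox (- One) One) (\<lambda>z::'a::euclidean_space. kern z * (v \<bullet> z)) = 0"
proof -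
  define K where "K z = - 2 * (z \<bullet> v) * flat_exp 2 (1 - (norm z)\<^sup>2)" for z :: 'a
  obtain e where e: "cball 0 (1 + norm v) \<subseteq> cbox (- e) (e::'a)"
    using bounded_subset_cbox_symmetric[of "cball 0 (1 + norm v)"] by auto
  have "integral (cbox (- e) e) K = 0"
  proof (rule has_integral_0_partial_deriv[where F="\<lambda>z. flat_exp 0 (1 - (norm z)\<^sup>2)" and b=v and R=1])
    show "((\<lambda>s. flat_exp 0 (1 - (norm (x + s *\<^sub>R v))\<^sup>2)) has_real_derivative K x) (at 0)" for x
      unfolding power2_norm_eq_inner K_def has_field_derivative_def
      by (rule derivative_eq_intros refl | simp add: fun_eq_iff inner_commute numeral_2_eq_2)+
    show "continuous_on UNIV K" unfolding K_def by (intro continuous_intros)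
    show "continuous_on UNIV (\<lambda>z::'a. flat_exp 0 (1 - (norm z)\<^sup>2))" by (intro continuous_intros)
    show "flat_exp 0 (1 - (norm x)\<^sup>2) = 0" if "1 < norm x" for x :: 'a
      using that by (simp add: one_le_power)
  qed (use e in auto)
  moreover have K0: "K z = 0" if "norm z > 1" for z
    using that by (simp add: K_def one_le_power)
  have "integral (cbox (- e) e) K = integral UNIV K"
  proof (rule integral_eq_integral_UNIV)
    fix x assume "x \<notin> cbox (- e) e"
    then have "x \<notin> cball 0 (1 + norm v)" using e by blast
    then have "1 < norm x" using norm_ge_zero[of v] unfolding mem_cball_0 by linarith
    then show "K x = 0" by (rule K0)
  qed
  moreover have "integral (cbox (- One) One) K = integral UNIV K"
  proof (rule integral_eq_integral_UNIV)
    show "K x = 0" if "x \<notin> cbox (- One) One" for x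
      using that unit_ball_cube[of x] by (intro K0) force
  qed
  ultimately have K: "integral (cbox (- One) One) K = 0" by simp
  have eq: "kern z * (v \<bullet> z) = (- 1 / (2 * integral (cbox (- One) (One::'a)) (\<lambda>z. flat_exp 2 (1 - (norm z)\<^sup>2)))) * K z" for z
    by (simp add: kern_def K_def inner_commute)
  show ?thesis unfolding eq by (simp only: integral_mult_right K)
qed

text \<open>The variance of the kernel in any single direction, in the form that integration by
  parts delivers. Later only its positivity matters.\<close>

definition kern_moment :: "'a::euclidean_space itself \<Rightarrow> real" where
  "kern_moment _ = integral (cbox (- One) (One::'a)) (\<lambda>z. flat_exp 0 (1 - (norm z)\<^sup>2))
     / (2 * integral (cbox (- One) (One::'a)) (\<lambda>z. flat_exp 2 (1 - (norm z)\<^sup>2)))"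

lemma kern_moment_pos: "0 < kern_moment TYPE('a::euclidean_space)"
  unfolding kern_moment_def using integral_flat_exp_pos by (intro divide_pos_pos mult_pos_pos) auto

text \<open>Isotropy of the second moments without any appeal to rotations: differentiate
  \<open>(w \<bullet> z) * flat_exp 0 (1 - (norm z)\<^sup>2)\<close> in direction \<open>v\<close>
  and integrate.\<close>

lemma integral_kern_inner_inner:
  "integral (cbox (- One) One) (\<lambda>z::'a::euclidean_space. kern z * ((v \<bullet> z) * (w \<bullet> z)))
     = kern_moment TYPE('a) * (v \<bullet> w)"
proof -
  define K where "K z = - 2 * ((v \<bullet> z) * (w \<bullet> z)) * flat_exp 2 (1 - (norm z)\<^sup>2) + (v \<bullet> w) * flat_exp 0 (1 - (norm z)\<^sup>2)" for z :: 'a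
  obtain e where e: "cball 0 (1 + norm v) \<subseteq> cbox (- e) (e::'a)"
    using bounded_subset_cbox_symmetric[of "cball 0 (1 + norm v)"] by auto
  have "integral (cbox (- e) e) K = 0"
  proof (rule has_integral_0_partial_deriv[where F="\<lambda>z. (w \<bullet> z) * flat_exp 0 (1 - (norm z)\<^sup>2)" and b=v and R=1])
    show "((\<lambda>s. (w \<bullet> (x + s *\<^sub>R v)) * flat_exp 0 (1 - (norm (x + s *\<^sub>R v))\<^sup>2)) has_real_derivative K x) (at 0)" for x
      unfolding power2_norm_eq_inner K_def has_field_derivative_def
      by (rule derivative_eq_intros refl | simp add: fun_eq_iff inner_commute algebra_simps numeral_2_eq_2)+
    show "continuous_on UNIV K" unfolding K_def by (intro continuous_intros)
    show "continuous_on UNIV (\<lambda>z::'a. (w \<bullet> z) * flat_exp 0 (1 - (norm z)\<^sup>2))" by (intro continuous_intros)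
    show "(w \<bullet> x) * flat_exp 0 (1 - (norm x)\<^sup>2) = 0" if "1 < norm x" for x :: 'a
      using that by (simp add: one_le_power)
  qed (use e in auto)
  moreover have K0: "K z = 0" if "norm z > 1" for z
    using that by (simp add: K_def one_le_power)
  have "integral (cbox (- e) e) K = integral UNIV K"
  proof (rule integral_eq_integral_UNIV)
    fix x assume "x \<notin> cbox (- e) e"
    then have "x \<notin> cball 0 (1 + norm v)" using e by blast
    then have "1 < norm x" using norm_ge_zero[of v] unfolding mem_cball_0 by linarith
    then show "K x = 0" by (rule K0)
  qed
  moreover have "integral (cbox (- One) One) K = integral UNIV K"
  proof (rule integral_eq_integral_UNIV)
    show "K x = 0" if "x \<notin> cbox (- One) One" for x
      using that unit_ball_cube[of x] by (intro K0) force
  qed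
  ultimately have K: "integral (cbox (- One) One) K = 0" by simp
  let ?I = "integral (cbox (- One) (One::'a)) (\<lambda>z. flat_exp 2 (1 - (norm z)\<^sup>2))"
  have I: "?I \<noteq> 0" using integral_flat_exp_pos[where 'a='a and k=2] by simp
  let ?J = "integral (cbox (- One) (One::'a)) (\<lambda>z. kern z * ((v \<bullet> z) * (w \<bullet> z)))"
  have "K = (\<lambda>z. (- 2 * ?I) * (kern z * ((v \<bullet> z) * (w \<bullet> z))) + (v \<bullet> w) * flat_exp 0 (1 - (norm z)\<^sup>2))"
    using I by (simp add: kern_def K_def fun_eq_iff)
  moreover have "integral (cbox (- One) (One::'a)) (\<lambda>z. (- 2 * ?I) * (kern z * ((v \<bullet> z) * (w \<bullet> z))) + (v \<bullet> w) * flat_exp 0 (1 - (norm z)\<^sup>2))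
     = integral (cbox (- One) (One::'a)) (\<lambda>z. (- 2 * ?I) * (kern z * ((v \<bullet> z) * (w \<bullet> z))))
       + integral (cbox (- One) (One::'a)) (\<lambda>z. (v \<bullet> w) * flat_exp 0 (1 - (norm z)\<^sup>2))"
    by (intro Henstock_Kurzweil_Integration.integral_add integrable_continuous continuous_intros)
  ultimately have "0 = (- 2 * ?I) * ?J + (v \<bullet> w) * integral (cbox (- One) (One::'a)) (\<lambda>z. flat_exp 0 (1 - (norm z)\<^sup>2))"
    using K by (simp only: integral_mult_right)
  then show ?thesis using I by (simp add: kern_moment_def field_simps)
qed

section \<open>The two-point maximum principle\<close>

definition mirror :: "'a::euclidean_space \<Rightarrow> 'a \<Rightarrow> 'a" where
  "mirror e z = z - (2 * (e \<bullet> z)) *\<^sub>R e"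

lemma mirror_add: "mirror e (x + y) = mirror e x + mirror e y"
  by (simp add: mirror_def inner_add_right distrib_left scaleR_add_left)

lemma mirror_scaleR: "mirror e (t *\<^sub>R x) = t *\<^sub>R mirror e x"
  by (simp add: mirror_def algebra_simps)

lemma mirror_mirror: "norm e = 1 \<Longrightarrow> mirror e (mirror e z) = z"
  by (simp add: mirror_def inner_diff_right dot_square_norm algebra_simps)

lemma inner_mirror: "mirror e x \<bullet> y = x \<bullet> mirror e y"
  by (simp add: mirror_def inner_diff_left inner_diff_right inner_commute)

lemma norm_mirror: "norm e = 1 \<Longrightarrow> norm (mirror e z) = norm z"
  by (simp add: norm_eq_sqrt_inner inner_mirror mirror_mirror)

lemma continuous_on_mirror [continuous_intros]:
  "continuous_on S f \<Longrightarrow> continuous_on S (\<lambda>x. mirror e (f x))"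
  unfolding mirror_def by (intro continuous_intros)

lemma measurable_mirror [measurable]: "mirror e \<in> borel_measurable borel"
  by (rule borel_measurable_continuous_onI) (intro continuous_intros)

lemma nn_integral_lborel_plus:
  fixes c :: "'a::euclidean_space"
  assumes "g \<in> borel_measurable borel"
  shows "(\<integral>\<^sup>+x. g (c + x) \<partial>lborel) = (\<integral>\<^sup>+x. g x \<partial>lborel)"
proof -
  have "(\<integral>\<^sup>+x. g x \<partial>lborel) = (\<integral>\<^sup>+x. g x \<partial>(distr lborel borel ((+) c)))"
    by (simp add: lborel_distr_plus)
  also have "\<dots> = (\<integral>\<^sup>+x. g (c + x) \<partial>lborel)"
    using assms by (subst nn_integral_distr) auto
  finally show ?thesis by simp
qed

text \<open>Uniqueness of translation invariant measures, with the unit ball as reference set: both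
  sides, multiplied by the volume of the ball, are the same double integral.\<close>

lemma nn_integral_lborel_mirror:
  fixes f :: "'a::euclidean_space \<Rightarrow> ennreal"
  assumes [measurable]: "f \<in> borel_measurable borel" and e: "norm e = 1"
  shows "(\<integral>\<^sup>+x. f (mirror e x) \<partial>lborel) = (\<integral>\<^sup>+x. f x \<partial>lborel)"
proof -
  define K :: "'a \<Rightarrow> ennreal" where "K = indicator (ball 0 1)"
  have [measurable]: "K \<in> borel_measurable borel" unfolding K_def by (intro borel_measurable_indicator) simp
  define V where "V = emeasure lborel (ball (0::'a) 1)"
  have "V = ennreal (unit_ball_vol (real DIM('a)))" unfolding V_def by (simp add: emeasure_ball)
  moreover have "0 < unit_ball_vol (real DIM('a))" by simp
  ultimately have V: "V \<noteq> 0" "V \<noteq> \<infinity>"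
    by (metis ennreal_eq_0_iff linorder_not_le, simp)
  have KV: "(\<integral>\<^sup>+y. K y \<partial>lborel) = V" unfolding K_def V_def by simp
  have "(\<integral>\<^sup>+x. f (mirror e x) \<partial>lborel) * V = (\<integral>\<^sup>+y. (\<integral>\<^sup>+x. f (mirror e x) \<partial>lborel) * K y \<partial>lborel)"
    by (simp add: nn_integral_cmult KV)
  also have "\<dots> = (\<integral>\<^sup>+y. (\<integral>\<^sup>+x. f (y + mirror e x) \<partial>lborel) * K y \<partial>lborel)"
  proof (rule nn_integral_cong)
    fix y
    have "(\<integral>\<^sup>+x. f (mirror e x) \<partial>lborel) = (\<integral>\<^sup>+x. f (mirror e (mirror e y + x)) \<partial>lborel)"
      by (rule nn_integral_lborel_plus[symmetric, where g="\<lambda>x. f (mirror e x)"]) measurable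
    then show "(\<integral>\<^sup>+x. f (mirror e x) \<partial>lborel) * K y = (\<integral>\<^sup>+x. f (y + mirror e x) \<partial>lborel) * K y"
      by (simp add: mirror_add mirror_mirror[OF e])
  qed
  also have "\<dots> = (\<integral>\<^sup>+y. (\<integral>\<^sup>+x. f (y + mirror e x) * K y \<partial>lborel) \<partial>lborel)"
    by (intro nn_integral_cong) (simp add: nn_integral_multc)
  also have "\<dots> = (\<integral>\<^sup>+x. (\<integral>\<^sup>+y. f (y + mirror e x) * K y \<partial>lborel) \<partial>lborel)"
    by (rule lborel_pair.Fubini') measurable
  also have "\<dots> = (\<integral>\<^sup>+x. (\<integral>\<^sup>+y. f y * K (y - mirror e x) \<partial>lborel) \<partial>lborel)"
  proof (rule nn_integral_cong)
    fix x
    have "(\<integral>\<^sup>+y. f (mirror e x + y) * K ((mirror e x + y) - mirror e x) \<partial>lborel)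
       = (\<integral>\<^sup>+y. f y * K (y - mirror e x) \<partial>lborel)"
      by (rule nn_integral_lborel_plus[where g="\<lambda>y. f y * K (y - mirror e x)"]) measurable
    then show "(\<integral>\<^sup>+y. f (y + mirror e x) * K y \<partial>lborel) = (\<integral>\<^sup>+y. f y * K (y - mirror e x) \<partial>lborel)"
      by (simp add: add.commute)
  qed
  also have "\<dots> = (\<integral>\<^sup>+y. (\<integral>\<^sup>+x. f y * K (y - mirror e x) \<partial>lborel) \<partial>lborel)"
    by (rule lborel_pair.Fubini'[symmetric]) measurable
  also have "\<dots> = (\<integral>\<^sup>+y. f y * V \<partial>lborel)"
  proof (rule nn_integral_cong)
    fix y
    have "norm (y - mirror e x) = norm (mirror e y - x)" for x
    proof -
      have "mirror e (y - mirror e x) = mirror e y - x"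
        using mirror_add[of e "y - mirror e x" "mirror e x"] by (simp add: mirror_mirror[OF e] algebra_simps)
      then show ?thesis using norm_mirror[OF e] by metis
    qed
    then have "K (y - mirror e x) = indicator (ball 0 1) (- mirror e y + x)" for x
      by (simp add: K_def indicator_def norm_minus_commute)
    then have "(\<integral>\<^sup>+x. K (y - mirror e x) \<partial>lborel) = (\<integral>\<^sup>+x. K (- mirror e y + x) \<partial>lborel)"
      by (simp add: K_def)
    also have "\<dots> = V"
      by (subst nn_integral_lborel_plus) (simp_all add: KV)
    finally show "(\<integral>\<^sup>+x. f y * K (y - mirror e x) \<partial>lborel) = f y * V"
      by (subst nn_integral_cmult) auto
  qed
  also have "\<dots> = (\<integral>\<^sup>+y. f y \<partial>lborel) * V"
    by (rule nn_integral_multc) simp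
  finally have eq: "(\<integral>\<^sup>+x. f (mirror e x) \<partial>lborel) * V = (\<integral>\<^sup>+y. f y \<partial>lborel) * V" .
  have "a * V / V = a" for a
    using V by (simp add: mult_divide_eq_ennreal)
  then show ?thesis using arg_cong[OF eq, of "\<lambda>a. a / V"] by simp
qed

lemma lborel_distr_mirror:
  assumes "norm (e::'a::euclidean_space) = 1"
  shows "distr lborel borel (mirror e) = lborel"
proof (rule measure_eqI)
  fix A :: "'a set" assume "A \<in> sets (distr lborel borel (mirror e))"
  then have A: "A \<in> sets borel" by simp
  then have "emeasure (distr lborel borel (mirror e)) A = (\<integral>\<^sup>+x. indicator A x \<partial>distr lborel borel (mirror e))"
    by simp
  also have "\<dots> = (\<integral>\<^sup>+x. indicator A (mirror e x) \<partial>lborel)"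
    using A by (subst nn_integral_distr) auto
  also have "\<dots> = (\<integral>\<^sup>+x. indicator A x \<partial>lborel)"
    using A assms by (intro nn_integral_lborel_mirror) auto
  finally show "emeasure (distr lborel borel (mirror e)) A = emeasure lborel A"
    using A by simp
qed simp

text \<open>The kernel is radial and the reflection preserves Lebesgue measure. The cube is not
  invariant, so the integrand is first cut off to the unit ball, outside which \<open>kern\<close>
  vanishes.\<close>

lemma integral_kern_mirror:
  fixes F :: "'a::euclidean_space \<Rightarrow> real"
  assumes F: "continuous_on (cball 0 1) F" and e: "norm e = 1"
  shows "integral (cbox (- One) One) (\<lambda>z. kern z * F (mirror e z)) = integral (cbox (- One) One) (\<lambda>z. kern z * F z)"
proof -
  define G where "G z = indicator (cball 0 1) z *\<^sub>R (kern z * F z)" for z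
  have int: "integrable lborel G"
    unfolding G_def by (intro borel_integrable_compact continuous_intros F) auto
  have kernG: "kern z * F z = G z" for z
    using kern_eq_0[of z] by (auto simp: G_def indicator_def)
  have kernG': "kern z * F (mirror e z) = G (mirror e z)" for z
  proof -
    have "kern z = kern (mirror e z)" using norm_mirror[OF e] by (simp add: kern_def)
    then show ?thesis using kernG[of "mirror e z"] by simp
  qed
  have int': "integrable lborel (\<lambda>z. G (mirror e z))"
    using int by (subst (asm) lborel_distr_mirror[OF e, symmetric], subst (asm) integrable_distr_eq) auto
  have out: "G z = 0" if "z \<notin> cbox (- One) One" for z
    using that unit_ball_cube[of z] by (auto simp: G_def indicator_def)
  have out': "G (mirror e z) = 0" if "z \<notin> cbox (- One) One" for z
    using that unit_ball_cube[of z] norm_mirror[OF e] by (auto simp: G_def indicator_def)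
  have "integral (cbox (- One) One) (\<lambda>z. G (mirror e z)) = integral UNIV (\<lambda>z. G (mirror e z))"
    by (rule integral_eq_integral_UNIV) (rule out')
  also have "\<dots> = (LINT z|lborel. G (mirror e z))"
    by (rule integral_lborel[OF int'])
  also have "\<dots> = (LINT z|distr lborel borel (mirror e). G z)"
    using int by (intro integral_distr[symmetric]) auto
  also have "\<dots> = integral UNIV G"
    using integral_lborel[OF int] by (simp add: lborel_distr_mirror[OF e])
  also have "\<dots> = integral (cbox (- One) One) G"
    by (rule integral_eq_integral_UNIV[symmetric]) (rule out)
  finally show ?thesis by (simp add: kernG kernG')
qed


section \<open>Second order comparison along mirrored increments\<close>

text \<open>Subharmonicity at one point, for all radii below a threshold that may depend on the
  point. This is local, survives scaling and cutting off at positive values, and suffices for tests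
  at a maximum.\<close>

definition submean_at :: "('a::euclidean_space \<Rightarrow> real) \<Rightarrow> 'a \<Rightarrow> bool" where
  "submean_at f x \<longleftrightarrow> (\<exists>t0>0. \<forall>t. 0 < t \<and> t < t0 \<longrightarrow> f x \<le> avg f x t)"

text \<open>The vanishing first moment of the kernel removes the linear term, and homogeneity turns
  the mean of \<open>q\<close> at radius \<open>t\<close> into \<open>t\<^sup>2\<close> times its
  mean at radius 1.\<close>

lemma avg_ge_expansion:
  fixes f :: "'a::euclidean_space \<Rightarrow> real"
  assumes f: "continuous_on (cball x r) f" and t: "0 < t" "t * real DIM('a) \<le> r"
    and q: "continuous_on UNIV q" "\<And>z. q (t *\<^sub>R z) = t\<^sup>2 * q z"
    and bound: "\<And>\<zeta>. norm \<zeta> \<le> t \<Longrightarrow> f (x + \<zeta>) \<ge> f x + p \<bullet> \<zeta> + q \<zeta> - C"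
  shows "avg f x t \<ge> f x + t\<^sup>2 * integral (cbox (- One) One) (\<lambda>z. kern z * q z) - C"
proof -
  let ?W = "cbox (- One) (One::'a)"
  have int1: "(\<lambda>z. kern z * (f x - C)) integrable_on ?W" "(\<lambda>z. t * (kern z * (p \<bullet> z))) integrable_on ?W"
    "(\<lambda>z. t\<^sup>2 * (kern z * q z)) integrable_on ?W"
    using continuous_on_subset[OF q(1) subset_UNIV] by (intro integrable_continuous continuous_intros; simp)+
  have "integral ?W (\<lambda>z. kern z * (f x - C) + t * (kern z * (p \<bullet> z)) + t\<^sup>2 * (kern z * q z)) \<le> avg f x t"
    unfolding avg_def
  proof (rule integral_le)
    show "(\<lambda>z. kern z * (f x - C) + t * (kern z * (p \<bullet> z)) + t\<^sup>2 * (kern z * q z)) integrable_on ?W"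
      by (intro integrable_add int1)
    show "(\<lambda>z. kern z * f (x + t *\<^sub>R z)) integrable_on ?W"
      using t by (intro integrable_avg continuous_on_subset[OF f]) auto
    fix z :: 'a assume "z \<in> ?W"
    show "kern z * (f x - C) + t * (kern z * (p \<bullet> z)) + t\<^sup>2 * (kern z * q z) \<le> kern z * f (x + t *\<^sub>R z)"
    proof (cases "norm z < 1")
      case True
      then have "f (x + t *\<^sub>R z) \<ge> f x + p \<bullet> (t *\<^sub>R z) + q (t *\<^sub>R z) - C"
        using t by (intro bound) auto
      from mult_left_mono[OF this kern_nonneg[of z]] show ?thesis
        by (simp add: q(2) algebra_simps)
    qed (use kern_eq_0[of z] in simp)
  qed
  also have "integral ?W (\<lambda>z. kern z * (f x - C) + t * (kern z * (p \<bullet> z)) + t\<^sup>2 * (kern z * q z))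
     = integral ?W (\<lambda>z. kern z * (f x - C)) + integral ?W (\<lambda>z. t * (kern z * (p \<bullet> z))) + integral ?W (\<lambda>z. t\<^sup>2 * (kern z * q z))"
    using int1 by (simp add: Henstock_Kurzweil_Integration.integral_add integrable_add)
  also have "\<dots> = f x - C + t\<^sup>2 * integral ?W (\<lambda>z. kern z * q z)"
    by (simp add: integral_kern integral_kern_inner)
  finally show ?thesis by simp
qed

text \<open>Averaging \<open>f (x + \<xi>) * g (y + mirror e \<xi>)\<close> over \<open>\<xi>\<close> is compared with the product of the two averages;
  the difference is of second order and given by the gradients \<open>A\<close> and \<open>B\<close>.\<close>

lemma two_point_touching:
  fixes f g :: "'a::euclidean_space \<Rightarrow> real"
  assumes e: "norm e = 1" and "r > 0"
    and f: "continuous_on (cball x r) f" and g: "continuous_on (cball y r) g"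
    and pos: "f x > 0" "g y > 0"
    and sub: "submean_at f x" "submean_at g y"
    and lip: "\<And>\<zeta>. norm \<zeta> \<le> r \<Longrightarrow> \<bar>g (y + \<zeta>) - g y\<bar> \<le> L * norm \<zeta>"
    and upf: "\<And>\<epsilon>. \<epsilon> > 0 \<Longrightarrow> \<exists>\<delta>>0. \<forall>\<xi>. norm \<xi> \<le> \<delta> \<longrightarrow> f (x + \<xi>) \<le> f x * (1 + A \<bullet> \<xi> + \<epsilon> * norm \<xi>)"
    and upg: "\<And>\<epsilon>. \<epsilon> > 0 \<Longrightarrow> \<exists>\<delta>>0. \<forall>\<xi>. norm \<xi> \<le> \<delta> \<longrightarrow> g (y + \<xi>) \<le> g y * (1 + B \<bullet> \<xi> + \<epsilon> * norm \<xi>)"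
    and upfg: "\<And>\<epsilon>. \<epsilon> > 0 \<Longrightarrow> \<exists>\<delta>>0. \<forall>\<xi>. norm \<xi> \<le> \<delta> \<longrightarrow>
        f (x + \<xi>) * g (y + mirror e \<xi>) \<le> f x * g y * (1 + p \<bullet> \<xi> + q \<xi> + \<epsilon> * (norm \<xi>)\<^sup>2)"
    and q: "continuous_on UNIV q" "\<And>t z. q (t *\<^sub>R z) = t\<^sup>2 * q z"
  shows "kern_moment TYPE('a) * (A \<bullet> mirror e B) \<le> integral (cbox (- One) One) (\<lambda>z. kern z * q z)"
proof (rule field_le_epsilon)
  fix \<epsilon>0 :: real assume "\<epsilon>0 > 0"
  define L' where "L' = \<bar>L\<bar> / g y"
  have L': "0 \<le> L'" using pos by (simp add: L'_def)
  \<comment> \<open>The errors collected at the end add up to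
    \<open>\<epsilon> * (1 + 2 * norm A + 2 * L')\<close>, hence this denominator.\<close>
  define \<epsilon> where "\<epsilon> = \<epsilon>0 / (1 + 2 * norm A + 2 * L')"
  have \<epsilon>: "\<epsilon> > 0" unfolding \<epsilon>_def using \<open>\<epsilon>0 > 0\<close> L' by (intro divide_pos_pos add_pos_nonneg) auto
  obtain d1 where d1: "d1 > 0" "\<And>\<xi>. norm \<xi> \<le> d1 \<Longrightarrow> f (x + \<xi>) \<le> f x * (1 + A \<bullet> \<xi> + \<epsilon> * norm \<xi>)"
    using upf[OF \<epsilon>] by blast
  obtain d2 where d2: "d2 > 0" "\<And>\<xi>. norm \<xi> \<le> d2 \<Longrightarrow> g (y + \<xi>) \<le> g y * (1 + B \<bullet> \<xi> + \<epsilon> * norm \<xi>)"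
    using upg[OF \<epsilon>] by blast
  obtain d3 where d3: "d3 > 0" "\<And>\<xi>. norm \<xi> \<le> d3 \<Longrightarrow>
        f (x + \<xi>) * g (y + mirror e \<xi>) \<le> f x * g y * (1 + p \<bullet> \<xi> + q \<xi> + \<epsilon> * (norm \<xi>)\<^sup>2)"
    using upfg[OF \<epsilon>] by blast
  obtain t1 where t1: "t1 > 0" "\<And>t. 0 < t \<Longrightarrow> t < t1 \<Longrightarrow> f x \<le> avg f x t"
    using sub(1) unfolding submean_at_def by blast
  obtain t2 where t2: "t2 > 0" "\<And>t. 0 < t \<Longrightarrow> t < t2 \<Longrightarrow> g y \<le> avg g y t"
    using sub(2) unfolding submean_at_def by blast
  define t where "t = min (min d1 d2) (min (min d3 (r / real DIM('a))) (min t1 t2 / 2))"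
  have t: "0 < t" "t \<le> d1" "t \<le> d2" "t \<le> d3" "t < t1" "t < t2" "t \<le> r / real DIM('a)"
  proof -
    have m: "min t1 t2 / 2 < t1" "min t1 t2 / 2 < t2" using t1 t2 by (auto simp: min_def)
    show "0 < t" unfolding t_def using d1 d2 d3 t1 t2 \<open>r > 0\<close> by simp
    show "t \<le> d1" "t \<le> d2" "t \<le> d3" "t \<le> r / real DIM('a)" unfolding t_def by simp_all
    have "t \<le> min t1 t2 / 2"
      unfolding t_def by (rule min.coboundedI2, rule min.coboundedI2, rule order_refl)
    then show "t < t1" "t < t2" using m by linarith+
  qed
  then have tr: "t * real DIM('a) \<le> r" by (simp add: field_simps)
  have "t * 1 \<le> t * real DIM('a)" using t by (intro mult_left_mono) (auto simp: Suc_leI)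
  then have tr': "t \<le> r" using tr by simp
  let ?W = "cbox (- One) (One::'a)"
  \<comment> \<open>\<open>\<alpha>\<close> and \<open>\<beta>\<close> are the relative increments
    of \<open>f\<close> and \<open>g\<close>; \<open>\<alpha>'\<close> and \<open>\<beta>'\<close>
    are what remains after the linear parts are removed. The increment of \<open>g\<close> is taken
    at the mirrored point, so that one variable \<open>z\<close> drives both.\<close>
  define \<alpha> where "\<alpha> z = f (x + t *\<^sub>R z) / f x - 1" for z
  define \<beta> where "\<beta> z = g (y + t *\<^sub>R mirror e z) / g y - 1" for z
  define \<alpha>' where "\<alpha>' z = \<alpha> z - t * (A \<bullet> z)" for z
  define \<beta>' where "\<beta>' z = \<beta> z - t * (mirror e B \<bullet> z)" for z
  have contf: "continuous_on ?W (\<lambda>z. f (x + t *\<^sub>R z))"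
    using tr t avg_add_mem[of t _ x] by (intro continuous_on_compose2[OF f] continuous_intros) force
  have mirror_W: "y + t *\<^sub>R mirror e z \<in> cball y r" if "z \<in> ?W" for z
  proof -
    have "t * norm z \<le> t * real DIM('a)" using unit_cube_norm[OF that] t by (intro mult_left_mono) auto
    then have "t * norm z \<le> r" using tr by linarith
    then show ?thesis using t by (simp add: dist_norm norm_mirror[OF e])
  qed
  have contg: "continuous_on ?W (\<lambda>z. g (y + t *\<^sub>R mirror e z))"
    using mirror_W by (intro continuous_on_compose2[OF g] continuous_intros) auto
  have c\<alpha>: "continuous_on ?W \<alpha>" and c\<beta>: "continuous_on ?W \<beta>"
    unfolding \<alpha>_def \<beta>_def using pos by (auto intro!: continuous_intros contf contg)
  have c\<alpha>': "continuous_on ?W \<alpha>'" and c\<beta>': "continuous_on ?W \<beta>'"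
    unfolding \<alpha>'_def \<beta>'_def by (intro continuous_intros c\<alpha> c\<beta>)+
  have cq: "continuous_on ?W q" by (rule continuous_on_subset[OF q(1)]) simp
  have cint: "(\<lambda>z. kern z * F z) integrable_on ?W" if "continuous_on ?W F" for F
    by (intro integrable_continuous continuous_intros that)
  define E where "E F = integral ?W (\<lambda>z. kern z * F z)" for F
  have E_add: "E (\<lambda>z. F z + G z) = E F + E G" if "continuous_on ?W F" "continuous_on ?W G" for F G
    unfolding E_def by (simp add: distrib_left Henstock_Kurzweil_Integration.integral_add cint that)
  have E_cmul: "E (\<lambda>z. c * F z) = c * E F" for c F
    unfolding E_def by (simp add: mult.left_commute)
  have E_const: "E (\<lambda>z. c) = c" for c unfolding E_def by (simp add: integral_kern)
  have E_mono: "E F \<le> E G" if "continuous_on ?W F" "continuous_on ?W G" "\<And>z. norm z < 1 \<Longrightarrow> F z \<le> G z" for F G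
    unfolding E_def
  proof (rule integral_le)
    fix z :: 'a
    show "kern z * F z \<le> kern z * G z"
      using that(3)[of z] kern_nonneg[of z] kern_eq_0[of z] by (cases "norm z < 1") (auto intro: mult_left_mono)
  qed (use cint that in auto)
  have E_inner: "E (\<lambda>z. v \<bullet> z) = 0" for v unfolding E_def by (rule integral_kern_inner)
  have E_inner2: "E (\<lambda>z. (v \<bullet> z) * (w \<bullet> z)) = kern_moment TYPE('a) * (v \<bullet> w)" for v w
    unfolding E_def by (rule integral_kern_inner_inner)
  note ci = continuous_intros c\<alpha> c\<beta> c\<alpha>' c\<beta>' cq
  have "E (\<lambda>z. f (x + t *\<^sub>R z)) \<ge> f x" using t1(2)[OF t(1,5)] by (simp add: avg_def E_def)
  then have "E (\<lambda>z. (1 / f x) * f (x + t *\<^sub>R z)) \<ge> 1" unfolding E_cmul using pos by simp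
  then have E\<alpha>: "E \<alpha> \<ge> 0"
    using E_add[of "\<lambda>z. (1 / f x) * f (x + t *\<^sub>R z)" "\<lambda>_. - 1"] contf
    by (simp add: E_const \<alpha>_def[abs_def] continuous_on_mult_left divide_inverse mult.commute)
  have "E (\<lambda>z. g (y + t *\<^sub>R mirror e z)) = E (\<lambda>z. g (y + t *\<^sub>R z))"
    unfolding E_def
  proof (rule integral_kern_mirror[OF _ e, of "\<lambda>z. g (y + t *\<^sub>R z)"])
    show "continuous_on (cball 0 1) (\<lambda>z. g (y + t *\<^sub>R z))"
    proof (rule continuous_on_compose2[OF g])
      show "(\<lambda>z. y + t *\<^sub>R z) ` cball 0 1 \<subseteq> cball y r"
      proof safe
        fix z :: 'a assume "z \<in> cball 0 1"
        then have "t * norm z \<le> t" using t by (intro mult_left_le) auto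
        then have "t * norm z \<le> r" using tr' by linarith
        then show "y + t *\<^sub>R z \<in> cball y r" using t by (simp add: dist_norm)
      qed
    qed (intro continuous_intros)
  qed
  then have "E (\<lambda>z. g (y + t *\<^sub>R mirror e z)) \<ge> g y" using t2(2)[OF t(1,6)] by (simp add: avg_def E_def)
  then have "E (\<lambda>z. (1 / g y) * g (y + t *\<^sub>R mirror e z)) \<ge> 1" unfolding E_cmul using pos by simp
  then have E\<beta>: "E \<beta> \<ge> 0"
    using E_add[of "\<lambda>z. (1 / g y) * g (y + t *\<^sub>R mirror e z)" "\<lambda>_. - 1"] contg
    by (simp add: E_const \<beta>_def[abs_def] continuous_on_mult_left divide_inverse mult.commute)
  have "\<alpha>' = (\<lambda>z. \<alpha> z + (- t) * (A \<bullet> z))" by (simp add: \<alpha>'_def fun_eq_iff)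
  moreover have "E (\<lambda>z. \<alpha> z + (- t) * (A \<bullet> z)) = E \<alpha> + E (\<lambda>z. (- t) * (A \<bullet> z))"
    by (rule E_add; intro ci)
  ultimately have E\<alpha>': "E \<alpha>' \<ge> 0" using E\<alpha> by (simp only: E_cmul E_inner)
  have "\<beta>' = (\<lambda>z. \<beta> z + (- t) * (mirror e B \<bullet> z))" by (simp add: \<beta>'_def fun_eq_iff)
  moreover have "E (\<lambda>z. \<beta> z + (- t) * (mirror e B \<bullet> z)) = E \<beta> + E (\<lambda>z. (- t) * (mirror e B \<bullet> z))"
    by (rule E_add; intro ci)
  ultimately have E\<beta>': "E \<beta>' \<ge> 0" using E\<beta> by (simp only: E_cmul E_inner)
  have \<alpha>'_le: "\<alpha>' z \<le> \<epsilon> * t" if "norm z < 1" for z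
  proof -
    have nz: "norm (t *\<^sub>R z) \<le> t" using that t by (simp add: mult_left_le)
    have "f (x + t *\<^sub>R z) \<le> f x * (1 + A \<bullet> (t *\<^sub>R z) + \<epsilon> * norm (t *\<^sub>R z))"
      by (intro d1(2) order_trans[OF nz] t)
    then have "\<alpha>' z \<le> \<epsilon> * norm (t *\<^sub>R z)"
      using pos by (simp add: \<alpha>'_def \<alpha>_def field_simps)
    also have "\<dots> \<le> \<epsilon> * t" using nz \<epsilon> by (intro mult_left_mono) auto
    finally show ?thesis .
  qed
  have \<beta>'_le: "\<beta>' z \<le> \<epsilon> * t" if "norm z < 1" for z
  proof -
    have nz: "norm (t *\<^sub>R mirror e z) \<le> t" using that t norm_mirror[OF e] by (simp add: mult_left_le)
    have "g (y + t *\<^sub>R mirror e z) \<le> g y * (1 + B \<bullet> (t *\<^sub>R mirror e z) + \<epsilon> * norm (t *\<^sub>R mirror e z))"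
      by (intro d2(2) order_trans[OF nz] t)
    then have "\<beta>' z \<le> \<epsilon> * norm (t *\<^sub>R mirror e z)"
      using pos by (simp add: \<beta>'_def \<beta>_def field_simps inner_mirror)
    also have "\<dots> \<le> \<epsilon> * t" using nz \<epsilon> by (intro mult_left_mono) auto
    finally show ?thesis .
  qed
  \<comment> \<open>The remainders are bounded from above pointwise, by touching, and from below in
    the mean, by the submean property. Together this controls the mean of the absolute value, since
    \<open>\<bar>s\<bar> \<le> 2 * (\<epsilon> * t) - s\<close> whenever
    \<open>s \<le> \<epsilon> * t\<close>.\<close>
  have E_abs: "E (\<lambda>z. \<bar>F z\<bar>) \<le> 2 * (\<epsilon> * t)" if "continuous_on ?W F" "E F \<ge> 0" "\<And>z. norm z < 1 \<Longrightarrow> F z \<le> \<epsilon> * t" for F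
  proof -
    have "E (\<lambda>z. \<bar>F z\<bar>) \<le> E (\<lambda>z. 2 * (\<epsilon> * t) + (- 1) * F z)"
    proof (rule E_mono)
      show "\<bar>F z\<bar> \<le> 2 * (\<epsilon> * t) + (- 1) * F z" if "norm z < 1" for z
        using \<open>\<And>z. norm z < 1 \<Longrightarrow> F z \<le> \<epsilon> * t\<close>[OF that] \<epsilon> t by (auto simp: abs_if)
    qed (intro continuous_intros that)+
    also have "\<dots> = 2 * (\<epsilon> * t) + (- 1) * E F"
      by (subst E_add) (auto simp only: E_const E_cmul intro!: continuous_intros that)
    finally show ?thesis using that by simp
  qed
  have \<beta>_abs: "\<bar>\<beta> z\<bar> \<le> L' * t" if "norm z < 1" for z
  proof -
    have nz: "norm (t *\<^sub>R mirror e z) \<le> t" using that t norm_mirror[OF e] by (simp add: mult_left_le)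
    have "\<bar>g (y + t *\<^sub>R mirror e z) - g y\<bar> \<le> L * norm (t *\<^sub>R mirror e z)"
      using nz tr' by (intro lip) simp
    also have "\<dots> \<le> \<bar>L\<bar> * t" using nz by (intro mult_mono) auto
    finally have "\<bar>g (y + t *\<^sub>R mirror e z) - g y\<bar> / g y \<le> L' * t"
      using pos by (simp add: L'_def divide_right_mono)
    moreover have "\<beta> z = (g (y + t *\<^sub>R mirror e z) - g y) / g y"
      using pos by (simp add: \<beta>_def diff_divide_distrib)
    ultimately show ?thesis using pos by (simp add: abs_divide)
  qed
  \<comment> \<open>Upper bound for the correlation of the increments: expand
    \<open>(1 + \<alpha> z) * (1 + \<beta> z)\<close> and drop the means of \<open>\<alpha>\<close>
    and \<open>\<beta>\<close>, which are nonnegative.\<close>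
  have upper: "E (\<lambda>z. \<alpha> z * \<beta> z) \<le> t\<^sup>2 * (E q + \<epsilon>)"
  proof -
    have "E (\<lambda>z. (1 + \<alpha> z) + (\<beta> z + \<alpha> z * \<beta> z)) \<le> E (\<lambda>z. (1 + \<epsilon> * t\<^sup>2) + (t * (p \<bullet> z) + t\<^sup>2 * q z))"
    proof (rule E_mono)
      fix z :: 'a assume z: "norm z < 1"
      then have nz: "norm (t *\<^sub>R z) \<le> t" using t by (simp add: mult_left_le)
      have "f (x + t *\<^sub>R z) * g (y + mirror e (t *\<^sub>R z)) \<le> f x * g y * (1 + p \<bullet> (t *\<^sub>R z) + q (t *\<^sub>R z) + \<epsilon> * (norm (t *\<^sub>R z))\<^sup>2)"
        by (intro d3(2) order_trans[OF nz] t)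
      then have "(f (x + t *\<^sub>R z) / f x) * (g (y + t *\<^sub>R mirror e z) / g y)
          \<le> 1 + t * (p \<bullet> z) + t\<^sup>2 * q z + \<epsilon> * (norm (t *\<^sub>R z))\<^sup>2"
        using pos by (simp add: field_simps mirror_scaleR q(2))
      also have "\<dots> \<le> 1 + t * (p \<bullet> z) + t\<^sup>2 * q z + \<epsilon> * t\<^sup>2"
        using nz \<epsilon> by (intro add_left_mono mult_left_mono power_mono) auto
      also have "(f (x + t *\<^sub>R z) / f x) * (g (y + t *\<^sub>R mirror e z) / g y) = (1 + \<alpha> z) * (1 + \<beta> z)"
        by (simp add: \<alpha>_def \<beta>_def)
      finally have "(1 + \<alpha> z) * (1 + \<beta> z) \<le> 1 + t * (p \<bullet> z) + t\<^sup>2 * q z + \<epsilon> * t\<^sup>2" .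
      then show "(1 + \<alpha> z) + (\<beta> z + \<alpha> z * \<beta> z) \<le> (1 + \<epsilon> * t\<^sup>2) + (t * (p \<bullet> z) + t\<^sup>2 * q z)"
        by (simp add: algebra_simps)
    qed (intro ci)+
    also have "\<dots> = E (\<lambda>z. 1 + \<epsilon> * t\<^sup>2) + E (\<lambda>z. t * (p \<bullet> z) + t\<^sup>2 * q z)"
      by (rule E_add; intro ci)
    also have "E (\<lambda>z. t * (p \<bullet> z) + t\<^sup>2 * q z) = E (\<lambda>z. t * (p \<bullet> z)) + E (\<lambda>z. t\<^sup>2 * q z)"
      by (rule E_add; intro ci)
    also have "E (\<lambda>z. 1 + \<epsilon> * t\<^sup>2) + (E (\<lambda>z. t * (p \<bullet> z)) + E (\<lambda>z. t\<^sup>2 * q z)) = (1 + \<epsilon> * t\<^sup>2) + t\<^sup>2 * E q"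
      by (simp add: E_const E_cmul E_inner)
    also have "E (\<lambda>z. (1 + \<alpha> z) + (\<beta> z + \<alpha> z * \<beta> z)) = 1 + E \<alpha> + (E \<beta> + E (\<lambda>z. \<alpha> z * \<beta> z))"
      by (subst E_add, (intro ci)+, subst E_add, (intro ci)+, subst E_add, (intro ci)+) (simp only: E_const)
    finally show ?thesis using E\<alpha> E\<beta> by (simp add: algebra_simps)
  qed
  have "t\<^sup>2 * (kern_moment TYPE('a) * (A \<bullet> mirror e B)) - (t * norm A) * (2 * (\<epsilon> * t)) - (L' * t) * (2 * (\<epsilon> * t)) \<le> E (\<lambda>z. \<alpha> z * \<beta> z)"
  proof -
    have "E (\<lambda>z. t\<^sup>2 * ((A \<bullet> z) * (mirror e B \<bullet> z)) + ((- (t * norm A)) * \<bar>\<beta>' z\<bar> + (- (L' * t)) * \<bar>\<alpha>' z\<bar>)) \<le> E (\<lambda>z. \<alpha> z * \<beta> z)"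
    proof (rule E_mono)
      fix z :: 'a assume z: "norm z < 1"
      have "\<bar>A \<bullet> z\<bar> \<le> norm A * norm z" by (rule Cauchy_Schwarz_ineq2)
      also have "\<dots> \<le> norm A" using z by (simp add: mult_left_le)
      finally have "\<bar>t * (A \<bullet> z) * \<beta>' z\<bar> \<le> (t * norm A) * \<bar>\<beta>' z\<bar>"
        using t by (simp add: abs_mult mult_right_mono)
      moreover have "\<bar>\<alpha>' z * \<beta> z\<bar> \<le> (L' * t) * \<bar>\<alpha>' z\<bar>"
        using \<beta>_abs[OF z] by (simp add: abs_mult mult.commute mult_left_mono)
      \<comment> \<open>The product of the linear parts carries the gradient term, and both mixed
        terms are small in the mean. The Lipschitz bound for \<open>g\<close> is what bounds the
        factor \<open>\<beta>\<close> in the last one.\<close>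
      moreover have "\<alpha> z * \<beta> z = t\<^sup>2 * ((A \<bullet> z) * (mirror e B \<bullet> z)) + t * (A \<bullet> z) * \<beta>' z + \<alpha>' z * \<beta> z"
        by (simp add: \<alpha>'_def \<beta>'_def algebra_simps power2_eq_square)
      ultimately show "t\<^sup>2 * ((A \<bullet> z) * (mirror e B \<bullet> z)) + ((- (t * norm A)) * \<bar>\<beta>' z\<bar> + (- (L' * t)) * \<bar>\<alpha>' z\<bar>) \<le> \<alpha> z * \<beta> z"
        by (simp add: abs_le_iff)
    qed (intro ci)+
    also have "E (\<lambda>z. t\<^sup>2 * ((A \<bullet> z) * (mirror e B \<bullet> z)) + ((- (t * norm A)) * \<bar>\<beta>' z\<bar> + (- (L' * t)) * \<bar>\<alpha>' z\<bar>))
       = t\<^sup>2 * (kern_moment TYPE('a) * (A \<bullet> mirror e B)) + ((- (t * norm A)) * E (\<lambda>z. \<bar>\<beta>' z\<bar>) + (- (L' * t)) * E (\<lambda>z. \<bar>\<alpha>' z\<bar>))"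
      by (subst E_add, (intro ci)+, subst E_add, (intro ci)+) (simp only: E_cmul E_inner2)
    finally have *: "t\<^sup>2 * (kern_moment TYPE('a) * (A \<bullet> mirror e B)) + ((- (t * norm A)) * E (\<lambda>z. \<bar>\<beta>' z\<bar>) + (- (L' * t)) * E (\<lambda>z. \<bar>\<alpha>' z\<bar>)) \<le> E (\<lambda>z. \<alpha> z * \<beta> z)" .
    have "(t * norm A) * E (\<lambda>z. \<bar>\<beta>' z\<bar>) \<le> (t * norm A) * (2 * (\<epsilon> * t))"
      using t by (intro mult_left_mono E_abs c\<beta>' E\<beta>' \<beta>'_le) auto
    moreover have "(L' * t) * E (\<lambda>z. \<bar>\<alpha>' z\<bar>) \<le> (L' * t) * (2 * (\<epsilon> * t))"
      using t L' by (intro mult_left_mono E_abs c\<alpha>' E\<alpha>' \<alpha>'_le) auto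
    moreover have "t\<^sup>2 * (kern_moment TYPE('a) * (A \<bullet> mirror e B)) - (t * norm A) * E (\<lambda>z. \<bar>\<beta>' z\<bar>) - (L' * t) * E (\<lambda>z. \<bar>\<alpha>' z\<bar>) \<le> E (\<lambda>z. \<alpha> z * \<beta> z)"
      using * by simp
    ultimately show ?thesis by linarith
  qed
  with upper have "t\<^sup>2 * (kern_moment TYPE('a) * (A \<bullet> mirror e B)) \<le> t\<^sup>2 * (E q + \<epsilon> * (1 + 2 * norm A + 2 * L'))"
    by (simp add: algebra_simps power2_eq_square)
  then have "kern_moment TYPE('a) * (A \<bullet> mirror e B) \<le> E q + \<epsilon> * (1 + 2 * norm A + 2 * L')"
    using t by (simp only: mult_le_cancel_left_pos zero_less_power)
  also have "\<epsilon> * (1 + 2 * norm A + 2 * L') = \<epsilon>0"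
  proof -
    have "1 + 2 * norm A + 2 * L' > 0" using L' by (intro add_pos_nonneg) auto
    then show ?thesis by (simp add: \<epsilon>_def)
  qed
  finally show "kern_moment TYPE('a) * (A \<bullet> mirror e B) \<le> integral ?W (\<lambda>z. kern z * q z) + \<epsilon>0"
    by (simp add: E_def)
qed

section \<open>Second order expansions\<close>

text \<open>A Peano expansion at 0. The growth bound on \<open>q\<close> makes the notion closed
  under composition with functions of one variable, so that expansions are assembled without
  computing Hessians.\<close>

definition taylor2 :: "('a::euclidean_space \<Rightarrow> real) \<Rightarrow> real \<Rightarrow> 'a \<Rightarrow> ('a \<Rightarrow> real) \<Rightarrow> bool" where
  "taylor2 F c l q \<longleftrightarrow>
     (\<forall>\<epsilon>>0. \<exists>\<delta>>0. \<forall>\<xi>. norm \<xi> \<le> \<delta> \<longrightarrow> \<bar>F \<xi> - (c + l \<bullet> \<xi> + q \<xi>)\<bar> \<le> \<epsilon> * (norm \<xi>)\<^sup>2) \<and>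
     (\<exists>C\<ge>0. \<forall>\<xi>. \<bar>q \<xi>\<bar> \<le> C * (norm \<xi>)\<^sup>2)"

lemma taylor2_quadratic:
  assumes "\<And>\<xi>. \<bar>q \<xi>\<bar> \<le> C * (norm \<xi>)\<^sup>2" "C \<ge> 0"
  shows "taylor2 (\<lambda>\<xi>. c + l \<bullet> \<xi> + q \<xi>) c l q"
  unfolding taylor2_def
proof (intro conjI allI impI)
  show "\<exists>\<delta>>0. \<forall>\<xi>. norm \<xi> \<le> \<delta> \<longrightarrow> \<bar>c + l \<bullet> \<xi> + q \<xi> - (c + l \<bullet> \<xi> + q \<xi>)\<bar> \<le> \<epsilon> * (norm \<xi>)\<^sup>2" if "\<epsilon> > 0" for \<epsilon>
    using that by (intro exI[of _ 1]) auto
  show "\<exists>C\<ge>0. \<forall>\<xi>. \<bar>q \<xi>\<bar> \<le> C * (norm \<xi>)\<^sup>2"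
    using assms by (intro exI[of _ C]) auto
qed

lemma taylor2_add:
  assumes "taylor2 F c l q" "taylor2 G c' l' q'"
  shows "taylor2 (\<lambda>\<xi>. F \<xi> + G \<xi>) (c + c') (l + l') (\<lambda>\<xi>. q \<xi> + q' \<xi>)"
  unfolding taylor2_def
proof (intro conjI allI impI)
  fix \<epsilon> :: real assume "\<epsilon> > 0"
  then obtain d1 where d1: "d1 > 0" "\<And>\<xi>. norm \<xi> \<le> d1 \<Longrightarrow> \<bar>F \<xi> - (c + l \<bullet> \<xi> + q \<xi>)\<bar> \<le> \<epsilon> / 2 * (norm \<xi>)\<^sup>2"
    using assms(1) unfolding taylor2_def by (meson half_gt_zero)
  obtain d2 where d2: "d2 > 0" "\<And>\<xi>. norm \<xi> \<le> d2 \<Longrightarrow> \<bar>G \<xi> - (c' + l' \<bullet> \<xi> + q' \<xi>)\<bar> \<le> \<epsilon> / 2 * (norm \<xi>)\<^sup>2"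
    using assms(2) \<open>\<epsilon> > 0\<close> unfolding taylor2_def by (meson half_gt_zero)
  show "\<exists>\<delta>>0. \<forall>\<xi>. norm \<xi> \<le> \<delta> \<longrightarrow> \<bar>F \<xi> + G \<xi> - (c + c' + (l + l') \<bullet> \<xi> + (q \<xi> + q' \<xi>))\<bar> \<le> \<epsilon> * (norm \<xi>)\<^sup>2"
  proof (intro exI[of _ "min d1 d2"] conjI allI impI)
    fix \<xi> :: 'a assume "norm \<xi> \<le> min d1 d2"
    then have "\<bar>F \<xi> - (c + l \<bullet> \<xi> + q \<xi>)\<bar> + \<bar>G \<xi> - (c' + l' \<bullet> \<xi> + q' \<xi>)\<bar> \<le> \<epsilon> / 2 * (norm \<xi>)\<^sup>2 + \<epsilon> / 2 * (norm \<xi>)\<^sup>2"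
      by (intro add_mono d1 d2) auto
    moreover have "F \<xi> + G \<xi> - (c + c' + (l + l') \<bullet> \<xi> + (q \<xi> + q' \<xi>)) = (F \<xi> - (c + l \<bullet> \<xi> + q \<xi>)) + (G \<xi> - (c' + l' \<bullet> \<xi> + q' \<xi>))"
      by (simp add: inner_add_left)
    ultimately show "\<bar>F \<xi> + G \<xi> - (c + c' + (l + l') \<bullet> \<xi> + (q \<xi> + q' \<xi>))\<bar> \<le> \<epsilon> * (norm \<xi>)\<^sup>2"
      using abs_triangle_ineq[of "F \<xi> - (c + l \<bullet> \<xi> + q \<xi>)" "G \<xi> - (c' + l' \<bullet> \<xi> + q' \<xi>)"] by simp
  qed (use d1 d2 in auto)
next
  obtain C1 where C1: "C1 \<ge> 0" "\<And>\<xi>. \<bar>q \<xi>\<bar> \<le> C1 * (norm \<xi>)\<^sup>2" using assms(1) unfolding taylor2_def by blast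
  obtain C2 where C2: "C2 \<ge> 0" "\<And>\<xi>. \<bar>q' \<xi>\<bar> \<le> C2 * (norm \<xi>)\<^sup>2" using assms(2) unfolding taylor2_def by blast
  show "\<exists>C\<ge>0. \<forall>\<xi>. \<bar>q \<xi> + q' \<xi>\<bar> \<le> C * (norm \<xi>)\<^sup>2"
  proof (intro exI[of _ "C1 + C2"] conjI allI)
    show "\<bar>q \<xi> + q' \<xi>\<bar> \<le> (C1 + C2) * (norm \<xi>)\<^sup>2" for \<xi>
      using abs_triangle_ineq[of "q \<xi>" "q' \<xi>"] C1(2)[of \<xi>] C2(2)[of \<xi>] by (simp add: distrib_right)
  qed (use C1 C2 in auto)
qed

text \<open>Between \<open>c\<close> and \<open>s\<close> the derivative of the remainder is at most
  \<open>\<epsilon> * \<bar>s - c\<bar>\<close>, so the mean value inequality applies to the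
  remainder.\<close>

lemma taylor2_real:
  fixes g :: "real \<Rightarrow> real"
  assumes "open S" "c \<in> S" and g: "\<And>s. s \<in> S \<Longrightarrow> (g has_real_derivative g' s) (at s)"
    and g': "(g' has_real_derivative k) (at c)" and "\<epsilon> > 0"
  shows "\<exists>\<delta>>0. \<forall>s. \<bar>s - c\<bar> \<le> \<delta> \<longrightarrow> \<bar>g s - (g c + g' c * (s - c) + k / 2 * (s - c)\<^sup>2)\<bar> \<le> \<epsilon> * (s - c)\<^sup>2"
proof -
  obtain d1 where d1: "d1 > 0" "ball c d1 \<subseteq> S" using assms(1,2) openE by blast
  obtain d2 where d2: "d2 > 0" "\<And>s. \<bar>s - c\<bar> < d2 \<Longrightarrow> \<bar>g' s - g' c - k * (s - c)\<bar> \<le> \<epsilon> * \<bar>s - c\<bar>"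
    using g'[unfolded has_field_derivative_def has_derivative_at_alt] \<open>\<epsilon> > 0\<close>
    by (auto simp: dist_real_def algebra_simps)
  define d where "d = min d1 d2 / 2"
  have d: "d > 0" "d < d1" "d < d2" using d1 d2 by (auto simp: d_def min_def)
  show ?thesis
  proof (intro exI[of _ d] conjI allI impI)
    fix s assume s: "\<bar>s - c\<bar> \<le> d"
    define F where "F s = g s - (g c + g' c * (s - c) + k / 2 * (s - c)\<^sup>2)" for s
    show "\<bar>g s - (g c + g' c * (s - c) + k / 2 * (s - c)\<^sup>2)\<bar> \<le> \<epsilon> * (s - c)\<^sup>2"
    proof (cases "s = c")
      case False
      have dF: "(F has_real_derivative (g' \<tau> - g' c - k * (\<tau> - c))) (at \<tau>)" if "\<bar>\<tau> - c\<bar> \<le> \<bar>s - c\<bar>" for \<tau>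
      proof -
        have "\<tau> \<in> ball c d1" using that s d by (auto simp: dist_real_def)
        then have "(g has_real_derivative g' \<tau>) (at \<tau>)" using g d1 by blast
        then show ?thesis unfolding F_def by (auto intro!: derivative_eq_intros)
      qed
      have bound: "\<bar>g' \<tau> - g' c - k * (\<tau> - c)\<bar> \<le> \<epsilon> * \<bar>s - c\<bar>" if "\<bar>\<tau> - c\<bar> \<le> \<bar>s - c\<bar>" for \<tau>
      proof -
        have "\<bar>g' \<tau> - g' c - k * (\<tau> - c)\<bar> \<le> \<epsilon> * \<bar>\<tau> - c\<bar>" using that s d by (intro d2) auto
        also have "\<dots> \<le> \<epsilon> * \<bar>s - c\<bar>" using that \<open>\<epsilon> > 0\<close> by simp
        finally show ?thesis .
      qed
      have mem: "\<tau> \<in> cball c \<bar>s - c\<bar> \<longleftrightarrow> \<bar>\<tau> - c\<bar> \<le> \<bar>s - c\<bar>" for \<tau>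
        unfolding mem_cball dist_real_def by (subst abs_minus_commute) (rule refl)
      have "norm (F s - F c) \<le> (\<epsilon> * \<bar>s - c\<bar>) * norm (s - c)"
      proof (rule field_differentiable_bound[of "cball c \<bar>s - c\<bar>" F "\<lambda>\<tau>. g' \<tau> - g' c - k * (\<tau> - c)"])
        show "(F has_field_derivative g' \<tau> - g' c - k * (\<tau> - c)) (at \<tau> within cball c \<bar>s - c\<bar>)" if "\<tau> \<in> cball c \<bar>s - c\<bar>" for \<tau>
          using that unfolding mem by (rule has_field_derivative_at_within[OF dF])
        show "norm (g' \<tau> - g' c - k * (\<tau> - c)) \<le> \<epsilon> * \<bar>s - c\<bar>" if "\<tau> \<in> cball c \<bar>s - c\<bar>" for \<tau>
          using bound[of \<tau>] that unfolding mem by simp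
        show "s \<in> cball c \<bar>s - c\<bar>" "c \<in> cball c \<bar>s - c\<bar>" unfolding mem by simp_all
      qed (rule convex_cball)
      moreover have "(\<epsilon> * \<bar>s - c\<bar>) * norm (s - c) = \<epsilon> * (s - c)\<^sup>2"
        by (simp add: power2_eq_square)
      ultimately have "\<bar>F s - F c\<bar> \<le> \<epsilon> * (s - c)\<^sup>2" by (simp only: real_norm_def)
      then show ?thesis by (simp add: F_def)
    qed simp
  qed (use d in auto)
qed

lemma taylor2_compose:
  fixes F :: "'a::euclidean_space \<Rightarrow> real"
  assumes F: "taylor2 F c l q" and "open S" "c \<in> S"
    and g: "\<And>s. s \<in> S \<Longrightarrow> (g has_real_derivative g' s) (at s)"
    and g': "(g' has_real_derivative k) (at c)"
  shows "taylor2 (\<lambda>\<xi>. g (F \<xi>)) (g c) (g' c *\<^sub>R l) (\<lambda>\<xi>. g' c * q \<xi> + k / 2 * (l \<bullet> \<xi>)\<^sup>2)"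
  unfolding taylor2_def
proof (intro conjI allI impI)
  obtain C where C: "C \<ge> 0" "\<And>\<xi>. \<bar>q \<xi>\<bar> \<le> C * (norm \<xi>)\<^sup>2" using F unfolding taylor2_def by blast
  show "\<exists>C\<ge>0. \<forall>\<xi>. \<bar>g' c * q \<xi> + k / 2 * (l \<bullet> \<xi>)\<^sup>2\<bar> \<le> C * (norm \<xi>)\<^sup>2"
  proof (intro exI[of _ "\<bar>g' c\<bar> * C + \<bar>k\<bar> / 2 * (norm l)\<^sup>2"] conjI allI)
    fix \<xi>
    have "(l \<bullet> \<xi>)\<^sup>2 \<le> (norm l)\<^sup>2 * (norm \<xi>)\<^sup>2"
      using power_mono[OF Cauchy_Schwarz_ineq2[of l \<xi>] abs_ge_zero, of 2] by (simp add: power_mult_distrib)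
    then have "\<bar>k\<bar> / 2 * (l \<bullet> \<xi>)\<^sup>2 \<le> \<bar>k\<bar> / 2 * ((norm l)\<^sup>2 * (norm \<xi>)\<^sup>2)"
      by (intro mult_left_mono) auto
    moreover have "\<bar>g' c\<bar> * \<bar>q \<xi>\<bar> \<le> \<bar>g' c\<bar> * (C * (norm \<xi>)\<^sup>2)" by (intro mult_left_mono C) auto
    moreover have "\<bar>g' c * q \<xi> + k / 2 * (l \<bullet> \<xi>)\<^sup>2\<bar> \<le> \<bar>g' c\<bar> * \<bar>q \<xi>\<bar> + \<bar>k\<bar> / 2 * (l \<bullet> \<xi>)\<^sup>2"
      by (rule order_trans[OF abs_triangle_ineq]) (simp add: abs_mult)
    ultimately show "\<bar>g' c * q \<xi> + k / 2 * (l \<bullet> \<xi>)\<^sup>2\<bar> \<le> (\<bar>g' c\<bar> * C + \<bar>k\<bar> / 2 * (norm l)\<^sup>2) * (norm \<xi>)\<^sup>2"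
      unfolding distrib_right mult.assoc by linarith
  qed (use C in auto)
  fix \<epsilon> :: real assume "\<epsilon> > 0"
  define D where "D = norm l + C + 1"
  have D: "D \<ge> 1" using C by (simp add: D_def)
  \<comment> \<open>Three errors share \<open>\<epsilon>\<close>: the Taylor remainder of
    \<open>g\<close>, the remainder of \<open>F\<close> multiplied by \<open>g' c\<close>, and the
    replacement of \<open>(F \<xi> - c)\<^sup>2\<close> by
    \<open>(l \<bullet> \<xi>)\<^sup>2\<close>. \<open>D\<close> bounds the slope of
    \<open>F\<close> near 0.\<close>
  define \<epsilon>1 where "\<epsilon>1 = \<epsilon> / (3 * D\<^sup>2)"
  have \<epsilon>1: "\<epsilon>1 > 0" using \<open>\<epsilon> > 0\<close> D by (simp add: \<epsilon>1_def)
  obtain d1 where d1: "d1 > 0" "\<And>s. \<bar>s - c\<bar> \<le> d1 \<Longrightarrow> \<bar>g s - (g c + g' c * (s - c) + k / 2 * (s - c)\<^sup>2)\<bar> \<le> \<epsilon>1 * (s - c)\<^sup>2"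
    using taylor2_real[OF assms(2-5) \<epsilon>1] by blast
  define \<epsilon>2 where "\<epsilon>2 = min 1 (\<epsilon> / (3 * (\<bar>g' c\<bar> + 1)))"
  have "\<epsilon> / (3 * (\<bar>g' c\<bar> + 1)) > 0" using \<open>\<epsilon> > 0\<close> by (intro divide_pos_pos) auto
  then have \<epsilon>2: "\<epsilon>2 > 0" "\<epsilon>2 \<le> 1" "\<epsilon>2 \<le> \<epsilon> / (3 * (\<bar>g' c\<bar> + 1))"
    unfolding \<epsilon>2_def by (simp_all only: min_less_iff_conj min.cobounded1 min.cobounded2 zero_less_one simp_thms)
  have \<epsilon>2': "\<bar>g' c\<bar> * \<epsilon>2 \<le> \<epsilon> / 3"
  proof -
    have "\<bar>g' c\<bar> * \<epsilon>2 \<le> (\<bar>g' c\<bar> + 1) * (\<epsilon> / (3 * (\<bar>g' c\<bar> + 1)))" 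
      by (rule mult_mono[OF _ \<epsilon>2(3)]) (use \<epsilon>2 in simp_all)
    also have "\<dots> = \<epsilon> / 3" by (simp add: field_simps)
    finally show ?thesis .
  qed
  obtain d2 where d2: "d2 > 0" "\<And>\<xi>. norm \<xi> \<le> d2 \<Longrightarrow> \<bar>F \<xi> - (c + l \<bullet> \<xi> + q \<xi>)\<bar> \<le> \<epsilon>2 * (norm \<xi>)\<^sup>2"
    using F \<epsilon>2 unfolding taylor2_def by blast
  define M where "M = \<bar>k\<bar> / 2 * ((C + 1) * (2 * D)) + 1"
  have M: "M \<ge> 1" using C D by (auto simp: M_def intro!: mult_nonneg_nonneg)
  define d where "d = min (min d2 1) (min (d1 / D) (\<epsilon> / (3 * M)))"
  have d: "d > 0" "d \<le> d2" "d \<le> 1" "d \<le> d1 / D" "d \<le> \<epsilon> / (3 * M)"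
    using d1 d2 D M \<open>\<epsilon> > 0\<close> by (auto simp: d_def)
  show "\<exists>\<delta>>0. \<forall>\<xi>. norm \<xi> \<le> \<delta> \<longrightarrow> \<bar>g (F \<xi>) - (g c + g' c *\<^sub>R l \<bullet> \<xi> + (g' c * q \<xi> + k / 2 * (l \<bullet> \<xi>)\<^sup>2))\<bar> \<le> \<epsilon> * (norm \<xi>)\<^sup>2"
  proof (intro exI[of _ d] conjI allI impI)
    fix \<xi> :: 'a assume \<xi>: "norm \<xi> \<le> d"
    have n2: "(norm \<xi>)\<^sup>2 \<le> norm \<xi>" using \<xi> d by (simp add: power2_eq_square mult_left_le)
    define R where "R = F \<xi> - (c + l \<bullet> \<xi> + q \<xi>)"
    have R: "\<bar>R\<bar> \<le> \<epsilon>2 * (norm \<xi>)\<^sup>2" unfolding R_def using \<xi> d by (intro d2) auto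
    also have "\<dots> \<le> 1 * (norm \<xi>)\<^sup>2" using \<epsilon>2 by (intro mult_right_mono) auto
    finally have R1: "\<bar>R\<bar> \<le> (norm \<xi>)\<^sup>2" by simp
    have qR: "\<bar>q \<xi> + R\<bar> \<le> (C + 1) * (norm \<xi>)\<^sup>2"
      using C(2)[of \<xi>] R1 by (simp add: distrib_right abs_le_iff)
    also have "\<dots> \<le> (C + 1) * norm \<xi>" using n2 C by (intro mult_left_mono) auto
    finally have qR': "\<bar>q \<xi> + R\<bar> \<le> (C + 1) * norm \<xi>" .
    have lx: "\<bar>l \<bullet> \<xi>\<bar> \<le> norm l * norm \<xi>" by (rule Cauchy_Schwarz_ineq2)
    have s: "F \<xi> - c = l \<bullet> \<xi> + (q \<xi> + R)" by (simp add: R_def)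
    have sD: "\<bar>F \<xi> - c\<bar> \<le> D * norm \<xi>"
      unfolding s D_def using lx qR' abs_triangle_ineq[of "l \<bullet> \<xi>" "q \<xi> + R"] by (simp add: algebra_simps)
    also have "\<dots> \<le> d1"
    proof -
      have "D * norm \<xi> \<le> D * (d1 / D)" using \<xi> d D by (intro mult_left_mono) auto
      then show ?thesis using D by simp
    qed
    finally have "\<bar>g (F \<xi>) - (g c + g' c * (F \<xi> - c) + k / 2 * (F \<xi> - c)\<^sup>2)\<bar> \<le> \<epsilon>1 * (F \<xi> - c)\<^sup>2" by (rule d1)
    also have "\<dots> \<le> \<epsilon>1 * (D * norm \<xi>)\<^sup>2"
      using sD \<epsilon>1 by (intro mult_left_mono) (auto intro: power2_le_iff_abs_le[THEN iffD2] simp: abs_le_square_iff[symmetric])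
    also have "\<dots> = \<epsilon> / 3 * (norm \<xi>)\<^sup>2" using D by (simp add: \<epsilon>1_def power_mult_distrib)
    finally have t1: "\<bar>g (F \<xi>) - (g c + g' c * (F \<xi> - c) + k / 2 * (F \<xi> - c)\<^sup>2)\<bar> \<le> \<epsilon> / 3 * (norm \<xi>)\<^sup>2" .
    have "\<bar>g' c * R\<bar> \<le> \<bar>g' c\<bar> * (\<epsilon>2 * (norm \<xi>)\<^sup>2)" unfolding abs_mult using R by (intro mult_left_mono) auto
    also have "\<dots> \<le> \<epsilon> / 3 * (norm \<xi>)\<^sup>2" unfolding mult.assoc[symmetric] using \<epsilon>2' by (intro mult_right_mono) auto
    finally have t2: "\<bar>g' c * R\<bar> \<le> \<epsilon> / 3 * (norm \<xi>)\<^sup>2" .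
    have "\<bar>(F \<xi> - c)\<^sup>2 - (l \<bullet> \<xi>)\<^sup>2\<bar> = \<bar>q \<xi> + R\<bar> * \<bar>(F \<xi> - c) + l \<bullet> \<xi>\<bar>"
      unfolding s abs_mult[symmetric] by (simp add: algebra_simps power2_eq_square)
    also have "\<dots> \<le> ((C + 1) * (norm \<xi>)\<^sup>2) * (2 * D * norm \<xi>)"
    proof (intro mult_mono qR)
      have "\<bar>l \<bullet> \<xi>\<bar> \<le> D * norm \<xi>" 
        using lx C mult_right_mono[of "norm l" D "norm \<xi>"] by (simp add: D_def)
      then show "\<bar>(F \<xi> - c) + l \<bullet> \<xi>\<bar> \<le> 2 * D * norm \<xi>" using sD by (simp add: abs_le_iff)
    qed (use C in auto)
    finally have I: "\<bar>(F \<xi> - c)\<^sup>2 - (l \<bullet> \<xi>)\<^sup>2\<bar> \<le> ((C + 1) * (norm \<xi>)\<^sup>2) * (2 * D * norm \<xi>)" .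
    have "\<bar>k / 2 * ((F \<xi> - c)\<^sup>2 - (l \<bullet> \<xi>)\<^sup>2)\<bar> = \<bar>k\<bar> / 2 * \<bar>(F \<xi> - c)\<^sup>2 - (l \<bullet> \<xi>)\<^sup>2\<bar>"
      by (simp only: abs_mult abs_divide abs_numeral)
    also have "\<dots> \<le> \<bar>k\<bar> / 2 * (((C + 1) * (norm \<xi>)\<^sup>2) * (2 * D * norm \<xi>))"
      by (rule mult_left_mono[OF I]) simp
    also have "\<dots> = (\<bar>k\<bar> / 2 * ((C + 1) * (2 * D))) * norm \<xi> * (norm \<xi>)\<^sup>2"
      by (simp only: mult.assoc mult.commute mult.left_commute)
    also have "\<dots> \<le> (M * d) * (norm \<xi>)\<^sup>2"
    proof (rule mult_right_mono)
      show "(\<bar>k\<bar> / 2 * ((C + 1) * (2 * D))) * norm \<xi> \<le> M * d"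
        by (rule mult_mono) (use \<xi> M in \<open>auto simp: M_def\<close>)
    qed simp
    also have "\<dots> \<le> \<epsilon> / 3 * (norm \<xi>)\<^sup>2"
    proof (rule mult_right_mono)
      have "M * d \<le> M * (\<epsilon> / (3 * M))" using d M by (intro mult_left_mono) auto
      then show "M * d \<le> \<epsilon> / 3" using M by simp
    qed simp
    finally have t3: "\<bar>k / 2 * ((F \<xi> - c)\<^sup>2 - (l \<bullet> \<xi>)\<^sup>2)\<bar> \<le> \<epsilon> / 3 * (norm \<xi>)\<^sup>2" .
    have eq: "g (F \<xi>) - (g c + g' c *\<^sub>R l \<bullet> \<xi> + (g' c * q \<xi> + k / 2 * (l \<bullet> \<xi>)\<^sup>2))
      = (g (F \<xi>) - (g c + g' c * (F \<xi> - c) + k / 2 * (F \<xi> - c)\<^sup>2)) + g' c * R + k / 2 * ((F \<xi> - c)\<^sup>2 - (l \<bullet> \<xi>)\<^sup>2)"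
      by (simp add: R_def algebra_simps)
    have "\<bar>g (F \<xi>) - (g c + g' c *\<^sub>R l \<bullet> \<xi> + (g' c * q \<xi> + k / 2 * (l \<bullet> \<xi>)\<^sup>2))\<bar> \<le> \<epsilon> / 3 * (norm \<xi>)\<^sup>2 + \<epsilon> / 3 * (norm \<xi>)\<^sup>2 + \<epsilon> / 3 * (norm \<xi>)\<^sup>2"
      unfolding eq by (intro order_trans[OF abs_triangle_ineq] add_mono t1 t2 t3)
    then show "\<bar>g (F \<xi>) - (g c + g' c *\<^sub>R l \<bullet> \<xi> + (g' c * q \<xi> + k / 2 * (l \<bullet> \<xi>)\<^sup>2))\<bar> \<le> \<epsilon> * (norm \<xi>)\<^sup>2"
      by simp
  qed (fact d(1))
qed

text \<open>Under mirrored increments of \<open>x\<close> and \<open>y\<close> the direction \<open>e = sgn (x - y)\<close> and the component along \<open>e\<close> of the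
  midpoint \<open>m\<close> do not change, hence neither does \<open>mirror_defect\<close>, which is \<open>(norm (e - e0))\<^sup>2 + (m \<bullet> e)\<^sup>2\<close>.
  Only \<open>scale_dist\<close> contributes to the second order test, and its exponential is a strict subsolution where its
  gradient is not small. The functions \<open>grad_scale_dist\<close>, \<open>grad_mirror_defect\<close>, \<open>grad_pair_weight\<close> are
  gradients in \<open>x\<close> (divided by \<open>pair_weight\<close> in the last case), and \<open>coupled_grad\<close> is the gradient of
  \<open>scale_dist\<close> along the coupling.\<close>

definition scale_dist :: "'a::euclidean_space \<Rightarrow> real \<Rightarrow> 'a \<Rightarrow> 'a \<Rightarrow> real" where
  "scale_dist mc rc x y = (norm ((1/2) *\<^sub>R (x + y) - mc))\<^sup>2 + (ln (norm (x - y)) - ln rc)\<^sup>2"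

definition mirror_defect :: "'a::euclidean_space \<Rightarrow> 'a \<Rightarrow> 'a \<Rightarrow> real" where
  "mirror_defect e0 x y = 2 - 2 * (sgn (x - y) \<bullet> e0) + (((1/2) *\<^sub>R (x + y)) \<bullet> sgn (x - y))\<^sup>2"

text \<open>The exponential keeps the pair near a hole centre and its mirror image; the penalty
  keeps it nearly mirrored in the hyperplane orthogonal to \<open>e0\<close>.\<close>

definition pair_barrier :: "real \<Rightarrow> real \<Rightarrow> 'a::euclidean_space \<Rightarrow> real \<Rightarrow> 'a \<Rightarrow> 'a \<Rightarrow> 'a \<Rightarrow> real" where
  "pair_barrier \<alpha> K mc rc e0 x y = exp (- \<alpha> * scale_dist mc rc x y) - K * mirror_defect e0 x y"

text \<open>The denominator of the two-point quotient. \<open>a\<close> softens small distances, and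
  \<open>b\<close> is the strength of the perturbation, chosen last: it helps to first order and
  hurts to second order.\<close>

definition pair_weight :: "real \<Rightarrow> real \<Rightarrow> real \<Rightarrow> real \<Rightarrow> 'a::euclidean_space \<Rightarrow> real \<Rightarrow> 'a \<Rightarrow> 'a \<Rightarrow> 'a \<Rightarrow> real" where
  "pair_weight a b \<alpha> K mc rc e0 x y = (norm (x - y) + a)\<^sup>2 * exp (- b * pair_barrier \<alpha> K mc rc e0 x y)"

definition grad_scale_dist :: "'a::euclidean_space \<Rightarrow> real \<Rightarrow> 'a \<Rightarrow> 'a \<Rightarrow> 'a" where
  "grad_scale_dist mc rc x y = ((1/2) *\<^sub>R (x + y) - mc) + (2 * (ln (norm (x - y)) - ln rc) / norm (x - y)) *\<^sub>R sgn (x - y)"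

definition perp :: "'a::euclidean_space \<Rightarrow> 'a \<Rightarrow> 'a" where
  "perp e v = v - (e \<bullet> v) *\<^sub>R e"

definition grad_mirror_defect :: "'a::euclidean_space \<Rightarrow> 'a \<Rightarrow> 'a \<Rightarrow> 'a" where
  "grad_mirror_defect e0 x y = (- 2 / norm (x - y)) *\<^sub>R perp (sgn (x - y)) e0 +
     (2 * (((1/2) *\<^sub>R (x + y)) \<bullet> sgn (x - y))) *\<^sub>R
       ((1/2) *\<^sub>R sgn (x - y) + (1 / norm (x - y)) *\<^sub>R perp (sgn (x - y)) ((1/2) *\<^sub>R (x + y)))"

definition grad_pair_weight :: "real \<Rightarrow> real \<Rightarrow> real \<Rightarrow> real \<Rightarrow> 'a::euclidean_space \<Rightarrow> real \<Rightarrow> 'a \<Rightarrow> 'a \<Rightarrow> 'a \<Rightarrow> 'a" where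
  "grad_pair_weight a b \<alpha> K mc rc e0 x y = (2 / (norm (x - y) + a)) *\<^sub>R sgn (x - y)
      + (b * \<alpha> * exp (- \<alpha> * scale_dist mc rc x y)) *\<^sub>R grad_scale_dist mc rc x y + (b * K) *\<^sub>R grad_mirror_defect e0 x y"

section \<open>Derivatives of the two-point weight\<close>

lemma has_derivative_norm_minus:
  fixes x y :: "'a::euclidean_space"
  assumes "x \<noteq> y"
  shows "((\<lambda>x. norm (x - y)) has_derivative (\<lambda>\<xi>. sgn (x - y) \<bullet> \<xi>)) (at x)"
proof -
  have "((\<lambda>x. x - y) has_derivative (\<lambda>\<xi>. \<xi>)) (at x)" by (auto intro!: derivative_eq_intros)
  from has_derivative_compose[OF this, of norm "\<lambda>h. h \<bullet> sgn (x - y)"] show ?thesis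
    using has_derivative_norm[of "x - y"] assms by (simp add: inner_commute)
qed

lemma norm_scaleR_sgn: "norm v *\<^sub>R sgn v = (v :: 'a::euclidean_space)"
  by (cases "v = 0") (simp_all add: sgn_div_norm)

lemma has_derivative_sgn_inner:
  fixes x y v :: "'a::euclidean_space"
  assumes "x \<noteq> y"
  shows "((\<lambda>x. sgn (x - y) \<bullet> v) has_derivative (\<lambda>\<xi>. ((1 / norm (x - y)) *\<^sub>R perp (sgn (x - y)) v) \<bullet> \<xi>)) (at x)"
proof -
  define n where "n = norm (x - y)"
  define e where "e = sgn (x - y)"
  have n: "n \<noteq> 0" using assms by (simp add: n_def)
  have eq: "(\<lambda>x. sgn (x - y) \<bullet> v) = (\<lambda>x. ((x - y) \<bullet> v) / norm (x - y))"
    by (simp add: sgn_div_norm fun_eq_iff divide_inverse mult.commute)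
  have xe: "(x - y) \<bullet> v = n * (e \<bullet> v)"
    unfolding n_def e_def by (metis inner_scaleR_left norm_scaleR_sgn)
  have num: "((\<lambda>x. (x - y) \<bullet> v) has_derivative (\<lambda>\<xi>. \<xi> \<bullet> v)) (at x)"
    by (auto intro!: derivative_eq_intros)
  have "((\<lambda>x. ((x - y) \<bullet> v) / norm (x - y)) has_derivative
     (\<lambda>h. - ((x - y) \<bullet> v) * (inverse n * (e \<bullet> h) * inverse n) + (h \<bullet> v) / n)) (at x)"
    using has_derivative_divide[OF num has_derivative_norm_minus[OF assms]] n unfolding n_def e_def by simp
  moreover have "- ((x - y) \<bullet> v) * (inverse n * (e \<bullet> h) * inverse n) + (h \<bullet> v) / n = ((1 / n) *\<^sub>R perp e v) \<bullet> h" for h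
    using n unfolding xe perp_def
    by (simp add: inner_diff_left inner_commute[of h v] field_simps)
  ultimately show ?thesis unfolding eq n_def e_def by simp
qed

lemma has_derivative_scale_dist:
  assumes "x \<noteq> y"
  shows "((\<lambda>x. scale_dist mc rc x y) has_derivative (\<lambda>\<xi>. grad_scale_dist mc rc x y \<bullet> \<xi>)) (at x)"
proof -
  have n: "norm (x - y) > 0" using assms by simp
  have "((\<lambda>x. (1/2) *\<^sub>R (x + y) - mc) has_derivative (\<lambda>\<xi>. (1/2) *\<^sub>R \<xi>)) (at x)"
    by (auto intro!: derivative_eq_intros)
  from has_derivative_inner[OF this this]
  have 1: "((\<lambda>x. (norm ((1/2) *\<^sub>R (x + y) - mc))\<^sup>2) has_derivative (\<lambda>\<xi>. ((1/2) *\<^sub>R (x + y) - mc) \<bullet> \<xi>)) (at x)"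
    unfolding power2_norm_eq_inner by (simp add: inner_commute)
  have "((\<lambda>x. ln (norm (x - y)) - ln rc) has_derivative (\<lambda>\<xi>. (sgn (x - y) \<bullet> \<xi>) / norm (x - y))) (at x)"
    using has_derivative_diff[OF has_derivative_ln[OF n has_derivative_norm_minus[OF assms]] has_derivative_const[of "ln rc"]]
    by (simp add: divide_inverse)
  from has_derivative_power[OF this, of 2]
  have 2: "((\<lambda>x. (ln (norm (x - y)) - ln rc)\<^sup>2) has_derivative
     (\<lambda>\<xi>. (2 * (ln (norm (x - y)) - ln rc) / norm (x - y)) * (sgn (x - y) \<bullet> \<xi>))) (at x)"
    by (rule has_derivative_eq_rhs) (simp add: fun_eq_iff)
  show ?thesis
    unfolding scale_dist_def grad_scale_dist_def inner_add_left inner_scaleR_left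
    using has_derivative_add[OF 1 2] unfolding inner_diff_left inner_add_left inner_scaleR_left .
qed

lemma has_derivative_mirror_defect:
  assumes "x \<noteq> y"
  shows "((\<lambda>x. mirror_defect e0 x y) has_derivative (\<lambda>\<xi>. grad_mirror_defect e0 x y \<bullet> \<xi>)) (at x)"
proof -
  have m: "((\<lambda>x. ((1/2) *\<^sub>R (x + y)) \<bullet> sgn (x - y)) has_derivative
     (\<lambda>\<xi>. ((1/2) *\<^sub>R sgn (x - y) + (1 / norm (x - y)) *\<^sub>R perp (sgn (x - y)) ((1/2) *\<^sub>R (x + y))) \<bullet> \<xi>)) (at x)"
  proof -
    \<comment> \<open>The midpoint is \<open>y\<close> plus half of \<open>x - y\<close>, so along
      \<open>sgn (x - y)\<close> only \<open>sgn\<close> and \<open>norm\<close> have to be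
      differentiated. \<open>perp\<close> then makes no difference between \<open>y\<close> and the
      midpoint.\<close>
    have eq: "((1/2) *\<^sub>R (x + y)) \<bullet> sgn (x - y) = sgn (x - y) \<bullet> y + (1/2) * norm (x - y)" for x :: 'a
    proof (cases "x = y")
      case False
      have "((1/2) *\<^sub>R (x + y)) \<bullet> sgn (x - y) = (y + (1/2) *\<^sub>R (x - y)) \<bullet> sgn (x - y)"
        by (simp add: algebra_simps flip: scaleR_add_left)
      also have "\<dots> = sgn (x - y) \<bullet> y + (1/2) * ((x - y) \<bullet> sgn (x - y))"
        by (simp add: inner_add_left inner_commute[of y])
      also have "(x - y) \<bullet> sgn (x - y) = norm (x - y)"
        using False by (simp add: sgn_div_norm dot_square_norm power2_eq_square)
      finally show ?thesis .
    qed simp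
    have "((\<lambda>x. sgn (x - y) \<bullet> y + (1/2) * norm (x - y)) has_derivative
       (\<lambda>\<xi>. ((1 / norm (x - y)) *\<^sub>R perp (sgn (x - y)) y) \<bullet> \<xi> + (1/2) * (sgn (x - y) \<bullet> \<xi>))) (at x)"
      by (intro derivative_intros has_derivative_sgn_inner has_derivative_norm_minus assms)
    moreover have "perp (sgn (x - y)) y = perp (sgn (x - y)) ((1/2) *\<^sub>R (x + y))"
    proof -
      have "(1/2) *\<^sub>R (x + y) = y + (1/2) *\<^sub>R (x - y)" by (simp add: algebra_simps flip: scaleR_add_left)
      moreover have "perp (sgn (x - y)) (x - y) = 0"
      proof -
        have "sgn (x - y) \<bullet> (x - y) = norm (x - y)"
          using assms by (simp add: sgn_div_norm dot_square_norm power2_eq_square)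
        then show ?thesis by (simp add: perp_def norm_scaleR_sgn)
      qed
      moreover have "perp e (u + (1/2) *\<^sub>R v) = perp e u + (1/2) *\<^sub>R perp e v" for e u v :: 'a
        by (simp add: perp_def algebra_simps inner_add_right)
      ultimately show ?thesis by simp
    qed
    ultimately show ?thesis unfolding eq by (simp add: inner_add_left add.commute)
  qed
  from has_derivative_power[OF this, of 2]
  have 2: "((\<lambda>x. (((1/2) *\<^sub>R (x + y)) \<bullet> sgn (x - y))\<^sup>2) has_derivative
     (\<lambda>\<xi>. (2 * (((1/2) *\<^sub>R (x + y)) \<bullet> sgn (x - y))) *
       (((1/2) *\<^sub>R sgn (x - y) + (1 / norm (x - y)) *\<^sub>R perp (sgn (x - y)) ((1/2) *\<^sub>R (x + y))) \<bullet> \<xi>))) (at x)"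
    by (rule has_derivative_eq_rhs) (simp add: fun_eq_iff)
  have 1: "((\<lambda>x. 2 - 2 * (sgn (x - y) \<bullet> e0)) has_derivative
     (\<lambda>\<xi>. (- 2 / norm (x - y)) * (perp (sgn (x - y)) e0 \<bullet> \<xi>))) (at x)"
    by (rule has_derivative_eq_rhs[OF has_derivative_diff[OF has_derivative_const
          has_derivative_mult_right[OF has_derivative_sgn_inner[OF assms]]]]) (simp add: fun_eq_iff)
  show ?thesis
    unfolding mirror_defect_def grad_mirror_defect_def
    by (rule has_derivative_eq_rhs[OF has_derivative_add[OF 1 2]]) (simp only: inner_add_left inner_scaleR_left)
qed

lemma has_derivative_pair_weight:
  fixes x y :: "'a::euclidean_space"
  assumes "x \<noteq> y" "a \<ge> 0"
  shows "((\<lambda>x. pair_weight a b \<alpha> K mc rc e0 x y) has_derivative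
     (\<lambda>\<xi>. pair_weight a b \<alpha> K mc rc e0 x y * (grad_pair_weight a b \<alpha> K mc rc e0 x y \<bullet> \<xi>))) (at x)"
proof -
  have "norm (x - y) + a > 0" using assms by (simp add: add_pos_nonneg)
  then show ?thesis
    unfolding pair_weight_def pair_barrier_def
    by (auto intro!: derivative_eq_intros has_derivative_norm_minus[OF assms(1)] has_derivative_scale_dist[OF assms(1)] has_derivative_mirror_defect[OF assms(1)]
        simp: fun_eq_iff grad_pair_weight_def inner_add_left field_simps power2_eq_square)
qed

text \<open>Derivatives in the second point are read off from those in the first one by exchanging
  the points and reversing \<open>e0\<close>.\<close>

lemma pair_weight_swap: "pair_weight a b \<alpha> K mc rc e0 x y = pair_weight a b \<alpha> K mc rc (- e0) y x"
proof -
  have s: "sgn (x - y) = - sgn (y - x)" using sgn_minus[of "y - x"] by simp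
  show ?thesis
    unfolding pair_weight_def pair_barrier_def scale_dist_def mirror_defect_def s by (simp add: norm_minus_commute add.commute)
qed

lemma taylor2_cong:
  assumes "taylor2 F c l q" "d > 0" "\<And>\<xi>. norm \<xi> \<le> d \<Longrightarrow> G \<xi> = F \<xi>"
  shows "taylor2 G c l q"
  unfolding taylor2_def
proof (intro conjI allI impI)
  fix \<epsilon> :: real assume "\<epsilon> > 0"
  then obtain \<delta> where \<delta>: "\<delta> > 0" "\<And>\<xi>. norm \<xi> \<le> \<delta> \<Longrightarrow> \<bar>F \<xi> - (c + l \<bullet> \<xi> + q \<xi>)\<bar> \<le> \<epsilon> * (norm \<xi>)\<^sup>2"
    using assms(1) unfolding taylor2_def by blast
  then show "\<exists>\<delta>>0. \<forall>\<xi>. norm \<xi> \<le> \<delta> \<longrightarrow> \<bar>G \<xi> - (c + l \<bullet> \<xi> + q \<xi>)\<bar> \<le> \<epsilon> * (norm \<xi>)\<^sup>2"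
    using assms(2,3) by (intro exI[of _ "min \<delta> d"]) auto
qed (use assms(1) in \<open>simp add: taylor2_def\<close>)

lemma perp_inner: "perp e u \<bullet> v = u \<bullet> perp e v"
  by (simp add: perp_def inner_diff_left inner_diff_right inner_commute)

lemma inner_perp: "norm e = 1 \<Longrightarrow> e \<bullet> perp e v = 0"
  by (simp add: perp_def inner_diff_right dot_square_norm)

lemma norm_perp_sq:
  assumes "norm e = 1" shows "(norm (perp e v))\<^sup>2 = (norm v)\<^sup>2 - (e \<bullet> v)\<^sup>2"
proof -
  have "e \<bullet> e = 1" using assms by (simp add: dot_square_norm)
  then show ?thesis unfolding power2_norm_eq_inner
    by (simp add: perp_def inner_diff_left inner_diff_right inner_commute[of v e] power2_eq_square)
qed

lemma norm_perp_le:
  assumes "norm e = 1" shows "norm (perp e v) \<le> norm v"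
proof -
  have "(norm (perp e v))\<^sup>2 \<le> (norm v)\<^sup>2" unfolding norm_perp_sq[OF assms] by simp
  then show ?thesis by (rule power2_le_imp_le) simp
qed

text \<open>\<open>\<xi> - mirror e \<xi>\<close> is parallel to \<open>e\<close> and
  \<open>\<xi> + mirror e \<xi>\<close> is orthogonal to it. The bound \<open>r / 4\<close> prevents
  the two points from passing each other.\<close>

lemma coupling_step:
  fixes x y :: "'a::euclidean_space"
  defines "e \<equiv> sgn (x - y)" and "r \<equiv> norm (x - y)"
  assumes "x \<noteq> y" and \<xi>: "norm \<xi> \<le> r / 4"
  shows "norm ((x + \<xi>) - (y + mirror e \<xi>)) = r + 2 * (e \<bullet> \<xi>)"
    and "sgn ((x + \<xi>) - (y + mirror e \<xi>)) = e"
    and "(1/2) *\<^sub>R ((x + \<xi>) + (y + mirror e \<xi>)) = (1/2) *\<^sub>R (x + y) + perp e \<xi>"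
    and "0 < r + 2 * (e \<bullet> \<xi>)"
proof -
  have e: "norm e = 1" using \<open>x \<noteq> y\<close> by (simp add: e_def norm_sgn)
  have r: "r > 0" using \<open>x \<noteq> y\<close> by (simp add: r_def)
  have "\<bar>e \<bullet> \<xi>\<bar> \<le> norm \<xi>" using Cauchy_Schwarz_ineq2[of e \<xi>] e by simp
  then show pos: "0 < r + 2 * (e \<bullet> \<xi>)" using \<xi> r by linarith
  have "(x + \<xi>) - (y + mirror e \<xi>) = (x - y) + (2 * (e \<bullet> \<xi>)) *\<^sub>R e"
    by (simp add: mirror_def algebra_simps)
  also have "x - y = r *\<^sub>R e" unfolding r_def e_def by (rule norm_scaleR_sgn[symmetric])
  finally have eq: "(x + \<xi>) - (y + mirror e \<xi>) = (r + 2 * (e \<bullet> \<xi>)) *\<^sub>R e"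
    by (simp add: scaleR_add_left)
  show "norm ((x + \<xi>) - (y + mirror e \<xi>)) = r + 2 * (e \<bullet> \<xi>)"
    unfolding eq using pos e by simp
  have "sgn e = e" using e by (simp add: sgn_div_norm)
  then show "sgn ((x + \<xi>) - (y + mirror e \<xi>)) = e"
    unfolding eq sgn_scaleR using pos by simp
  have "(x + \<xi>) + (y + mirror e \<xi>) = (x + y) + 2 *\<^sub>R perp e \<xi>"
    by (simp add: mirror_def perp_def algebra_simps scaleR_2)
  then have "(1/2) *\<^sub>R ((x + \<xi>) + (y + mirror e \<xi>)) = (1/2) *\<^sub>R ((x + y) + 2 *\<^sub>R perp e \<xi>)"
    by (simp only:)
  also have "\<dots> = (1/2) *\<^sub>R (x + y) + perp e \<xi>"
    unfolding scaleR_add_right[of _ "x + y"] by simp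
  finally show "(1/2) *\<^sub>R ((x + \<xi>) + (y + mirror e \<xi>)) = (1/2) *\<^sub>R (x + y) + perp e \<xi>" .
qed

definition coupled_grad :: "'a::euclidean_space \<Rightarrow> real \<Rightarrow> 'a \<Rightarrow> 'a \<Rightarrow> 'a" where
  "coupled_grad mc rc x y = 2 *\<^sub>R perp (sgn (x - y)) ((1/2) *\<^sub>R (x + y) - mc)
     + (4 * (ln (norm (x - y)) - ln rc) / norm (x - y)) *\<^sub>R sgn (x - y)"

lemma grad_scale_dist_mirror:
  fixes x y :: "'a::euclidean_space"
  assumes "x \<noteq> y"
  shows "grad_scale_dist mc rc x y + mirror (sgn (x - y)) (grad_scale_dist mc rc y x) = coupled_grad mc rc x y"
proof -
  define e where "e = sgn (x - y)"
  have e: "e \<bullet> e = 1" using assms by (simp add: e_def dot_square_norm norm_sgn)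
  have s: "sgn (y - x) = - e" unfolding e_def using sgn_minus[of "x - y"] by simp
  have n: "norm (y - x) = norm (x - y)" by (rule norm_minus_commute)
  define k where "k = (1/2) *\<^sub>R (x + y) - mc"
  have k: "(1/2) *\<^sub>R (y + x) - mc = k" by (simp add: k_def add.commute)
  show ?thesis
    unfolding grad_scale_dist_def coupled_grad_def s n k e_def[symmetric] k_def[symmetric]
    by (simp add: mirror_def perp_def inner_diff_right inner_add_right e algebra_simps scaleR_2 flip: scaleR_add_left)
qed

text \<open>The first order form of the invariance of \<open>mirror_defect\<close> under mirrored
  increments.\<close>

lemma grad_mirror_defect_mirror:
  fixes x y :: "'a::euclidean_space"
  assumes "x \<noteq> y"
  shows "grad_mirror_defect e0 x y + mirror (sgn (x - y)) (grad_mirror_defect (- e0) y x) = 0"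
proof -
  define e where "e = sgn (x - y)"
  have e: "e \<bullet> e = 1" using assms by (simp add: e_def dot_square_norm norm_sgn)
  have s: "sgn (y - x) = - e" unfolding e_def using sgn_minus[of "x - y"] by simp
  have "norm (y - x) = norm (x - y)" by (rule norm_minus_commute)
  define m where "m = (1/2) *\<^sub>R (x + y)"
  have m: "(1/2) *\<^sub>R (y + x) = m" by (simp add: m_def add.commute)
  have p: "perp (- e) u = perp e u" "perp e (- u) = - perp e u" for u by (simp_all add: perp_def)
  have mp: "mirror e (perp e u) = perp e u" for u
    using e by (simp add: mirror_def perp_def inner_diff_right)
  have me: "mirror e e = - e" using e by (simp add: mirror_def scaleR_2)
  define P where "P = perp e e0"
  define M where "M = perp e m"
  define c where "c = m \<bullet> e"
  define n where "n = norm (x - y)"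
  have A: "grad_mirror_defect e0 x y = (- 2 / n) *\<^sub>R P + (2 * c) *\<^sub>R ((1/2) *\<^sub>R e + (1 / n) *\<^sub>R M)"
    by (simp add: grad_mirror_defect_def e_def[symmetric] m_def[symmetric] n_def P_def M_def c_def)
  have "grad_mirror_defect (- e0) y x = (2 / n) *\<^sub>R P + ((c) *\<^sub>R e + (- 2 * c / n) *\<^sub>R M)"
    unfolding grad_mirror_defect_def s \<open>norm (y - x) = norm (x - y)\<close> m n_def[symmetric] p P_def[symmetric] M_def[symmetric]
    by (simp add: c_def algebra_simps)
  then have "mirror e (grad_mirror_defect (- e0) y x) = (2 / n) *\<^sub>R P + ((- c) *\<^sub>R e + (- 2 * c / n) *\<^sub>R M)"
    by (simp only: mirror_add mirror_scaleR mp P_def M_def me) simp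
  then show ?thesis unfolding e_def[symmetric] A by (simp add: scaleR_add_right)
qed

text \<open>Because \<open>mirror\<close> is symmetric, the left side is the gradient at 0 of the
  logarithm of the weight as a function of the coupled increments \<open>\<xi>\<close> and
  \<open>mirror e \<xi>\<close>.\<close>

lemma grad_pair_weight_mirror:
  fixes x y :: "'a::euclidean_space"
  assumes "x \<noteq> y"
  shows "grad_pair_weight a b \<alpha> K mc rc e0 x y + mirror (sgn (x - y)) (grad_pair_weight a b \<alpha> K mc rc (- e0) y x)
    = (4 / (norm (x - y) + a)) *\<^sub>R sgn (x - y) + (b * \<alpha> * exp (- \<alpha> * scale_dist mc rc x y)) *\<^sub>R coupled_grad mc rc x y"
proof -
  define e where "e = sgn (x - y)"
  have e: "e \<bullet> e = 1" using assms by (simp add: e_def dot_square_norm norm_sgn)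
  have s: "sgn (y - x) = - e" unfolding e_def using sgn_minus[of "x - y"] by simp
  have n: "norm (y - x) = norm (x - y)" by (rule norm_minus_commute)
  have X: "scale_dist mc rc y x = scale_dist mc rc x y" unfolding scale_dist_def n by (simp add: add.commute)
  have me: "mirror e (- e) = e" using e by (simp add: mirror_def scaleR_2)
  define c1 where "c1 = 2 / (norm (x - y) + a)"
  define c2 where "c2 = b * \<alpha> * exp (- \<alpha> * scale_dist mc rc x y)"
  have "grad_pair_weight a b \<alpha> K mc rc e0 x y + mirror e (grad_pair_weight a b \<alpha> K mc rc (- e0) y x)
    = c1 *\<^sub>R (e + mirror e (- e)) + c2 *\<^sub>R (grad_scale_dist mc rc x y + mirror e (grad_scale_dist mc rc y x))
      + (b * K) *\<^sub>R (grad_mirror_defect e0 x y + mirror e (grad_mirror_defect (- e0) y x))"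
    unfolding grad_pair_weight_def s n X e_def[symmetric] c1_def[symmetric] c2_def[symmetric]
    by (simp only: mirror_add mirror_scaleR scaleR_add_right) (simp only: add_ac)
  also have "\<dots> = (2 * c1) *\<^sub>R e + c2 *\<^sub>R coupled_grad mc rc x y"
    unfolding me grad_scale_dist_mirror[OF assms, folded e_def] grad_mirror_defect_mirror[OF assms, folded e_def]
    by (simp add: scaleR_2[symmetric] mult.commute)
  finally show ?thesis by (simp add: e_def c1_def c2_def)
qed

lemma taylor2_pair_weight:
  fixes x y mc e0 :: "'a::euclidean_space" and a b \<alpha> K rc :: real
  defines "e \<equiv> sgn (x - y)" and "r \<equiv> norm (x - y)"
  defines "w \<equiv> ln r - ln rc" and "E \<equiv> exp (- \<alpha> * scale_dist mc rc x y)" and "v \<equiv> coupled_grad mc rc x y"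
  defines "p \<equiv> (4 / (r + a)) *\<^sub>R e + (b * \<alpha> * E) *\<^sub>R v"
  assumes "x \<noteq> y" "a \<ge> 0"
  shows "taylor2 (\<lambda>\<xi>. pair_weight a b \<alpha> K mc rc e0 (x + \<xi>) (y + mirror e \<xi>)) (pair_weight a b \<alpha> K mc rc e0 x y)
     (pair_weight a b \<alpha> K mc rc e0 x y *\<^sub>R p)
     (\<lambda>\<xi>. pair_weight a b \<alpha> K mc rc e0 x y * (- 4 / (r + a)\<^sup>2 * (e \<bullet> \<xi>)\<^sup>2
         + b * \<alpha> * E * ((norm \<xi>)\<^sup>2 - (e \<bullet> \<xi>)\<^sup>2 + 4 * (1 - w) / r\<^sup>2 * (e \<bullet> \<xi>)\<^sup>2)
         - b * \<alpha>\<^sup>2 * E / 2 * (v \<bullet> \<xi>)\<^sup>2 + (p \<bullet> \<xi>)\<^sup>2 / 2))"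
proof -
  have e: "norm e = 1" using \<open>x \<noteq> y\<close> by (simp add: e_def norm_sgn)
  have r: "r > 0" using \<open>x \<noteq> y\<close> by (simp add: r_def)
  define k where "k = (1/2) *\<^sub>R (x + y) - mc"
  define X where "X = scale_dist mc rc x y"
  have X: "X = (norm k)\<^sup>2 + w\<^sup>2" by (simp add: X_def scale_dist_def k_def w_def r_def)
  note step = coupling_step[OF \<open>x \<noteq> y\<close>, folded e_def r_def]
  have t0: "taylor2 (\<lambda>\<xi>. r + (2 *\<^sub>R e) \<bullet> \<xi> + 0) r (2 *\<^sub>R e) (\<lambda>\<xi>. 0)"
    by (rule taylor2_quadratic[of _ 0]) auto
  have t1: "taylor2 (\<lambda>\<xi>. (ln (r + (2 *\<^sub>R e) \<bullet> \<xi> + 0) - ln rc)\<^sup>2) (w\<^sup>2) ((2 * w / r) *\<^sub>R (2 *\<^sub>R e))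
      (\<lambda>\<xi>. 2 * w / r * 0 + (2 * (1 - w) / r\<^sup>2) / 2 * ((2 *\<^sub>R e) \<bullet> \<xi>)\<^sup>2)"
    unfolding w_def
    by (rule taylor2_compose[OF t0, of "{0<..}" "\<lambda>s. (ln s - ln rc)\<^sup>2" "\<lambda>s. 2 * (ln s - ln rc) / s"])
       (use r in \<open>auto intro!: derivative_eq_intros simp: field_simps power2_eq_square\<close>)
  have t2: "taylor2 (\<lambda>\<xi>. (norm k)\<^sup>2 + (2 *\<^sub>R perp e k) \<bullet> \<xi> + (norm (perp e \<xi>))\<^sup>2) ((norm k)\<^sup>2) (2 *\<^sub>R perp e k) (\<lambda>\<xi>. (norm (perp e \<xi>))\<^sup>2)"
    by (rule taylor2_quadratic[of _ 1]) (use norm_perp_le[OF e] in \<open>auto intro: power_mono\<close>)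
  have tX: "taylor2 (\<lambda>\<xi>. scale_dist mc rc (x + \<xi>) (y + mirror e \<xi>)) X v
     (\<lambda>\<xi>. (norm (perp e \<xi>))\<^sup>2 + (2 * w / r * 0 + (2 * (1 - w) / r\<^sup>2) / 2 * ((2 *\<^sub>R e) \<bullet> \<xi>)\<^sup>2))"
  proof (rule taylor2_cong[of _ _ _ _ "r / 4"])
    have "v = 2 *\<^sub>R perp e k + (2 * w / r) *\<^sub>R (2 *\<^sub>R e)"
      by (simp add: v_def coupled_grad_def e_def r_def k_def w_def)
    then show "taylor2 (\<lambda>\<xi>. ((norm k)\<^sup>2 + (2 *\<^sub>R perp e k) \<bullet> \<xi> + (norm (perp e \<xi>))\<^sup>2) + (ln (r + (2 *\<^sub>R e) \<bullet> \<xi> + 0) - ln rc)\<^sup>2) X v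
     (\<lambda>\<xi>. (norm (perp e \<xi>))\<^sup>2 + (2 * w / r * 0 + (2 * (1 - w) / r\<^sup>2) / 2 * ((2 *\<^sub>R e) \<bullet> \<xi>)\<^sup>2))"
      unfolding X using taylor2_add[OF t2 t1] by simp
    fix \<xi> :: 'a assume \<xi>: "norm \<xi> \<le> r / 4"
    have "(1/2) *\<^sub>R ((x + \<xi>) + (y + mirror e \<xi>)) - mc = k + perp e \<xi>"
      unfolding step(3)[OF \<xi>] by (simp add: k_def)
    moreover have "(norm (k + perp e \<xi>))\<^sup>2 = (norm k)\<^sup>2 + (2 *\<^sub>R perp e k) \<bullet> \<xi> + (norm (perp e \<xi>))\<^sup>2"
      unfolding power2_norm_eq_inner inner_scaleR_left perp_inner[of e k \<xi>]
      by (simp add: inner_add_left inner_add_right inner_commute[of "perp e \<xi>" k])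
    ultimately show "scale_dist mc rc (x + \<xi>) (y + mirror e \<xi>) = ((norm k)\<^sup>2 + (2 *\<^sub>R perp e k) \<bullet> \<xi> + (norm (perp e \<xi>))\<^sup>2) + (ln (r + (2 *\<^sub>R e) \<bullet> \<xi> + 0) - ln rc)\<^sup>2"
      unfolding scale_dist_def step(1)[OF \<xi>] by simp
  qed (use r in simp)
  define qX where "qX \<xi> = (norm (perp e \<xi>))\<^sup>2 + (2 * w / r * 0 + (2 * (1 - w) / r\<^sup>2) / 2 * ((2 *\<^sub>R e) \<bullet> \<xi>)\<^sup>2)" for \<xi>
  have t3: "taylor2 (\<lambda>\<xi>. - b * exp (- \<alpha> * scale_dist mc rc (x + \<xi>) (y + mirror e \<xi>))) (- b * E) ((b * \<alpha> * E) *\<^sub>R v)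
     (\<lambda>\<xi>. (b * \<alpha> * E) * qX \<xi> + (- b * \<alpha>\<^sup>2 * E) / 2 * (v \<bullet> \<xi>)\<^sup>2)"
    unfolding E_def X_def[symmetric]
    by (rule taylor2_compose[OF tX[folded qX_def], of UNIV "\<lambda>s. - b * exp (- \<alpha> * s)" "\<lambda>s. b * \<alpha> * exp (- \<alpha> * s)"])
       (auto intro!: derivative_eq_intros simp: power2_eq_square)
  have t4: "taylor2 (\<lambda>\<xi>. 2 * ln ((r + (2 *\<^sub>R e) \<bullet> \<xi> + 0) + a)) (2 * ln (r + a)) ((2 / (r + a)) *\<^sub>R (2 *\<^sub>R e))
      (\<lambda>\<xi>. 2 / (r + a) * 0 + (- 2 / (r + a)\<^sup>2) / 2 * ((2 *\<^sub>R e) \<bullet> \<xi>)\<^sup>2)"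
    by (rule taylor2_compose[OF t0, of "{0<..}" "\<lambda>s. 2 * ln (s + a)" "\<lambda>s. 2 / (s + a)"])
       (use r \<open>a \<ge> 0\<close> in \<open>auto intro!: derivative_eq_intros simp: field_simps power2_eq_square\<close>)
  define c where "c = b * K * mirror_defect e0 x y"
  have t5: "taylor2 (\<lambda>\<xi>::'a. c + 0 \<bullet> \<xi> + 0) c 0 (\<lambda>\<xi>. 0)"
    by (rule taylor2_quadratic[of _ 0]) auto
  \<comment> \<open>\<open>T0\<close> is the logarithm of the weight at \<open>\<xi> = 0\<close>, a
    sum of expansions in one variable each. Exponentiating at the end adds the term
    \<open>(p \<bullet> \<xi>)\<^sup>2 / 2\<close>.\<close>
  define T0 where "T0 = 2 * ln (r + a) + - b * E + c"
  define q' where "q' \<xi> = (2 / (r + a) * 0 + (- 2 / (r + a)\<^sup>2) / 2 * ((2 *\<^sub>R e) \<bullet> \<xi>)\<^sup>2)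
       + ((b * \<alpha> * E) * qX \<xi> + (- b * \<alpha>\<^sup>2 * E) / 2 * (v \<bullet> \<xi>)\<^sup>2) + 0" for \<xi>
  have peq: "p = (2 / (r + a)) *\<^sub>R (2 *\<^sub>R e) + (b * \<alpha> * E) *\<^sub>R v + 0" by (simp add: p_def)
  have t6: "taylor2 (\<lambda>\<xi>. 2 * ln ((r + (2 *\<^sub>R e) \<bullet> \<xi> + 0) + a) + - b * exp (- \<alpha> * scale_dist mc rc (x + \<xi>) (y + mirror e \<xi>)) + (c + 0 \<bullet> \<xi> + 0)) T0 p q'"
    unfolding T0_def q'_def peq by (intro taylor2_add t3 t4 t5)
  have t7: "taylor2 (\<lambda>\<xi>. exp (2 * ln ((r + (2 *\<^sub>R e) \<bullet> \<xi> + 0) + a) + - b * exp (- \<alpha> * scale_dist mc rc (x + \<xi>) (y + mirror e \<xi>)) + (c + 0 \<bullet> \<xi> + 0)))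
     (exp T0) (exp T0 *\<^sub>R p) (\<lambda>\<xi>. exp T0 * q' \<xi> + exp T0 / 2 * (p \<bullet> \<xi>)\<^sup>2)"
    by (rule taylor2_compose[OF t6, of UNIV exp exp]) (auto intro!: derivative_eq_intros)
  have ra: "r + a > 0" using r \<open>a \<ge> 0\<close> by simp
  have eqexp: "(s + a)\<^sup>2 * exp (- b * (F - K * mirror_defect e0 x y)) = exp (2 * ln (s + a) + - b * F + c)" if "s + a > 0" for s F
  proof -
    have "exp (2 * ln (s + a)) = (s + a)\<^sup>2"
      using exp_of_nat_mult[of 2 "ln (s + a)"] that by simp
    then show ?thesis by (simp add: exp_add c_def algebra_simps exp_diff exp_minus field_simps)
  qed
  have P0: "pair_weight a b \<alpha> K mc rc e0 x y = exp T0"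
    unfolding pair_weight_def pair_barrier_def T0_def E_def r_def[symmetric] by (rule eqexp[OF ra])
  have q'eq: "exp T0 * q' \<xi> + exp T0 / 2 * (p \<bullet> \<xi>)\<^sup>2 = exp T0 * (- 4 / (r + a)\<^sup>2 * (e \<bullet> \<xi>)\<^sup>2
         + b * \<alpha> * E * ((norm \<xi>)\<^sup>2 - (e \<bullet> \<xi>)\<^sup>2 + 4 * (1 - w) / r\<^sup>2 * (e \<bullet> \<xi>)\<^sup>2)
         - b * \<alpha>\<^sup>2 * E / 2 * (v \<bullet> \<xi>)\<^sup>2 + (p \<bullet> \<xi>)\<^sup>2 / 2)" for \<xi>
  proof -
    have "2 * w / r * 0 + (2 * (1 - w) / r\<^sup>2) / 2 * ((2 *\<^sub>R e) \<bullet> \<xi>)\<^sup>2 = 4 * (1 - w) / r\<^sup>2 * (e \<bullet> \<xi>)\<^sup>2"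
      "2 / (r + a) * 0 + (- 2 / (r + a)\<^sup>2) / 2 * ((2 *\<^sub>R e) \<bullet> \<xi>)\<^sup>2 = - 4 / (r + a)\<^sup>2 * (e \<bullet> \<xi>)\<^sup>2"
      by (simp_all add: power_mult_distrib)
    then show ?thesis unfolding q'_def qX_def norm_perp_sq[OF e] by (simp only:) (simp add: distrib_left)
  qed
  show ?thesis
    unfolding P0
  proof (rule taylor2_cong[of _ _ _ _ "r / 4"])
    show "taylor2 (\<lambda>\<xi>. exp (2 * ln ((r + (2 *\<^sub>R e) \<bullet> \<xi> + 0) + a) + - b * exp (- \<alpha> * scale_dist mc rc (x + \<xi>) (y + mirror e \<xi>)) + (c + 0 \<bullet> \<xi> + 0)))
     (exp T0) (exp T0 *\<^sub>R p) (\<lambda>\<xi>. exp T0 * (- 4 / (r + a)\<^sup>2 * (e \<bullet> \<xi>)\<^sup>2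
         + b * \<alpha> * E * ((norm \<xi>)\<^sup>2 - (e \<bullet> \<xi>)\<^sup>2 + 4 * (1 - w) / r\<^sup>2 * (e \<bullet> \<xi>)\<^sup>2)
         - b * \<alpha>\<^sup>2 * E / 2 * (v \<bullet> \<xi>)\<^sup>2 + (p \<bullet> \<xi>)\<^sup>2 / 2))"
      using t7 unfolding q'eq .
    fix \<xi> :: 'a assume \<xi>: "norm \<xi> \<le> r / 4"
    have me: "((1/2) *\<^sub>R ((x + \<xi>) + (y + mirror e \<xi>))) \<bullet> e = ((1/2) *\<^sub>R (x + y)) \<bullet> e"
      unfolding step(3)[OF \<xi>] inner_add_left[of _ "perp e \<xi>"] inner_commute[of "perp e \<xi>" e] inner_perp[OF e] by simp
    have Q: "mirror_defect e0 (x + \<xi>) (y + mirror e \<xi>) = mirror_defect e0 x y"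
      unfolding mirror_defect_def step(2)[OF \<xi>] me by (simp add: e_def)
    have "r + 2 * (e \<bullet> \<xi>) + a > 0" using step(4)[OF \<xi>] \<open>a \<ge> 0\<close> by linarith
    from eqexp[OF this] show "pair_weight a b \<alpha> K mc rc e0 (x + \<xi>) (y + mirror e \<xi>)
      = exp (2 * ln ((r + (2 *\<^sub>R e) \<bullet> \<xi> + 0) + a) + - b * exp (- \<alpha> * scale_dist mc rc (x + \<xi>) (y + mirror e \<xi>)) + (c + 0 \<bullet> \<xi> + 0))"
      unfolding pair_weight_def pair_barrier_def step(1)[OF \<xi>] Q by simp
  qed (use r in simp)
qed


lemma integral_kern_quadratic:
  fixes e v p :: "'a::euclidean_space"
  shows "integral (cbox (- One) One) (\<lambda>z. kern z * (c1 * (e \<bullet> z)\<^sup>2 + c2 * (norm z)\<^sup>2 + c3 * (v \<bullet> z)\<^sup>2 + c4 * (p \<bullet> z)\<^sup>2))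
    = kern_moment TYPE('a) * (c1 * (norm e)\<^sup>2 + c2 * real DIM('a) + c3 * (norm v)\<^sup>2 + c4 * (norm p)\<^sup>2)"
proof -
  let ?W = "cbox (- One) (One::'a)"
  define E where "E F = integral ?W (\<lambda>z. kern z * F z)" for F
  have cint: "(\<lambda>z. kern z * F z) integrable_on ?W" if "continuous_on ?W F" for F
    by (intro integrable_continuous continuous_intros that)
  have E_add: "E (\<lambda>z. F z + G z) = E F + E G" if "continuous_on ?W F" "continuous_on ?W G" for F G
    unfolding E_def by (simp add: distrib_left Henstock_Kurzweil_Integration.integral_add cint that)
  have E_cmul: "E (\<lambda>z. c * F z) = c * E F" for c F
    unfolding E_def by (simp add: mult.left_commute)
  have E_sq: "E (\<lambda>z. (u \<bullet> z)\<^sup>2) = kern_moment TYPE('a) * (norm u)\<^sup>2" for u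
    unfolding E_def power2_norm_eq_inner using integral_kern_inner_inner[of u u] by (simp add: power2_eq_square)
  have "E (\<lambda>z. (norm z)\<^sup>2) = E (\<lambda>z. \<Sum>b\<in>Basis. (b \<bullet> z)\<^sup>2)"
    unfolding power2_norm_eq_inner by (subst euclidean_inner) (simp add: power2_eq_square inner_commute)
  also have "\<dots> = (\<Sum>b\<in>Basis. E (\<lambda>z. (b \<bullet> z)\<^sup>2))"
    unfolding E_def sum_distrib_left by (intro integral_sum cint) (auto intro!: continuous_intros)
  also have "\<dots> = kern_moment TYPE('a) * real DIM('a)"
    unfolding E_sq by (simp add: mult.commute)
  finally have E_norm: "E (\<lambda>z. (norm z)\<^sup>2) = kern_moment TYPE('a) * real DIM('a)" .
  have "E (\<lambda>z. c1 * (e \<bullet> z)\<^sup>2 + c2 * (norm z)\<^sup>2 + c3 * (v \<bullet> z)\<^sup>2 + c4 * (p \<bullet> z)\<^sup>2)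
    = E (\<lambda>z. c1 * (e \<bullet> z)\<^sup>2 + c2 * (norm z)\<^sup>2 + c3 * (v \<bullet> z)\<^sup>2) + E (\<lambda>z. c4 * (p \<bullet> z)\<^sup>2)"
    by (rule E_add) (intro continuous_intros)+
  also have "E (\<lambda>z. c1 * (e \<bullet> z)\<^sup>2 + c2 * (norm z)\<^sup>2 + c3 * (v \<bullet> z)\<^sup>2)
    = E (\<lambda>z. c1 * (e \<bullet> z)\<^sup>2 + c2 * (norm z)\<^sup>2) + E (\<lambda>z. c3 * (v \<bullet> z)\<^sup>2)"
    by (rule E_add) (intro continuous_intros)+
  also have "E (\<lambda>z. c1 * (e \<bullet> z)\<^sup>2 + c2 * (norm z)\<^sup>2) = E (\<lambda>z. c1 * (e \<bullet> z)\<^sup>2) + E (\<lambda>z. c2 * (norm z)\<^sup>2)"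
    by (rule E_add) (intro continuous_intros)+
  finally show ?thesis
    unfolding E_cmul E_sq E_norm by (simp add: E_def algebra_simps)
qed

text \<open>Interior maximum test for the two-point function with the mirror coupling. At \<open>b = 0\<close> both sides
  vanish: this is the borderline exponent 2.\<close>

lemma touching_pair_weight:
  fixes x y mc e0 :: "'a::euclidean_space" and f g :: "'a \<Rightarrow> real" and a b \<alpha> K rc J d L :: real
  defines "e \<equiv> sgn (x - y)" and "r \<equiv> norm (x - y)"
  defines "w \<equiv> ln r - ln rc" and "E \<equiv> exp (- \<alpha> * scale_dist mc rc x y)" and "v \<equiv> coupled_grad mc rc x y"
  assumes "x \<noteq> y" "a \<ge> 0" "d > 0" "J > 0"
    and f: "continuous_on (cball x d) f" and g: "continuous_on (cball y d) g"
    and pos: "f x > 0" "g y > 0"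
    and sub: "submean_at f x" "submean_at g y"
    and lip: "\<And>\<zeta>. norm \<zeta> \<le> d \<Longrightarrow> \<bar>g (y + \<zeta>) - g y\<bar> \<le> L * norm \<zeta>"
    and le: "\<And>\<xi> \<zeta>. norm \<xi> \<le> d \<Longrightarrow> norm \<zeta> \<le> d \<Longrightarrow> f (x + \<xi>) * g (y + \<zeta>) \<le> J * pair_weight a b \<alpha> K mc rc e0 (x + \<xi>) (y + \<zeta>)"
    and eq: "f x * g y = J * pair_weight a b \<alpha> K mc rc e0 x y"
  shows "b * \<alpha> * E * (\<alpha> / 2 * (norm v)\<^sup>2) \<le> b * \<alpha> * E * (real DIM('a) - 1 + 4 * (1 - w) / r\<^sup>2 + 8 * w / (r * (r + a)))
     + (b * \<alpha> * E)\<^sup>2 / 4 * (norm v)\<^sup>2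
     + (norm ((b * \<alpha> * E * (e \<bullet> ((1/2) *\<^sub>R (x + y) - mc))) *\<^sub>R e + (b * K) *\<^sub>R grad_mirror_defect e0 x y))\<^sup>2"
proof -
  define P0 where "P0 = pair_weight a b \<alpha> K mc rc e0 x y"
  define A where "A = grad_pair_weight a b \<alpha> K mc rc e0 x y"
  define B where "B = grad_pair_weight a b \<alpha> K mc rc (- e0) y x"
  define p where "p = (4 / (r + a)) *\<^sub>R e + (b * \<alpha> * E) *\<^sub>R v"
  define c where "c = b * \<alpha> * E"
  have e: "norm e = 1" using \<open>x \<noteq> y\<close> by (simp add: e_def norm_sgn)
  have ee: "e \<bullet> e = 1" using e by (simp add: dot_square_norm)
  have r: "r > 0" using \<open>x \<noteq> y\<close> by (simp add: r_def)
  have P0: "P0 > 0" unfolding P0_def pair_weight_def r_def[symmetric] using r \<open>a \<ge> 0\<close> by simp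
  have AB: "A + mirror e B = p"
    unfolding A_def B_def p_def e_def r_def E_def v_def by (rule grad_pair_weight_mirror[OF \<open>x \<noteq> y\<close>])
  define q where "q \<xi> = (- 4 / (r + a)\<^sup>2 + c * (4 * (1 - w) / r\<^sup>2 - 1)) * (e \<bullet> \<xi>)\<^sup>2 + c * (norm \<xi>)\<^sup>2
      + (- c * \<alpha> / 2) * (v \<bullet> \<xi>)\<^sup>2 + (1/2) * (p \<bullet> \<xi>)\<^sup>2" for \<xi>
  have t: "taylor2 (\<lambda>\<xi>. pair_weight a b \<alpha> K mc rc e0 (x + \<xi>) (y + mirror e \<xi>)) P0 (P0 *\<^sub>R p) (\<lambda>\<xi>. P0 * q \<xi>)"
  proof -
    have "q = (\<lambda>\<xi>. - 4 / (r + a)\<^sup>2 * (e \<bullet> \<xi>)\<^sup>2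
         + b * \<alpha> * E * ((norm \<xi>)\<^sup>2 - (e \<bullet> \<xi>)\<^sup>2 + 4 * (1 - w) / r\<^sup>2 * (e \<bullet> \<xi>)\<^sup>2)
         - b * \<alpha>\<^sup>2 * E / 2 * (v \<bullet> \<xi>)\<^sup>2 + (p \<bullet> \<xi>)\<^sup>2 / 2)"
      by (simp add: q_def c_def fun_eq_iff power2_eq_square algebra_simps)
    then show ?thesis
      using taylor2_pair_weight[OF \<open>x \<noteq> y\<close> \<open>a \<ge> 0\<close>, of b \<alpha> K mc rc e0]
      unfolding P0_def p_def e_def r_def w_def E_def v_def by simp
  qed
  \<comment> \<open>Touching from above by a differentiable function yields a one-sided first order
    bound. It serves for \<open>f\<close> and for \<open>g\<close>, with the value \<open>M\<close>
    of the other function frozen.\<close>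
  have first_order: "\<exists>\<delta>>0. \<forall>\<xi>. norm \<xi> \<le> \<delta> \<longrightarrow> F (z + \<xi>) \<le> F z * (1 + G \<bullet> \<xi> + \<epsilon> * norm \<xi>)"
    if D: "(\<Psi> has_derivative (\<lambda>\<xi>. P0 * (G \<bullet> \<xi>))) (at z)" and \<Psi>z: "\<Psi> z = P0" and "\<epsilon> > 0" "M > 0"
      and bd: "\<And>\<xi>. norm \<xi> \<le> d \<Longrightarrow> F (z + \<xi>) * M \<le> J * \<Psi> (z + \<xi>)" and eqz: "F z * M = J * P0"
    for F \<Psi> :: "'a \<Rightarrow> real" and z G :: 'a and \<epsilon> M :: real
  proof -
    obtain \<delta> where \<delta>: "\<delta> > 0" "\<And>y. norm (y - z) < \<delta> \<Longrightarrow> \<bar>\<Psi> y - \<Psi> z - P0 * (G \<bullet> (y - z))\<bar> \<le> (P0 * \<epsilon>) * norm (y - z)"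
      using D[unfolded has_derivative_at_alt] mult_pos_pos[OF P0 \<open>\<epsilon> > 0\<close>] by (metis real_norm_def)
    show ?thesis
    proof (intro exI[of _ "min d (\<delta> / 2)"] conjI allI impI)
      fix \<xi> :: 'a assume \<xi>: "norm \<xi> \<le> min d (\<delta> / 2)"
      then have "norm ((z + \<xi>) - z) < \<delta>" using \<delta>(1) by auto
      from \<delta>(2)[OF this] have "\<Psi> (z + \<xi>) \<le> P0 * (1 + G \<bullet> \<xi> + \<epsilon> * norm \<xi>)"
        unfolding \<Psi>z by (simp add: algebra_simps abs_le_iff)
      then have "J * \<Psi> (z + \<xi>) \<le> J * (P0 * (1 + G \<bullet> \<xi> + \<epsilon> * norm \<xi>))"
        using \<open>J > 0\<close> by (intro mult_left_mono) auto
      also have "\<dots> = (F z * (1 + G \<bullet> \<xi> + \<epsilon> * norm \<xi>)) * M"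
        by (simp only: mult.assoc[symmetric] eqz[symmetric]) (simp only: mult_ac)
      finally have "F (z + \<xi>) * M \<le> (F z * (1 + G \<bullet> \<xi> + \<epsilon> * norm \<xi>)) * M"
        using bd[of \<xi>] \<xi> by simp
      then show "F (z + \<xi>) \<le> F z * (1 + G \<bullet> \<xi> + \<epsilon> * norm \<xi>)" using \<open>M > 0\<close> by simp
    qed (use \<delta> \<open>d > 0\<close> in auto)
  qed
  have "kern_moment TYPE('a) * (A \<bullet> mirror e B) \<le> integral (cbox (- One) One) (\<lambda>z. kern z * q z)"
  proof (rule two_point_touching[OF e \<open>d > 0\<close> f g pos sub lip])
    show "\<exists>\<delta>>0. \<forall>\<xi>. norm \<xi> \<le> \<delta> \<longrightarrow> f (x + \<xi>) \<le> f x * (1 + A \<bullet> \<xi> + \<epsilon> * norm \<xi>)" if "\<epsilon> > 0" for \<epsilon>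
    proof (rule first_order[of "\<lambda>x. pair_weight a b \<alpha> K mc rc e0 x y" _ _ _ "g y"])
      show "((\<lambda>x. pair_weight a b \<alpha> K mc rc e0 x y) has_derivative (\<lambda>\<xi>. P0 * (A \<bullet> \<xi>))) (at x)"
        unfolding P0_def A_def by (rule has_derivative_pair_weight[OF \<open>x \<noteq> y\<close> \<open>a \<ge> 0\<close>])
      show "f (x + \<xi>) * g y \<le> J * pair_weight a b \<alpha> K mc rc e0 (x + \<xi>) y" if "norm \<xi> \<le> d" for \<xi>
        using le[OF that, of 0] \<open>d > 0\<close> by simp
    qed (use that pos eq in \<open>auto simp: P0_def\<close>)
    show "\<exists>\<delta>>0. \<forall>\<xi>. norm \<xi> \<le> \<delta> \<longrightarrow> g (y + \<xi>) \<le> g y * (1 + B \<bullet> \<xi> + \<epsilon> * norm \<xi>)" if "\<epsilon> > 0" for \<epsilon>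
    proof (rule first_order[of "\<lambda>y. pair_weight a b \<alpha> K mc rc (- e0) y x" _ _ _ "f x"])
      have P0': "P0 = pair_weight a b \<alpha> K mc rc (- e0) y x" unfolding P0_def by (rule pair_weight_swap)
      show "((\<lambda>y. pair_weight a b \<alpha> K mc rc (- e0) y x) has_derivative (\<lambda>\<xi>. P0 * (B \<bullet> \<xi>))) (at y)"
        unfolding P0' B_def by (rule has_derivative_pair_weight) (use \<open>x \<noteq> y\<close> \<open>a \<ge> 0\<close> in auto)
      show "g (y + \<xi>) * f x \<le> J * pair_weight a b \<alpha> K mc rc (- e0) (y + \<xi>) x" if "norm \<xi> \<le> d" for \<xi>
        using le[OF _ that, of 0] \<open>d > 0\<close> pair_weight_swap[of a b \<alpha> K mc rc e0 x "y + \<xi>"] by (simp add: mult.commute)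
      show "pair_weight a b \<alpha> K mc rc (- e0) y x = P0" using P0' by simp
    qed (use that pos eq in \<open>auto simp: P0_def mult.commute\<close>)
    show "\<exists>\<delta>>0. \<forall>\<xi>. norm \<xi> \<le> \<delta> \<longrightarrow> f (x + \<xi>) * g (y + mirror e \<xi>) \<le> f x * g y * (1 + p \<bullet> \<xi> + q \<xi> + \<epsilon> * (norm \<xi>)\<^sup>2)"
      if "\<epsilon> > 0" for \<epsilon>
    proof -
      obtain \<delta> where \<delta>: "\<delta> > 0" "\<And>\<xi>. norm \<xi> \<le> \<delta> \<Longrightarrow> \<bar>pair_weight a b \<alpha> K mc rc e0 (x + \<xi>) (y + mirror e \<xi>)
           - (P0 + (P0 *\<^sub>R p) \<bullet> \<xi> + P0 * q \<xi>)\<bar> \<le> (P0 * \<epsilon>) * (norm \<xi>)\<^sup>2"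
        using t mult_pos_pos[OF P0 \<open>\<epsilon> > 0\<close>] unfolding taylor2_def by blast
      show ?thesis
      proof (intro exI[of _ "min d \<delta>"] conjI allI impI)
        fix \<xi> :: 'a assume \<xi>: "norm \<xi> \<le> min d \<delta>"
        then have "pair_weight a b \<alpha> K mc rc e0 (x + \<xi>) (y + mirror e \<xi>) \<le> P0 * (1 + p \<bullet> \<xi> + q \<xi> + \<epsilon> * (norm \<xi>)\<^sup>2)"
          using \<delta>(2)[of \<xi>] by (simp add: algebra_simps abs_le_iff)
        then have "J * pair_weight a b \<alpha> K mc rc e0 (x + \<xi>) (y + mirror e \<xi>) \<le> J * (P0 * (1 + p \<bullet> \<xi> + q \<xi> + \<epsilon> * (norm \<xi>)\<^sup>2))"
          using \<open>J > 0\<close> by (intro mult_left_mono) auto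
        moreover have "f (x + \<xi>) * g (y + mirror e \<xi>) \<le> J * pair_weight a b \<alpha> K mc rc e0 (x + \<xi>) (y + mirror e \<xi>)"
          using \<xi> norm_mirror[OF e, of \<xi>] by (intro le) auto
        ultimately show "f (x + \<xi>) * g (y + mirror e \<xi>) \<le> f x * g y * (1 + p \<bullet> \<xi> + q \<xi> + \<epsilon> * (norm \<xi>)\<^sup>2)"
          unfolding eq P0_def[symmetric] by (simp add: mult.assoc)
      qed (use \<delta> \<open>d > 0\<close> in auto)
    qed
    show "continuous_on UNIV q" unfolding q_def by (intro continuous_intros)
    show "q (t *\<^sub>R z) = t\<^sup>2 * q z" for t z unfolding q_def by (simp add: power_mult_distrib algebra_simps)
  qed
  also have "\<dots> = kern_moment TYPE('a) * ((- 4 / (r + a)\<^sup>2 + c * (4 * (1 - w) / r\<^sup>2 - 1)) * (norm e)\<^sup>2 + c * real DIM('a)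
      + (- c * \<alpha> / 2) * (norm v)\<^sup>2 + (1/2) * (norm p)\<^sup>2)"
    unfolding q_def by (rule integral_kern_quadratic)
  finally have main: "A \<bullet> mirror e B \<le> (- 4 / (r + a)\<^sup>2 + c * (4 * (1 - w) / r\<^sup>2 - 1)) + c * real DIM('a)
      + (- c * \<alpha> / 2) * (norm v)\<^sup>2 + (1/2) * (norm p)\<^sup>2"
    using kern_moment_pos[where 'a='a] e by (simp del: times_divide_eq_right times_divide_eq_left)
  have mB: "mirror e B = p - A" using AB by (simp add: algebra_simps)
  \<comment> \<open>Since \<open>A + mirror e B = p\<close>, the scalar product is
    \<open>(norm p)\<^sup>2 / 4 - (norm D)\<^sup>2\<close>. On the right a quarter of
    \<open>(norm p)\<^sup>2\<close> remains, and its part \<open>4 / (r + a)\<^sup>2\<close> cancels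
    against \<open>- 4 / (r + a)\<^sup>2\<close>. Every term left has a factor \<open>b\<close>:
    this is the borderline nature of the exponent 2.\<close>
  define D where "D = A - (1/2) *\<^sub>R p"
  have "A \<bullet> mirror e B = (norm p)\<^sup>2 / 4 - (norm D)\<^sup>2"
    unfolding mB D_def power2_norm_eq_inner
    by (simp add: inner_diff_left inner_diff_right inner_commute algebra_simps)
  moreover have ev: "e \<bullet> v = 4 * w / r"
    unfolding v_def coupled_grad_def e_def[symmetric] w_def r_def[symmetric]
    by (simp add: inner_add_right inner_perp[OF e] ee)
  have "(norm p)\<^sup>2 = 16 / (r + a)\<^sup>2 + 2 * (4 / (r + a)) * c * (4 * w / r) + c\<^sup>2 * (norm v)\<^sup>2"
    unfolding p_def c_def[symmetric] power2_norm_eq_inner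
    using ee ev by (simp add: inner_add_left inner_add_right inner_commute power2_eq_square algebra_simps)
  moreover have "D = (c * (e \<bullet> ((1/2) *\<^sub>R (x + y) - mc))) *\<^sub>R e + (b * K) *\<^sub>R grad_mirror_defect e0 x y"
  proof -
    define k where "k = (1/2) *\<^sub>R (x + y) - mc"
    have A1: "A = (2 / (r + a)) *\<^sub>R e + c *\<^sub>R (k + (2 * w / r) *\<^sub>R e) + (b * K) *\<^sub>R grad_mirror_defect e0 x y"
      unfolding A_def grad_pair_weight_def grad_scale_dist_def r_def[symmetric] e_def[symmetric] k_def[symmetric] w_def[symmetric] E_def[symmetric] c_def[symmetric] by (rule refl)
    have v1: "v = 2 *\<^sub>R perp e k + (4 * w / r) *\<^sub>R e"
      unfolding v_def coupled_grad_def r_def[symmetric] e_def[symmetric] k_def[symmetric] w_def[symmetric] by (rule refl)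
    have "(1/2) *\<^sub>R p = (2 / (r + a)) *\<^sub>R e + c *\<^sub>R (perp e k + (2 * w / r) *\<^sub>R e)"
      unfolding p_def c_def[symmetric] v1 by (simp add: scaleR_add_right)
    then have "D = c *\<^sub>R (k - perp e k) + (b * K) *\<^sub>R grad_mirror_defect e0 x y"
      unfolding D_def A1 by (simp add: algebra_simps)
    also have "k - perp e k = (e \<bullet> k) *\<^sub>R e" by (simp add: perp_def)
    finally show ?thesis by (simp add: k_def)
  qed
  moreover have "8 * w / (r * (r + a)) = (1/4) * (2 * (4 / (r + a)) * (4 * w / r))"
    by (simp add: mult.commute)
  ultimately show ?thesis
    using main unfolding c_def[symmetric] by (simp add: algebra_simps)
qed

section \<open>The region where the barrier is active\<close>

lemma mirror_defect_eq:
  assumes "x \<noteq> y" "norm e0 = 1"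
  shows "mirror_defect e0 x y = (norm (sgn (x - y) - e0))\<^sup>2 + (((1/2) *\<^sub>R (x + y)) \<bullet> sgn (x - y))\<^sup>2"
proof -
  have "norm (sgn (x - y)) = 1" using assms by (simp add: norm_sgn)
  moreover have "(norm (sgn (x - y) - e0))\<^sup>2 = (norm (sgn (x - y)))\<^sup>2 + (norm e0)\<^sup>2 - 2 * (sgn (x - y) \<bullet> e0)"
    by (simp add: power2_norm_eq_inner inner_diff_left inner_diff_right inner_commute)
  ultimately have "(norm (sgn (x - y) - e0))\<^sup>2 = 2 - 2 * (sgn (x - y) \<bullet> e0)"
    using assms(2) by simp
  then show ?thesis by (simp add: mirror_defect_def)
qed

lemma continuous_on_scale_dist:
  fixes f h :: "'b::topological_space \<Rightarrow> 'a::euclidean_space"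
  assumes "continuous_on S f" "continuous_on S h" "\<And>p. p \<in> S \<Longrightarrow> f p \<noteq> h p"
  shows "continuous_on S (\<lambda>p. scale_dist mc rc (f p) (h p))"
  unfolding scale_dist_def using assms by (intro continuous_intros) auto

lemma continuous_on_mirror_defect:
  fixes f h :: "'b::topological_space \<Rightarrow> 'a::euclidean_space"
  assumes "continuous_on S f" "continuous_on S h" "\<And>p. p \<in> S \<Longrightarrow> f p \<noteq> h p"
  shows "continuous_on S (\<lambda>p. mirror_defect e0 (f p) (h p))"
  unfolding mirror_defect_def using assms by (intro continuous_intros continuous_on_sgn) auto

lemma continuous_on_pair_barrier:
  fixes f h :: "'b::topological_space \<Rightarrow> 'a::euclidean_space"
  assumes "continuous_on S f" "continuous_on S h" "\<And>p. p \<in> S \<Longrightarrow> f p \<noteq> h p"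
  shows "continuous_on S (\<lambda>p. pair_barrier \<alpha> K mc rc e0 (f p) (h p))"
  unfolding pair_barrier_def by (intro continuous_intros continuous_on_scale_dist continuous_on_mirror_defect assms)

lemma abs_ln_diff_ge:
  fixes x y M :: real
  assumes "0 < x" "0 < y" "x \<le> M" "y \<le> M"
  shows "\<bar>x - y\<bar> / M \<le> \<bar>ln x - ln y\<bar>"
proof -
  have *: "(x - y) / M \<le> ln x - ln y" if "0 < x" "0 < y" "x \<le> M" "y \<le> x" for x y :: real
  proof -
    have "(x - y) / M \<le> (x - y) / x" using that by (intro divide_left_mono) auto
    also have "\<dots> \<le> ln x - ln y" using ln_diff_le[of y x] that by (simp add: diff_divide_distrib)
    finally show ?thesis .
  qed
  show ?thesis
  proof (cases "y \<le> x")
    case True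
    then show ?thesis using *[of x y] assms by simp
  next
    case False
    then show ?thesis using *[of y x] assms by simp
  qed
qed

text \<open>The geometry of the region where the barrier is active: there the pair is nearly mirrored in the
  hyperplane orthogonal to \<open>e0\<close>, and either the first point lies in the hole \<open>ball c \<rho>\<close>
  or the barrier is uniformly non-degenerate.\<close>

lemma barrier_region:
  fixes x y c e0 :: "'a::euclidean_space" and \<rho> N Xo K \<alpha> :: real
  defines "rc \<equiv> 2 * (c \<bullet> e0)" and "mc \<equiv> c - (c \<bullet> e0) *\<^sub>R e0"
  defines "r \<equiv> norm (x - y)" and "e \<equiv> sgn (x - y)" and "m \<equiv> (1/2) *\<^sub>R (x + y)"
  assumes "norm e0 = 1" and \<rho>: "0 < \<rho>" "\<rho> \<le> c \<bullet> e0" and N: "norm c \<le> N" "1 \<le> N" and "1 \<le> Xo" and "\<alpha> > 0"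
    and K: "K = (4 * (1 + 2 * N) / \<rho>)\<^sup>2" and "x \<noteq> y"
    and H: "exp (- \<alpha> * Xo) \<le> pair_barrier \<alpha> K mc rc e0 x y"
  shows "scale_dist mc rc x y \<le> Xo" "norm (m - mc) \<le> Xo" "\<bar>ln r - ln rc\<bar> \<le> Xo"
    "2 * \<rho> * exp (- Xo) \<le> r" "r \<le> 2 * N * exp Xo" "norm m \<le> N + Xo" "\<bar>m \<bullet> e\<bar> \<le> 1"
    "norm x \<le> N + Xo + 2 * N * exp Xo" "norm y \<le> N + Xo + 2 * N * exp Xo"
    "x \<notin> ball c \<rho> \<Longrightarrow> min (\<rho>\<^sup>2 / 4) (4 * \<rho>\<^sup>2 / (2 * N * exp Xo) ^ 4) \<le> (norm (coupled_grad mc rc x y))\<^sup>2"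
proof -
  define X where "X = scale_dist mc rc x y"
  define Q where "Q = mirror_defect e0 x y"
  define w where "w = ln r - ln rc"
  define r2 where "r2 = 2 * N * exp Xo"
  have r: "r > 0" using \<open>x \<noteq> y\<close> by (simp add: r_def)
  have e: "norm e = 1" using \<open>x \<noteq> y\<close> by (simp add: e_def norm_sgn)
  have rc: "2 * \<rho> \<le> rc" "rc \<le> 2 * N" "0 < rc"
  proof -
    have "c \<bullet> e0 \<le> norm c * norm e0" by (rule norm_cauchy_schwarz)
    then show "2 * \<rho> \<le> rc" "rc \<le> 2 * N" "0 < rc" using assms by (auto simp: rc_def)
  qed
  have Q: "Q = (norm (e - e0))\<^sup>2 + (m \<bullet> e)\<^sup>2"
    unfolding Q_def e_def m_def by (rule mirror_defect_eq[OF \<open>x \<noteq> y\<close> \<open>norm e0 = 1\<close>])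
  have K0: "K > 0" unfolding K using \<rho> N by simp
  have HX: "exp (- \<alpha> * Xo) \<le> exp (- \<alpha> * X) - K * Q" using H by (simp add: pair_barrier_def X_def Q_def)
  have KQ0: "K * Q \<ge> 0" using K0 by (simp add: Q)
  have X: "X = (norm (m - mc))\<^sup>2 + w\<^sup>2" by (simp add: X_def scale_dist_def m_def w_def r_def)
  then have X0: "X \<ge> 0" by simp
  have "exp (- \<alpha> * Xo) \<le> exp (- \<alpha> * X)" using HX KQ0 by linarith
  then show XXo: "scale_dist mc rc x y \<le> Xo" using \<open>\<alpha> > 0\<close> by (simp add: X_def)
  have sq: "Xo \<le> Xo\<^sup>2" using \<open>1 \<le> Xo\<close> by (simp add: power2_eq_square)
  have "(norm (m - mc))\<^sup>2 \<le> Xo\<^sup>2" using X XXo sq zero_le_power2[of w] unfolding X_def[symmetric] by linarith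
  then show mmc: "norm (m - mc) \<le> Xo" by (rule power2_le_imp_le) (use \<open>1 \<le> Xo\<close> in simp)
  have "w\<^sup>2 \<le> Xo\<^sup>2" using X XXo sq zero_le_power2[of "norm (m - mc)"] unfolding X_def[symmetric] by linarith
  then show wXo: "\<bar>ln r - ln rc\<bar> \<le> Xo"
    using \<open>1 \<le> Xo\<close> by (simp add: w_def abs_le_square_iff[symmetric])
  have r_eq: "r = rc * exp w" using r rc by (simp add: w_def exp_diff)
  have "2 * \<rho> * exp (- Xo) \<le> rc * exp w"
    using rc wXo \<rho> by (intro mult_mono) (auto simp: w_def)
  then show "2 * \<rho> * exp (- Xo) \<le> r" using r_eq by simp
  have "rc * exp w \<le> 2 * N * exp Xo"
    using rc wXo by (intro mult_mono) (auto simp: w_def)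
  then show rr2: "r \<le> 2 * N * exp Xo" using r_eq by simp
  have mcN: "norm mc \<le> N"
    using norm_perp_le[OF \<open>norm e0 = 1\<close>, of c] N by (simp add: mc_def perp_def inner_commute)
  have "norm m \<le> norm mc + norm (m - mc)" using norm_triangle_ineq[of mc "m - mc"] by simp
  then show mN: "norm m \<le> N + Xo" using mcN mmc by linarith
  have xm: "x = m + (1/2) *\<^sub>R (x - y)" "y = m - (1/2) *\<^sub>R (x - y)"
    by (simp_all add: m_def algebra_simps flip: scaleR_add_left)
  have "norm x \<le> norm m + norm ((1/2) *\<^sub>R (x - y))" by (subst xm(1)) (rule norm_triangle_ineq)
  then have "norm x \<le> norm m + r / 2" by (simp add: r_def)
  then show "norm x \<le> N + Xo + 2 * N * exp Xo" using mN rr2 r by linarith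
  have "norm y \<le> norm m + norm ((1/2) *\<^sub>R (x - y))" by (subst xm(2)) (rule norm_triangle_ineq4)
  then have "norm y \<le> norm m + r / 2" by (simp add: r_def)
  then show "norm y \<le> N + Xo + 2 * N * exp Xo" using mN rr2 r by linarith
  \<comment> \<open>\<open>K\<close> satisfies \<open>K * \<kappa>\<^sup>2 = 1\<close>. As the
    barrier is positive, the defect \<open>Q\<close> is at most \<open>\<kappa>\<^sup>2\<close>, and
    deviations of this size from a mirrored pair account for at most \<open>\<rho> / 4\<close> in
    the distance of \<open>x\<close> from \<open>c\<close>.\<close>
  define \<kappa> where "\<kappa> = \<rho> / (4 * (1 + 2 * N))"
  have \<kappa>0: "\<kappa> > 0" using \<rho> N by (simp add: \<kappa>_def)
  have "exp (- \<alpha> * X) \<le> 1" using \<open>\<alpha> > 0\<close> X0 by simp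
  then have "K * Q \<le> 1" using HX exp_gt_zero[of "- \<alpha> * Xo"] by linarith
  moreover have "K * \<kappa>\<^sup>2 = 1"
  proof -
    have "4 * (1 + 2 * N) / \<rho> * \<kappa> = 1" using \<rho> N by (simp add: \<kappa>_def)
    then show ?thesis unfolding K by (metis power_mult_distrib power_one)
  qed
  ultimately have "K * Q \<le> K * \<kappa>\<^sup>2" by simp
  then have Q\<kappa>: "Q \<le> \<kappa>\<^sup>2" using K0 by simp
  have "(norm (e - e0))\<^sup>2 \<le> \<kappa>\<^sup>2" using Q Q\<kappa> zero_le_power2[of "m \<bullet> e"] by linarith
  then have e\<kappa>: "norm (e - e0) \<le> \<kappa>" by (rule power2_le_imp_le) (use \<kappa>0 in simp)
  have "(m \<bullet> e)\<^sup>2 \<le> \<kappa>\<^sup>2" using Q Q\<kappa> zero_le_power2[of "norm (e - e0)"] by linarith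
  then have m\<kappa>: "\<bar>m \<bullet> e\<bar> \<le> \<kappa>" using \<kappa>0 by (simp add: abs_le_square_iff[symmetric])
  have "1 + 2 * N > 0" using N by linarith
  then have \<kappa>N: "\<kappa> * (1 + 2 * N) = \<rho> / 4" unfolding \<kappa>_def by (simp add: divide_simps)
  have \<rho>N: "\<rho> \<le> N" using rc by linarith
  have "\<kappa> * 1 \<le> \<kappa> * (1 + 2 * N)" using \<kappa>0 N by (intro mult_left_mono) auto
  have "\<rho> / (4 * (1 + 2 * N)) \<le> 1" using \<rho> \<rho>N N by (simp add: field_simps)
  then show "\<bar>m \<bullet> e\<bar> \<le> 1" using m\<kappa> by (simp add: \<kappa>_def)
  show "min (\<rho>\<^sup>2 / 4) (4 * \<rho>\<^sup>2 / (2 * N * exp Xo) ^ 4) \<le> (norm (coupled_grad mc rc x y))\<^sup>2" if "x \<notin> ball c \<rho>"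
  proof -
    define P where "P = perp e (m - mc)"
    \<comment> \<open>\<open>c\<close> and \<open>mc - (rc / 2) *\<^sub>R e0\<close> form the pair
      at which \<open>scale_dist\<close> is 0. So degenerate pairs have their first point in the
      hole; outside it the midpoint or the distance of the pair is off by a definite amount.\<close>
    have ce: "c = mc + (rc / 2) *\<^sub>R e0" by (simp add: mc_def rc_def)
    have xe: "x = m + (r / 2) *\<^sub>R e"
      using xm(1) norm_scaleR_sgn[of "x - y"] unfolding r_def e_def by (metis scaleR_scaleR times_divide_eq_left mult_1)
    have mce0: "mc \<bullet> e0 = 0" using \<open>norm e0 = 1\<close> by (simp add: mc_def inner_diff_left dot_square_norm)
    have "\<bar>mc \<bullet> e\<bar> = \<bar>mc \<bullet> (e - e0)\<bar>" by (simp add: inner_diff_right mce0)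
    also have "\<dots> \<le> norm mc * norm (e - e0)" by (rule Cauchy_Schwarz_ineq2)
    also have "\<dots> \<le> N * \<kappa>" using mcN e\<kappa> N by (intro mult_mono) auto
    finally have mce: "\<bar>mc \<bullet> e\<bar> \<le> N * \<kappa>" .
    have "m - mc = P + (e \<bullet> (m - mc)) *\<^sub>R e" by (simp add: P_def perp_def)
    then have "norm (m - mc) \<le> norm P + \<bar>e \<bullet> (m - mc)\<bar>"
      using norm_triangle_ineq[of P "(e \<bullet> (m - mc)) *\<^sub>R e"] e by simp
    moreover have "\<bar>e \<bullet> (m - mc)\<bar> \<le> \<bar>m \<bullet> e\<bar> + \<bar>mc \<bullet> e\<bar>"
      by (simp add: inner_diff_right inner_commute[of e] abs_triangle_ineq4)
    ultimately have mP: "norm (m - mc) \<le> norm P + \<kappa> + N * \<kappa>" using m\<kappa> mce by linarith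
    have "x - c = (m - mc) + ((r - rc) / 2) *\<^sub>R e + (rc / 2) *\<^sub>R (e - e0)"
      unfolding xe ce by (simp add: algebra_simps diff_divide_distrib)
    then have "norm (x - c) \<le> norm (m - mc) + norm (((r - rc) / 2) *\<^sub>R e) + norm ((rc / 2) *\<^sub>R (e - e0))"
      by (metis norm_triangle_mono norm_triangle_ineq order_refl)
    also have "norm (((r - rc) / 2) *\<^sub>R e) = \<bar>r - rc\<bar> / 2" using e by simp
    also have "norm ((rc / 2) *\<^sub>R (e - e0)) = rc / 2 * norm (e - e0)" using rc by simp
    finally have "norm (x - c) \<le> norm (m - mc) + \<bar>r - rc\<bar> / 2 + rc / 2 * norm (e - e0)" .
    moreover have "rc / 2 * norm (e - e0) \<le> N * \<kappa>" using rc e\<kappa> by (intro mult_mono) auto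
    moreover have "\<rho> \<le> norm (x - c)" using that by (simp add: dist_norm norm_minus_commute)
    ultimately have "\<rho> \<le> norm P + \<bar>r - rc\<bar> / 2 + \<kappa> * (1 + 2 * N)" using mP by (simp add: algebra_simps)
    then have split: "\<rho> * (3 / 4) \<le> norm P + \<bar>r - rc\<bar> / 2" using \<kappa>N by simp
    have coupled_grad: "(norm (coupled_grad mc rc x y))\<^sup>2 = 4 * (norm P)\<^sup>2 + (4 * w / r)\<^sup>2"
    proof -
      have "coupled_grad mc rc x y = 2 *\<^sub>R P + (4 * w / r) *\<^sub>R e"
        by (simp add: coupled_grad_def P_def e_def m_def w_def r_def)
      moreover have "P \<bullet> e = 0" unfolding P_def using inner_perp[OF e] by (simp add: inner_commute)
      moreover have "e \<bullet> e = 1" using e by (simp add: dot_square_norm)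
      moreover have "e \<bullet> P = 0" unfolding P_def by (rule inner_perp[OF e])
      ultimately show ?thesis
        unfolding power2_norm_eq_inner by (simp add: inner_add_left inner_add_right power2_eq_square)
    qed
    show ?thesis
    proof (cases "\<rho> / 4 \<le> norm P")
      case True
      then have "(\<rho> / 4)\<^sup>2 \<le> (norm P)\<^sup>2" using \<rho> by (intro power_mono) auto
      then have "\<rho>\<^sup>2 / 4 \<le> 4 * (norm P)\<^sup>2" by (simp add: power_divide)
      then show ?thesis unfolding coupled_grad by (intro min.coboundedI1) (simp add: add_increasing2)
    next
      case False
      then have "norm P < \<rho> / 4" by simp
      moreover have "\<rho> \<le> q" if "\<rho> * (3 / 4) \<le> p + q / 2" "p < \<rho> / 4" for p q :: real
        using that by (simp add: field_simps)
      ultimately have rrc: "\<rho> \<le> \<bar>r - rc\<bar>" using split by blast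
      have r2: "r \<le> r2" "rc \<le> r2" "r2 > 0"
      proof -
        show "r \<le> r2" using rr2 by (simp add: r2_def)
        have "2 * N * 1 \<le> r2" unfolding r2_def using N \<open>1 \<le> Xo\<close> by (intro mult_left_mono) auto
        then show "rc \<le> r2" "r2 > 0" using rc N by linarith+
      qed
      have "\<rho> / r2 \<le> \<bar>r - rc\<bar> / r2" using rrc r2 by (intro divide_right_mono) auto
      also have "\<dots> \<le> \<bar>w\<bar>" unfolding w_def by (rule abs_ln_diff_ge) (use r rc r2 in auto)
      finally have "\<rho> / r2 \<le> \<bar>w\<bar>" .
      then have "4 * (\<rho> / r2) / r2 \<le> 4 * \<bar>w\<bar> / r"
        using r r2 \<rho> by (intro frac_le mult_left_mono) auto
      then have "(4 * (\<rho> / r2) / r2)\<^sup>2 \<le> (4 * \<bar>w\<bar> / r)\<^sup>2"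
        using \<rho> r2 by (intro power_mono) auto
      moreover have "4 * \<rho>\<^sup>2 / r2 ^ 4 \<le> (4 * (\<rho> / r2) / r2)\<^sup>2"
        using \<rho> r2 by (simp add: power_divide power_mult_distrib field_simps eval_nat_numeral)
      moreover have "(4 * \<bar>w\<bar> / r)\<^sup>2 = (4 * w / r)\<^sup>2" by (simp add: power_divide power_mult_distrib)
      ultimately have "4 * \<rho>\<^sup>2 / r2 ^ 4 \<le> (4 * w / r)\<^sup>2" by linarith
      then show ?thesis unfolding coupled_grad r2_def[symmetric] by (intro min.coboundedI2) (simp add: add_increasing)
    qed
  qed
qed

lemma norm_grad_mirror_defect_le:
  fixes x y e0 :: "'a::euclidean_space"
  assumes "x \<noteq> y" "norm e0 = 1" "norm ((1/2) *\<^sub>R (x + y)) \<le> M" "\<bar>((1/2) *\<^sub>R (x + y)) \<bullet> sgn (x - y)\<bar> \<le> 1"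
    and "0 < r1" "r1 \<le> norm (x - y)"
  shows "norm (grad_mirror_defect e0 x y) \<le> 2 / r1 + 2 * (1 + M / r1)"
proof -
  define e where "e = sgn (x - y)"
  define m where "m = (1/2) *\<^sub>R (x + y)"
  define r where "r = norm (x - y)"
  have e: "norm e = 1" using assms by (simp add: e_def norm_sgn)
  have r: "0 < r" "r1 \<le> r" using assms by (auto simp: r_def)
  have M: "0 \<le> M" using order_trans[OF norm_ge_zero assms(3)] .
  have "norm (grad_mirror_defect e0 x y) \<le> norm ((- 2 / r) *\<^sub>R perp e e0) + norm ((2 * (m \<bullet> e)) *\<^sub>R ((1/2) *\<^sub>R e + (1 / r) *\<^sub>R perp e m))"
    unfolding grad_mirror_defect_def e_def[symmetric] m_def[symmetric] r_def[symmetric] by (rule norm_triangle_ineq)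
  moreover have "norm ((- 2 / r) *\<^sub>R perp e e0) \<le> 2 / r1"
  proof -
    have "norm ((- 2 / r) *\<^sub>R perp e e0) = 2 / r * norm (perp e e0)" using r by simp
    also have "\<dots> \<le> 2 / r1 * 1"
      using r \<open>0 < r1\<close> norm_perp_le[OF e, of e0] assms(2) by (intro mult_mono frac_le) auto
    finally show ?thesis by simp
  qed
  moreover have "norm ((2 * (m \<bullet> e)) *\<^sub>R ((1/2) *\<^sub>R e + (1 / r) *\<^sub>R perp e m)) \<le> 2 * (1 + M / r1)"
  proof -
    have "norm ((1 / r) *\<^sub>R perp e m) = norm (perp e m) / r" using r by simp
    also have "\<dots> \<le> M / r1"
      using r M \<open>0 < r1\<close> norm_perp_le[OF e, of m] assms(3) unfolding m_def[symmetric]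
      by (intro frac_le) (auto intro: order_trans)
    finally have "norm ((1 / r) *\<^sub>R perp e m) \<le> M / r1" .
    then have "norm ((1/2) *\<^sub>R e + (1 / r) *\<^sub>R perp e m) \<le> 1 + M / r1"
      using norm_triangle_ineq[of "(1/2) *\<^sub>R e" "(1 / r) *\<^sub>R perp e m"] e by simp
    moreover have "\<bar>2 * (m \<bullet> e)\<bar> \<le> 2" using assms(4) unfolding m_def[symmetric] e_def[symmetric] by simp
    ultimately show ?thesis unfolding norm_scaleR by (intro mult_mono) auto
  qed
  ultimately show ?thesis by linarith
qed


text \<open>If the pair \<open>x0, y0\<close> almost maximises the quotient with \<open>(norm (x - y) + a)\<^sup>2\<close>, then the quotient with
  \<open>pair_weight\<close> is maximal in the interior of the region where the barrier is not small, because the barrier is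
  larger at \<open>x0, y0\<close> than on the boundary of this region.\<close>

lemma two_point_rigidity:
  fixes \<rho> N rm :: real
  assumes \<rho>: "0 < \<rho>" and N: "1 \<le> N" and rm: "0 < rm" "rm \<le> 1"
  shows "\<exists>R>0. \<exists>\<epsilon>>0. \<forall>(f :: 'a::euclidean_space \<Rightarrow> real) g e0 r0 a c L.
    norm e0 = 1 \<and> rm \<le> r0 \<and> 0 \<le> a \<and> r0 + a = 1 \<and> norm c \<le> N \<and> \<rho> \<le> c \<bullet> e0 \<and> (\<forall>x\<in>ball c \<rho>. f x = 0) \<and>
    L-lipschitz_on (ball 0 R) f \<and> L-lipschitz_on (ball 0 R) g \<and> (\<forall>x. 0 \<le> f x) \<and> (\<forall>x. 0 \<le> g x) \<and>
    (\<forall>x\<in>ball 0 R. f x > 0 \<longrightarrow> submean_at f x) \<and> (\<forall>x\<in>ball 0 R. g x > 0 \<longrightarrow> submean_at g x) \<and>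
    0 < f ((r0 / 2) *\<^sub>R e0) \<and> 0 < g (- (r0 / 2) *\<^sub>R e0) \<and>
    (\<forall>x\<in>ball 0 R. \<forall>y\<in>ball 0 R. f x * g y \<le> (1 + \<epsilon>) * (f ((r0 / 2) *\<^sub>R e0) * g (- (r0 / 2) *\<^sub>R e0)) * (norm (x - y) + a)\<^sup>2)
    \<longrightarrow> False"
proof -
  \<comment> \<open>\<open>Xm\<close> bounds \<open>scale_dist\<close> at the given pair for all
    admissible data. The region ends at \<open>Xo = Xm + 1\<close>, and \<open>h0\<close> is the
    drop of the exponential in between.\<close>
  define \<Lambda> where "\<Lambda> = \<bar>ln rm\<bar> + \<bar>ln (2 * \<rho>)\<bar> + \<bar>ln (2 * N)\<bar>"
  define Xm where "Xm = N\<^sup>2 + \<Lambda>\<^sup>2"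
  define Xo where "Xo = Xm + 1"
  have Xo: "1 \<le> Xo" by (simp add: Xo_def Xm_def)
  define r1 where "r1 = 2 * \<rho> * exp (- Xo)"
  define r2 where "r2 = 2 * N * exp Xo"
  have r1: "0 < r1" using \<rho> by (simp add: r1_def)
  have r2: "0 < r2" using N by (simp add: r2_def)
  define B where "B = N + Xo + r2"
  define K where "K = (4 * (1 + 2 * N) / \<rho>)\<^sup>2"
  have K: "K > 0" using \<rho> N by (simp add: K_def)
  define vm where "vm = min (\<rho>\<^sup>2 / 4) (4 * \<rho>\<^sup>2 / r2 ^ 4)"
  have vm: "vm > 0" using \<rho> r2 by (simp add: vm_def)
  define C1 where "C1 = real DIM('a) + 4 * (1 + Xo) / r1\<^sup>2 + 8 * Xo / r1\<^sup>2"
  have C1: "0 \<le> C1" using r1 Xo by (auto simp: C1_def intro!: add_nonneg_nonneg divide_nonneg_nonneg)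
  \<comment> \<open>This gives \<open>\<alpha> / 2 * vm = C1 + 1\<close>: the convexity of the
    exponential beats all other contributions that are linear in \<open>b\<close> by 1.\<close>
  define \<alpha> where "\<alpha> = 2 * (C1 + 1) / vm"
  have \<alpha>: "\<alpha> > 0" using C1 vm by (simp add: \<alpha>_def)
  define V where "V = 2 * Xo + 4 * Xo / r1"
  have V: "V \<ge> 0" using Xo r1 by (simp add: V_def)
  define C2 where "C2 = 2 / r1 + 2 * (1 + (N + Xo) / r1)"
  have C2: "C2 \<ge> 0" using r1 N Xo by (auto simp: C2_def intro!: add_nonneg_nonneg)
  define C3 where "C3 = \<alpha>\<^sup>2 / 4 * V\<^sup>2 + (\<alpha> * Xo + K * C2)\<^sup>2"
  have "0 < (\<alpha> * Xo + K * C2)\<^sup>2" using \<alpha> Xo K C2 by (intro zero_less_power add_pos_nonneg) auto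
  then have C3: "C3 > 0" unfolding C3_def by (intro add_nonneg_pos) auto
  define E0 where "E0 = exp (- \<alpha> * Xo)"
  have E0: "E0 > 0" by (simp add: E0_def)
  \<comment> \<open>\<open>C3\<close> collects the losses quadratic in \<open>b\<close>. With this
    \<open>b\<close> they are at most half of the gain \<open>b * \<alpha> * E0\<close>.\<close>
  define b where "b = \<alpha> * E0 / (2 * C3)"
  have b: "b > 0" using \<alpha> E0 C3 by (simp add: b_def)
  define h0 where "h0 = exp (- \<alpha> * Xm) - E0"
  have h0: "h0 > 0" using \<alpha> by (simp add: h0_def E0_def Xo_def)
  \<comment> \<open>As \<open>1 + \<epsilon> < exp (b * h0)\<close>, the larger barrier at the given
    pair outweighs its failure to be an exact maximum.\<close>
  define \<epsilon> where "\<epsilon> = b * h0 / 2"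
  have \<epsilon>: "\<epsilon> > 0" using b h0 by (simp add: \<epsilon>_def)
  have Bpos: "B + 1 > 0" using N Xo r2 by (simp add: B_def)
  show ?thesis
  proof (rule exI[of _ "B + 1"], rule conjI, rule Bpos, rule exI[of _ \<epsilon>], rule conjI, rule \<epsilon>, intro allI impI, elim conjE)
    fix f g :: "'a \<Rightarrow> real" and e0 c :: 'a and r0 a L :: real
    assume e0: "norm e0 = 1" and r0: "rm \<le> r0" "r0 + a = 1" and a: "0 \<le> a" and c: "norm c \<le> N" "\<rho> \<le> c \<bullet> e0"
      and fc: "\<forall>x\<in>ball c \<rho>. f x = 0"
      and lip: "L-lipschitz_on (ball 0 (B + 1)) f" "L-lipschitz_on (ball 0 (B + 1)) g"
      and nonneg: "\<forall>x. 0 \<le> f x" "\<forall>x. 0 \<le> g x"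
      and sub: "\<forall>x\<in>ball 0 (B + 1). f x > 0 \<longrightarrow> submean_at f x" "\<forall>x\<in>ball 0 (B + 1). g x > 0 \<longrightarrow> submean_at g x"
      and pos: "0 < f ((r0 / 2) *\<^sub>R e0)" "0 < g (- (r0 / 2) *\<^sub>R e0)"
      and max0: "\<forall>x\<in>ball 0 (B + 1). \<forall>y\<in>ball 0 (B + 1).
         f x * g y \<le> (1 + \<epsilon>) * (f ((r0 / 2) *\<^sub>R e0) * g (- (r0 / 2) *\<^sub>R e0)) * (norm (x - y) + a)\<^sup>2"
    define rc where "rc = 2 * (c \<bullet> e0)"
    define mc where "mc = c - (c \<bullet> e0) *\<^sub>R e0"
    define x0 where "x0 = (r0 / 2) *\<^sub>R e0"
    define y0 where "y0 = - (r0 / 2) *\<^sub>R e0"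
    define J0 where "J0 = f x0 * g y0"
    have J0: "J0 > 0" using pos by (simp add: J0_def x0_def y0_def)
    note region = barrier_region[OF e0 \<rho> c(2) c(1) N Xo \<alpha> K_def, folded rc_def mc_def, folded E0_def r1_def r2_def, folded B_def vm_def]
    have d0: "x0 - y0 = r0 *\<^sub>R e0" by (simp add: x0_def y0_def flip: scaleR_add_left)
    have r0': "0 < r0" "r0 \<le> 1" using r0 rm a by auto
    have n0: "norm (x0 - y0) = r0" unfolding d0 using r0' e0 by simp
    have s0: "sgn (x0 - y0) = e0" unfolding d0 sgn_scaleR using r0' e0 by (simp add: sgn_div_norm)
    have m0: "x0 + y0 = 0" by (simp add: x0_def y0_def)
    have xy0: "x0 \<noteq> y0" using n0 r0' by auto
    have Q0: "mirror_defect e0 x0 y0 = 0" unfolding mirror_defect_def s0 m0 using e0 by (simp add: dot_square_norm)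
    have X0: "scale_dist mc rc x0 y0 \<le> Xm"
    proof -
      have "c \<bullet> e0 \<le> norm c * norm e0" by (rule norm_cauchy_schwarz)
      then have rc: "2 * \<rho> \<le> rc" "rc \<le> 2 * N" using e0 c by (auto simp: rc_def)
      have "ln (2 * \<rho>) \<le> ln rc" "ln rc \<le> ln (2 * N)" using rc \<rho> by auto
      moreover have "ln rm \<le> ln r0" "ln r0 \<le> 0" using r0 r0' rm by auto
      ultimately have "\<bar>ln r0 - ln rc\<bar> \<le> \<Lambda>" unfolding \<Lambda>_def by linarith
      then have "(ln r0 - ln rc)\<^sup>2 \<le> \<Lambda>\<^sup>2" by (metis abs_ge_zero power2_abs power_mono)
      moreover have "norm mc \<le> N" using norm_perp_le[OF e0, of c] c by (simp add: mc_def perp_def inner_commute)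
      then have "(norm mc)\<^sup>2 \<le> N\<^sup>2" by (intro power_mono) auto
      ultimately show ?thesis unfolding scale_dist_def n0 m0 Xm_def by simp
    qed
    have H0: "h0 + E0 \<le> pair_barrier \<alpha> K mc rc e0 x0 y0" unfolding pair_barrier_def Q0 h0_def using X0 \<alpha> by simp
    define S0 where "S0 = {p \<in> cball 0 B \<times> cball (0::'a) B. r1 \<le> norm (fst p - snd p)}"
    define S where "S = {p \<in> S0. E0 \<le> pair_barrier \<alpha> K mc rc e0 (fst p) (snd p)}"
    have S_iff: "(x, y) \<in> S \<longleftrightarrow> x \<noteq> y \<and> E0 \<le> pair_barrier \<alpha> K mc rc e0 x y" for x y
      using region(4,8,9)[of x y] r1 unfolding S_def S0_def by auto
    have S0_eq: "S0 = (cball 0 B \<times> cball 0 B) \<inter> (\<lambda>p. norm (fst p - snd p)) -` {r1..}"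
      by (auto simp: S0_def)
    have closedS0: "closed S0" unfolding S0_eq
      by (intro continuous_closed_preimage continuous_intros closed_Times) auto
    have neS0: "fst p \<noteq> snd p" if "p \<in> S0" for p using that r1 by (auto simp: S0_def)
    have Seq: "S = S0 \<inter> (\<lambda>p. pair_barrier \<alpha> K mc rc e0 (fst p) (snd p)) -` {E0..}" by (auto simp: S_def)
    have contH: "continuous_on S0 (\<lambda>p. pair_barrier \<alpha> K mc rc e0 (fst p) (snd p))"
      by (intro continuous_on_pair_barrier continuous_intros neS0)
    have closedS: "closed S"
      unfolding Seq by (rule continuous_closed_preimage[OF contH closedS0 closed_atLeast])
    have "S \<subseteq> cball 0 B \<times> cball 0 B" by (auto simp: S_def S0_def)
    from bounded_subset[OF bounded_Times[OF bounded_cball bounded_cball] this]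
    have compS: "compact S" using closedS by (simp add: compact_eq_bounded_closed)
    define \<Psi> where "\<Psi> x y = pair_weight a b \<alpha> K mc rc e0 x y" for x y
    have \<Psi>: "\<Psi> x y > 0" if "x \<noteq> y" for x y
    proof -
      have "norm (x - y) + a > 0" using that a by (simp add: add_pos_nonneg)
      then show ?thesis unfolding \<Psi>_def pair_weight_def by simp
    qed
    have contf: "continuous_on (ball 0 (B + 1)) f" "continuous_on (ball 0 (B + 1)) g"
      using lip by (auto intro: lipschitz_on_continuous_on)
    have SB: "fst p \<in> ball 0 (B + 1)" "snd p \<in> ball 0 (B + 1)" if "p \<in> S" for p
      using that by (auto simp: S_def S0_def)
    have neS: "fst p \<noteq> snd p" if "p \<in> S" for p using that neS0 by (auto simp: S_def)
    have "continuous_on S (\<lambda>p. f (fst p) * g (snd p) / \<Psi> (fst p) (snd p))"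
    proof (intro continuous_on_divide continuous_on_mult ballI)
      show "continuous_on S (\<lambda>p. f (fst p))" "continuous_on S (\<lambda>p. g (snd p))"
        using SB by (auto intro!: continuous_on_compose2[OF contf(1)] continuous_on_compose2[OF contf(2)] continuous_intros)
      show "continuous_on S (\<lambda>p. \<Psi> (fst p) (snd p))"
        unfolding \<Psi>_def pair_weight_def using neS by (intro continuous_intros continuous_on_pair_barrier) auto
      show "\<Psi> (fst p) (snd p) \<noteq> 0" if "p \<in> S" for p using \<Psi>[OF neS[OF that]] by simp
    qed
    moreover have S0mem: "(x0, y0) \<in> S" using S_iff xy0 H0 h0 by simp
    ultimately obtain p1 where p1: "p1 \<in> S"
      "\<And>p. p \<in> S \<Longrightarrow> f (fst p) * g (snd p) / \<Psi> (fst p) (snd p) \<le> f (fst p1) * g (snd p1) / \<Psi> (fst p1) (snd p1)"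
      using continuous_attains_sup[OF compS] by blast
    define x1 where "x1 = fst p1"
    define y1 where "y1 = snd p1"
    define J where "J = f x1 * g y1 / \<Psi> x1 y1"
    have xy1: "x1 \<noteq> y1" "E0 \<le> pair_barrier \<alpha> K mc rc e0 x1 y1" using p1(1) S_iff[of x1 y1] by (auto simp: x1_def y1_def)
    have Jmax: "f x * g y \<le> J * \<Psi> x y" if "(x, y) \<in> S" for x y
    proof -
      have "\<Psi> x y > 0" using that S_iff \<Psi> by blast
      moreover have "f x * g y / \<Psi> x y \<le> J" using p1(2)[OF that] by (simp add: J_def x1_def y1_def)
      ultimately show ?thesis by (simp add: pos_divide_le_eq)
    qed
    have \<Psi>0: "\<Psi> x0 y0 = exp (- b * pair_barrier \<alpha> K mc rc e0 x0 y0)"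
      unfolding \<Psi>_def pair_weight_def n0 using r0 by simp
    have J_ge: "J0 * exp (b * (h0 + E0)) \<le> J"
    proof -
      have "J0 \<le> J * exp (- b * pair_barrier \<alpha> K mc rc e0 x0 y0)" using Jmax[OF S0mem] by (simp add: J0_def \<Psi>0)
      then have "J0 * exp (b * pair_barrier \<alpha> K mc rc e0 x0 y0) \<le> J"
        by (simp add: exp_minus field_simps)
      moreover have "J0 * exp (b * (h0 + E0)) \<le> J0 * exp (b * pair_barrier \<alpha> K mc rc e0 x0 y0)"
        using J0 b H0 by simp
      ultimately show ?thesis by linarith
    qed
    have J: "J > 0" using J_ge J0 by (meson exp_gt_zero less_le_trans mult_pos_pos)
    have eq1: "f x1 * g y1 = J * \<Psi> x1 y1" using \<Psi>[OF xy1(1)] by (simp add: J_def)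
    then have "f x1 * g y1 > 0" using J \<Psi>[OF xy1(1)] by simp
    then have pos1: "f x1 > 0" "g y1 > 0" using nonneg by (auto simp: zero_less_mult_iff order.strict_iff_order)
    have B1: "norm x1 \<le> B" "norm y1 \<le> B" using region(8,9)[OF xy1] by auto
    then have x1B: "x1 \<in> ball 0 (B + 1)" and y1B: "y1 \<in> ball 0 (B + 1)" by auto
    \<comment> \<open>A maximum on the boundary of the region, where the barrier equals
      \<open>E0\<close>, would turn the almost maximality of the given pair into
      \<open>exp (b * h0) \<le> 1 + \<epsilon>\<close>.\<close>
    have strict: "E0 < pair_barrier \<alpha> K mc rc e0 x1 y1"
    proof (rule ccontr)
      assume "\<not> ?thesis"
      then have H1: "pair_barrier \<alpha> K mc rc e0 x1 y1 = E0" using xy1 by simp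
      have "J * \<Psi> x1 y1 \<le> (1 + \<epsilon>) * J0 * (norm (x1 - y1) + a)\<^sup>2"
        using max0 x1B y1B unfolding eq1[symmetric] J0_def x0_def y0_def by blast
      moreover have "\<Psi> x1 y1 = (norm (x1 - y1) + a)\<^sup>2 * exp (- b * E0)" unfolding \<Psi>_def pair_weight_def H1 by simp
      moreover have "norm (x1 - y1) + a > 0" using xy1 a by (simp add: add_pos_nonneg)
      then have sq: "(norm (x1 - y1) + a)\<^sup>2 > 0" by simp
      ultimately have "(norm (x1 - y1) + a)\<^sup>2 * (J * exp (- b * E0)) \<le> (norm (x1 - y1) + a)\<^sup>2 * ((1 + \<epsilon>) * J0)"
        by (simp add: mult_ac)
      then have "J * exp (- b * E0) \<le> (1 + \<epsilon>) * J0" using sq by (simp only: mult_le_cancel_left_pos)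
      moreover have "J0 * exp (b * (h0 + E0)) * exp (- b * E0) \<le> J * exp (- b * E0)"
        using J_ge by (intro mult_right_mono) auto
      moreover have "exp (b * (h0 + E0)) * exp (- b * E0) = exp (b * h0)"
        by (simp add: algebra_simps flip: exp_add)
      then have "J0 * exp (b * (h0 + E0)) * exp (- b * E0) = J0 * exp (b * h0)" by (simp only: mult.assoc)
      ultimately have "J0 * exp (b * h0) \<le> J0 * (1 + \<epsilon>)" by (simp only: mult.commute[of "1 + \<epsilon>"])
      then have "exp (b * h0) \<le> 1 + \<epsilon>" using J0 by simp
      moreover have "1 + b * h0 \<le> exp (b * h0)" by (rule exp_ge_add_one_self)
      moreover have "\<epsilon> < b * h0" using b h0 by (simp add: \<epsilon>_def)
      ultimately show False by linarith
    qed
    obtain d where d: "0 < d" "d < 1"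
      "\<And>\<xi> \<zeta>. norm \<xi> \<le> d \<Longrightarrow> norm \<zeta> \<le> d \<Longrightarrow> (x1 + \<xi>, y1 + \<zeta>) \<in> S"
    proof -
      define U where "U = {p :: 'a \<times> 'a. fst p \<noteq> snd p}"
      have "U = - {p. fst p = snd p}" by (auto simp: U_def)
      moreover have "closed {p :: 'a \<times> 'a. fst p = snd p}" by (intro closed_Collect_eq continuous_intros)
      ultimately have U: "open U" by (simp add: open_Compl)
      have "continuous_on U (\<lambda>p. pair_barrier \<alpha> K mc rc e0 (fst p) (snd p))"
        by (intro continuous_on_pair_barrier continuous_intros) (auto simp: U_def)
      then have "open (U \<inter> (\<lambda>p. pair_barrier \<alpha> K mc rc e0 (fst p) (snd p)) -` {E0<..})"
        using U by (intro continuous_open_preimage) auto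
      moreover have "(x1, y1) \<in> U \<inter> (\<lambda>p. pair_barrier \<alpha> K mc rc e0 (fst p) (snd p)) -` {E0<..}"
        using strict xy1 by (auto simp: U_def)
      ultimately obtain \<delta> where \<delta>: "\<delta> > 0" "ball (x1, y1) \<delta> \<subseteq> U \<inter> (\<lambda>p. pair_barrier \<alpha> K mc rc e0 (fst p) (snd p)) -` {E0<..}"
        using openE by blast
      show thesis
      proof (rule that[of "min (\<delta> / 3) (1/2)"])
        fix \<xi> \<zeta> :: 'a assume *: "norm \<xi> \<le> min (\<delta> / 3) (1/2)" "norm \<zeta> \<le> min (\<delta> / 3) (1/2)"
        have "dist (x1, y1) (x1 + \<xi>, y1 + \<zeta>) \<le> norm \<xi> + norm \<zeta>"
          by (simp add: dist_norm norm_Pair sqrt_sum_squares_le_sum)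
        then have "(x1 + \<xi>, y1 + \<zeta>) \<in> ball (x1, y1) \<delta>" using * \<delta> by auto
        then have "(x1 + \<xi>, y1 + \<zeta>) \<in> U \<inter> (\<lambda>p. pair_barrier \<alpha> K mc rc e0 (fst p) (snd p)) -` {E0<..}" using \<delta> by blast
        then show "(x1 + \<xi>, y1 + \<zeta>) \<in> S" unfolding S_iff by (auto simp: U_def)
      qed (use \<delta> in auto)
    qed
    have cb: "cball x1 d \<subseteq> ball 0 (B + 1)" "cball y1 d \<subseteq> ball 0 (B + 1)"
    proof -
      have *: "cball z d \<subseteq> ball 0 (B + 1)" if "norm z \<le> B" for z :: 'a
      proof
        fix u assume "u \<in> cball z d"
        then have "norm u \<le> norm z + d" using norm_triangle_ineq2[of u z] by (simp add: dist_norm norm_minus_commute)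
        then show "u \<in> ball 0 (B + 1)" using that d by simp
      qed
      from *[OF B1(1)] *[OF B1(2)] show "cball x1 d \<subseteq> ball 0 (B + 1)" "cball y1 d \<subseteq> ball 0 (B + 1)" .
    qed
    define r where "r = norm (x1 - y1)"
    define w where "w = ln r - ln rc"
    define E where "E = exp (- \<alpha> * scale_dist mc rc x1 y1)"
    define v where "v = coupled_grad mc rc x1 y1"
    define e where "e = sgn (x1 - y1)"
    define k where "k = (1/2) *\<^sub>R (x1 + y1) - mc"
    have touch: "b * \<alpha> * E * (\<alpha> / 2 * (norm v)\<^sup>2) \<le> b * \<alpha> * E * (real DIM('a) - 1 + 4 * (1 - w) / r\<^sup>2 + 8 * w / (r * (r + a)))
     + (b * \<alpha> * E)\<^sup>2 / 4 * (norm v)\<^sup>2 + (norm ((b * \<alpha> * E * (e \<bullet> k)) *\<^sub>R e + (b * K) *\<^sub>R grad_mirror_defect e0 x1 y1))\<^sup>2"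
      unfolding r_def w_def E_def v_def e_def k_def
    proof (rule touching_pair_weight[where f=f and g=g and x=x1 and y=y1 and L=L, OF xy1(1) a d(1) J _ _ pos1])
      show "continuous_on (cball x1 d) f" "continuous_on (cball y1 d) g"
        using contf cb continuous_on_subset by blast+
      show "submean_at f x1" "submean_at g y1" using sub x1B y1B pos1 by blast+
      show "\<bar>g (y1 + \<zeta>) - g y1\<bar> \<le> L * norm \<zeta>" if "norm \<zeta> \<le> d" for \<zeta>
      proof -
        have "y1 + \<zeta> \<in> ball 0 (B + 1)" using that by (intro subsetD[OF cb(2)]) (simp add: dist_norm)
        from lipschitz_onD[OF lip(2) this y1B] show ?thesis by (simp add: dist_norm)
      qed
      show "f (x1 + \<xi>) * g (y1 + \<zeta>) \<le> J * pair_weight a b \<alpha> K mc rc e0 (x1 + \<xi>) (y1 + \<zeta>)" if "norm \<xi> \<le> d" "norm \<zeta> \<le> d" for \<xi> \<zeta>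
        using Jmax[OF d(3)[OF that]] by (simp add: \<Psi>_def)
      show "f x1 * g y1 = J * pair_weight a b \<alpha> K mc rc e0 x1 y1" using eq1 by (simp add: \<Psi>_def)
    qed
    \<comment> \<open>Here the vanishing of \<open>f\<close> on the hole enters: the maximum lies
      outside it, where \<open>coupled_grad\<close> is bounded away from 0.\<close>
    have x1c: "x1 \<notin> ball c \<rho>" using fc pos1 by force
    note reg = region[OF xy1, folded r_def e_def w_def]
    have r: "r1 \<le> r" "0 < r" using reg(4) r1 by auto
    have vlow: "vm \<le> (norm v)\<^sup>2" unfolding v_def by (rule reg(10)[OF x1c])
    have e: "norm e = 1" using xy1 by (simp add: e_def norm_sgn)
    have kXo: "norm k \<le> Xo" unfolding k_def by (rule reg(2))
    have wXo: "\<bar>w\<bar> \<le> Xo" using reg(3) by (simp add: w_def)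
    have vup: "norm v \<le> V"
    proof -
      have "norm v \<le> norm (2 *\<^sub>R perp e k) + norm ((4 * w / r) *\<^sub>R e)"
        unfolding v_def coupled_grad_def e_def[symmetric] k_def[symmetric] r_def[symmetric] w_def[symmetric] by (rule norm_triangle_ineq)
      also have "norm (2 *\<^sub>R perp e k) \<le> 2 * Xo" using norm_perp_le[OF e, of k] kXo by simp
      also have "norm ((4 * w / r) *\<^sub>R e) = 4 * \<bar>w\<bar> / r" using e r by simp
      also have "\<dots> \<le> 4 * Xo / r1" using wXo r r1 by (intro frac_le) auto
      finally show ?thesis by (simp add: V_def)
    qed
    have grad_mirror_defect: "norm (grad_mirror_defect e0 x1 y1) \<le> C2"
      unfolding C2_def
      by (rule norm_grad_mirror_defect_le[OF xy1(1) e0 reg(6)]) (use reg(7) r r1 in \<open>auto simp: e_def r_def\<close>)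
    have E: "E0 \<le> E" "E \<le> 1"
    proof -
      show "E0 \<le> E" unfolding E_def E0_def using reg(1) \<alpha> by simp
      show "E \<le> 1" unfolding E_def using \<alpha> by (simp add: scale_dist_def)
    qed
    have C1': "real DIM('a) - 1 + 4 * (1 - w) / r\<^sup>2 + 8 * w / (r * (r + a)) \<le> C1"
    proof -
      have "4 * (1 - w) / r\<^sup>2 \<le> 4 * (1 + Xo) / r1\<^sup>2"
        using wXo r r1 Xo by (intro frac_le power_mono) auto
      moreover have "8 * w / (r * (r + a)) \<le> 8 * Xo / r1\<^sup>2"
      proof -
        have "r1 * r1 \<le> r * (r + a)" using r r1 a by (intro mult_mono) auto
        then show ?thesis unfolding power2_eq_square using wXo Xo r1 by (intro frac_le) auto
      qed
      ultimately show ?thesis by (simp add: C1_def)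
    qed
    have low: "C1 + 1 \<le> \<alpha> / 2 * (norm v)\<^sup>2"
    proof -
      have "\<alpha> / 2 * vm \<le> \<alpha> / 2 * (norm v)\<^sup>2" using vlow \<alpha> by (intro mult_left_mono) auto
      moreover have "\<alpha> / 2 * vm = C1 + 1" using vm by (simp add: \<alpha>_def)
      ultimately show ?thesis by simp
    qed
    have cpos: "0 < b * \<alpha> * E" using b \<alpha> E E0 by simp
    have D: "norm ((b * \<alpha> * E * (e \<bullet> k)) *\<^sub>R e + (b * K) *\<^sub>R grad_mirror_defect e0 x1 y1) \<le> b * (\<alpha> * Xo + K * C2)"
    proof -
      have "\<bar>e \<bullet> k\<bar> \<le> Xo" using Cauchy_Schwarz_ineq2[of e k] e kXo by simp
      then have "E * \<bar>e \<bullet> k\<bar> \<le> 1 * Xo" using E E0 by (intro mult_mono) auto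
      then have "b * \<alpha> * (E * \<bar>e \<bullet> k\<bar>) \<le> b * \<alpha> * (1 * Xo)" using b \<alpha> by (intro mult_left_mono) auto
      moreover have "norm ((b * \<alpha> * E * (e \<bullet> k)) *\<^sub>R e) = b * \<alpha> * (E * \<bar>e \<bullet> k\<bar>)"
        using e b \<alpha> E E0 by (simp add: abs_mult)
      moreover have "norm ((b * K) *\<^sub>R grad_mirror_defect e0 x1 y1) \<le> b * K * C2"
        using grad_mirror_defect b K by (simp add: abs_mult mult.assoc)
      ultimately show ?thesis
        using norm_triangle_ineq[of "(b * \<alpha> * E * (e \<bullet> k)) *\<^sub>R e" "(b * K) *\<^sub>R grad_mirror_defect e0 x1 y1"] by (simp add: algebra_simps)
    qed
    have D2: "(norm ((b * \<alpha> * E * (e \<bullet> k)) *\<^sub>R e + (b * K) *\<^sub>R grad_mirror_defect e0 x1 y1))\<^sup>2 \<le> b\<^sup>2 * (\<alpha> * Xo + K * C2)\<^sup>2"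
      using power_mono[OF D norm_ge_zero, of 2] by (simp only: power_mult_distrib)
    have D3: "(b * \<alpha> * E)\<^sup>2 / 4 * (norm v)\<^sup>2 \<le> b\<^sup>2 * (\<alpha>\<^sup>2 / 4 * V\<^sup>2)"
    proof -
      have "(norm v)\<^sup>2 \<le> V\<^sup>2" using vup by (intro power_mono) auto
      moreover have "(b * \<alpha> * E)\<^sup>2 \<le> (b * \<alpha> * 1)\<^sup>2" using E E0 b \<alpha> by (intro power_mono mult_left_mono) auto
      ultimately have "(b * \<alpha> * E)\<^sup>2 / 4 * (norm v)\<^sup>2 \<le> (b * \<alpha> * 1)\<^sup>2 / 4 * V\<^sup>2"
        by (intro mult_mono divide_right_mono) auto
      then show ?thesis by (simp add: power_mult_distrib)
    qed
    have "b * \<alpha> * E * (C1 + 1) \<le> b * \<alpha> * E * (\<alpha> / 2 * (norm v)\<^sup>2)" using low cpos by (intro mult_left_mono) auto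
    also note touch
    also have "b * \<alpha> * E * (real DIM('a) - 1 + 4 * (1 - w) / r\<^sup>2 + 8 * w / (r * (r + a))) \<le> b * \<alpha> * E * C1"
      using C1' cpos by (intro mult_left_mono) auto
    finally have "b * \<alpha> * E \<le> b\<^sup>2 * C3"
      using D2 D3 by (simp add: C3_def algebra_simps)
    then have "b * (\<alpha> * E) \<le> b * (b * C3)" by (simp add: power2_eq_square mult.assoc)
    then have "\<alpha> * E \<le> b * C3" using b by simp
    also have "b * C3 = \<alpha> * E0 / 2" using C3 by (simp add: b_def)
    finally have "E \<le> E0 / 2" using \<alpha> by simp
    then show False using E E0 by linarith
  qed
qed

section \<open>Barriers and Harnack chains\<close>

lemma taylor2_exp_barrier:
  fixes x z :: "'a::euclidean_space"
  shows "taylor2 (\<lambda>\<xi>. exp (- \<alpha> * (norm (x + \<xi> - z))\<^sup>2)) (exp (- \<alpha> * (norm (x - z))\<^sup>2))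
     ((- \<alpha> * exp (- \<alpha> * (norm (x - z))\<^sup>2)) *\<^sub>R (2 *\<^sub>R (x - z)))
     (\<lambda>\<xi>. - \<alpha> * exp (- \<alpha> * (norm (x - z))\<^sup>2) * (norm \<xi>)\<^sup>2
       + \<alpha>\<^sup>2 * exp (- \<alpha> * (norm (x - z))\<^sup>2) / 2 * ((2 *\<^sub>R (x - z)) \<bullet> \<xi>)\<^sup>2)"
proof -
  have t: "taylor2 (\<lambda>\<xi>. (norm (x - z))\<^sup>2 + (2 *\<^sub>R (x - z)) \<bullet> \<xi> + (norm \<xi>)\<^sup>2) ((norm (x - z))\<^sup>2) (2 *\<^sub>R (x - z)) (\<lambda>\<xi>. (norm \<xi>)\<^sup>2)"
    by (rule taylor2_quadratic[of _ 1]) auto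
  have eq: "(norm (x + \<xi> - z))\<^sup>2 = (norm (x - z))\<^sup>2 + (2 *\<^sub>R (x - z)) \<bullet> \<xi> + (norm \<xi>)\<^sup>2" for \<xi>
  proof -
    have "x + \<xi> - z = (x - z) + \<xi>" by simp
    then show ?thesis unfolding power2_norm_eq_inner by (simp only: inner_add_left inner_add_right) (simp add: inner_commute)
  qed
  show ?thesis unfolding eq
    by (rule taylor2_compose[OF t, of UNIV "\<lambda>s. exp (- \<alpha> * s)" "\<lambda>s. - \<alpha> * exp (- \<alpha> * s)"])
       (auto intro!: derivative_eq_intros simp: power2_eq_square)
qed

text \<open>By the second moments of the kernel the average exceeds the value by
  \<open>t\<^sup>2\<close> times a positive multiple of
  \<open>2 * \<alpha> * (norm (x - z))\<^sup>2 - real DIM('a)\<close>, up to smaller terms.\<close>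

lemma exp_barrier_strict_submean:
  fixes x z :: "'a::euclidean_space"
  assumes "\<alpha> > 0" "2 * \<alpha> * (norm (x - z))\<^sup>2 > real DIM('a)"
  shows "\<exists>t0>0. \<forall>t. 0 < t \<and> t < t0 \<longrightarrow> exp (- \<alpha> * (norm (x - z))\<^sup>2) < avg (\<lambda>y. exp (- \<alpha> * (norm (y - z))\<^sup>2)) x t"
proof -
  define h where "h y = exp (- \<alpha> * (norm (y - z))\<^sup>2)" for y
  define q where "q \<xi> = - \<alpha> * h x * (norm \<xi>)\<^sup>2 + \<alpha>\<^sup>2 * h x / 2 * ((2 *\<^sub>R (x - z)) \<bullet> \<xi>)\<^sup>2" for \<xi>
  define p where "p = (- \<alpha> * h x) *\<^sub>R (2 *\<^sub>R (x - z))"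
  define I where "I = integral (cbox (- One) One) (\<lambda>\<zeta>. kern \<zeta> * q \<zeta>)"
  have hx: "h x > 0" by (simp add: h_def)
  have "I = integral (cbox (- One) One) (\<lambda>\<zeta>. kern \<zeta> * (0 * ((0::'a) \<bullet> \<zeta>)\<^sup>2 + (- \<alpha> * h x) * (norm \<zeta>)\<^sup>2
      + (\<alpha>\<^sup>2 * h x / 2) * ((2 *\<^sub>R (x - z)) \<bullet> \<zeta>)\<^sup>2 + 0 * ((0::'a) \<bullet> \<zeta>)\<^sup>2))"
    unfolding I_def q_def by simp
  also have "\<dots> = kern_moment TYPE('a) * (0 * (norm (0::'a))\<^sup>2 + (- \<alpha> * h x) * real DIM('a) + (\<alpha>\<^sup>2 * h x / 2) * (norm (2 *\<^sub>R (x - z)))\<^sup>2 + 0 * (norm (0::'a))\<^sup>2)"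
    by (rule integral_kern_quadratic)
  also have "\<dots> = kern_moment TYPE('a) * (\<alpha> * h x * (2 * \<alpha> * (norm (x - z))\<^sup>2 - real DIM('a)))"
    unfolding norm_scaleR by (simp add: power_mult_distrib) (simp add: algebra_simps power2_eq_square)
  also have "\<dots> > 0" using kern_moment_pos[where 'a='a] hx assms by simp
  finally have I: "I > 0" .
  obtain \<delta> where \<delta>: "\<delta> > 0" "\<And>\<xi>. norm \<xi> \<le> \<delta> \<Longrightarrow> \<bar>h (x + \<xi>) - (h x + p \<bullet> \<xi> + q \<xi>)\<bar> \<le> (I / 2) * (norm \<xi>)\<^sup>2"
    using taylor2_exp_barrier[of \<alpha> x z] half_gt_zero[OF I] unfolding taylor2_def h_def[symmetric] p_def[symmetric] q_def[symmetric] by blast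
  have "h x < avg h x t" if t: "0 < t" "t < \<delta>" for t
  proof -
    have "avg h x t \<ge> h x + t\<^sup>2 * integral (cbox (- One) One) (\<lambda>z. kern z * q z) - (I / 2) * t\<^sup>2"
    proof (rule avg_ge_expansion[where r="t * real DIM('a)" and p=p])
      show "continuous_on (cball x (t * real DIM('a))) h" unfolding h_def by (intro continuous_intros)
      show "continuous_on UNIV q" unfolding q_def by (intro continuous_intros)
      show "q (t *\<^sub>R z) = t\<^sup>2 * q z" for z unfolding q_def inner_scaleR_right[of _ t] norm_scaleR power_mult_distrib by (simp only: power2_abs) (simp add: algebra_simps)
      fix \<zeta> :: 'a assume "norm \<zeta> \<le> t"
      then have "(I / 2) * (norm \<zeta>)\<^sup>2 \<le> (I / 2) * t\<^sup>2" using I by (intro mult_left_mono power_mono) auto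
      moreover have "\<bar>h (x + \<zeta>) - (h x + p \<bullet> \<zeta> + q \<zeta>)\<bar> \<le> (I / 2) * (norm \<zeta>)\<^sup>2"
        using \<open>norm \<zeta> \<le> t\<close> t by (intro \<delta>(2)) auto
      ultimately show "h x + p \<bullet> \<zeta> + q \<zeta> - I / 2 * t\<^sup>2 \<le> h (x + \<zeta>)" unfolding abs_le_iff by linarith
    qed (use t in auto)
    moreover have "t\<^sup>2 * I - (I / 2) * t\<^sup>2 > 0" using I t by simp
    ultimately show ?thesis unfolding I_def by linarith
  qed
  then show ?thesis using \<delta>(1) unfolding h_def by blast
qed

lemma avg_mono:
  fixes F G :: "'a::euclidean_space \<Rightarrow> real"
  assumes "continuous_on (cball x (t * real DIM('a))) F" "continuous_on (cball x (t * real DIM('a))) G"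
    "0 < t" "\<And>y. y \<in> cball x (t * real DIM('a)) \<Longrightarrow> F y \<le> G y"
  shows "avg F x t \<le> avg G x t"
  unfolding avg_def
proof (rule integral_le)
  show "(\<lambda>z. kern z * F (x + t *\<^sub>R z)) integrable_on cbox (- One) One"
    using assms by (intro integrable_avg) auto
  show "(\<lambda>z. kern z * G (x + t *\<^sub>R z)) integrable_on cbox (- One) One"
    using assms by (intro integrable_avg) auto
  show "kern z * F (x + t *\<^sub>R z) \<le> kern z * G (x + t *\<^sub>R z)" if "z \<in> cbox (- One) One" for z
    using assms(3) that by (intro mult_left_mono assms(4) avg_add_mem kern_nonneg) auto
qed

lemma avg_const: "avg (\<lambda>_. M) x t = M"
  by (simp add: avg_def integral_kern)

lemma avg_le_const:
  fixes F :: "'a::euclidean_space \<Rightarrow> real"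
  assumes "continuous_on (cball x (t * real DIM('a))) F" "0 < t" "\<And>y. y \<in> cball x (t * real DIM('a)) \<Longrightarrow> F y \<le> M"
  shows "avg F x t \<le> M"
  using avg_mono[OF assms(1) continuous_on_const assms(2,3)] by (simp add: avg_const)

lemma avg_add:
  fixes F G :: "'a::euclidean_space \<Rightarrow> real"
  assumes "continuous_on (cball x (t * real DIM('a))) F" "continuous_on (cball x (t * real DIM('a))) G" "0 < t"
  shows "avg (\<lambda>y. F y + c * G y) x t = avg F x t + c * avg G x t"
proof -
  have "avg (\<lambda>y. F y + c * G y) x t = integral (cbox (- One) One) (\<lambda>z. kern z * F (x + t *\<^sub>R z) + c * (kern z * G (x + t *\<^sub>R z)))"
    unfolding avg_def by (simp add: algebra_simps)
  also have "\<dots> = avg F x t + c * avg G x t"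
    unfolding avg_def using integrable_avg[OF assms(1)] integrable_avg[OF assms(2)] assms(3)
    by (subst Henstock_Kurzweil_Integration.integral_add) (auto intro!: integrable_on_mult_right)
  finally show ?thesis .
qed

text \<open>A submean function plus a strictly submean one has no interior maximum. The condition
  \<open>far\<close> keeps \<open>U\<close> where the Gaussian is strict.\<close>

lemma barrier_principle:
  fixes f :: "'a::euclidean_space \<Rightarrow> real"
  assumes "open U" "bounded U" and f: "continuous_on (closure U) f"
    and sub: "\<And>x. x \<in> U \<Longrightarrow> submean_at f x"
    and "\<alpha> > 0" "b > 0" and far: "\<And>x. x \<in> U \<Longrightarrow> 2 * \<alpha> * (norm (x - z))\<^sup>2 > real DIM('a)"
    and bdry: "\<And>x. x \<in> frontier U \<Longrightarrow> f x + b * exp (- \<alpha> * (norm (x - z))\<^sup>2) \<le> M"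
    and "x \<in> U"
  shows "f x + b * exp (- \<alpha> * (norm (x - z))\<^sup>2) \<le> M"
proof -
  define h where "h y = exp (- \<alpha> * (norm (y - z))\<^sup>2)" for y
  have conth: "continuous_on S h" for S unfolding h_def by (intro continuous_intros)
  have "compact (closure U)" using assms(2) by (simp add: compact_closure)
  moreover have "closure U \<noteq> {}" using \<open>x \<in> U\<close> by auto
  moreover have "continuous_on (closure U) (\<lambda>y. f y + b * h y)" by (intro continuous_intros f conth)
  ultimately obtain p where p: "p \<in> closure U" "\<And>y. y \<in> closure U \<Longrightarrow> f y + b * h y \<le> f p + b * h p"
    using continuous_attains_sup[of "closure U" "\<lambda>y. f y + b * h y"] by auto
  have "p \<notin> U"
  proof
    assume "p \<in> U"
    obtain \<delta> where \<delta>: "\<delta> > 0" "ball p \<delta> \<subseteq> U" using \<open>open U\<close> \<open>p \<in> U\<close> openE by blast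
    obtain t1 where t1: "t1 > 0" "\<And>t. 0 < t \<Longrightarrow> t < t1 \<Longrightarrow> f p \<le> avg f p t"
      using sub[OF \<open>p \<in> U\<close>] unfolding submean_at_def by blast
    obtain t2 where t2: "t2 > 0" "\<And>t. 0 < t \<Longrightarrow> t < t2 \<Longrightarrow> h p < avg h p t"
      using exp_barrier_strict_submean[OF \<open>\<alpha> > 0\<close> far[OF \<open>p \<in> U\<close>]] unfolding h_def by blast
    define t where "t = min (min t1 t2) (\<delta> / real DIM('a)) / 2"
    have t: "0 < t" "t < t1" "t < t2" using t1 t2 \<delta> by (auto simp: t_def min_def)
    have "t \<le> \<delta> / real DIM('a) / 2" unfolding t_def by (intro divide_right_mono) auto
    then have "t * real DIM('a) < \<delta>" using \<delta> by (simp add: field_simps)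
    then have cb: "cball p (t * real DIM('a)) \<subseteq> U" using \<delta>(2) by (auto simp: subset_eq)
    then have cbc: "cball p (t * real DIM('a)) \<subseteq> closure U" using closure_subset by blast
    have contf: "continuous_on (cball p (t * real DIM('a))) f" using f cbc continuous_on_subset by blast
    have "f p + b * h p < avg f p t + b * avg h p t"
      using t1(2)[OF t(1,2)] t2(2)[OF t(1,3)] \<open>b > 0\<close> by (intro add_le_less_mono) auto
    also have "\<dots> = avg (\<lambda>y. f y + b * h y) p t" by (rule avg_add[OF contf conth t(1), symmetric])
    also have "\<dots> \<le> f p + b * h p"
      by (rule avg_le_const) (use contf conth t p cbc in \<open>auto intro!: continuous_intros\<close>)
    finally show False by simp
  qed
  then have "p \<in> frontier U" using p(1) \<open>open U\<close> by (simp add: frontier_def interior_open)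
  then have "f p + b * h p \<le> M" using bdry by (simp add: h_def)
  moreover have "f x + b * h x \<le> f p + b * h p" using \<open>x \<in> U\<close> closure_subset by (intro p) blast
  ultimately show ?thesis by (simp add: h_def)
qed

section \<open>The mean value property and the Harnack inequality\<close>

lemma kern_bounds:
  obtains k0 k1 where "k0 > 0" "k1 > 0" "\<And>z::'a::euclidean_space. norm z \<le> 1/2 \<Longrightarrow> k0 \<le> kern z" "\<And>z::'a. kern z \<le> k1"
proof -
  have c: "continuous_on S (kern :: 'a \<Rightarrow> real)" for S
    using continuous_on_kern[OF continuous_on_id[of S]] by simp
  have ne: "cball (0::'a) (1/2) \<noteq> {}" "cball (0::'a) 1 \<noteq> {}" by simp_all
  from continuous_attains_inf[OF compact_cball ne(1) c] obtain p :: 'a where p: "p \<in> cball 0 (1/2)" "\<forall>z\<in>cball (0::'a) (1/2). kern p \<le> kern z" ..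
  from continuous_attains_sup[OF compact_cball ne(2) c] obtain p' :: 'a where p': "\<forall>z\<in>cball (0::'a) 1. kern z \<le> kern p'" by blast
  have "kern p > 0" using p(1) by (intro kern_pos) simp
  moreover have le: "kern z \<le> kern p'" for z :: 'a
  proof (cases "norm z \<le> 1")
    case False
    then show ?thesis using kern_eq_0[of z] kern_nonneg[of p'] by simp
  qed (use p' in simp)
  moreover have "0 < kern (0::'a)" by (rule kern_pos) simp
  then have "0 < kern p'" using le[of 0] by linarith
  ultimately show thesis using that[of "kern p" "kern p'"] p by auto
qed

text \<open>The form in which harmonicity is used from here on; it passes to linear combinations
  without any derivative. The factor \<open>DIM('a)\<close> is there because \<open>avg\<close>
  integrates over a cube, which the ball of that radius contains.\<close>

definition mean_value_on :: "('a::euclidean_space \<Rightarrow> real) \<Rightarrow> 'a set \<Rightarrow> bool" where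
  "mean_value_on u U \<longleftrightarrow> continuous_on U u \<and> (\<forall>x t. 0 < t \<and> cball x (t * real DIM('a)) \<subseteq> U \<longrightarrow> avg u x t = u x)"

lemma mean_value_on_harmonic:
  assumes "open U" "harmonic_on u U"
  shows "mean_value_on u U"
proof -
  have "continuous_on U u"
    using assms(2) unfolding harmonic_on_def numeral_2_eq_2 Ck_on.simps
    by (intro differentiable_imp_continuous_on) auto
  then show ?thesis using avg_harmonic[OF assms] by (simp add: mean_value_on_def)
qed

lemma mean_value_on_subset: "mean_value_on u U \<Longrightarrow> V \<subseteq> U \<Longrightarrow> mean_value_on u V"
  unfolding mean_value_on_def using continuous_on_subset by (metis order_trans)

lemma mean_value_on_const: "mean_value_on (\<lambda>_. d) U"
  by (simp add: mean_value_on_def avg_const)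

lemma mean_value_on_add_mult:
  assumes "mean_value_on u U" "mean_value_on v U"
  shows "mean_value_on (\<lambda>y. u y + c * v y) U"
  unfolding mean_value_on_def
proof (intro conjI allI impI)
  show "continuous_on U (\<lambda>y. u y + c * v y)" using assms by (intro continuous_intros) (auto simp: mean_value_on_def)
  fix x t assume t: "0 < t \<and> cball x (t * real DIM('a)) \<subseteq> U"
  then show "avg (\<lambda>y. u y + c * v y) x t = u x + c * v x"
    using assms unfolding mean_value_on_def by (subst avg_add) (auto intro: continuous_on_subset)
qed

text \<open>Touching from below by a function with the mean value property. It applies to solutions
  themselves and to their positive and negative parts.\<close>

lemma submean_at_mean_value:
  fixes w f :: "'a::euclidean_space \<Rightarrow> real"
  assumes "open U" "x \<in> U" "mean_value_on w U" "continuous_on U f" "\<And>y. y \<in> U \<Longrightarrow> w y \<le> f y" "f x = w x"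
  shows "submean_at f x"
proof -
  obtain \<delta> where \<delta>: "\<delta> > 0" "ball x \<delta> \<subseteq> U" using assms(1,2) openE by blast
  have "f x \<le> avg f x t" if t: "0 < t" "t < \<delta> / real DIM('a)" for t
  proof -
    have "t * real DIM('a) < \<delta>" using t by (simp add: field_simps)
    then have cb: "cball x (t * real DIM('a)) \<subseteq> U" using \<delta>(2) by (auto simp: subset_eq)
    have "f x = avg w x t" using assms(3,6) t cb by (simp add: mean_value_on_def)
    also have "\<dots> \<le> avg f x t"
      using assms(3,4,5) cb t unfolding mean_value_on_def by (intro avg_mono) (auto intro: continuous_on_subset)
    finally show ?thesis .
  qed
  moreover have "\<delta> / real DIM('a) > 0" using \<delta> by simp
  ultimately show ?thesis unfolding submean_at_def by blast
qed

text \<open>The average at \<open>q'\<close> of radius \<open>s / 4\<close> is compared with the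
  average at \<open>q\<close> of radius \<open>s\<close>: the ball of the first lies where the
  kernel of the second is at least \<open>k0\<close>. The change of variables costs
  \<open>4 ^ DIM('a)\<close>, the kernels \<open>k1 / k0\<close>.\<close>

lemma harnack_ball:
  obtains C h where "C \<ge> 1" "h > 0" "h \<le> 1/2"
    "\<And>(u :: 'a::euclidean_space \<Rightarrow> real) U q q' t. mean_value_on u U \<Longrightarrow> (\<And>x. x \<in> U \<Longrightarrow> 0 \<le> u x) \<Longrightarrow>
       t > 0 \<Longrightarrow> ball q t \<subseteq> U \<Longrightarrow> norm (q - q') \<le> h * t \<Longrightarrow> u q' \<le> C * u q"
proof -
  obtain k0 k1 where k: "k0 > 0" "k1 > 0" "\<And>z::'a. norm z \<le> 1/2 \<Longrightarrow> k0 \<le> kern z" "\<And>z::'a. kern z \<le> k1"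
    using kern_bounds by blast
  define C where "C = max 1 (4 ^ DIM('a) * (k1 / k0))"
  define h where "h = 1 / (8 * real DIM('a))"
  have D: "1 \<le> real DIM('a)" by (metis DIM_positive Suc_leI of_nat_1 of_nat_le_iff One_nat_def)
  show thesis
  proof (rule that[of C h])
    show "C \<ge> 1" by (simp add: C_def)
    show "h > 0" unfolding h_def by simp
    have "2 \<le> 8 * real DIM('a)" using D by linarith
    then have "1 / (8 * real DIM('a)) \<le> 1 / 2" by (rule divide_left_mono) auto
    then show "h \<le> 1/2" unfolding h_def .
    fix u :: "'a \<Rightarrow> real" and U q q' t
    assume u: "mean_value_on u U" and pos: "\<And>x. x \<in> U \<Longrightarrow> 0 \<le> u x" and t: "t > 0"
      and sub: "ball q t \<subseteq> U" and qq: "norm (q - q') \<le> h * t"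
    have cont: "continuous_on U u" using u by (simp add: mean_value_on_def)
    define s where "s = t / (2 * real DIM('a))"
    have s: "s > 0" "s * real DIM('a) = t / 2" "h * t = s / 4" using t D by (auto simp: s_def h_def)
    have sD: "s \<le> s * real DIM('a)" using s D by (simp add: mult_le_cancel_left1)
    have sub1: "cball q (s * real DIM('a)) \<subseteq> U" unfolding s(2) using sub t by (auto simp: subset_eq)
    have sub2: "cball q' (s / 4 * real DIM('a)) \<subseteq> U"
    proof
      fix x assume "x \<in> cball q' (s / 4 * real DIM('a))"
      then have "norm (x - q') \<le> t / 8" using s(2) by (simp add: dist_norm norm_minus_commute)
      moreover have "norm (x - q) \<le> norm (x - q') + norm (q' - q)" using norm_triangle_ineq[of "x - q'" "q' - q"] by simp
      moreover have "norm (q' - q) \<le> t / 8" using qq s sD unfolding norm_minus_commute[of q' q] by linarith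
      ultimately have "norm (x - q) < t" using t by linarith
      then show "x \<in> U" using sub by (auto simp: subset_eq dist_norm norm_minus_commute)
    qed
    let ?W = "cbox (- One) (One::'a)"
    define F where "F z = kern z * u (q' + (s / 4) *\<^sub>R z)" for z
    have uq: "u q = integral ?W (\<lambda>z. kern z * u (q + s *\<^sub>R z))"
      using u s(1) sub1 unfolding mean_value_on_def avg_def by simp
    have uq': "u q' = integral ?W F"
      using u s(1) sub2 unfolding mean_value_on_def avg_def F_def by simp
    have intF: "F integrable_on ?W"
      unfolding F_def using s by (intro integrable_avg continuous_on_subset[OF cont sub2]) auto
    define v where "v = (1 / s) *\<^sub>R (q' - q)"
    have v: "norm v \<le> 1/4"
      unfolding v_def norm_scaleR norm_minus_commute[of q' q] using qq s by (simp add: field_simps)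
    \<comment> \<open>The integrand at \<open>q'\<close> in the coordinates of the average at
      \<open>q\<close>; the point \<open>z\<close> there corresponds to
      \<open>4 *\<^sub>R (z - v)\<close> here.\<close>
    define G where "G z = F (4 *\<^sub>R z + (- 4) *\<^sub>R v)" for z
    have "(G has_integral (integral ?W F /\<^sub>R 4 ^ DIM('a))) (cbox ((- One - (- 4) *\<^sub>R v) /\<^sub>R 4) ((One - (- 4) *\<^sub>R v) /\<^sub>R 4))"
      unfolding G_def by (rule has_integral_affinity'[OF integrable_integral[OF intF]]) simp
    moreover have Gout: "G z = 0" if "norm (z - v) \<ge> 1/4" for z
    proof -
      have "norm (4 *\<^sub>R z + (- 4) *\<^sub>R v) = 4 * norm (z - v)"
        by (metis abs_numeral norm_scaleR scaleR_diff_right add_uminus_conv_diff scaleR_minus_left)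
      then show ?thesis using that kern_eq_0[of "4 *\<^sub>R z + (- 4) *\<^sub>R v"] by (simp add: G_def F_def)
    qed
    moreover have "cbox ((- One - (- 4) *\<^sub>R v) /\<^sub>R 4) ((One - (- 4) *\<^sub>R v) /\<^sub>R 4) = cbox (v - (1/4) *\<^sub>R One) (v + (1/4) *\<^sub>R One)"
    proof -
      have "(- One - (- 4) *\<^sub>R v) /\<^sub>R 4 = v - (1/4) *\<^sub>R One" "(One - (- 4) *\<^sub>R v) /\<^sub>R 4 = v + (1/4) *\<^sub>R One"
        by (simp_all add: scaleR_diff_right scaleR_add_right)
      then show ?thesis by simp
    qed
    ultimately have G1: "(G has_integral (integral ?W F /\<^sub>R 4 ^ DIM('a))) (cbox (v - (1/4) *\<^sub>R One) (v + (1/4) *\<^sub>R One))" by simp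
    have "(G has_integral (integral ?W F /\<^sub>R 4 ^ DIM('a))) UNIV"
    proof (rule has_integral_on_superset[OF G1])
      show "G z = 0" if "z \<notin> cbox (v - (1/4) *\<^sub>R One) (v + (1/4) *\<^sub>R One)" for z
        using that cball_subset_cube[of v "1/4"] by (intro Gout) (force simp: dist_norm norm_minus_commute)
    qed simp
    then have "integral UNIV G = integral ?W F / 4 ^ DIM('a)" by (simp add: integral_unique divide_inverse_commute)
    moreover have "integral ?W G = integral UNIV G"
    proof (rule integral_eq_integral_UNIV)
      fix z assume z: "z \<notin> ?W"
      then have "norm z > 1" using unit_ball_cube[of z] by force
      then have "norm (z - v) \<ge> 1/4" using norm_triangle_ineq2[of z v] v by linarith
      then show "G z = 0" by (rule Gout)
    qed
    ultimately have uG: "u q' = 4 ^ DIM('a) * integral ?W G" using uq' by simp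
    have Gle: "G z \<le> (k1 / k0) * (kern z * u (q + s *\<^sub>R z))" if "z \<in> ?W" for z
    proof (cases "norm (z - v) < 1/4")
      case True
      then have nz: "norm z \<le> 1/2" using norm_triangle_ineq[of "z - v" v] v by simp
      have eq: "q' + (s / 4) *\<^sub>R (4 *\<^sub>R z + (- 4) *\<^sub>R v) = q + s *\<^sub>R z"
        using s by (simp add: v_def algebra_simps)
      have uz: "0 \<le> u (q + s *\<^sub>R z)"
        using avg_add_mem[OF less_imp_le[OF s(1)] that, of q] sub1 by (intro pos) blast
      have "G z \<le> k1 * u (q + s *\<^sub>R z)" unfolding G_def F_def eq by (rule mult_right_mono[OF k(4) uz])
      also have "\<dots> = (k1 / k0) * (k0 * u (q + s *\<^sub>R z))" using k by simp
      also have "\<dots> \<le> (k1 / k0) * (kern z * u (q + s *\<^sub>R z))"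
        using k(3)[OF nz] k uz by (intro mult_left_mono mult_right_mono) auto
      finally show ?thesis .
    next
      case False
      have uz: "0 \<le> u (q + s *\<^sub>R z)"
        using avg_add_mem[OF less_imp_le[OF s(1)] that, of q] sub1 by (intro pos) blast
      have "G z = 0" using False by (intro Gout) simp
      then show ?thesis using k uz kern_nonneg[of z] by simp
    qed
    have intG: "G integrable_on ?W"
    proof -
      have "(\<lambda>z. if z \<in> ?W then G z else 0) = G"
      proof
        fix z show "(if z \<in> ?W then G z else 0) = G z"
        proof (cases "z \<in> ?W")
          case False
          then have "norm z > 1" using unit_ball_cube[of z] by force
          then have "norm (z - v) \<ge> 1/4" using norm_triangle_ineq2[of z v] v by linarith
          then show ?thesis using Gout by simp
        qed simp
      qed
      moreover have "G integrable_on UNIV"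
        using \<open>(G has_integral (integral ?W F /\<^sub>R 4 ^ DIM('a))) UNIV\<close> by blast
      ultimately show ?thesis using integrable_restrict_UNIV[of ?W G] by simp
    qed
    have int2: "(\<lambda>z. (k1 / k0) * (kern z * u (q + s *\<^sub>R z))) integrable_on ?W"
      using s by (intro integrable_on_mult_right integrable_avg continuous_on_subset[OF cont sub1]) auto
    have "integral ?W G \<le> integral ?W (\<lambda>z. (k1 / k0) * (kern z * u (q + s *\<^sub>R z)))"
      by (rule integral_le[OF intG int2 Gle])
    also have "\<dots> = (k1 / k0) * u q" unfolding uq by simp
    finally have "u q' \<le> 4 ^ DIM('a) * ((k1 / k0) * u q)" unfolding uG by (intro mult_left_mono) auto
    also have "\<dots> = (4 ^ DIM('a) * (k1 / k0)) * u q" by simp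
    also have "\<dots> \<le> C * u q"
      using pos[of q] sub t centre_in_ball[of q t] by (intro mult_right_mono) (auto simp: C_def subset_eq)
    finally show "u q' \<le> C * u q" .
  qed
qed

text \<open>On a connected set covered by \<open>N\<close> cells on each of which \<open>u\<close> varies at most by a factor, the
  interval of values of \<open>u\<close> is short: \<open>N + 1\<close> values in geometric progression would put two of them in
  one cell.\<close>

lemma harnack_chain:
  fixes B :: real
  shows "\<exists>C\<ge>1. \<forall>(u :: 'a::euclidean_space \<Rightarrow> real) U S p t x y. mean_value_on u U \<and> (\<forall>x\<in>U. 0 \<le> u x) \<and>
     t > 0 \<and> S \<subseteq> ball p (B * t) \<and> (\<forall>q\<in>S. ball q t \<subseteq> U) \<and> y \<in> connected_component_set S x \<longrightarrow> u x \<le> C * u y"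
proof -
  obtain C h where C: "C \<ge> 1" and h: "h > 0" "h \<le> 1/2"
    and harnack: "\<And>(u :: 'a \<Rightarrow> real) U q q' t. mean_value_on u U \<Longrightarrow> (\<And>x. x \<in> U \<Longrightarrow> 0 \<le> u x) \<Longrightarrow>
       t > 0 \<Longrightarrow> ball q t \<subseteq> U \<Longrightarrow> norm (q - q') \<le> h * t \<Longrightarrow> u q' \<le> C * u q"
    by (rule harnack_ball) blast
  have "\<exists>K. finite K \<and> K \<subseteq> cball 0 B \<and> cball (0::'a) B \<subseteq> (\<Union>k\<in>K. ball k (h / 2))"
    using h seq_compact_imp_totally_bounded[of "cball (0::'a) B"] compact_cball[of "0::'a" B]
    by (simp add: compact_eq_seq_compact_metric)
  then obtain K where K: "finite K" "cball (0::'a) B \<subseteq> (\<Union>k\<in>K. ball k (h / 2))" by blast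
  define N where "N = card K"
  show ?thesis
  \<comment> \<open>The values selected below differ by factors of at least \<open>2 * C\<close>,
    strictly more than the \<open>C\<close> allowed within one cell.\<close>
  proof (intro exI[of _ "(2 * C) ^ (N + 1)"] conjI allI impI)
    show "1 \<le> (2 * C) ^ (N + 1)" using C by (intro one_le_power) auto
    fix u :: "'a \<Rightarrow> real" and U S p t x y
    assume *: "mean_value_on u U \<and> (\<forall>x\<in>U. 0 \<le> u x) \<and> t > 0 \<and> S \<subseteq> ball p (B * t) \<and> (\<forall>q\<in>S. ball q t \<subseteq> U) \<and>
      y \<in> connected_component_set S x"
    then have u: "mean_value_on u U" "\<And>x. x \<in> U \<Longrightarrow> 0 \<le> u x" and t: "t > 0" and SB: "S \<subseteq> ball p (B * t)"
      and SU: "\<And>q. q \<in> S \<Longrightarrow> ball q t \<subseteq> U" and y: "connected_component S x y" by auto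
    obtain T where T: "connected T" "T \<subseteq> S" "x \<in> T" "y \<in> T" using y unfolding connected_component_def by blast
    have TU: "T \<subseteq> U" using T(2) SU t by fastforce
    show "u x \<le> (2 * C) ^ (N + 1) * u y"
    proof (rule ccontr)
      assume big: "\<not> u x \<le> (2 * C) ^ (N + 1) * u y"
      have uy: "0 \<le> u y" using T(4) TU u(2) by blast
      have C2: "(2 * C) ^ j > 0" for j using C by simp
      have ux: "u x > 0" using big uy mult_nonneg_nonneg[OF less_imp_le[OF C2[of "N + 1"]] uy] by linarith
      have "\<exists>q\<in>T. u q = u x / (2 * C) ^ j" if "j \<le> N" for j
      proof -
        have "(2 * C) ^ j \<le> (2 * C) ^ (N + 1)" using that C by (intro power_increasing) auto
        then have "u y * (2 * C) ^ j \<le> u x"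
          using mult_left_mono[OF _ uy] big by (smt (verit) mult.commute)
        then have le1: "u y \<le> u x / (2 * C) ^ j" using C2[of j] by (simp add: field_simps)
        have le2: "u x / (2 * C) ^ j \<le> u x" using ux one_le_power[of "2 * C" j] C C2[of j] by (simp add: field_simps)
        have "continuous_on T u" using u(1) TU continuous_on_subset unfolding mean_value_on_def by blast
        then have "connected (u ` T)" using T(1) by (rule connected_continuous_image)
        then have "u x / (2 * C) ^ j \<in> u ` T" using le1 le2 T(3,4) by (meson connected_contains_Icc atLeastAtMost_iff image_eqI subset_iff)
        then show ?thesis by (metis imageE)
      qed
      then obtain q where q: "\<And>j. j \<le> N \<Longrightarrow> q j \<in> T" "\<And>j. j \<le> N \<Longrightarrow> u (q j) = u x / (2 * C) ^ j" by metis
      have "\<exists>k\<in>K. dist k ((1 / t) *\<^sub>R (q j - p)) < h / 2" if "j \<le> N" for j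
      proof -
        have "q j \<in> ball p (B * t)" using q(1)[OF that] T(2) SB by blast
        then have "norm (q j - p) \<le> B * t" by (simp add: dist_norm norm_minus_commute)
        then have "norm ((1 / t) *\<^sub>R (q j - p)) \<le> B" using t unfolding norm_scaleR by (simp add: field_simps)
        then show ?thesis using K(2) by (auto simp: subset_eq)
      qed
      then obtain k where k: "\<And>j. j \<le> N \<Longrightarrow> k j \<in> K" "\<And>j. j \<le> N \<Longrightarrow> dist (k j) ((1 / t) *\<^sub>R (q j - p)) < h / 2" by metis
      have "\<not> inj_on k {..N}"
      proof
        assume "inj_on k {..N}"
        then have "card {..N} \<le> card K" using k(1) K(1) by (intro card_inj_on_le[of k]) auto
        then show False by (simp add: N_def)
      qed
      then obtain i j where ij: "i \<le> N" "j \<le> N" "i < j" "k i = k j"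
        unfolding inj_on_def by (metis atMost_iff linorder_neqE_nat)
      have "dist ((1 / t) *\<^sub>R (q j - p)) ((1 / t) *\<^sub>R (q i - p)) < h"
        using k(2)[OF ij(1)] k(2)[OF ij(2)] ij(4) dist_triangle_half_r[of "k i"] by auto
      moreover have "(1 / t) *\<^sub>R (q j - p) - (1 / t) *\<^sub>R (q i - p) = (1 / t) *\<^sub>R (q j - q i)" by (simp add: algebra_simps)
      ultimately have "norm ((1 / t) *\<^sub>R (q j - q i)) < h" by (simp add: dist_norm)
      then have "norm (q j - q i) \<le> h * t" using t unfolding norm_scaleR by (simp add: field_simps)
      moreover have "ball (q j) t \<subseteq> U" using q(1)[OF ij(2)] T(2) SU by blast
      ultimately have "u (q i) \<le> C * u (q j)" using harnack[OF u t] by blast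
      then have 1: "u x / (2 * C) ^ i \<le> C * (u x / (2 * C) ^ j)" using q(2) ij by simp
      have "(2 * C) ^ j = (2 * C) ^ i * (2 * C) ^ (j - i)" using ij by (metis power_add le_add_diff_inverse less_imp_le)
      moreover have "(2 * C) ^ (j - i) \<ge> (2 * C) ^ 1" using ij C by (intro power_increasing) auto
      then have "(2 * C) ^ i * (2 * C) ^ 1 \<le> (2 * C) ^ i * (2 * C) ^ (j - i)" using C2[of i] by (intro mult_left_mono) auto
      ultimately have "(2 * C) ^ i * (2 * C) \<le> (2 * C) ^ j" by simp
      then have "C * (u x / (2 * C) ^ j) \<le> C * (u x / ((2 * C) ^ i * (2 * C)))"
        using C C2[of i] C2[of j] ux by (intro mult_left_mono divide_left_mono mult_pos_pos) auto
      also have "C * (u x / ((2 * C) ^ i * (2 * C))) = u x / (2 * C) ^ i / 2" using C by (simp add: field_simps)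
      finally have "u x / (2 * C) ^ i \<le> u x / (2 * C) ^ i / 2" using 1 by (rule order_trans[rotated])
      moreover have "u x / (2 * C) ^ i > 0" using ux C2[of i] by (rule divide_pos_pos)
      moreover have "\<not> d \<le> d / 2" if "d > 0" for d :: real using that by simp
      ultimately show False by blast
    qed
  qed
qed

section \<open>Climbing and boundary decay\<close>

text \<open>Hypotheses (e), (f) and (g) of the theorem enter only through the exterior balls.\<close>

locale nice_domain =
  fixes L \<kappa> \<theta> :: real and \<Omega> :: "'a::euclidean_space set" and \<phi> :: "'a \<Rightarrow> real"
  assumes L_pos: "0 < L" and \<kappa>_pos: "0 < \<kappa>" and \<theta>_pos: "0 < \<theta>" and \<theta>_le: "\<theta> \<le> 1"
    and open_dom: "open \<Omega>" and dom_subset: "\<Omega> \<subseteq> ball 0 1" and zero_frontier: "0 \<in> frontier \<Omega>"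
    and pos: "\<And>x. x \<in> \<Omega> \<Longrightarrow> 0 < \<phi> x" and zero: "\<And>x. x \<in> ball 0 1 \<Longrightarrow> x \<notin> \<Omega> \<Longrightarrow> \<phi> x = 0"
    and lip: "L-lipschitz_on (ball 0 1) \<phi>"
    and dist_le: "\<And>x. x \<in> ball 0 (1/2) \<Longrightarrow> \<kappa> * infdist x (ball 0 1 - \<Omega>) \<le> \<phi> x"
    and submean: "\<And>x. x \<in> \<Omega> \<Longrightarrow> submean_at \<phi> x"
    and exterior_ball: "\<And>z r. z \<in> frontier \<Omega> \<Longrightarrow> norm z < 1/2 \<Longrightarrow> 0 < r \<Longrightarrow> r \<le> 1/4 \<Longrightarrow>
      \<exists>c. ball c (\<theta> * r) \<subseteq> ball z r - \<Omega>"
begin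

lemma lipD: "norm x < 1 \<Longrightarrow> norm y < 1 \<Longrightarrow> \<bar>\<phi> x - \<phi> y\<bar> \<le> L * norm (x - y)"
  using lipschitz_onD[OF lip, of x y] by (simp add: dist_norm)

lemma cont: "continuous_on (ball 0 1) \<phi>"
  using lip by (rule lipschitz_on_continuous_on)

lemma pos_iff: "norm x < 1 \<Longrightarrow> 0 < \<phi> x \<longleftrightarrow> x \<in> \<Omega>"
  using pos zero by force

lemma frontier_notin: "z \<in> frontier \<Omega> \<Longrightarrow> z \<notin> \<Omega>"
  using open_dom by (simp add: frontier_def interior_open)

lemma frontier_zero: "z \<in> frontier \<Omega> \<Longrightarrow> norm z < 1 \<Longrightarrow> \<phi> z = 0"
  using frontier_notin zero by auto

text \<open>As 0 is on the frontier, the nearest frontier point is within \<open>norm x\<close> of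
  \<open>x\<close> and thus inside the unit ball. The ball of this radius around \<open>x\<close>
  stays in \<open>\<Omega>\<close>, so the distance to \<open>ball 0 1 - \<Omega>\<close> is at
  least \<open>norm (x - z)\<close>, and \<open>\<phi> x\<close> is comparable to it.\<close>

lemma nearest_frontier:
  assumes "x \<in> \<Omega>" "norm x < 1/2"
  obtains z where "z \<in> frontier \<Omega>" "norm z \<le> 2 * norm x" "norm (x - z) \<le> norm x" "0 < norm (x - z)"
    "\<kappa> * norm (x - z) \<le> \<phi> x" "\<phi> x \<le> L * norm (x - z)"
proof -
  obtain z where z: "z \<in> frontier \<Omega>" "\<And>y. y \<in> frontier \<Omega> \<Longrightarrow> dist x z \<le> dist x y"
    using distance_attains_inf[OF frontier_closed, of \<Omega> x] zero_frontier by auto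
  have le: "norm (x - z) \<le> norm x" using z(2)[OF zero_frontier] by (simp add: dist_norm)
  moreover have "norm z \<le> norm (x - z) + norm x" by (metis add.commute norm_triangle_sub norm_minus_commute)
  ultimately have nz: "norm z \<le> 2 * norm x" by linarith
  have "x \<noteq> z" using frontier_notin[OF z(1)] assms by auto
  have "ball x (norm (x - z)) \<inter> frontier \<Omega> = {}" using z(2) by (auto simp: dist_norm) (metis dist_norm not_less)
  then have "ball x (norm (x - z)) \<subseteq> \<Omega>"
    using connected_Int_frontier[of "ball x (norm (x - z))" \<Omega>] assms(1) \<open>x \<noteq> z\<close>
    by (metis IntI Diff_eq_empty_iff centre_in_ball connected_ball empty_iff right_minus_eq zero_less_norm_iff)
  then have "norm (x - z) \<le> dist x y" if "y \<in> ball 0 1 - \<Omega>" for y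
    using that by (force simp: not_less subset_eq)
  moreover have "z \<in> ball 0 1 - \<Omega>" using frontier_notin[OF z(1)] nz assms by auto
  ultimately have "norm (x - z) \<le> infdist x (ball 0 1 - \<Omega>)" unfolding infdist_def by (auto intro!: cINF_greatest)
  then have "\<kappa> * norm (x - z) \<le> \<kappa> * infdist x (ball 0 1 - \<Omega>)" using \<kappa>_pos by simp
  also have "\<dots> \<le> \<phi> x" using assms by (intro dist_le) simp
  finally have "\<kappa> * norm (x - z) \<le> \<phi> x" .
  moreover have "\<phi> x \<le> L * norm (x - z)" using lipD[of x z] frontier_zero[OF z(1)] nz assms by simp
  ultimately show thesis using that[of z] z(1) nz le \<open>x \<noteq> z\<close> by simp
qed

lemma open_superlevel:
  assumes "open B" "B \<subseteq> ball 0 1"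
  shows "open {q \<in> B. \<tau> < \<phi> q}"
proof -
  have "continuous_on B \<phi>" using cont assms(2) continuous_on_subset by blast
  from continuous_open_preimage[OF this assms(1), of "{\<tau><..}"] show ?thesis
    by (simp add: vimage_def Int_def)
qed

end

lemma frontier_component_notin:
  fixes V :: "'a::euclidean_space set"
  assumes "open V" "y \<in> frontier (connected_component_set V x)"
  shows "y \<notin> V"
  using frontier_of_connected_component_subset[of V x] assms by (auto simp: frontier_def interior_open)

text \<open>Put \<open>s = \<phi> x\<close> and suppose that \<open>\<phi>\<close> stays below
  \<open>(1 + c) * s\<close> on the component of \<open>{\<phi> > s / 2}\<close> in a ball around a
  close frontier point \<open>z\<close>. A Gaussian at \<open>z\<close> of height
  \<open>s / 2\<close> lifts the value at \<open>x\<close> to \<open>s + s / 2 * e1\<close>, but the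
  sum is at most \<open>s\<close> on the level \<open>s / 2\<close> and at most
  \<open>(1 + c) * s + s / 2 * e4\<close> on the outer sphere.\<close>

lemma climb_step:
  fixes L \<kappa> :: real
  assumes "0 < L" "0 < \<kappa>"
  shows "\<exists>C c. 1 \<le> C \<and> 0 < c \<and> (\<forall>\<theta> \<Omega> (\<phi> :: 'a::euclidean_space \<Rightarrow> real) x. nice_domain L \<kappa> \<theta> \<Omega> \<phi> \<and> norm x \<le> 1/4 \<and> 0 < \<phi> x \<and> \<phi> x \<le> \<kappa> / 8 \<longrightarrow>
    (\<exists>y. y \<in> connected_component_set {q \<in> ball x (C * \<phi> x). \<phi> x / 2 < \<phi> q} x \<and> (1 + c) * \<phi> x \<le> \<phi> y))"
proof -
  \<comment> \<open>Where \<open>\<phi> > s / 2\<close> the distance to \<open>z\<close> exceeds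
    \<open>s / (2 * L)\<close>, and \<open>A / s\<^sup>2\<close> is the exponent for which the
    Gaussian is strict from there on. \<open>e1\<close> and \<open>e4\<close> belong to the
    distances \<open>s / \<kappa>\<close> and \<open>2 * s / \<kappa>\<close>.\<close>
  define A where "A = 2 * L\<^sup>2 * real DIM('a)"
  define e1 where "e1 = exp (- A * (1 / \<kappa>\<^sup>2))"
  define e4 where "e4 = exp (- A * (4 / \<kappa>\<^sup>2))"
  define C where "C = max 1 (3 / \<kappa>)"
  define c where "c = (e1 - e4) / 4"
  have A: "A > 0" using assms by (simp add: A_def)
  have "e4 < e1" unfolding e1_def e4_def using A assms by (simp add: field_simps)
  have e: "c > 0" "e4 > 0" "e1 > 0" using \<open>e4 < e1\<close> by (auto simp: c_def e1_def e4_def)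
  show ?thesis
  proof (rule exI[of _ C], rule exI[of _ c], intro conjI allI impI)
    show "1 \<le> C" "0 < c" using e by (auto simp: C_def)
    fix \<theta> \<Omega> and \<phi> :: "'a \<Rightarrow> real" and x
    assume *: "nice_domain L \<kappa> \<theta> \<Omega> \<phi> \<and> norm x \<le> 1/4 \<and> 0 < \<phi> x \<and> \<phi> x \<le> \<kappa> / 8"
    then interpret nice_domain L \<kappa> \<theta> \<Omega> \<phi> by blast
    define s where "s = \<phi> x"
    have s: "0 < s" "s \<le> \<kappa> / 8" and x: "norm x \<le> 1/4" using * by (auto simp: s_def)
    have x\<Omega>: "x \<in> \<Omega>" using pos_iff[of x] x s by (simp add: s_def)
    obtain z where z: "z \<in> frontier \<Omega>" "norm z \<le> 2 * norm x" "norm (x - z) \<le> norm x"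
        "\<kappa> * norm (x - z) \<le> \<phi> x" "\<phi> x \<le> L * norm (x - z)"
      using nearest_frontier[of x] x x\<Omega> by auto
    define R where "R = 2 * s / \<kappa>"
    have R: "0 < R" "R \<le> 1/4" using s assms by (auto simp: R_def field_simps)
    have ball1: "norm q < 1" if "norm (q - z) \<le> R" for q
      using that R z(2) x norm_triangle_sub[of q z] by linarith
    define V where "V = {q \<in> ball z R. s / 2 < \<phi> q}"
    have oV: "open V" unfolding V_def using ball1 by (intro open_superlevel) (auto simp: dist_norm norm_minus_commute)
    define \<omega> where "\<omega> = connected_component_set V x"
    have xz: "norm (x - z) \<le> s / \<kappa>" using z(4) assms by (simp add: s_def field_simps)
    have xV: "x \<in> V" using xz s assms by (auto simp: V_def R_def s_def dist_norm norm_minus_commute field_simps)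
    then have x\<omega>: "x \<in> \<omega>" by (simp add: \<omega>_def)
    have \<omega>V: "\<omega> \<subseteq> V" unfolding \<omega>_def by (rule connected_component_subset)
    have cl: "closure \<omega> \<subseteq> cball z R"
      using \<omega>V by (intro closure_minimal) (auto simp: V_def)
    have bd: "bounded \<omega>" using cl bounded_cball bounded_subset closure_subset by (metis order_trans)
    have o\<omega>: "open \<omega>" unfolding \<omega>_def by (rule open_connected_component[OF oV])
    define \<alpha> where "\<alpha> = A / s\<^sup>2"
    have \<alpha>: "\<alpha> > 0" using A s by (simp add: \<alpha>_def)
    have "\<exists>y\<in>\<omega>. (1 + c) * s \<le> \<phi> y"
    proof (rule ccontr)
      assume neg: "\<not> ?thesis"
      define M where "M = max s ((1 + c) * s + s / 2 * e4)"
      have "\<phi> x + s / 2 * exp (- \<alpha> * (norm (x - z))\<^sup>2) \<le> M"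
      proof (rule barrier_principle[OF o\<omega> bd])
        show contcl: "continuous_on (closure \<omega>) \<phi>"
          using cont cl ball1 by (rule_tac continuous_on_subset[OF cont]) (auto simp: subset_eq dist_norm norm_minus_commute)
        show "submean_at \<phi> y" if "y \<in> \<omega>" for y
          using that \<omega>V s ball1[of y] pos_iff[of y] by (intro submean) (force simp: V_def dist_norm norm_minus_commute)
        show "\<alpha> > 0" "s / 2 > 0" using \<alpha> s by auto
        show "real DIM('a) < 2 * \<alpha> * (norm (y - z))\<^sup>2" if y: "y \<in> \<omega>" for y
        proof -
          have yV: "norm (y - z) < R" "s / 2 < \<phi> y" using y \<omega>V by (auto simp: V_def dist_norm norm_minus_commute)
          have "\<phi> y \<le> L * norm (y - z)"
            using lipD[of y z] frontier_zero[OF z(1)] ball1[of y] ball1[of z] yV R by simp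
          then have "s / (2 * L) < norm (y - z)" using yV assms by (simp add: field_simps)
          then have "(s / (2 * L))\<^sup>2 < (norm (y - z))\<^sup>2" using s assms by (intro power_strict_mono) auto
          moreover have "2 * \<alpha> * (s / (2 * L))\<^sup>2 = real DIM('a)"
            using s assms by (simp add: \<alpha>_def A_def power_divide power_mult_distrib field_simps)
          ultimately show ?thesis using \<alpha> by (smt (verit) mult_strict_left_mono mult_pos_pos)
        qed
        fix y assume y: "y \<in> frontier \<omega>"
        have yR: "norm (y - z) \<le> R" using y cl by (auto simp: frontier_def dist_norm norm_minus_commute)
        have yV: "y \<notin> V" using frontier_component_notin[OF oV] y by (simp add: \<omega>_def)
        have exple: "exp (- \<alpha> * (norm (y - z))\<^sup>2) \<le> 1" using \<alpha> by simp
        show "\<phi> y + s / 2 * exp (- \<alpha> * (norm (y - z))\<^sup>2) \<le> M"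
        proof (cases "norm (y - z) < R")
          case True
          then have "\<phi> y \<le> s / 2" using yV by (auto simp: V_def dist_norm norm_minus_commute)
          moreover have "s / 2 * exp (- \<alpha> * (norm (y - z))\<^sup>2) \<le> s / 2 * 1" using exple s by (intro mult_left_mono) auto
          ultimately show ?thesis unfolding M_def by linarith
        next
          case False
          then have yR: "norm (y - z) = R" using yR by simp
          have ex: "exp (- \<alpha> * (norm (y - z))\<^sup>2) = e4"
            unfolding yR \<alpha>_def R_def e4_def using s by (simp add: power_divide power_mult_distrib field_simps)
          moreover have "\<phi> y \<le> (1 + c) * s"
            using contcl
          proof (rule continuous_le_on_closure)
            show "y \<in> closure \<omega>" using y by (simp add: frontier_def)
            show "\<phi> q \<le> (1 + c) * s" if "q \<in> \<omega>" for q using that neg by force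
          qed
          ultimately show ?thesis unfolding M_def ex by linarith
        qed
      qed (rule x\<omega>)
      moreover have "e1 \<le> exp (- \<alpha> * (norm (x - z))\<^sup>2)"
      proof -
        have "(norm (x - z))\<^sup>2 \<le> (s / \<kappa>)\<^sup>2" using xz by (intro power_mono) auto
        then have "\<alpha> * (norm (x - z))\<^sup>2 \<le> \<alpha> * (s / \<kappa>)\<^sup>2" using \<alpha> by simp
        also have "\<dots> = A * (1 / \<kappa>\<^sup>2)" using s by (simp add: \<alpha>_def power_divide)
        finally show ?thesis unfolding e1_def by simp
      qed
      then have "s / 2 * e1 \<le> s / 2 * exp (- \<alpha> * (norm (x - z))\<^sup>2)" using s by (intro mult_left_mono) auto
      ultimately have "s + s / 2 * e1 \<le> M" unfolding s_def by linarith
      moreover have "s / 2 * e1 > 0" using s e by simp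
      moreover have "s + s / 2 * e1 > (1 + c) * s + s / 2 * e4"
      proof -
        have "s + s / 2 * e1 - ((1 + c) * s + s / 2 * e4) = s * c" by (simp add: c_def field_simps)
        then show ?thesis using mult_pos_pos[OF s(1) e(1)] by linarith
      qed
      ultimately show False unfolding M_def by linarith
    qed
    then obtain y where y: "y \<in> \<omega>" "(1 + c) * s \<le> \<phi> y" by blast
    have "V \<subseteq> {q \<in> ball x (C * \<phi> x). \<phi> x / 2 < \<phi> q}"
    proof
      fix q assume q: "q \<in> V"
      have "norm (x - q) \<le> norm (x - z) + norm (z - q)" using norm_triangle_ineq[of "x - z" "z - q"] by simp
      also have "\<dots> < s / \<kappa> + R" using q xz by (auto simp: V_def dist_norm)
      also have "\<dots> = 3 / \<kappa> * s" by (simp add: R_def field_simps)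
      also have "\<dots> \<le> C * s" using s by (intro mult_right_mono) (auto simp: C_def)
      finally show "q \<in> {q \<in> ball x (C * \<phi> x). \<phi> x / 2 < \<phi> q}" using q by (simp add: V_def s_def dist_norm)
    qed
    then have "\<omega> \<subseteq> connected_component_set {q \<in> ball x (C * \<phi> x). \<phi> x / 2 < \<phi> q} x"
      unfolding \<omega>_def by (rule connected_component_mono)
    then show "\<exists>y. y \<in> connected_component_set {q \<in> ball x (C * \<phi> x). \<phi> x / 2 < \<phi> q} x \<and> (1 + c) * \<phi> x \<le> \<phi> y"
      using y unfolding s_def by blast
  qed
qed

text \<open>Each step of the climb multiplies \<open>\<phi>\<close> by at least a fixed factor and changes \<open>u\<close> at most by a
  fixed factor, so that \<open>u\<close> is controlled by powers of \<open>\<phi>\<close>.\<close>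

lemma climb:
  fixes L \<kappa> :: real
  assumes "0 < L" "0 < \<kappa>"
  shows "\<exists>C (K::nat). 1 \<le> C \<and> (\<forall>\<theta> \<Omega> (\<phi> :: 'a::euclidean_space \<Rightarrow> real) x \<tau>.
    nice_domain L \<kappa> \<theta> \<Omega> \<phi> \<and> x \<in> \<Omega> \<and> \<phi> x \<le> \<tau> \<and> norm x + C * \<tau> \<le> 1/4 \<longrightarrow>
    (\<exists>y. norm (y - x) < C * \<tau> \<and> \<tau> \<le> \<phi> y \<and> \<phi> y \<le> C * \<tau> \<and> y \<in> \<Omega> \<and>
      (\<forall>u U. mean_value_on u U \<and> (\<forall>q\<in>U. 0 \<le> u q) \<and> ball x (C * \<tau>) \<inter> \<Omega> \<subseteq> U \<longrightarrow>
         u x * \<phi> x ^ K \<le> u y * \<phi> y ^ K \<and> u y * \<phi> x ^ K \<le> u x * \<phi> y ^ K)))"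
proof -
  obtain C0 c where C0: "1 \<le> C0" and c: "0 < c"
    and step: "\<And>\<theta> \<Omega> (\<phi> :: 'a \<Rightarrow> real) x. nice_domain L \<kappa> \<theta> \<Omega> \<phi> \<Longrightarrow> norm x \<le> 1/4 \<Longrightarrow> 0 < \<phi> x \<Longrightarrow> \<phi> x \<le> \<kappa> / 8 \<Longrightarrow>
      \<exists>y. y \<in> connected_component_set {q \<in> ball x (C0 * \<phi> x). \<phi> x / 2 < \<phi> q} x \<and> (1 + c) * \<phi> x \<le> \<phi> y"
    using climb_step[OF assms, where 'a='a] by fast
  obtain H where H: "1 \<le> H"
    and harnack: "\<And>(u :: 'a \<Rightarrow> real) U S p t x y. mean_value_on u U \<Longrightarrow> (\<And>x. x\<in>U \<Longrightarrow> 0 \<le> u x) \<Longrightarrow> t > 0 \<Longrightarrow>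
       S \<subseteq> ball p (2 * C0 * max L 1 * t) \<Longrightarrow> (\<And>q. q\<in>S \<Longrightarrow> ball q t \<subseteq> U) \<Longrightarrow> y \<in> connected_component_set S x \<Longrightarrow> u x \<le> H * u y"
    using harnack_chain[where 'a='a, of "2 * C0 * max L 1"] by metis
  \<comment> \<open>This power makes \<open>u * \<phi> ^ K\<close> nondecreasing and
    \<open>u / \<phi> ^ K\<close> nonincreasing along the climb.\<close>
  obtain K where K: "H \<le> (1 + c) ^ K" using real_arch_pow[of "1 + c" H] c by (auto intro: less_imp_le)
  \<comment> \<open>\<open>D\<close> is so large that the gain of \<open>\<phi>\<close> in one step,
    multiplied by \<open>D\<close>, pays for the length of the step and a margin
    \<open>\<phi> x\<close>. \<open>B\<close> bounds the overshoot of a single step.\<close>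
  define D where "D = (C0 + 1) / c + C0 + 1"
  define B where "B = 1 + L * C0"
  define C where "C = max (max B (8 / \<kappa>)) (2 * B * D)"
  have B: "B \<ge> 1" using assms C0 by (simp add: B_def)
  have D: "D \<ge> 1" "D > 0" "C0 + 1 \<le> D * c"
    using C0 c by (auto simp: D_def add_pos_pos field_simps intro!: add_nonneg_pos)
  have CC: "1 \<le> C" "B \<le> C" "8 / \<kappa> \<le> C" "2 * B * D \<le> C" using B by (auto simp: C_def)
  show ?thesis
  proof (intro exI[of _ C] exI[of _ K] conjI allI impI)
    show "1 \<le> C" by fact
    fix \<theta> \<Omega> and \<phi> :: "'a \<Rightarrow> real" and x \<tau>
    assume *: "nice_domain L \<kappa> \<theta> \<Omega> \<phi> \<and> x \<in> \<Omega> \<and> \<phi> x \<le> \<tau> \<and> norm x + C * \<tau> \<le> 1/4"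
    then interpret nice_domain L \<kappa> \<theta> \<Omega> \<phi> by blast
    have \<tau>: "0 < \<tau>" using * pos[of x] by linarith
    have \<tau>\<kappa>: "\<tau> \<le> \<kappa> / 8"
    proof -
      have "8 / \<kappa> * \<tau> \<le> C * \<tau>" using CC \<tau> by (intro mult_right_mono) auto
      also have "\<dots> \<le> 1" using * norm_ge_zero[of x] by linarith
      finally show ?thesis using assms by (simp add: field_simps)
    qed
    \<comment> \<open>Induction on the number of steps still needed.
      \<open>D * (2 * B * \<tau> - \<phi> x)\<close> is both the radius that the rest of the climb
      may use and the potential that decreases along it; \<open>\<phi> x \<le> B * \<tau>\<close>
      keeps it positive.\<close>
    have main: "\<exists>y. norm (y - x) < D * (2 * B * \<tau> - \<phi> x) \<and> \<tau> \<le> \<phi> y \<and> \<phi> y \<le> B * \<tau> \<and> y \<in> \<Omega> \<and>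
      (\<forall>u U. mean_value_on u U \<and> (\<forall>q\<in>U. 0 \<le> u q) \<and> ball x (D * (2 * B * \<tau> - \<phi> x)) \<inter> \<Omega> \<subseteq> U \<longrightarrow>
         u x * \<phi> x ^ K \<le> u y * \<phi> y ^ K \<and> u y * \<phi> x ^ K \<le> u x * \<phi> y ^ K)"
      if "\<tau> \<le> \<phi> x * (1 + c) ^ n" "x \<in> \<Omega>" "\<phi> x \<le> B * \<tau>" "norm x + D * (2 * B * \<tau> - \<phi> x) \<le> 1/4" for n x
      using that
    proof (induction n arbitrary: x)
      case 0
      have "0 < D * (2 * B * \<tau> - \<phi> x)" using 0 D B \<tau> by (intro mult_pos_pos) (auto simp: algebra_simps intro: le_less_trans)
      then show ?case using 0 by (intro exI[of _ x]) auto
    next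
      case (Suc n)
      have Dpos: "0 < D * (2 * B * \<tau> - \<phi> x)"
        using Suc.prems(3) D mult_pos_pos[of B \<tau>] B \<tau> by (intro mult_pos_pos) linarith+
      show ?case
      proof (cases "\<tau> \<le> \<phi> x")
        case True
        then show ?thesis using Suc.prems Dpos by (intro exI[of _ x]) auto
      next
        case False
        define s where "s = \<phi> x"
        have s: "0 < s" "s < \<tau>" using pos[OF Suc.prems(2)] False by (auto simp: s_def)
        have nx: "norm x \<le> 1/4" using Suc.prems(4) Dpos by linarith
        define S where "S = {q \<in> ball x (C0 * s). s / 2 < \<phi> q}"
        obtain y where y: "y \<in> connected_component_set S x" "(1 + c) * s \<le> \<phi> y"
          using step[of \<theta> \<Omega> \<phi> x] nice_domain_axioms nx s \<tau>\<kappa> unfolding s_def S_def by fastforce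
        have yS: "y \<in> S" using y(1) connected_component_subset by blast
        then have yx: "norm (y - x) < C0 * s" by (simp add: S_def dist_norm norm_minus_commute)
        have B\<tau>: "\<tau> \<le> B * \<tau>" using B \<tau> by simp
        have Ds: "D * s < D * (2 * B * \<tau> - s)" using s B\<tau> D by (intro mult_strict_left_mono) linarith+
        have C0D: "C0 + 1 \<le> D" using c C0 by (simp add: D_def)
        have C0s: "(C0 + 1) * s \<le> D * s" using C0D s by (intro mult_right_mono) auto
        have in1: "norm q < 1" if "norm (q - x) < (C0 + 1) * s" for q
          using that C0s Ds Suc.prems(4) norm_triangle_sub[of q x] by (simp add: s_def)
        have y1: "norm y < 1" using yx s by (intro in1) (simp add: algebra_simps)
        have y\<Omega>: "y \<in> \<Omega>" using pos_iff[OF y1] yS s by (simp add: S_def)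
        have "\<phi> y \<le> \<phi> x + L * norm (y - x)" using lipD[OF y1, of x] nx by simp
        also have "\<dots> \<le> s + L * (C0 * s)" using yx assms by (simp add: s_def)
        also have "\<dots> = B * s" by (simp add: B_def algebra_simps)
        also have "\<dots> \<le> B * \<tau>" using s B by simp
        finally have yB: "\<phi> y \<le> B * \<tau>" .
        have gain: "D * (\<phi> y - s) \<ge> (C0 + 1) * s"
        proof -
          have "(C0 + 1) * s \<le> (D * c) * s" using D s by (intro mult_right_mono) auto
          also have "\<dots> = D * (c * s)" by simp
          also have "\<dots> \<le> D * (\<phi> y - s)" using y(2) D by (intro mult_left_mono) (auto simp: algebra_simps)
          finally show ?thesis .
        qed
        have "D * (2 * B * \<tau> - \<phi> y) = D * (2 * B * \<tau> - s) - D * (\<phi> y - s)" by (simp add: algebra_simps)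
        then have shrink: "D * (2 * B * \<tau> - \<phi> y) + norm (y - x) < D * (2 * B * \<tau> - s)"
          using gain yx s by (simp add: algebra_simps)
        have "\<tau> \<le> s * (1 + c) ^ Suc n" using Suc.prems(1) by (simp add: s_def)
        also have "\<dots> = ((1 + c) * s) * (1 + c) ^ n" by simp
        also have "\<dots> \<le> \<phi> y * (1 + c) ^ n" using y(2) c by (intro mult_right_mono) auto
        finally have "\<tau> \<le> \<phi> y * (1 + c) ^ n" .
        moreover have "norm y + D * (2 * B * \<tau> - \<phi> y) \<le> 1/4"
          using shrink Suc.prems(4) norm_triangle_sub[of y x] by (simp add: s_def)
        ultimately obtain y' where y': "norm (y' - y) < D * (2 * B * \<tau> - \<phi> y)" "\<tau> \<le> \<phi> y'" "\<phi> y' \<le> B * \<tau>" "y' \<in> \<Omega>"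
          and uy': "\<And>u U. mean_value_on u U \<Longrightarrow> (\<forall>q\<in>U. 0 \<le> u q) \<Longrightarrow> ball y (D * (2 * B * \<tau> - \<phi> y)) \<inter> \<Omega> \<subseteq> U \<Longrightarrow>
             u y * \<phi> y ^ K \<le> u y' * \<phi> y' ^ K \<and> u y' * \<phi> y ^ K \<le> u y * \<phi> y' ^ K"
          using Suc.IH[OF _ y\<Omega> yB] by blast
        have "u x * \<phi> x ^ K \<le> u y' * \<phi> y' ^ K \<and> u y' * \<phi> x ^ K \<le> u x * \<phi> y' ^ K"
          if u: "mean_value_on u U" "\<forall>q\<in>U. 0 \<le> u q" "ball x (D * (2 * B * \<tau> - \<phi> x)) \<inter> \<Omega> \<subseteq> U" for u U
        proof -
          have "ball y (D * (2 * B * \<tau> - \<phi> y)) \<subseteq> ball x (D * (2 * B * \<tau> - \<phi> x))"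
            using shrink by (simp add: subset_ball s_def ball_subset_ball_iff dist_norm)
          then have "ball y (D * (2 * B * \<tau> - \<phi> y)) \<inter> \<Omega> \<subseteq> U" using u(3) by blast
          note IH = uy'[OF u(1,2) this]
          \<comment> \<open>By the Lipschitz bound, balls of this radius around points with
            \<open>\<phi> > s / 2\<close> stay in \<open>\<Omega>\<close>. The radius
            \<open>C0 * s\<close> is a fixed multiple of \<open>t\<close>, so the same Harnack
            constant \<open>H\<close> serves at every level.\<close>
          define t where "t = s / (2 * max L 1)"
          have t: "0 < t" "t \<le> s" "L * t \<le> s / 2" "2 * C0 * max L 1 * t = C0 * s"
            using s assms by (auto simp: t_def field_simps)
          have SU: "ball q t \<subseteq> U" if q: "q \<in> S" for q
          proof
            fix p assume p: "p \<in> ball q t"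
            have qx: "norm (q - x) < C0 * s" "s / 2 < \<phi> q" using q by (auto simp: S_def dist_norm norm_minus_commute)
            have pq: "norm (q - p) < t" using p by (simp add: dist_norm)
            have px: "norm (p - x) < (C0 + 1) * s"
              using qx pq t norm_triangle_ineq[of "p - q" "q - x"] by (simp add: algebra_simps norm_minus_commute)
            have q1: "norm q < 1" using qx s by (intro in1) (simp add: algebra_simps)
            have "\<phi> q - \<phi> p \<le> L * norm (q - p)" using lipD[OF q1 in1[OF px]] by simp
            also have "\<dots> \<le> s / 2" using t(3) pq assms by (smt (verit) mult_left_mono)
            finally have "0 < \<phi> p" using qx by linarith
            then have "p \<in> \<Omega>" using pos_iff[OF in1[OF px]] by simp
            moreover have "p \<in> ball x (D * (2 * B * \<tau> - \<phi> x))"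
              using px C0s Ds by (simp add: dist_norm norm_minus_commute s_def)
            ultimately show "p \<in> U" using u(3) by blast
          qed
          have Sx: "S \<subseteq> ball x (2 * C0 * max L 1 * t)" unfolding t(4) by (auto simp: S_def)
          have xy: "x \<in> connected_component_set S y" using y(1) by (simp add: connected_component_sym)
          have pw: "H * \<phi> x ^ K \<le> \<phi> y ^ K"
          proof -
            have "H * \<phi> x ^ K \<le> (1 + c) ^ K * \<phi> x ^ K" using K s by (intro mult_right_mono) (auto simp: s_def)
            also have "\<dots> = ((1 + c) * s) ^ K" by (simp add: power_mult_distrib s_def)
            also have "\<dots> \<le> \<phi> y ^ K" using y(2) s c by (intro power_mono) auto
            finally show ?thesis .
          qed
          have "x \<in> U" "y \<in> U" using SU[of x] SU[of y] yS y(1) t(1) connected_component_in[of S x y] by auto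
          then have u0: "0 \<le> u x" "0 \<le> u y" using u(2) by auto
          have "u x \<le> H * u y" "u y \<le> H * u x"
            using harnack[OF u(1) _ t(1) Sx SU y(1)] harnack[OF u(1) _ t(1) Sx SU xy] u(2) by auto
          have xpow: "0 \<le> \<phi> x ^ K" "0 < \<phi> y ^ K" using s pos[OF y\<Omega>] by (auto simp: s_def)
          have 1: "u x * \<phi> x ^ K \<le> u y * \<phi> y ^ K"
          proof -
            have "u x * \<phi> x ^ K \<le> (H * u y) * \<phi> x ^ K" using \<open>u x \<le> H * u y\<close> xpow by (intro mult_right_mono)
            also have "\<dots> = u y * (H * \<phi> x ^ K)" by simp
            also have "\<dots> \<le> u y * \<phi> y ^ K" using pw u0 by (intro mult_left_mono)
            finally show ?thesis .
          qed
          have 2: "u y * \<phi> x ^ K \<le> u x * \<phi> y ^ K"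
          proof -
            have "u y * \<phi> x ^ K \<le> (H * u x) * \<phi> x ^ K" using \<open>u y \<le> H * u x\<close> xpow by (intro mult_right_mono)
            also have "\<dots> = u x * (H * \<phi> x ^ K)" by simp
            also have "\<dots> \<le> u x * \<phi> y ^ K" using pw u0 by (intro mult_left_mono)
            finally show ?thesis .
          qed
          have "(u y' * \<phi> x ^ K) * \<phi> y ^ K \<le> (u x * \<phi> y' ^ K) * \<phi> y ^ K"
          proof -
            have "(u y' * \<phi> x ^ K) * \<phi> y ^ K = (u y' * \<phi> y ^ K) * \<phi> x ^ K" by simp
            also have "\<dots> \<le> (u y * \<phi> y' ^ K) * \<phi> x ^ K" using IH xpow by (intro mult_right_mono) auto
            also have "\<dots> = (u y * \<phi> x ^ K) * \<phi> y' ^ K" by simp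
            also have "\<dots> \<le> (u x * \<phi> y ^ K) * \<phi> y' ^ K" using 2 \<tau> y'(2) by (intro mult_right_mono) auto
            finally show ?thesis by (simp add: ac_simps)
          qed
          then have "u y' * \<phi> x ^ K \<le> u x * \<phi> y' ^ K" using xpow(2) by simp
          then show ?thesis using 1 IH by linarith
        qed
        moreover have "norm (y' - x) < D * (2 * B * \<tau> - \<phi> x)"
          using y'(1) shrink norm_triangle_ineq[of "y' - y" "y - x"] by (simp add: s_def)
        ultimately show ?thesis using y' by blast
      qed
    qed
    show "\<exists>y. norm (y - x) < C * \<tau> \<and> \<tau> \<le> \<phi> y \<and> \<phi> y \<le> C * \<tau> \<and> y \<in> \<Omega> \<and>
      (\<forall>u U. mean_value_on u U \<and> (\<forall>q\<in>U. 0 \<le> u q) \<and> ball x (C * \<tau>) \<inter> \<Omega> \<subseteq> U \<longrightarrow>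
         u x * \<phi> x ^ K \<le> u y * \<phi> y ^ K \<and> u y * \<phi> x ^ K \<le> u x * \<phi> y ^ K)"
    proof -
      have x: "x \<in> \<Omega>" "\<phi> x \<le> \<tau>" "norm x + C * \<tau> \<le> 1/4" using * by auto
      have \<phi>x: "0 < \<phi> x" by (rule pos[OF x(1)])
      obtain n where "\<tau> / \<phi> x < (1 + c) ^ n" using real_arch_pow[of "1 + c"] c by auto
      then have n: "\<tau> \<le> \<phi> x * (1 + c) ^ n" using \<phi>x by (simp add: field_simps)
      have "\<tau> \<le> B * \<tau>" using B \<tau> by simp
      then have xB: "\<phi> x \<le> B * \<tau>" using x by linarith
      have "D * (2 * B * \<tau> - \<phi> x) \<le> D * (2 * B * \<tau>)" using \<phi>x D by simp
      also have "\<dots> = 2 * B * D * \<tau>" by simp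
      also have "\<dots> \<le> C * \<tau>" using CC \<tau> by (intro mult_right_mono) auto
      finally have le: "D * (2 * B * \<tau> - \<phi> x) \<le> C * \<tau>" .
      then have "ball x (D * (2 * B * \<tau> - \<phi> x)) \<inter> \<Omega> \<subseteq> ball x (C * \<tau>) \<inter> \<Omega>" by (auto simp: subset_eq)
      moreover have "B * \<tau> \<le> C * \<tau>" using CC \<tau> by (intro mult_right_mono) auto
      ultimately show ?thesis using main[OF n x(1) xB] le x(3) by (smt (verit, ccfv_threshold) order_trans)
    qed
  qed
qed

text \<open>The barrier centred at an exterior ball shows that a subsolution vanishing outside \<open>\<Omega>\<close> drops by a
  fixed factor from a ball around a boundary point to a smaller one.\<close>

lemma boundary_decay:
  fixes \<theta> :: real
  assumes "0 < \<theta>"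
  shows "\<exists>c. 0 < c \<and> c < 1 \<and> (\<forall>L \<kappa> \<Omega> (\<phi> :: 'a::euclidean_space \<Rightarrow> real) f z r n m x.
    nice_domain L \<kappa> \<theta> \<Omega> \<phi> \<and> continuous_on (ball 0 1) f \<and> (\<forall>x\<in>ball 0 1 - \<Omega>. f x \<le> 0) \<and>
    (\<forall>x\<in>\<Omega>. 0 < f x \<longrightarrow> submean_at f x) \<and> z \<in> frontier \<Omega> \<and> 0 < r \<and> norm z + 5 ^ n * r < 1/2 \<and> 0 \<le> m \<and>
    (\<forall>x\<in>ball z (5 ^ n * r). f x \<le> m) \<and> x \<in> ball z r \<longrightarrow> f x \<le> (1 - c) ^ n * m)"
proof -
  \<comment> \<open>With \<open>\<alpha> = A / r\<^sup>2\<close> the Gaussian around the centre of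
    the exterior ball is strict on all of \<open>\<Omega>\<close>. The numbers 4 and 9 are the
    squares, in units of \<open>r\<close>, of an upper bound for the distance from this centre in
    \<open>ball z r\<close> and a lower bound on the sphere of radius \<open>4 * r\<close>.\<close>
  define A where "A = real DIM('a) / \<theta>\<^sup>2"
  define e4 where "e4 = exp (- A * 4)"
  define e9 where "e9 = exp (- A * 9)"
  define c where "c = e4 - e9"
  have A: "A > 0" using assms by (simp add: A_def)
  have e: "e9 < e4" "e4 < 1" "0 < e9" using A by (auto simp: e4_def e9_def)
  have c: "0 < c" "c < 1" using e by (auto simp: c_def)
  \<comment> \<open>One scale. The radius \<open>5 * r\<close> makes the bound \<open>m\<close>
    available on the closed ball of radius \<open>4 * r\<close>.\<close>
  have step: "f x \<le> (1 - c) * m"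
    if "nice_domain L \<kappa> \<theta> \<Omega> \<phi>" and f: "continuous_on (ball 0 1) f" "\<forall>x\<in>ball 0 1 - \<Omega>. f x \<le> 0"
      "\<forall>x\<in>\<Omega>. 0 < f x \<longrightarrow> submean_at f x" and z: "z \<in> frontier \<Omega>" "0 < r" "norm z + 5 * r < 1/2"
      and m: "0 \<le> m" "\<forall>x\<in>ball z (5 * r). f x \<le> m" and x: "x \<in> ball z r"
    for L \<kappa> \<Omega> z r m x and \<phi> f :: "'a \<Rightarrow> real"
  proof (cases "0 < f x")
    case False
    then show ?thesis using m c by (smt (verit) mult_nonneg_nonneg)
  next
    case True
    interpret nice_domain L \<kappa> \<theta> \<Omega> \<phi> by fact
    have "norm z < 1/2" "r \<le> 1/4" using z(2,3) norm_ge_zero[of z] by linarith+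
    then obtain p where p: "ball p (\<theta> * r) \<subseteq> ball z r - \<Omega>" using exterior_ball[OF z(1) _ z(2)] by blast
    have \<theta>r: "0 < \<theta> * r" using assms z by simp
    then have pz: "norm (p - z) < r" using p centre_in_ball[of p "\<theta> * r"] by (auto simp: subset_eq dist_norm norm_minus_commute)
    have "x \<in> ball z (5 * r)" using x z(2) by simp
    then have mpos: "0 < m" using True m(2) by fastforce
    define \<alpha> where "\<alpha> = A / r\<^sup>2"
    have \<alpha>: "\<alpha> > 0" using A z by (simp add: \<alpha>_def)
    have b1: "norm q < 1" if "norm (q - z) \<le> 4 * r" for q
      using that z(2,3) norm_triangle_sub[of q z] by linarith
    define V where "V = {q \<in> ball z (4 * r). 0 < f q}"
    have "continuous_on (ball z (4 * r)) f"
      using b1 by (intro continuous_on_subset[OF f(1)]) (auto simp: dist_norm norm_minus_commute)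
    from continuous_open_preimage[OF this open_ball open_greaterThan[of 0]]
    have oV: "open V" by (simp add: V_def vimage_def Int_def)
    have V\<Omega>: "V \<subseteq> \<Omega>"
    proof
      fix q assume "q \<in> V"
      then have "norm q < 1" "0 < f q" using b1[of q] by (auto simp: V_def dist_norm norm_minus_commute)
      then show "q \<in> \<Omega>" using f(2) by force
    qed
    have cl: "closure V \<subseteq> cball z (4 * r)" by (intro closure_minimal) (auto simp: V_def)
    have bV: "bounded V" by (rule bounded_subset[OF bounded_ball[of z "4 * r"]]) (auto simp: V_def)
    have cont_cl: "continuous_on (closure V) f"
      using cl b1 by (intro continuous_on_subset[OF f(1)]) (auto simp: dist_norm norm_minus_commute)
    have xV: "x \<in> V" using x True z by (auto simp: V_def)
    have far: "\<theta> * r \<le> norm (q - p)" if "q \<in> closure \<Omega>" for q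
    proof -
      have "\<Omega> \<subseteq> - ball p (\<theta> * r)" using p by blast
      then have "closure \<Omega> \<subseteq> - ball p (\<theta> * r)" by (intro closure_minimal) auto
      then show ?thesis using that by (auto simp: dist_norm norm_minus_commute)
    qed
    \<comment> \<open>On the part of the frontier of \<open>V\<close> inside the ball
      \<open>f\<close> is nonpositive and the barrier contributes at most \<open>m\<close>; on the
      sphere \<open>f \<le> m\<close> and the barrier contributes at most
      \<open>m * e9\<close>.\<close>
    have "f x + m * exp (- (\<alpha>) * (norm (x - p))\<^sup>2) \<le> m + m * e9"
    proof (rule barrier_principle[OF oV bV cont_cl _ \<alpha> mpos])
      show "submean_at f q" if "q \<in> V" for q using that V\<Omega> f(3) by (auto simp: V_def)
      show "real DIM('a) < 2 * \<alpha> * (norm (q - p))\<^sup>2" if "q \<in> V" for q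
      proof -
        have "(\<theta> * r)\<^sup>2 \<le> (norm (q - p))\<^sup>2" using far[of q] that V\<Omega> closure_subset[of \<Omega>] \<theta>r by (intro power_mono) auto
        then have "\<alpha> * (\<theta> * r)\<^sup>2 \<le> \<alpha> * (norm (q - p))\<^sup>2" using \<alpha> by simp
        moreover have "\<alpha> * (\<theta> * r)\<^sup>2 = real DIM('a)" using assms z by (simp add: \<alpha>_def A_def power_mult_distrib)
        moreover have "0 < real DIM('a)" by simp
        ultimately show ?thesis by linarith
      qed
      fix q assume q: "q \<in> frontier V"
      then have qV: "q \<notin> V" "q \<in> closure V" using oV by (auto simp: frontier_def interior_open)
      have q4: "norm (q - z) \<le> 4 * r" using qV cl by (auto simp: dist_norm norm_minus_commute)
      show "f q + m * exp (- \<alpha> * (norm (q - p))\<^sup>2) \<le> m + m * e9"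
      proof (cases "norm (q - z) < 4 * r")
        case True
        then have "f q \<le> 0" using qV by (auto simp: V_def dist_norm norm_minus_commute)
        moreover have "m * exp (- \<alpha> * (norm (q - p))\<^sup>2) \<le> m * 1" using \<alpha> mpos by (intro mult_left_mono) auto
        moreover have "0 < m * e9" using mpos e by simp
        ultimately show ?thesis by linarith
      next
        case False
        then have "3 * r \<le> norm (q - p)" using q4 pz norm_triangle_ineq[of "q - p" "p - z"] by simp
        then have "(3 * r)\<^sup>2 \<le> (norm (q - p))\<^sup>2" using z by (intro power_mono) auto
        then have "\<alpha> * (3 * r)\<^sup>2 \<le> \<alpha> * (norm (q - p))\<^sup>2" using \<alpha> by simp
        moreover have "\<alpha> * (3 * r)\<^sup>2 = A * 9" using z by (simp add: \<alpha>_def power_mult_distrib)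
        ultimately have "exp (- \<alpha> * (norm (q - p))\<^sup>2) \<le> e9" by (simp add: e9_def)
        then have "m * exp (- \<alpha> * (norm (q - p))\<^sup>2) \<le> m * e9" using mpos by simp
        moreover have "f q \<le> m" using m(2) q4 z by (auto simp: dist_norm norm_minus_commute)
        ultimately show ?thesis by linarith
      qed
    qed (rule xV)
    moreover have "e4 \<le> exp (- \<alpha> * (norm (x - p))\<^sup>2)"
    proof -
      have "norm (x - p) \<le> 2 * r"
        using x pz norm_triangle_ineq[of "x - z" "z - p"] by (simp add: dist_norm norm_minus_commute)
      then have "(norm (x - p))\<^sup>2 \<le> (2 * r)\<^sup>2" by (intro power_mono) auto
      then have "\<alpha> * (norm (x - p))\<^sup>2 \<le> \<alpha> * (2 * r)\<^sup>2" using \<alpha> by simp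
      also have "\<dots> = A * 4" using z by (simp add: \<alpha>_def power_mult_distrib)
      finally show ?thesis by (simp add: e4_def)
    qed
    then have "m * e4 \<le> m * exp (- \<alpha> * (norm (x - p))\<^sup>2)" using mpos by simp
    ultimately show ?thesis by (simp add: c_def algebra_simps)
  qed
  show ?thesis
  proof (intro exI[of _ c] conjI allI impI)
    show "0 < c" "c < 1" by fact+
    fix L \<kappa> \<Omega> and \<phi> f :: "'a \<Rightarrow> real" and z r n m x
    assume *: "nice_domain L \<kappa> \<theta> \<Omega> \<phi> \<and> continuous_on (ball 0 1) f \<and> (\<forall>x\<in>ball 0 1 - \<Omega>. f x \<le> 0) \<and>
      (\<forall>x\<in>\<Omega>. 0 < f x \<longrightarrow> submean_at f x) \<and> z \<in> frontier \<Omega> \<and> 0 < r \<and> norm z + 5 ^ n * r < 1/2 \<and> 0 \<le> m \<and>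
      (\<forall>x\<in>ball z (5 ^ n * r). f x \<le> m) \<and> x \<in> ball z r"
    then have nd: "nice_domain L \<kappa> \<theta> \<Omega> \<phi>" and f: "continuous_on (ball 0 1) f" "\<forall>x\<in>ball 0 1 - \<Omega>. f x \<le> 0"
      "\<forall>x\<in>\<Omega>. 0 < f x \<longrightarrow> submean_at f x" and z: "z \<in> frontier \<Omega>" by auto
    have "f x \<le> (1 - c) ^ n * m" if "0 < r" "norm z + 5 ^ n * r < 1/2" "0 \<le> m" "\<forall>x\<in>ball z (5 ^ n * r). f x \<le> m" "x \<in> ball z r" for m r
      using that
    proof (induction n arbitrary: m r x)
      case (Suc n)
      have "\<forall>y\<in>ball z (5 * r). f y \<le> (1 - c) ^ n * m"
        using Suc.prems by (intro ballI Suc.IH[where r="5 * r"]) (auto simp: ac_simps)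
      moreover have "5 * r \<le> 5 ^ Suc n * r" using Suc.prems(1) by simp
      then have "norm z + 5 * r < 1/2" using Suc.prems(2) by linarith
      moreover have "0 \<le> (1 - c) ^ n * m" using c Suc.prems(3) by simp
      ultimately show ?case using step[OF nd f z Suc.prems(1) _ _ _ Suc.prems(5)] by (simp add: mult.assoc)
    qed simp
    then show "f x \<le> (1 - c) ^ n * m" using * by blast
  qed
qed

section \<open>Connectedness of the superlevel sets\<close>

lemma submean_at_scaled:
  fixes f :: "'a::euclidean_space \<Rightarrow> real"
  assumes "submean_at f (m + s *\<^sub>R X)" "0 < s"
  shows "submean_at (\<lambda>X. f (m + s *\<^sub>R X) / s) X"
proof -
  have eq: "avg (\<lambda>X. f (m + s *\<^sub>R X) / s) X t = avg f (m + s *\<^sub>R X) (s * t) / s" for t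
  proof -
    have "m + s *\<^sub>R (X + t *\<^sub>R z) = m + s *\<^sub>R X + (s * t) *\<^sub>R z" for z by (simp add: scaleR_add_right)
    then have "avg (\<lambda>X. f (m + s *\<^sub>R X) / s) X t
        = integral (cbox (- One) One) (\<lambda>z. (kern z * f (m + s *\<^sub>R X + (s * t) *\<^sub>R z)) / s)"
      by (simp only: avg_def times_divide_eq_right)
    then show ?thesis unfolding avg_def by simp
  qed
  obtain t0 where t0: "t0 > 0" "\<And>t. 0 < t \<Longrightarrow> t < t0 \<Longrightarrow> f (m + s *\<^sub>R X) \<le> avg f (m + s *\<^sub>R X) t"
    using assms(1) unfolding submean_at_def by blast
  have "f (m + s *\<^sub>R X) / s \<le> avg (\<lambda>X. f (m + s *\<^sub>R X) / s) X t" if "0 < t" "t < t0 / s" for t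
    unfolding eq using t0(2)[of "s * t"] that assms(2) by (intro divide_right_mono) (auto simp: field_simps)
  moreover have "0 < t0 / s" using t0 assms by simp
  ultimately show ?thesis unfolding submean_at_def by blast
qed

text \<open>The contrapositive of \<open>two_point_rigidity\<close>, centred at the midpoint and
  scaled by \<open>s\<close>. There the hole has to lie on the side of the first point; otherwise
  the two functions exchange their roles, which is why both vanish on it.\<close>

lemma pair_improvement:
  fixes \<theta> rm :: real
  assumes "0 < \<theta>" "\<theta> \<le> 1" "0 < rm" "rm \<le> 1"
  shows "\<exists>R>0. \<exists>\<epsilon>>0. \<forall>(f :: 'a::euclidean_space \<Rightarrow> real) g x y a c L s.
    x \<noteq> y \<and> 0 \<le> a \<and> s = norm (x - y) + a \<and> rm * s \<le> norm (x - y) \<and>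
    norm (c - midpoint x y) \<le> 5 / 2 * s \<and> (\<forall>q\<in>ball c (\<theta> * s). f q = 0 \<and> g q = 0) \<and>
    L-lipschitz_on (ball (midpoint x y) (R * s)) f \<and> L-lipschitz_on (ball (midpoint x y) (R * s)) g \<and>
    (\<forall>q. 0 \<le> f q) \<and> (\<forall>q. 0 \<le> g q) \<and>
    (\<forall>q\<in>ball (midpoint x y) (R * s). 0 < f q \<longrightarrow> submean_at f q) \<and>
    (\<forall>q\<in>ball (midpoint x y) (R * s). 0 < g q \<longrightarrow> submean_at g q) \<and> 0 < f x \<and> 0 < g y \<longrightarrow>
    (\<exists>x'\<in>ball (midpoint x y) (R * s). \<exists>y'\<in>ball (midpoint x y) (R * s).
       (1 + \<epsilon>) * (f x * g y / s\<^sup>2) * (norm (x' - y') + a)\<^sup>2 < f x' * g y')"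
proof -
  have "0 < \<theta> / 2" "(1::real) \<le> 3" using assms by auto
  from two_point_rigidity[where 'a='a, OF this assms(3,4)]
  obtain R \<epsilon> where R: "0 < R" and \<epsilon>: "0 < \<epsilon>" and rigid: "\<And>(f :: 'a \<Rightarrow> real) g e0 r0 a c L.
    norm e0 = 1 \<and> rm \<le> r0 \<and> 0 \<le> a \<and> r0 + a = 1 \<and> norm c \<le> 3 \<and> \<theta> / 2 \<le> c \<bullet> e0 \<and> (\<forall>x\<in>ball c (\<theta> / 2). f x = 0) \<and>
    L-lipschitz_on (ball 0 R) f \<and> L-lipschitz_on (ball 0 R) g \<and> (\<forall>x. 0 \<le> f x) \<and> (\<forall>x. 0 \<le> g x) \<and>
    (\<forall>x\<in>ball 0 R. f x > 0 \<longrightarrow> submean_at f x) \<and> (\<forall>x\<in>ball 0 R. g x > 0 \<longrightarrow> submean_at g x) \<and>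
    0 < f ((r0 / 2) *\<^sub>R e0) \<and> 0 < g (- (r0 / 2) *\<^sub>R e0) \<and>
    (\<forall>x\<in>ball 0 R. \<forall>y\<in>ball 0 R. f x * g y \<le> (1 + \<epsilon>) * (f ((r0 / 2) *\<^sub>R e0) * g (- (r0 / 2) *\<^sub>R e0)) * (norm (x - y) + a)\<^sup>2)
    \<Longrightarrow> False" by blast
  have half: "\<exists>x'\<in>ball (midpoint x y) (R * s). \<exists>y'\<in>ball (midpoint x y) (R * s).
       (1 + \<epsilon>) * (f x * g y / s\<^sup>2) * (norm (x' - y') + a)\<^sup>2 < f x' * g y'"
    if xy: "x \<noteq> y" "0 \<le> a" and s: "s = norm (x - y) + a" "rm * s \<le> norm (x - y)"
      and c: "norm (c - midpoint x y) \<le> 5 / 2 * s" "0 \<le> (c - midpoint x y) \<bullet> (x - y)"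
      and zero: "\<And>q. q \<in> ball c (\<theta> * s) \<Longrightarrow> f q = 0"
      and lip: "L-lipschitz_on (ball (midpoint x y) (R * s)) f" "L-lipschitz_on (ball (midpoint x y) (R * s)) g"
      and nonneg: "\<And>q. 0 \<le> f q" "\<And>q. 0 \<le> g q"
      and sub: "\<And>q. q \<in> ball (midpoint x y) (R * s) \<Longrightarrow> 0 < f q \<Longrightarrow> submean_at f q"
        "\<And>q. q \<in> ball (midpoint x y) (R * s) \<Longrightarrow> 0 < g q \<Longrightarrow> submean_at g q"
      and fg: "0 < f x" "0 < g y" for f g :: "'a \<Rightarrow> real" and x y a c L s
  proof (rule ccontr)
    assume neg: "\<not> ?thesis"
    define m where "m = midpoint x y"
    define F where "F X = f (m + s *\<^sub>R X) / s" for X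
    define G where "G X = g (m + s *\<^sub>R X) / s" for X
    define d where "d = norm (x - y)"
    define e0 where "e0 = (1 / d) *\<^sub>R (x - y)"
    define r0 where "r0 = d / s"
    \<comment> \<open>Half of the radius of the hole is spent on moving its centre by
      \<open>\<theta> / 2\<close> towards the first point. This turns a nonnegative component along
      \<open>e0\<close> into one of at least \<open>\<theta> / 2\<close>, and the centre stays
      within \<open>5 / 2 + 1 / 2 = 3\<close>.\<close>
    define c' where "c' = (1 / s) *\<^sub>R (c - m) + (\<theta> / 2) *\<^sub>R e0"
    have d: "0 < d" using xy by (simp add: d_def)
    have s0: "0 < s" unfolding s(1) using d xy by (simp add: d_def add_pos_nonneg)
    have e0: "norm e0 = 1" unfolding e0_def using d by (simp add: d_def)
    have rs: "r0 + a / s = 1" proof -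
      have "r0 + a / s = (d + a) / s" by (simp add: r0_def add_divide_distrib)
      also have "d + a = s" using s by (simp add: d_def)
      finally show ?thesis using s0 by simp
    qed
    have mem: "m + s *\<^sub>R X \<in> ball m (R * s)" if "X \<in> ball 0 R" for X
      using that s0 by (simp add: dist_norm mult.commute)
    have pos1: "m + s *\<^sub>R ((r0 / 2) *\<^sub>R e0) = x"
    proof -
      have "s *\<^sub>R ((r0 / 2) *\<^sub>R e0) = (1/2) *\<^sub>R (x - y)" using d s0 by (simp add: r0_def e0_def)
      moreover have "m = (1/2) *\<^sub>R (x + y)" by (simp add: m_def midpoint_def)
      ultimately have "m + s *\<^sub>R ((r0 / 2) *\<^sub>R e0) = (1/2) *\<^sub>R ((x + y) + (x - y))" by (simp only: scaleR_add_right)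
      also have "(x + y) + (x - y) = 2 *\<^sub>R x" by (simp add: scaleR_2)
      finally show ?thesis by simp
    qed
    have pos2: "m + s *\<^sub>R (- (r0 / 2) *\<^sub>R e0) = y"
    proof -
      have "m + s *\<^sub>R (- (r0 / 2) *\<^sub>R e0) = m + m - (m + s *\<^sub>R ((r0 / 2) *\<^sub>R e0))" by simp
      also have "\<dots> = (x + y) - x" unfolding pos1 by (simp add: m_def midpoint_def scaleR_half_double flip: scaleR_add_left scaleR_add_right)
      finally show ?thesis by simp
    qed
    show False
    proof (rule rigid[of e0 r0 "a / s" c' F L G], intro conjI ballI allI impI)
      show "norm e0 = 1" by fact
      show "rm \<le> r0" using s s0 by (simp add: r0_def d_def field_simps)
      show "0 \<le> a / s" using xy s0 by simp
      show "r0 + a / s = 1" by fact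
      have "norm ((1 / s) *\<^sub>R (c - m)) \<le> 5 / 2" using c(1) s0 unfolding norm_scaleR m_def by (simp add: field_simps)
      moreover have "norm ((\<theta> / 2) *\<^sub>R e0) \<le> 1 / 2" using e0 assms by simp
      ultimately show "norm c' \<le> 3" unfolding c'_def using norm_triangle_ineq[of "(1 / s) *\<^sub>R (c - m)" "(\<theta> / 2) *\<^sub>R e0"] by linarith
      have "0 \<le> ((1 / s) *\<^sub>R (c - m)) \<bullet> e0" using c(2) d s0 by (simp add: e0_def m_def)
      moreover have ee: "e0 \<bullet> e0 = 1" using e0 by (simp add: dot_square_norm)
      ultimately show "\<theta> / 2 \<le> c' \<bullet> e0" unfolding c'_def inner_add_left inner_scaleR_left[of "\<theta> / 2"] ee by linarith
      show "F X = 0" if X: "X \<in> ball c' (\<theta> / 2)" for X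
      proof -
        have "norm (X - (1 / s) *\<^sub>R (c - m)) \<le> norm (X - c') + norm ((\<theta> / 2) *\<^sub>R e0)"
          using norm_triangle_ineq[of "X - c'" "(\<theta> / 2) *\<^sub>R e0"] by (simp add: c'_def)
        also have "\<dots> < \<theta>" using X e0 assms by (simp add: dist_norm norm_minus_commute)
        finally have 1: "s * norm (X - (1 / s) *\<^sub>R (c - m)) < s * \<theta>" using s0 by simp
        have "(m + s *\<^sub>R X) - c = s *\<^sub>R (X - (1 / s) *\<^sub>R (c - m))" using s0 by (simp add: algebra_simps)
        then have "norm ((m + s *\<^sub>R X) - c) < \<theta> * s" using 1 s0 by (simp add: mult.commute)
        then show ?thesis using zero by (simp add: F_def dist_norm norm_minus_commute)
      qed
      have lipsc: "L-lipschitz_on (ball 0 R) (\<lambda>X. h (m + s *\<^sub>R X) / s)" if "L-lipschitz_on (ball m (R * s)) h" for h :: "'a \<Rightarrow> real"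
      proof (rule lipschitz_onI)
        show "0 \<le> L" using that by (rule lipschitz_on_nonneg)
        fix X Y :: 'a assume XY: "X \<in> ball 0 R" "Y \<in> ball 0 R"
        have "\<bar>h (m + s *\<^sub>R X) - h (m + s *\<^sub>R Y)\<bar> \<le> L * norm ((m + s *\<^sub>R X) - (m + s *\<^sub>R Y))"
          using lipschitz_onD[OF that mem[OF XY(1)] mem[OF XY(2)]] by (simp add: dist_norm)
        also have "(m + s *\<^sub>R X) - (m + s *\<^sub>R Y) = s *\<^sub>R (X - Y)" by (simp add: scaleR_diff_right)
        also have "norm (s *\<^sub>R (X - Y)) = s * norm (X - Y)" using s0 by simp
        finally have "\<bar>h (m + s *\<^sub>R X) - h (m + s *\<^sub>R Y)\<bar> / s \<le> L * norm (X - Y)" using s0 by (simp add: field_simps)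
        then show "dist (h (m + s *\<^sub>R X) / s) (h (m + s *\<^sub>R Y) / s) \<le> L * dist X Y"
          using s0 by (simp add: dist_norm diff_divide_distrib[symmetric])
      qed
      show "L-lipschitz_on (ball 0 R) F" "L-lipschitz_on (ball 0 R) G"
        unfolding F_def[abs_def] G_def[abs_def] by (rule lipsc; use lip in \<open>simp add: m_def\<close>)+
      show "0 \<le> F X" "0 \<le> G X" for X using nonneg s0 by (simp_all add: F_def G_def)
      show "submean_at F X" if "X \<in> ball 0 R" "0 < F X" for X
        unfolding F_def[abs_def] using sub(1) mem that s0 by (intro submean_at_scaled) (auto simp: m_def F_def zero_less_divide_iff)
      show "submean_at G X" if "X \<in> ball 0 R" "0 < G X" for X
        unfolding G_def[abs_def] using sub(2) mem that s0 by (intro submean_at_scaled) (auto simp: m_def G_def zero_less_divide_iff)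
      show "0 < F ((r0 / 2) *\<^sub>R e0)" "0 < G (- (r0 / 2) *\<^sub>R e0)"
        unfolding F_def G_def pos1 pos2 using fg s0 by auto
      fix X Y :: 'a assume XY: "X \<in> ball 0 R" "Y \<in> ball 0 R"
      define x' where "x' = m + s *\<^sub>R X"
      define y' where "y' = m + s *\<^sub>R Y"
      have "f x' * g y' \<le> (1 + \<epsilon>) * (f x * g y / s\<^sup>2) * (norm (x' - y') + a)\<^sup>2"
        using neg mem[OF XY(1)] mem[OF XY(2)] unfolding x'_def y'_def m_def by (meson not_le)
      moreover have "norm (x' - y') = s * norm (X - Y)"
      proof -
        have "x' - y' = s *\<^sub>R (X - Y)" by (simp add: x'_def y'_def scaleR_diff_right)
        then show ?thesis using s0 by simp
      qed
      moreover have "s * norm (X - Y) + a = s * (norm (X - Y) + a / s)" using s0 by (simp add: field_simps)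
      ultimately have "f x' * g y' \<le> (1 + \<epsilon>) * (f x * g y / s\<^sup>2) * (s * (norm (X - Y) + a / s))\<^sup>2" by simp
      then have "f x' * g y' / s\<^sup>2 \<le> (1 + \<epsilon>) * (f x * g y / s\<^sup>2) * (s * (norm (X - Y) + a / s))\<^sup>2 / s\<^sup>2"
        by (rule divide_right_mono) simp
      also have "\<dots> = (1 + \<epsilon>) * (f x * g y / s\<^sup>2) * (norm (X - Y) + a / s)\<^sup>2"
        using s0 unfolding power_mult_distrib by simp
      finally have "f x' * g y' / s\<^sup>2 \<le> (1 + \<epsilon>) * (f x * g y / s\<^sup>2) * (norm (X - Y) + a / s)\<^sup>2" .
      then show "F X * G Y \<le> (1 + \<epsilon>) * (F ((r0 / 2) *\<^sub>R e0) * G (- (r0 / 2) *\<^sub>R e0)) * (norm (X - Y) + a / s)\<^sup>2"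
        unfolding F_def G_def pos1 pos2 x'_def y'_def by (simp only: times_divide_times_eq power2_eq_square)
    qed
  qed
  show ?thesis
  proof (rule exI[of _ R], intro conjI R, rule exI[of _ \<epsilon>], intro conjI \<epsilon> allI impI)
    fix f g :: "'a \<Rightarrow> real" and x y a c L s
    assume *: "x \<noteq> y \<and> 0 \<le> a \<and> s = norm (x - y) + a \<and> rm * s \<le> norm (x - y) \<and>
    norm (c - midpoint x y) \<le> 5 / 2 * s \<and> (\<forall>q\<in>ball c (\<theta> * s). f q = 0 \<and> g q = 0) \<and>
    L-lipschitz_on (ball (midpoint x y) (R * s)) f \<and> L-lipschitz_on (ball (midpoint x y) (R * s)) g \<and>
    (\<forall>q. 0 \<le> f q) \<and> (\<forall>q. 0 \<le> g q) \<and>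
    (\<forall>q\<in>ball (midpoint x y) (R * s). 0 < f q \<longrightarrow> submean_at f q) \<and>
    (\<forall>q\<in>ball (midpoint x y) (R * s). 0 < g q \<longrightarrow> submean_at g q) \<and> 0 < f x \<and> 0 < g y"
    show "\<exists>x'\<in>ball (midpoint x y) (R * s). \<exists>y'\<in>ball (midpoint x y) (R * s).
       (1 + \<epsilon>) * (f x * g y / s\<^sup>2) * (norm (x' - y') + a)\<^sup>2 < f x' * g y'"
    proof (cases "0 \<le> (c - midpoint x y) \<bullet> (x - y)")
      case True
      show ?thesis by (rule half[of x y a s c f L g]) (use * True in auto)
    next
      case False
      have yx: "midpoint y x = midpoint x y" "norm (y - x) = norm (x - y)" by (auto simp: midpoint_sym norm_minus_commute)
      have "(c - midpoint y x) \<bullet> (y - x) = - ((c - midpoint x y) \<bullet> (x - y))" unfolding yx by (simp add: inner_diff_right)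
      then have nn: "0 \<le> (c - midpoint y x) \<bullet> (y - x)" using False by linarith
      have "\<exists>x'\<in>ball (midpoint y x) (R * s). \<exists>y'\<in>ball (midpoint y x) (R * s).
       (1 + \<epsilon>) * (g y * f x / s\<^sup>2) * (norm (x' - y') + a)\<^sup>2 < g x' * f y'"
        by (rule half[of y x a s c g L f]) (use * nn in \<open>auto simp: yx\<close>)
      then obtain x' y' where "x' \<in> ball (midpoint x y) (R * s)" "y' \<in> ball (midpoint x y) (R * s)"
        "(1 + \<epsilon>) * (g y * f x / s\<^sup>2) * (norm (x' - y') + a)\<^sup>2 < g x' * f y'" unfolding yx by blast
      then show ?thesis
        by (rule_tac bexI[of _ y'], rule_tac bexI[of _ x']) (auto simp: ac_simps norm_minus_commute)
    qed
  qed
qed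

section \<open>Components of superlevel sets\<close>

context nice_domain
begin

definition superlevel :: "real \<Rightarrow> 'a set" where
  "superlevel \<tau> = {q \<in> ball 0 (1/8). \<tau> < \<phi> q}"

text \<open>Phrased through connected sets, so that a single component and the union of all the
  others are both instances.\<close>

definition component_union :: "real \<Rightarrow> 'a set \<Rightarrow> bool" where
  "component_union \<tau> A \<longleftrightarrow> A \<subseteq> superlevel \<tau> \<and> (\<forall>T. connected T \<and> T \<subseteq> superlevel \<tau> \<and> T \<inter> A \<noteq> {} \<longrightarrow> T \<subseteq> A)"

definition excess :: "real \<Rightarrow> 'a set \<Rightarrow> 'a \<Rightarrow> real" where
  "excess \<tau> A q = (if q \<in> A then \<phi> q - \<tau> else 0)"

lemma component_unionD: "component_union \<tau> A \<Longrightarrow> q \<in> A \<Longrightarrow> norm q < 1/8 \<and> \<tau> < \<phi> q"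
  by (auto simp: component_union_def superlevel_def)

lemma component_union_component: "component_union \<tau> (connected_component_set (superlevel \<tau>) x)"
  unfolding component_union_def
  by (metis connected_component_maximal connected_component_eq connected_component_subset disjoint_iff)

lemma component_union_diff:
  assumes "component_union \<tau> A"
  shows "component_union \<tau> (superlevel \<tau> - A)"
  using assms unfolding component_union_def by fastforce

lemma excess_nonneg: "component_union \<tau> A \<Longrightarrow> 0 \<le> excess \<tau> A q"
  using component_unionD[of \<tau> A q] by (auto simp: excess_def)

lemma excess_pos_iff: "component_union \<tau> A \<Longrightarrow> 0 < excess \<tau> A q \<longleftrightarrow> q \<in> A"
  using component_unionD[of \<tau> A q] by (auto simp: excess_def)

lemma segment_crosses:
  assumes "component_union \<tau> A" "p \<in> A" "q \<notin> A" "norm q < 1/8"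
  obtains w where "w \<in> closed_segment p q" "norm w < 1/8" "\<phi> w \<le> \<tau>"
proof -
  have "closed_segment p q \<subseteq> ball 0 (1/8)"
    using component_unionD[OF assms(1,2)] assms(4) by (intro closed_segment_subset) auto
  moreover have "\<not> closed_segment p q \<subseteq> superlevel \<tau>"
  proof
    assume "closed_segment p q \<subseteq> superlevel \<tau>"
    then have "closed_segment p q \<subseteq> A"
      using assms(1,2) connected_segment(1)[of p q] ends_in_segment(1)[of p q] unfolding component_union_def by blast
    then show False using assms(3) by (meson ends_in_segment(2) subsetD)
  qed
  ultimately show thesis using that by (auto simp: superlevel_def subset_eq not_less)
qed

text \<open>Cutting off does not increase the Lipschitz constant: a segment that leaves
  \<open>A\<close> contains a point with \<open>\<phi> \<le> \<tau>\<close>, which is no farther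
  from its start than its end is.\<close>

lemma excess_lipschitz:
  assumes "component_union \<tau> A"
  shows "L-lipschitz_on (ball 0 (1/8)) (excess \<tau> A)"
proof (rule lipschitz_onI)
  have half: "\<bar>excess \<tau> A p - excess \<tau> A q\<bar> \<le> L * norm (p - q)" if pq: "p \<in> A" "q \<notin> A" "norm q < 1/8" for p q
  proof -
    obtain w where w: "w \<in> closed_segment p q" "norm w < 1/8" "\<phi> w \<le> \<tau>" using segment_crosses[OF assms pq] by blast
    have p: "norm p < 1/8" "\<tau> < \<phi> p" using component_unionD[OF assms pq(1)] by auto
    have "\<phi> p - \<tau> \<le> L * norm (p - w)" using lipD[of p w] w p by simp
    also have "\<dots> \<le> L * norm (p - q)"
      using segment_bound1[OF w(1)] L_pos by (intro mult_left_mono) (auto simp: norm_minus_commute)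
    finally show ?thesis using pq p by (simp add: excess_def)
  qed
  fix p q :: 'a assume pq: "p \<in> ball 0 (1/8)" "q \<in> ball 0 (1/8)"
  show "dist (excess \<tau> A p) (excess \<tau> A q) \<le> L * dist p q"
  proof (cases "p \<in> A"; cases "q \<in> A")
    assume "p \<in> A" "q \<in> A"
    then show ?thesis using lipD[of p q] pq by (simp add: excess_def dist_norm)
  next
    assume "p \<in> A" "q \<notin> A"
    then show ?thesis using half pq by (simp add: dist_norm)
  next
    assume "p \<notin> A" "q \<in> A"
    then show ?thesis using half[of q p] pq by (simp add: dist_norm norm_minus_commute abs_minus_commute)
  next
    assume "p \<notin> A" "q \<notin> A"
    then show ?thesis using L_pos by (simp add: excess_def)
  qed
qed (use L_pos in simp)

lemma excess_submean:
  assumes "component_union \<tau> A" "0 \<le> \<tau>" "q \<in> A"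
  shows "submean_at (excess \<tau> A) q"
proof -
  have q: "norm q < 1/8" "\<tau> < \<phi> q" using component_unionD[OF assms(1,3)] by auto
  have "open (superlevel \<tau>)" unfolding superlevel_def by (rule open_superlevel) auto
  moreover have "q \<in> superlevel \<tau>" using q by (simp add: superlevel_def)
  ultimately obtain \<delta> where \<delta>: "\<delta> > 0" "ball q \<delta> \<subseteq> superlevel \<tau>" using openE by blast
  then have A: "ball q \<delta> \<subseteq> A" using assms(1,3) unfolding component_union_def
    by (metis IntI centre_in_ball connected_ball empty_iff)
  obtain t0 where t0: "t0 > 0" "\<And>t. 0 < t \<Longrightarrow> t < t0 \<Longrightarrow> \<phi> q \<le> avg \<phi> q t"
    using submean[of q] pos_iff[of q] q assms(2) unfolding submean_at_def by auto
  have "excess \<tau> A q \<le> avg (excess \<tau> A) q t" if t: "0 < t" "t < min t0 (\<delta> / real DIM('a))" for t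
  proof -
    have "t * real DIM('a) < \<delta>" using t by (simp add: field_simps)
    then have cb: "cball q (t * real DIM('a)) \<subseteq> ball q \<delta>" by auto
    then have sub: "cball q (t * real DIM('a)) \<subseteq> ball 0 (1/8)" "cball q (t * real DIM('a)) \<subseteq> ball 0 1"
    proof -
      have "ball q \<delta> \<subseteq> ball 0 (1/8)" using \<delta>(2) by (auto simp: superlevel_def subset_eq)
      with cb show 1: "cball q (t * real DIM('a)) \<subseteq> ball 0 (1/8)" by (rule order_trans)
      have "ball 0 (1/8) \<subseteq> ball (0::'a) 1" by (rule subset_ball) simp
      with 1 show "cball q (t * real DIM('a)) \<subseteq> ball 0 1" by (rule order_trans)
    qed
    have c1: "continuous_on (cball q (t * real DIM('a))) \<phi>" by (rule continuous_on_subset[OF cont sub(2)])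
    have c2: "continuous_on (cball q (t * real DIM('a))) (excess \<tau> A)"
      by (rule continuous_on_subset[OF lipschitz_on_continuous_on[OF excess_lipschitz[OF assms(1)]] sub(1)])
    have "excess \<tau> A q = \<phi> q - \<tau>" using assms by (simp add: excess_def)
    also have "\<dots> \<le> avg \<phi> q t + (-1) * avg (\<lambda>_. \<tau>) q t" using t0(2)[of t] t by (simp add: avg_const)
    also have "\<dots> = avg (\<lambda>y. \<phi> y + (-1) * \<tau>) q t" using t by (intro avg_add[symmetric] c1) auto
    also have "\<dots> \<le> avg (excess \<tau> A) q t"
      using t A cb by (intro avg_mono c2 continuous_intros c1) (auto simp: excess_def)
    finally show ?thesis .
  qed
  moreover have "0 < min t0 (\<delta> / real DIM('a))" using t0 \<delta> by simp
  ultimately show ?thesis unfolding submean_at_def by blast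
qed

text \<open>A single point of the segment with \<open>\<phi> \<le> \<tau>\<close> bounds both
  factors. This is the cap against which the growth of the quotient is played off.\<close>

lemma excess_mult_le:
  assumes "component_union \<tau> A" "component_union \<tau> B" "A \<inter> B = {}" "x \<in> A" "y \<in> B"
  shows "excess \<tau> A x * excess \<tau> B y \<le> (L * norm (x - y))\<^sup>2"
proof -
  have x: "norm x < 1/8" "\<tau> < \<phi> x" and y: "norm y < 1/8" "\<tau> < \<phi> y"
    using component_unionD assms by blast+
  obtain w where w: "w \<in> closed_segment x y" "norm w < 1/8" "\<phi> w \<le> \<tau>"
    using segment_crosses[OF assms(1,4), of y] assms y by blast
  have "\<phi> x - \<tau> \<le> L * norm (x - w)" using lipD[of x w] w x by simp
  also have "\<dots> \<le> L * norm (x - y)" using segment_bound1[OF w(1)] L_pos by (intro mult_left_mono) (auto simp: norm_minus_commute)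
  finally have 1: "\<phi> x - \<tau> \<le> L * norm (x - y)" .
  have "\<phi> y - \<tau> \<le> L * norm (y - w)" using lipD[of y w] w y by simp
  also have "\<dots> \<le> L * norm (x - y)" using segment_bound[OF w(1)] L_pos by (intro mult_left_mono) (auto simp: norm_minus_commute)
  finally have 2: "\<phi> y - \<tau> \<le> L * norm (x - y)" .
  have "(\<phi> x - \<tau>) * (\<phi> y - \<tau>) \<le> (L * norm (x - y)) * (L * norm (x - y))"
    using 1 2 x y L_pos by (intro mult_mono) auto
  then show ?thesis using assms by (simp add: excess_def power2_eq_square)
qed

end

text \<open>If two points of \<open>{\<phi> > \<nu> \<rho>}\<close> near the origin lay in different components of \<open>{\<phi> > \<tau>}\<close>, then
  \<open>pair_improvement\<close> could be iterated: the pairs move away from the origin geometrically while the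
  quotient \<open>f x * g y / s\<^sup>2\<close> grows geometrically, although it is at most \<open>L\<^sup>2\<close>.\<close>

lemma superlevel_connected:
  fixes L \<kappa> \<theta> \<nu> :: real
  assumes "0 < L" "0 < \<kappa>" "0 < \<theta>" "\<theta> \<le> 1" "0 < \<nu>"
  shows "\<exists>\<rho> \<tau>. 0 < \<rho> \<and> \<rho> \<le> 1/8 \<and> 0 < \<tau> \<and> (\<forall>\<Omega> (\<phi> :: 'a::euclidean_space \<Rightarrow> real) x y.
    nice_domain L \<kappa> \<theta> \<Omega> \<phi> \<and> norm x < \<rho> \<and> norm y < \<rho> \<and> \<nu> * \<rho> < \<phi> x \<and> \<nu> * \<rho> < \<phi> y \<longrightarrow>
    y \<in> connected_component_set {q \<in> ball 0 (1/8). \<tau> < \<phi> q} x)"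
proof -
  \<comment> \<open>Initially both excesses are at least \<open>\<nu> * \<rho> / 2\<close> and the
    softened distance is at most \<open>3 * \<rho>\<close>, so the quotient is at least
    \<open>\<nu>\<^sup>2 / 36\<close>. It never falls below this, and with the cap
    \<open>(L * norm (p - q))\<^sup>2\<close> on the numerator this keeps
    \<open>norm (p - q)\<close> above \<open>rm * s\<close>.\<close>
  define c0 where "c0 = \<nu>\<^sup>2 / 36"
  define rm where "rm = min 1 (sqrt c0 / L)"
  have c0: "0 < c0" using assms by (simp add: c0_def)
  have rm: "0 < rm" "rm \<le> 1" "rm * L \<le> sqrt c0" using c0 assms by (auto simp: rm_def min_def field_simps)
  obtain R \<epsilon> where R: "0 < R" and \<epsilon>: "0 < \<epsilon>" and improve: "\<And>(f :: 'a \<Rightarrow> real) g x y a c L s.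
    x \<noteq> y \<and> 0 \<le> a \<and> s = norm (x - y) + a \<and> rm * s \<le> norm (x - y) \<and>
    norm (c - midpoint x y) \<le> 5 / 2 * s \<and> (\<forall>q\<in>ball c (\<theta> * s). f q = 0 \<and> g q = 0) \<and>
    L-lipschitz_on (ball (midpoint x y) (R * s)) f \<and> L-lipschitz_on (ball (midpoint x y) (R * s)) g \<and>
    (\<forall>q. 0 \<le> f q) \<and> (\<forall>q. 0 \<le> g q) \<and>
    (\<forall>q\<in>ball (midpoint x y) (R * s). 0 < f q \<longrightarrow> submean_at f q) \<and>
    (\<forall>q\<in>ball (midpoint x y) (R * s). 0 < g q \<longrightarrow> submean_at g q) \<and> 0 < f x \<and> 0 < g y \<Longrightarrow>
    (\<exists>x'\<in>ball (midpoint x y) (R * s). \<exists>y'\<in>ball (midpoint x y) (R * s).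
       (1 + \<epsilon>) * (f x * g y / s\<^sup>2) * (norm (x' - y') + a)\<^sup>2 < f x' * g y')"
    using pair_improvement[where 'a='a, OF assms(3,4) rm(1,2)] by blast
  obtain J where "L\<^sup>2 / c0 < (1 + \<epsilon>) ^ J" using real_arch_pow[of "1 + \<epsilon>"] \<epsilon> by auto
  then have J: "L\<^sup>2 < c0 * (1 + \<epsilon>) ^ J" using c0 by (simp add: field_simps)
  define B where "B = 2 * R + 1"
  have B: "1 \<le> B" using R by (simp add: B_def)
  \<comment> \<open>In each step the scale grows at most by the factor \<open>B\<close>. This
    \<open>\<rho>\<close> keeps all pairs of the \<open>J\<close> steps, and the balls around them,
    within \<open>1/32\<close> of the origin.\<close>
  define \<rho> where "\<rho> = 1 / (32 * (1 + 3 * (1 + R) * B ^ J))"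
  \<comment> \<open>The bound \<open>\<nu> * \<rho> / 2\<close> leaves room for the initial excess;
    the bound \<open>\<kappa> * \<rho>\<close> places points of \<open>\<Omega>\<close> near the
    origin with \<open>\<phi> \<le> \<tau>\<close> within \<open>\<rho>\<close> of the
    frontier.\<close>
  define \<tau> where "\<tau> = \<rho> * min (\<nu> / 2) \<kappa>"
  have den: "0 < 3 * (1 + R) * B ^ J" using R B by simp
  have \<rho>: "0 < \<rho>" "\<rho> \<le> 1/8" using den by (auto simp: \<rho>_def field_simps add_pos_pos intro: less_imp_le)
  have \<rho>eq: "\<rho> + (1 + R) * (3 * \<rho> * B ^ J) = 1/32"
  proof -
    have "\<rho> + (1 + R) * (3 * \<rho> * B ^ J) = \<rho> * (1 + 3 * (1 + R) * B ^ J)" by (simp add: algebra_simps)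
    also have "\<dots> = 1 / 32" unfolding \<rho>_def using den by (simp add: add_pos_pos less_imp_neq[symmetric])
    finally show ?thesis .
  qed
  have \<tau>: "0 < \<tau>" "\<tau> \<le> \<rho> * (\<nu> / 2)" "\<tau> \<le> \<kappa> * \<rho>"
    using \<rho> assms by (auto simp: \<tau>_def mult.commute[of \<kappa>] intro!: mult_left_mono)
  show ?thesis
  proof (rule exI[of _ \<rho>], rule exI[of _ \<tau>], intro conjI \<rho> \<tau>(1) allI impI)
    fix \<Omega> and \<phi> :: "'a \<Rightarrow> real" and x y
    assume *: "nice_domain L \<kappa> \<theta> \<Omega> \<phi> \<and> norm x < \<rho> \<and> norm y < \<rho> \<and> \<nu> * \<rho> < \<phi> x \<and> \<nu> * \<rho> < \<phi> y"
    then interpret nice_domain L \<kappa> \<theta> \<Omega> \<phi> by blast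
    have xy: "norm x < \<rho>" "norm y < \<rho>" "\<nu> * \<rho> < \<phi> x" "\<nu> * \<rho> < \<phi> y" using * by auto
    have \<tau>\<nu>: "\<tau> + \<nu> * \<rho> / 2 \<le> \<nu> * \<rho>" using \<tau>(2) by (simp add: mult.commute)
    have \<nu>\<rho>: "0 < \<nu> * \<rho>" using assms \<rho> by simp
    define A where "A = connected_component_set (superlevel \<tau>) x"
    define A' where "A' = superlevel \<tau> - A"
    have A: "component_union \<tau> A" unfolding A_def by (rule component_union_component)
    have A': "component_union \<tau> A'" unfolding A'_def by (rule component_union_diff[OF A])
    have xyS: "x \<in> superlevel \<tau>" "y \<in> superlevel \<tau>" using xy \<rho> \<tau>\<nu> \<nu>\<rho> by (auto simp: superlevel_def)
    have xA: "x \<in> A" using xyS by (simp add: A_def)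
    have "y \<in> A"
    proof (rule ccontr)
      assume "y \<notin> A"
      then have yA': "y \<in> A'" using xyS by (simp add: A'_def)
      define f where "f = excess \<tau> A"
      define g where "g = excess \<tau> A'"
      \<comment> \<open>The softening \<open>\<rho>\<close> is the same in all steps. It keeps
        \<open>s \<ge> \<rho>\<close>, so the frontier points found through
        \<open>\<tau> \<le> \<kappa> * \<rho>\<close> are within a multiple of
        \<open>s\<close>.\<close>
      have "\<exists>p q. p \<in> A \<and> q \<in> A' \<and> norm (p - q) + \<rho> \<le> 3 * \<rho> * B ^ j \<and> norm (midpoint p q) \<le> \<rho> + 3 * \<rho> * B ^ j \<and>
         c0 * (1 + \<epsilon>) ^ j * (norm (p - q) + \<rho>)\<^sup>2 \<le> f p * g q" if "j \<le> J" for j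
        using that
      proof (induction j)
        case 0
        have n: "norm (x - y) \<le> 2 * \<rho>" using norm_triangle_ineq4[of x y] xy by linarith
        have "norm (midpoint x y) \<le> \<rho>"
          using norm_triangle_ineq[of x y] xy by (simp add: midpoint_def)
        moreover have "c0 * (norm (x - y) + \<rho>)\<^sup>2 \<le> f x * g y"
        proof -
          have "(norm (x - y) + \<rho>)\<^sup>2 \<le> (3 * \<rho>)\<^sup>2" using n \<rho> by (intro power_mono) auto
          then have "c0 * (norm (x - y) + \<rho>)\<^sup>2 \<le> c0 * (3 * \<rho>)\<^sup>2" using c0 by simp
          also have "\<dots> = (\<nu> * \<rho> / 2) * (\<nu> * \<rho> / 2)" by (simp add: c0_def power2_eq_square)
          also have "\<dots> \<le> f x * g y"
            using xA yA' xy \<tau>\<nu> \<nu>\<rho> by (intro mult_mono) (auto simp: f_def g_def excess_def)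
          finally show ?thesis .
        qed
        ultimately show ?case using xA yA' n \<rho> by (rule_tac exI[of _ x], rule_tac exI[of _ y]) auto
      next
        case (Suc j)
        then obtain p q where pq: "p \<in> A" "q \<in> A'" and s_le: "norm (p - q) + \<rho> \<le> 3 * \<rho> * B ^ j"
          and m_le: "norm (midpoint p q) \<le> \<rho> + 3 * \<rho> * B ^ j"
          and G: "c0 * (1 + \<epsilon>) ^ j * (norm (p - q) + \<rho>)\<^sup>2 \<le> f p * g q" by auto
        define s where "s = norm (p - q) + \<rho>"
        define m where "m = midpoint p q"
        have s: "0 < s" "norm (p - q) < s" "\<rho> \<le> s" using \<rho> by (auto simp: s_def add_nonneg_pos)
        have pn: "norm p < 1/8" "\<tau> < \<phi> p" "norm q < 1/8" "\<tau> < \<phi> q"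
          using component_unionD[OF A pq(1)] component_unionD[OF A' pq(2)] by auto
        have "3 * \<rho> * B ^ j \<le> 3 * \<rho> * B ^ J" using B \<rho> Suc.prems by (intro mult_left_mono power_increasing) auto
        then have "(1 + R) * (3 * \<rho> * B ^ j) \<le> (1 + R) * (3 * \<rho> * B ^ J)" using R by (rule_tac mult_left_mono) auto
        then have bound: "\<rho> + (1 + R) * (3 * \<rho> * B ^ j) \<le> 1/32" using \<rho>eq by linarith
        have Rs: "R * s \<le> R * (3 * \<rho> * B ^ j)" using s_le R by (simp add: s_def)
        have mR: "norm m + R * s \<le> 1/32" using m_le Rs bound by (simp add: m_def algebra_simps)
        have s32: "s \<le> 1/32"
        proof -
          have "1 * (3 * \<rho> * B ^ j) \<le> (1 + R) * (3 * \<rho> * B ^ j)" using R \<rho> B by (intro mult_right_mono) auto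
          then show ?thesis using s_le bound \<rho> unfolding s_def by linarith
        qed
        have subs: "ball m (R * s) \<subseteq> ball 0 (1/8)"
        proof
          fix w assume "w \<in> ball m (R * s)"
          then show "w \<in> ball 0 (1/8)" using mR norm_triangle_sub[of w m] by (simp add: dist_norm norm_minus_commute)
        qed
        have disj: "A \<inter> A' = {}" by (auto simp: A'_def)
        have qA: "q \<notin> A" using pq disj by blast
        have G1: "f p * g q \<le> (L * norm (p - q))\<^sup>2" unfolding f_def g_def by (rule excess_mult_le[OF A A' disj pq])
        have G2: "c0 * s\<^sup>2 \<le> f p * g q"
        proof -
          have "c0 * s\<^sup>2 * 1 \<le> c0 * s\<^sup>2 * (1 + \<epsilon>) ^ j" using c0 \<epsilon> by (intro mult_left_mono one_le_power) auto
          then show ?thesis using G by (simp add: s_def ac_simps)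
        qed
        have ratio: "rm * s \<le> norm (p - q)"
        proof -
          have "(sqrt c0 * s)\<^sup>2 \<le> (L * norm (p - q))\<^sup>2" using G1 G2 c0 by (simp add: power_mult_distrib)
          then have "sqrt c0 * s \<le> L * norm (p - q)" using L_pos by (rule_tac power2_le_imp_le) auto
          moreover have "(rm * L) * s \<le> sqrt c0 * s" using rm(3) s by (intro mult_right_mono) auto
          ultimately have "L * (rm * s) \<le> L * norm (p - q)" by (simp add: ac_simps)
          then show ?thesis using L_pos by simp
        qed
        have segm: "norm (w - m) \<le> s / 2" if w: "w \<in> closed_segment p q" for w
        proof -
          have "p \<in> cball m (s / 2)" "q \<in> cball m (s / 2)"
            using s by (auto simp: m_def dist_midpoint dist_commute[of "midpoint p q"]) (auto simp: dist_norm norm_minus_commute)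
          then have "closed_segment p q \<subseteq> cball m (s / 2)" by (intro closed_segment_subset) auto
          then show ?thesis using w by (auto simp: dist_norm norm_minus_commute)
        qed
        \<comment> \<open>A segment between different components either leaves
          \<open>\<Omega>\<close>, and then meets the frontier, or contains a point of
          \<open>\<Omega>\<close> with \<open>\<phi> \<le> \<tau>\<close>, and then passes close to
          it.\<close>
        obtain z where z: "z \<in> frontier \<Omega>" "norm (z - m) \<le> 3 / 2 * s"
        proof (cases "closed_segment p q \<subseteq> \<Omega>")
          case True
          obtain w where w: "w \<in> closed_segment p q" "norm w < 1/8" "\<phi> w \<le> \<tau>"
            using segment_crosses[OF A pq(1) qA pn(3)] by blast
          obtain z where z: "z \<in> frontier \<Omega>" "\<kappa> * norm (w - z) \<le> \<phi> w"
          proof -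
            have "w \<in> \<Omega>" "norm w < 1/2" using True w by auto
            then show thesis using nearest_frontier that by blast
          qed
          have "\<kappa> * norm (w - z) \<le> \<kappa> * \<rho>" using z w \<tau> by linarith
          then have "norm (w - z) \<le> s" using \<kappa>_pos s by simp
          moreover have "norm (w - m) \<le> s / 2" by (rule segm[OF w(1)])
          ultimately have "norm (z - m) \<le> 3 / 2 * s" using norm_triangle_ineq[of "z - w" "w - m"] by (simp add: norm_minus_commute)
          then show thesis using that z by blast
        next
          case False
          have "p \<in> \<Omega>" using pos_iff[of p] pn \<tau> by simp
          then obtain w where w: "w \<in> closed_segment p q" "w \<in> frontier \<Omega>"
            using connected_Int_frontier[OF connected_segment(1)[of p q], of \<Omega>] False by blast
          have "norm (w - m) \<le> s / 2" by (rule segm[OF w(1)])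
          then show thesis using that[OF w(2)] s by linarith
        qed
        have "norm z < 1/2" using z(2) s32 mR norm_triangle_sub[of z m] mult_pos_pos[OF R s(1)] by linarith
        then obtain c where c: "ball c (\<theta> * s) \<subseteq> ball z s - \<Omega>"
          using exterior_ball[OF z(1) _ s(1)] s32 by auto
        have "c \<in> ball z s" using c s assms by (metis DiffD1 centre_in_ball mult_pos_pos subsetD)
        then have cm: "norm (c - m) \<le> 5 / 2 * s"
          using z(2) norm_triangle_ineq[of "c - z" "z - m"] by (simp add: dist_norm norm_minus_commute)
        have in\<Omega>: "w \<in> \<Omega>" if "w \<in> A \<or> w \<in> A'" for w
        proof -
          have "norm w < 1/8 \<and> \<tau> < \<phi> w" using component_unionD[OF A] component_unionD[OF A'] that by blast
          then show ?thesis using pos_iff[of w] \<tau> by simp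
        qed
        have fgpos: "0 < f p" "0 < g q" using excess_pos_iff[OF A] excess_pos_iff[OF A'] pq by (auto simp: f_def g_def)
        have "\<exists>x'\<in>ball (midpoint p q) (R * s). \<exists>y'\<in>ball (midpoint p q) (R * s).
           (1 + \<epsilon>) * (f p * g q / s\<^sup>2) * (norm (x' - y') + \<rho>)\<^sup>2 < f x' * g y'"
        proof (rule improve[of p q \<rho> s c f g L], intro conjI ballI allI impI)
          show "p \<noteq> q" using pq qA by blast
          show "0 \<le> \<rho>" "s = norm (p - q) + \<rho>" "rm * s \<le> norm (p - q)" using \<rho> ratio by (auto simp: s_def)
          show "norm (c - midpoint p q) \<le> 5 / 2 * s" using cm by (simp add: m_def)
          show "f w = 0" "g w = 0" if "w \<in> ball c (\<theta> * s)" for w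
            using in\<Omega>[of w] c that by (auto simp: f_def g_def excess_def)
          show "L-lipschitz_on (ball (midpoint p q) (R * s)) f" "L-lipschitz_on (ball (midpoint p q) (R * s)) g"
            unfolding f_def g_def using excess_lipschitz[OF A] excess_lipschitz[OF A'] subs
            by (auto intro: lipschitz_on_subset simp: m_def)
          show "0 \<le> f w" "0 \<le> g w" for w
            unfolding f_def g_def using excess_nonneg[OF A] excess_nonneg[OF A'] by auto
          show "submean_at f w" if "w \<in> ball (midpoint p q) (R * s)" "0 < f w" for w
            using that \<tau> unfolding f_def by (intro excess_submean[OF A]) (auto simp: excess_pos_iff[OF A])
          show "submean_at g w" if "w \<in> ball (midpoint p q) (R * s)" "0 < g w" for w
            using that \<tau> unfolding g_def by (intro excess_submean[OF A']) (auto simp: excess_pos_iff[OF A'])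
        qed (use fgpos in auto)
        then obtain x' y' where x': "x' \<in> ball m (R * s)" "y' \<in> ball m (R * s)"
          and big: "(1 + \<epsilon>) * (f p * g q / s\<^sup>2) * (norm (x' - y') + \<rho>)\<^sup>2 < f x' * g y'" unfolding m_def by blast
        have grow: "c0 * (1 + \<epsilon>) ^ Suc j * (norm (x' - y') + \<rho>)\<^sup>2 \<le> f x' * g y'"
        proof -
          have "c0 * (1 + \<epsilon>) ^ j \<le> f p * g q / s\<^sup>2" using G s by (simp add: s_def[symmetric] pos_le_divide_eq)
          then have "(1 + \<epsilon>) * (c0 * (1 + \<epsilon>) ^ j) * (norm (x' - y') + \<rho>)\<^sup>2 \<le> (1 + \<epsilon>) * (f p * g q / s\<^sup>2) * (norm (x' - y') + \<rho>)\<^sup>2"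
            using \<epsilon> by (intro mult_right_mono mult_left_mono) auto
          then show ?thesis using big by (simp add: ac_simps)
        qed
        have "0 < (1 + \<epsilon>) * (f p * g q / s\<^sup>2) * (norm (x' - y') + \<rho>)\<^sup>2"
          using \<epsilon> fgpos s add_nonneg_pos[OF norm_ge_zero \<rho>(1), of "x' - y'"] by simp
        then have "0 < f x' * g y'" using big by linarith
        then have "0 < f x'" "0 < g y'"
          using excess_nonneg[OF A, of x'] excess_nonneg[OF A', of y'] by (auto simp: f_def g_def zero_less_mult_iff)
        then have mem: "x' \<in> A" "y' \<in> A'" using excess_pos_iff[OF A] excess_pos_iff[OF A'] by (auto simp: f_def g_def)
        have nx: "norm (x' - m) < R * s" "norm (y' - m) < R * s" using x' by (auto simp: dist_norm norm_minus_commute)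
        have "norm (x' - y') < 2 * (R * s)"
          using nx norm_triangle_ineq4[of "x' - m" "y' - m"] by simp
        then have "norm (x' - y') + \<rho> \<le> B * s" using s by (simp add: B_def algebra_simps)
        also have "\<dots> \<le> B * (3 * \<rho> * B ^ j)" using s_le B by (intro mult_left_mono) (auto simp: s_def)
        finally have 1: "norm (x' - y') + \<rho> \<le> 3 * \<rho> * B ^ Suc j" by (simp add: ac_simps)
        have "midpoint x' y' - m = (1/2) *\<^sub>R ((x' - m) + (y' - m))"
        proof -
          have "(x' - m) + (y' - m) = (x' + y') - 2 *\<^sub>R m" by (simp add: scaleR_2)
          moreover have "(1/2) *\<^sub>R (x' + y') = midpoint x' y'" by (simp add: midpoint_def)
          ultimately show ?thesis by (simp only: scaleR_diff_right) simp
        qed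
        then have "norm (midpoint x' y' - m) \<le> R * s"
          using nx norm_triangle_ineq[of "x' - m" "y' - m"] by simp
        then have "norm (midpoint x' y') \<le> norm m + R * s" using norm_triangle_sub[of "midpoint x' y'" m] by linarith
        also have "\<dots> \<le> \<rho> + 3 * \<rho> * B ^ j + R * (3 * \<rho> * B ^ j)" using m_le Rs by (simp add: m_def)
        also have "\<dots> \<le> \<rho> + B * (3 * \<rho> * B ^ j)" using R \<rho> B by (simp add: B_def algebra_simps)
        finally have 2: "norm (midpoint x' y') \<le> \<rho> + 3 * \<rho> * B ^ Suc j" by (simp add: ac_simps)
        show ?case using mem grow 1 2 by blast
      qed
      from this[of J] obtain p q where pq: "p \<in> A" "q \<in> A'"
        and G: "c0 * (1 + \<epsilon>) ^ J * (norm (p - q) + \<rho>)\<^sup>2 \<le> f p * g q" by auto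
      have "f p * g q \<le> (L * norm (p - q))\<^sup>2" unfolding f_def g_def by (rule excess_mult_le[OF A A' _ pq]) (auto simp: A'_def)
      also have "\<dots> \<le> L\<^sup>2 * (norm (p - q) + \<rho>)\<^sup>2"
        unfolding power_mult_distrib using \<rho> by (intro mult_left_mono power_mono) auto
      also have "\<dots> < c0 * (1 + \<epsilon>) ^ J * (norm (p - q) + \<rho>)\<^sup>2"
        using J add_nonneg_pos[OF norm_ge_zero \<rho>(1), of "p - q"] by (intro mult_strict_right_mono) auto
      finally show False using G by linarith
    qed
    then show "y \<in> connected_component_set {q \<in> ball 0 (1/8). \<tau> < \<phi> q} x"
      by (simp add: A_def superlevel_def)
  qed
qed

section \<open>The comparison of two solutions\<close>

definition nonneg_solution :: "'a::euclidean_space set \<Rightarrow> ('a \<Rightarrow> real) \<Rightarrow> bool" where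
  "nonneg_solution \<Omega> u \<longleftrightarrow> continuous_on (ball 0 1) u \<and> (\<forall>x\<in>ball 0 1. 0 \<le> u x) \<and>
     mean_value_on u \<Omega> \<and> (\<forall>x\<in>ball 0 1 - \<Omega>. u x = 0)"

text \<open>Points with \<open>\<phi> > \<tau>\<close> carry balls inside \<open>\<Omega>\<close>
  whose radius is fixed by \<open>\<tau>\<close> and \<open>L\<close>. The connected set supplied by
  \<open>superlevel_connected\<close> therefore supports a Harnack chain with a uniform
  constant.\<close>

lemma superlevel_harnack:
  fixes L \<kappa> \<theta> \<nu> :: real
  assumes "0 < L" "0 < \<kappa>" "0 < \<theta>" "\<theta> \<le> 1" "0 < \<nu>"
  shows "\<exists>\<rho> C. 0 < \<rho> \<and> \<rho> \<le> 1/8 \<and> 1 \<le> C \<and> (\<forall>\<Omega> (\<phi> :: 'a::euclidean_space \<Rightarrow> real) u x y.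
    nice_domain L \<kappa> \<theta> \<Omega> \<phi> \<and> nonneg_solution \<Omega> u \<and> norm x < \<rho> \<and> norm y < \<rho> \<and> \<nu> * \<rho> < \<phi> x \<and> \<nu> * \<rho> < \<phi> y \<longrightarrow>
    u x \<le> C * u y)"
proof -
  obtain \<rho> \<tau> where \<rho>: "0 < \<rho>" "\<rho> \<le> 1/8" and \<tau>: "0 < \<tau>" and conn: "\<And>\<Omega> (\<phi> :: 'a \<Rightarrow> real) x y.
    nice_domain L \<kappa> \<theta> \<Omega> \<phi> \<Longrightarrow> norm x < \<rho> \<Longrightarrow> norm y < \<rho> \<Longrightarrow> \<nu> * \<rho> < \<phi> x \<Longrightarrow> \<nu> * \<rho> < \<phi> y \<Longrightarrow>
    y \<in> connected_component_set {q \<in> ball 0 (1/8). \<tau> < \<phi> q} x"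
    using superlevel_connected[where 'a='a, OF assms] by blast
  define t where "t = min (\<tau> / L) (1/8)"
  have t: "0 < t" "t \<le> 1/8" "L * t \<le> \<tau>" using \<tau> assms by (auto simp: t_def min_def field_simps)
  obtain C where C: "1 \<le> C" and harnack: "\<And>(u :: 'a \<Rightarrow> real) U S p t' x y. mean_value_on u U \<and> (\<forall>x\<in>U. 0 \<le> u x) \<and>
     t' > 0 \<and> S \<subseteq> ball p (1 / (8 * t) * t') \<and> (\<forall>q\<in>S. ball q t' \<subseteq> U) \<and> y \<in> connected_component_set S x \<Longrightarrow> u x \<le> C * u y"
    using harnack_chain[where 'a='a, of "1 / (8 * t)"] by blast
  show ?thesis
  proof (rule exI[of _ \<rho>], rule exI[of _ C], intro conjI \<rho> C allI impI)
    fix \<Omega> and \<phi> u :: "'a \<Rightarrow> real" and x y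
    assume *: "nice_domain L \<kappa> \<theta> \<Omega> \<phi> \<and> nonneg_solution \<Omega> u \<and> norm x < \<rho> \<and> norm y < \<rho> \<and> \<nu> * \<rho> < \<phi> x \<and> \<nu> * \<rho> < \<phi> y"
    then interpret nice_domain L \<kappa> \<theta> \<Omega> \<phi> by blast
    have u: "nonneg_solution \<Omega> u" using * by blast
    show "u x \<le> C * u y"
    proof (rule harnack, intro conjI ballI)
      show "mean_value_on u \<Omega>" "0 < t" using u t by (auto simp: nonneg_solution_def)
      show "0 \<le> u q" if "q \<in> \<Omega>" for q using u that dom_subset by (auto simp: nonneg_solution_def)
      show "y \<in> connected_component_set {q \<in> ball 0 (1/8). \<tau> < \<phi> q} x" using * by (intro conn) auto
      show "{q \<in> ball 0 (1/8). \<tau> < \<phi> q} \<subseteq> ball 0 (1 / (8 * t) * t)" using t by auto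
      fix q assume q: "q \<in> {q \<in> ball 0 (1/8). \<tau> < \<phi> q}"
      show "ball q t \<subseteq> \<Omega>"
      proof
        fix p assume "p \<in> ball q t"
        then have p: "norm (q - p) < t" by (simp add: dist_norm)
        have n: "norm p < 1" "norm q < 1" using p q t norm_triangle_sub[of p q] by (auto simp: norm_minus_commute)
        have "\<phi> q - \<phi> p \<le> L * norm (q - p)" using lipD[OF n(2,1)] by simp
        also have "\<dots> \<le> L * t" using p assms by (intro mult_left_mono) auto
        finally show "p \<in> \<Omega>" using pos_iff[OF n(1)] q t by simp
      qed
    qed
  qed
qed

lemma (in nice_domain) \<phi>_le: "norm x < 1 \<Longrightarrow> \<phi> x \<le> L"
proof -
  assume x: "norm x < 1"
  have "\<phi> x \<le> L * norm x" using lipD[OF x, of 0] frontier_zero[OF zero_frontier] by simp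
  also have "\<dots> \<le> L * 1" using x L_pos by (intro mult_left_mono) auto
  finally show ?thesis by simp
qed

text \<open>From \<open>x\<close> one climbs above the level \<open>\<nu> * R\<close>, where values
  are compared with the one at \<open>P\<close> along a connected superlevel set. The power of
  \<open>\<phi> x\<close> is the price of the climb.\<close>

lemma growth_bounds:
  fixes L \<kappa> \<theta> \<eta> :: real
  assumes "0 < L" "0 < \<kappa>" "0 < \<theta>" "\<theta> \<le> 1" "0 < \<eta>"
  shows "\<exists>R \<nu> C (K::nat). 0 < R \<and> R \<le> 1/8 \<and> 0 < \<nu> \<and> \<nu> \<le> \<eta> \<and> 1 \<le> C \<and> 0 < K \<and>
    (\<forall>\<Omega> (\<phi> :: 'a::euclidean_space \<Rightarrow> real) u P x. nice_domain L \<kappa> \<theta> \<Omega> \<phi> \<and> nonneg_solution \<Omega> u \<and>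
      norm P < R \<and> \<nu> * R < \<phi> P \<and> x \<in> \<Omega> \<and> norm x < R / 2 \<longrightarrow>
      u x * \<phi> x ^ K \<le> C * u P \<and> u P * \<phi> x ^ K \<le> C * u x)"
proof -
  obtain C2 K where C2: "1 \<le> C2" and climb: "\<And>\<theta> \<Omega> (\<phi> :: 'a \<Rightarrow> real) x \<tau>.
    nice_domain L \<kappa> \<theta> \<Omega> \<phi> \<and> x \<in> \<Omega> \<and> \<phi> x \<le> \<tau> \<and> norm x + C2 * \<tau> \<le> 1/4 \<Longrightarrow>
    (\<exists>y. norm (y - x) < C2 * \<tau> \<and> \<tau> \<le> \<phi> y \<and> \<phi> y \<le> C2 * \<tau> \<and> y \<in> \<Omega> \<and>
      (\<forall>u U. mean_value_on u U \<and> (\<forall>q\<in>U. 0 \<le> u q) \<and> ball x (C2 * \<tau>) \<inter> \<Omega> \<subseteq> U \<longrightarrow>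
         u x * \<phi> x ^ K \<le> u y * \<phi> y ^ K \<and> u y * \<phi> x ^ K \<le> u x * \<phi> y ^ K))"
    using climb[where 'a='a, OF assms(1,2)] by blast
  \<comment> \<open>A climb to the level \<open>2 * \<nu> * R\<close> travels less than
    \<open>R / 2\<close> and so ends in \<open>ball 0 R\<close>. \<open>\<nu>\<close> has to be
    fixed first, since \<open>R\<close> depends on it through connectedness.\<close>
  define \<nu> where "\<nu> = min \<eta> (1 / (4 * C2))"
  have \<nu>: "0 < \<nu>" "\<nu> \<le> \<eta>" "4 * C2 * \<nu> \<le> 1" using assms C2 by (auto simp: \<nu>_def min_def field_simps)
  obtain R H where R: "0 < R" "R \<le> 1/8" and H: "1 \<le> H" and harnack: "\<And>\<Omega> (\<phi> :: 'a \<Rightarrow> real) u x y.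
    nice_domain L \<kappa> \<theta> \<Omega> \<phi> \<and> nonneg_solution \<Omega> u \<and> norm x < R \<and> norm y < R \<and> \<nu> * R < \<phi> x \<and> \<nu> * R < \<phi> y \<Longrightarrow>
    u x \<le> H * u y"
    using superlevel_harnack[where 'a='a, OF assms(1-4) \<nu>(1)] by blast
  define Lm where "Lm = max L 1"
  have Lm: "1 \<le> Lm" "L \<le> Lm" by (auto simp: Lm_def)
  define C where "C = H * Lm ^ Suc K"
  have "1 * 1 \<le> C" unfolding C_def using H Lm one_le_power[OF Lm(1), of "Suc K"] by (intro mult_mono) auto
  then have C: "1 \<le> C" by simp
  show ?thesis
  \<comment> \<open>\<open>Suc K\<close> makes the exponent positive, and the extra factor
    \<open>\<phi> x \<le> Lm\<close> goes into \<open>C\<close>. Positivity is used in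
    \<open>carleson\<close>, where the weight must vanish on the sphere.\<close>
  proof (rule exI[of _ R], rule exI[of _ \<nu>], rule exI[of _ C], rule exI[of _ "Suc K"], intro conjI R \<nu>(1,2) C allI impI)
    fix \<Omega> and \<phi> u :: "'a \<Rightarrow> real" and P x :: 'a
    assume *: "nice_domain L \<kappa> \<theta> \<Omega> \<phi> \<and> nonneg_solution \<Omega> u \<and> norm P < R \<and> \<nu> * R < \<phi> P \<and> x \<in> \<Omega> \<and> norm x < R / 2"
    then interpret nice_domain L \<kappa> \<theta> \<Omega> \<phi> by blast
    have u: "nonneg_solution \<Omega> u" and P: "norm P < R" "\<nu> * R < \<phi> P" and x: "x \<in> \<Omega>" "norm x < R / 2" using * by auto
    have \<phi>x: "0 < \<phi> x" "\<phi> x \<le> Lm" using pos[OF x(1)] \<phi>_le[of x] Lm x R by auto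
    have unn: "0 \<le> u q" if "norm q < 1" for q using u that by (simp add: nonneg_solution_def)
    have uP: "0 \<le> u P" "0 \<le> u x" using P R x by (auto intro!: unn)
    obtain y where y: "norm y < R" "\<nu> * R < \<phi> y" "u x * \<phi> x ^ K \<le> u y * \<phi> y ^ K" "u y * \<phi> x ^ K \<le> u x * \<phi> y ^ K"
    proof (cases "\<nu> * R < \<phi> x")
      case True
      then show thesis using that[of x] x R by simp
    next
      case False
      define \<tau> where "\<tau> = 2 * \<nu> * R"
      have "4 * C2 * \<nu> * R \<le> 1 * R" using \<nu>(3) R by (intro mult_right_mono) auto
      then have C\<tau>: "C2 * \<tau> \<le> R / 2" by (simp add: \<tau>_def)
      have "0 < \<nu> * R" using \<nu> R by simp
      then have \<tau>: "\<phi> x \<le> \<tau>" "\<nu> * R < \<tau>" using False unfolding \<tau>_def by linarith+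
      have "\<exists>y. norm (y - x) < C2 * \<tau> \<and> \<tau> \<le> \<phi> y \<and> \<phi> y \<le> C2 * \<tau> \<and> y \<in> \<Omega> \<and>
        (\<forall>u U. mean_value_on u U \<and> (\<forall>q\<in>U. 0 \<le> u q) \<and> ball x (C2 * \<tau>) \<inter> \<Omega> \<subseteq> U \<longrightarrow>
           u x * \<phi> x ^ K \<le> u y * \<phi> y ^ K \<and> u y * \<phi> x ^ K \<le> u x * \<phi> y ^ K)"
        using nice_domain_axioms x \<tau> C\<tau> R by (intro climb) auto
      then obtain y where y: "norm (y - x) < C2 * \<tau>" "\<tau> \<le> \<phi> y" and uy: "mean_value_on u \<Omega> \<and> (\<forall>q\<in>\<Omega>. 0 \<le> u q) \<and> ball x (C2 * \<tau>) \<inter> \<Omega> \<subseteq> \<Omega> \<longrightarrow>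
           u x * \<phi> x ^ K \<le> u y * \<phi> y ^ K \<and> u y * \<phi> x ^ K \<le> u x * \<phi> y ^ K" by blast
      have "norm y < R" using y(1) C\<tau> x(2) norm_triangle_sub[of y x] by linarith
      moreover have "mean_value_on u \<Omega>" "\<forall>q\<in>\<Omega>. 0 \<le> u q" using u dom_subset by (auto simp: nonneg_solution_def)
      ultimately show thesis using that[of y] uy y \<tau> by auto
    qed
    have y1: "norm y < 1" using y(1) R by linarith
    have \<phi>y: "0 < \<phi> y" "\<phi> y \<le> Lm" using y(2) mult_pos_pos[OF \<nu>(1) R(1)] \<phi>_le[OF y1] Lm by linarith+
    have "u y \<le> H * u P" "u P \<le> H * u y" using * y by (auto intro!: harnack)
    have pw: "0 \<le> \<phi> x ^ K" "\<phi> y ^ K \<le> Lm ^ K" "0 \<le> \<phi> y ^ K" "0 < Lm ^ K" using \<phi>x \<phi>y Lm by (auto intro!: power_mono)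
    have "u x * \<phi> x ^ K \<le> (H * u P) * Lm ^ K"
    proof -
      have "u y * \<phi> y ^ K \<le> (H * u P) * Lm ^ K"
        using \<open>u y \<le> H * u P\<close> pw unn[OF y1] H uP by (intro mult_mono) auto
      then show ?thesis using y(3) by linarith
    qed
    then have 1: "(u x * \<phi> x ^ K) * \<phi> x \<le> ((H * u P) * Lm ^ K) * Lm"
      using \<phi>x uP H pw by (rule_tac mult_mono) auto
    have "u P * \<phi> x ^ K \<le> (H * u x) * Lm ^ K"
    proof -
      have "u P * \<phi> x ^ K \<le> (H * u y) * \<phi> x ^ K" using \<open>u P \<le> H * u y\<close> pw by (intro mult_right_mono)
      also have "\<dots> = H * (u y * \<phi> x ^ K)" by simp
      also have "\<dots> \<le> H * (u x * \<phi> y ^ K)" using y(4) H by (intro mult_left_mono) auto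
      also have "\<dots> \<le> H * (u x * Lm ^ K)" using H pw uP by (intro mult_left_mono) auto
      finally show ?thesis by simp
    qed
    then have 2: "(u P * \<phi> x ^ K) * \<phi> x \<le> ((H * u x) * Lm ^ K) * Lm"
      using \<phi>x uP H pw by (rule_tac mult_mono) auto
    show "u x * \<phi> x ^ Suc K \<le> C * u P" using 1 by (simp add: C_def ac_simps)
    show "u P * \<phi> x ^ Suc K \<le> C * u x" using 2 by (simp add: C_def ac_simps)
  qed simp
qed

section \<open>The Carleson estimate\<close>

lemma small_power:
  fixes q b :: real
  assumes "0 < q" "q < 1" "0 < b"
  obtains n where "q ^ n < b"
  using real_arch_pow_inv[of b q] assms by blast

text \<open>Maximising \<open>u x * (R' - norm x) ^ K\<close> produces a point so close to the boundary, relative to the room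
  available around it, that \<open>boundary_decay\<close> contradicts maximality.\<close>

lemma carleson:
  fixes L \<kappa> \<theta> \<eta> :: real
  assumes "0 < L" "0 < \<kappa>" "0 < \<theta>" "\<theta> \<le> 1" "0 < \<eta>"
  shows "\<exists>R \<nu> C (K::nat). 0 < R \<and> R \<le> 1/8 \<and> 0 < \<nu> \<and> \<nu> \<le> \<eta> \<and> 1 \<le> C \<and>
    (\<forall>\<Omega> (\<phi> :: 'a::euclidean_space \<Rightarrow> real) u P x. nice_domain L \<kappa> \<theta> \<Omega> \<phi> \<and> nonneg_solution \<Omega> u \<and>
      norm P < R \<and> \<nu> * R < \<phi> P \<and> norm x < R / 4 \<longrightarrow>
      u x \<le> C * u P \<and> (x \<in> \<Omega> \<longrightarrow> u P * \<phi> x ^ K \<le> C * u x))"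
proof -
  obtain R \<nu> C1 K where R: "0 < R" "R \<le> 1/8" and \<nu>: "0 < \<nu>" "\<nu> \<le> \<eta>" and C1: "1 \<le> C1" and K: "0 < K"
    and growth: "\<And>\<Omega> (\<phi> :: 'a \<Rightarrow> real) u P x. nice_domain L \<kappa> \<theta> \<Omega> \<phi> \<and> nonneg_solution \<Omega> u \<and>
      norm P < R \<and> \<nu> * R < \<phi> P \<and> x \<in> \<Omega> \<and> norm x < R / 2 \<Longrightarrow>
      u x * \<phi> x ^ K \<le> C1 * u P \<and> u P * \<phi> x ^ K \<le> C1 * u x"
    using growth_bounds[where 'a='a, OF assms] by blast
  obtain c where c: "0 < c" "c < 1" and decay: "\<And>L \<kappa> \<Omega> (\<phi> :: 'a \<Rightarrow> real) f z r n m x.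
    nice_domain L \<kappa> \<theta> \<Omega> \<phi> \<and> continuous_on (ball 0 1) f \<and> (\<forall>x\<in>ball 0 1 - \<Omega>. f x \<le> 0) \<and>
    (\<forall>x\<in>\<Omega>. 0 < f x \<longrightarrow> submean_at f x) \<and> z \<in> frontier \<Omega> \<and> 0 < r \<and> norm z + 5 ^ n * r < 1/2 \<and> 0 \<le> m \<and>
    (\<forall>x\<in>ball z (5 ^ n * r). f x \<le> m) \<and> x \<in> ball z r \<Longrightarrow> f x \<le> (1 - c) ^ n * m"
    using boundary_decay[where 'a='a, OF assms(3)] by blast
  obtain n where n: "(1 - c) ^ n < 1 / 2 ^ K" using small_power[of "1 - c" "1 / 2 ^ K"] c by auto
  \<comment> \<open>At the maximum \<open>\<phi> p < \<epsilon> * d\<close> puts the frontier within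
    \<open>r = 2 * \<epsilon> * d / \<kappa>\<close>, and \<open>5 ^ n * r = d / 4\<close>. So all
    \<open>n\<close> decays take place where the room \<open>R' - norm q\<close> is still at least
    \<open>d / 2\<close>; there \<open>u\<close> is at most \<open>2 ^ K * u p\<close>, a factor
    that the choice of \<open>n\<close> outweighs.\<close>
  define \<epsilon> where "\<epsilon> = \<kappa> / (8 * 5 ^ n)"
  have \<epsilon>: "0 < \<epsilon>" "\<epsilon> \<le> \<kappa> / 8" using assms one_le_power[of "5::real" n] by (auto simp: \<epsilon>_def field_simps)
  \<comment> \<open>Between \<open>R / 4\<close>, where the bound is claimed, and
    \<open>R / 2\<close>, where the growth bounds hold; this leaves the room \<open>R / 8\<close> at
    the points of interest.\<close>
  define R' where "R' = 3 / 8 * R"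
  define C where "C = max C1 (C1 / \<epsilon> ^ K / (R / 8) ^ K)"
  have C: "1 \<le> C" "C1 \<le> C" "C1 / \<epsilon> ^ K / (R / 8) ^ K \<le> C" using C1 by (auto simp: C_def)
  show ?thesis
  proof (rule exI[of _ R], rule exI[of _ \<nu>], rule exI[of _ C], rule exI[of _ K], intro conjI R \<nu> C(1) allI impI)
    fix \<Omega> and \<phi> u :: "'a \<Rightarrow> real" and P x :: 'a
    assume *: "nice_domain L \<kappa> \<theta> \<Omega> \<phi> \<and> nonneg_solution \<Omega> u \<and> norm P < R \<and> \<nu> * R < \<phi> P \<and> norm x < R / 4"
    then interpret nice_domain L \<kappa> \<theta> \<Omega> \<phi> by blast
    have u: "nonneg_solution \<Omega> u" and P: "norm P < R" "\<nu> * R < \<phi> P" and x: "norm x < R / 4" using * by auto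
    have unn: "0 \<le> u q" if "norm q < 1" for q using u that by (simp add: nonneg_solution_def)
    have contu: "continuous_on (ball 0 1) u" and mv: "mean_value_on u \<Omega>" and u0: "\<And>q. norm q < 1 \<Longrightarrow> q \<notin> \<Omega> \<Longrightarrow> u q = 0"
      using u by (auto simp: nonneg_solution_def)
    have uP: "0 \<le> u P" using P R by (intro unn) simp
    show "u P * \<phi> x ^ K \<le> C * u x" if "x \<in> \<Omega>"
    proof -
      have "norm x < R / 2" "norm x < 1" using x R by linarith+
      then have "u P * \<phi> x ^ K \<le> C1 * u x" "0 \<le> u x" using growth * that unn by blast+
      moreover have "C1 * u x \<le> C * u x" using C \<open>0 \<le> u x\<close> by (intro mult_right_mono)
      ultimately show ?thesis by linarith
    qed
    define g where "g q = u q * (R' - norm q) ^ K" for q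
    have R': "0 < R'" "R' < R / 2" "R' < 1/16" using R by (auto simp: R'_def)
    have "continuous_on (cball 0 R') g" unfolding g_def
      using R' by (intro continuous_intros continuous_on_subset[OF contu]) auto
    moreover have "cball (0::'a) R' \<noteq> {}" using R' by simp
    ultimately obtain p where p: "norm p \<le> R'" and pmax: "\<And>q. norm q \<le> R' \<Longrightarrow> g q \<le> g p"
      using continuous_attains_sup[of "cball 0 R'" g] by (auto simp: Ball_def)
    have "g p \<le> C1 / \<epsilon> ^ K * u P"
    proof (rule ccontr)
      assume neg: "\<not> ?thesis"
      define d where "d = R' - norm p"
      have "0 \<le> C1 / \<epsilon> ^ K * u P" using C1 \<epsilon> uP by simp
      then have gp: "0 < g p" using neg by linarith
      have d0: "0 \<le> d" using p by (simp add: d_def)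
      have p1: "norm p < 1" "norm p < R / 2" using p R' by linarith+
      have "d \<noteq> 0" using gp K by (auto simp: g_def d_def zero_power)
      then have d: "0 < d" using d0 by simp
      have up: "0 < u p" using gp d unn[OF p1(1)] by (auto simp: g_def zero_less_mult_iff)
      then have p\<Omega>: "p \<in> \<Omega>" using u0[OF p1(1)] by force
      have "u p * \<phi> p ^ K \<le> C1 * u P" using growth * p\<Omega> p1 by blast
      also have "\<dots> = \<epsilon> ^ K * (C1 / \<epsilon> ^ K * u P)" using \<epsilon> by simp
      also have "\<dots> < \<epsilon> ^ K * g p" using neg \<epsilon> by (intro mult_strict_left_mono) auto
      also have "\<dots> = u p * (\<epsilon> * d) ^ K" by (simp add: g_def d_def power_mult_distrib)
      finally have "\<phi> p ^ K < (\<epsilon> * d) ^ K" using up by simp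
      then have \<phi>p: "\<phi> p < \<epsilon> * d" using \<epsilon> d by (intro power_less_imp_less_base[of "\<phi> p" K]) auto
      have "norm p < 1/2" using p1(2) R by linarith
      from nearest_frontier[OF p\<Omega> this]
      obtain z where z: "z \<in> frontier \<Omega>" "norm z \<le> 2 * norm p" "\<kappa> * norm (p - z) \<le> \<phi> p" by blast
      define r where "r = 2 * \<epsilon> * d / \<kappa>"
      have r: "0 < r" "5 ^ n * r = d / 4" using \<epsilon> d assms by (auto simp: r_def \<epsilon>_def)
      have "\<kappa> * norm (p - z) < \<epsilon> * d" using z \<phi>p by linarith
      then have pz: "norm (p - z) < \<epsilon> * d / \<kappa>" using assms by (simp add: field_simps)
      have "\<epsilon> * d \<le> \<kappa> / 8 * d" using \<epsilon> d by (intro mult_right_mono) auto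
      then have "\<epsilon> * d / \<kappa> \<le> d / 8" using assms by (simp add: field_simps)
      then have pz8: "norm (p - z) < d / 8" using pz by linarith
      have "r = 2 * (\<epsilon> * d / \<kappa>)" "0 < \<epsilon> * d / \<kappa>" using \<epsilon> d assms by (simp_all add: r_def)
      then have pzr: "norm (p - z) < r" using pz by linarith
      have ub: "u q \<le> 2 ^ K * u p" if q: "q \<in> ball z (5 ^ n * r)" for q
      proof -
        have "norm (q - p) < d / 2"
          using q pz8 d norm_triangle_ineq[of "q - z" "z - p"] unfolding r(2) by (simp add: dist_norm norm_minus_commute)
        then have dq: "d / 2 \<le> R' - norm q" using norm_triangle_sub[of q p] by (simp add: d_def)
        then have "norm q \<le> R'" "norm q < 1" using d R' by linarith+
        have "u q * (d / 2) ^ K \<le> u q * (R' - norm q) ^ K"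
          using dq d unn[OF \<open>norm q < 1\<close>] by (intro mult_left_mono power_mono) auto
        also have "\<dots> \<le> u p * d ^ K" using pmax[OF \<open>norm q \<le> R'\<close>] by (simp add: g_def d_def)
        also have "\<dots> = (2 ^ K * u p) * (d / 2) ^ K" by (simp add: power_divide)
        finally show ?thesis using d by simp
      qed
      have "u p \<le> (1 - c) ^ n * (2 ^ K * u p)"
      proof (rule decay[of L \<kappa> \<Omega> \<phi> u z r n], intro conjI ballI impI)
        show "submean_at u q" if "q \<in> \<Omega>" for q
          by (rule submean_at_mean_value[OF open_dom that mv])
             (use dom_subset contu in \<open>auto intro: continuous_on_subset\<close>)
        have "d \<le> R'" by (simp add: d_def)
        then show "norm z + 5 ^ n * r < 1/2" unfolding r(2) using z(2) p R'(3) norm_ge_zero[of p] by linarith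
        show "p \<in> ball z r" using pzr by (simp add: dist_norm norm_minus_commute)
      qed (use nice_domain_axioms contu z r up ub u0 in auto)
      also have "\<dots> < 1 / 2 ^ K * (2 ^ K * u p)" using n up by (intro mult_strict_right_mono) auto
      finally show False by simp
    qed
    moreover have "u x * (R / 8) ^ K \<le> g x" unfolding g_def
      using x R by (intro mult_left_mono power_mono unn) (auto simp: R'_def)
    moreover have "g x \<le> g p" using x R by (intro pmax) (simp add: R'_def)
    ultimately have "u x * (R / 8) ^ K \<le> C1 / \<epsilon> ^ K * u P" by linarith
    moreover have "0 < (R / 8) ^ K" using R by simp
    ultimately have "u x \<le> (C1 / \<epsilon> ^ K * u P) / (R / 8) ^ K" by (simp only: pos_le_divide_eq)
    then have "u x \<le> C1 / \<epsilon> ^ K / (R / 8) ^ K * u P" by simp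
    also have "\<dots> \<le> C * u P" using C uP by (intro mult_right_mono)
    finally show "u x \<le> C * u P" .
  qed
qed

section \<open>Iteration over dyadic scales\<close>

lemma dyadic_scale:
  fixes t r :: real
  assumes "0 < t" "t < r"
  obtains k where "r / 2 ^ Suc k \<le> t" "t < r / 2 ^ k"
proof -
  obtain n where "r / t < 2 ^ n" using real_arch_pow[of 2 "r / t"] by auto
  then have "r / 2 ^ n \<le> t" using assms by (simp add: field_simps)
  define k where "k = (LEAST n. r / 2 ^ n \<le> t)"
  have k: "r / 2 ^ k \<le> t" unfolding k_def by (rule LeastI) fact
  then have "k \<noteq> 0" using assms by (auto intro: ccontr)
  then obtain j where j: "k = Suc j" by (cases k) auto
  have "\<not> r / 2 ^ j \<le> t" using not_less_Least[of j "\<lambda>n. r / 2 ^ n \<le> t"] j by (simp add: k_def)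
  then show thesis using that[of j] k j by auto
qed

text \<open>The iteration of De Silva and Savin. At scale \<open>r\<close> the difference \<open>w\<close> is at least \<open>\<Theta> m\<close> where \<open>\<phi>\<close> is
  not small and at least \<open>- m\<close> elsewhere. The first bound persists at scale \<open>r / 2\<close> by climbing, the
  second one improves by \<open>boundary_decay\<close>. Hence \<open>w\<close> is positive at every point of \<open>\<Omega>\<close>.\<close>

lemma one_sided_comparison:
  fixes L \<kappa> \<theta> \<eta> :: real
  assumes "0 < L" "0 < \<kappa>" "0 < \<theta>" "\<theta> \<le> 1" "0 < \<eta>"
  shows "\<exists>R \<nu> \<rho> M. 0 < \<rho> \<and> \<rho> < R \<and> R \<le> 1 \<and> 0 < \<nu> \<and> \<nu> \<le> \<eta> \<and> 0 < M \<and>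
    (\<forall>\<Omega> (\<phi> :: 'a::euclidean_space \<Rightarrow> real) u v P x. nice_domain L \<kappa> \<theta> \<Omega> \<phi> \<and> nonneg_solution \<Omega> u \<and> nonneg_solution \<Omega> v \<and>
      norm P < R \<and> \<nu> * R < \<phi> P \<and> u P = v P \<and> norm x < \<rho> \<longrightarrow> u x \<le> M * v x)"
proof -
  obtain R \<nu> C K where R: "0 < R" "R \<le> 1/8" and \<nu>: "0 < \<nu>" "\<nu> \<le> \<eta>" and C: "1 \<le> C"
    and carleson: "\<And>\<Omega> (\<phi> :: 'a \<Rightarrow> real) u P x. nice_domain L \<kappa> \<theta> \<Omega> \<phi> \<and> nonneg_solution \<Omega> u \<and>
      norm P < R \<and> \<nu> * R < \<phi> P \<and> norm x < R / 4 \<Longrightarrow>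
      u x \<le> C * u P \<and> (x \<in> \<Omega> \<longrightarrow> u P * \<phi> x ^ K \<le> C * u x)"
    using carleson[where 'a='a, OF assms] by blast
  obtain C2 N where C2: "1 \<le> C2" and climb: "\<And>\<theta> \<Omega> (\<phi> :: 'a \<Rightarrow> real) x \<tau>.
    nice_domain L \<kappa> \<theta> \<Omega> \<phi> \<and> x \<in> \<Omega> \<and> \<phi> x \<le> \<tau> \<and> norm x + C2 * \<tau> \<le> 1/4 \<Longrightarrow>
    (\<exists>y. norm (y - x) < C2 * \<tau> \<and> \<tau> \<le> \<phi> y \<and> \<phi> y \<le> C2 * \<tau> \<and> y \<in> \<Omega> \<and>
      (\<forall>u U. mean_value_on u U \<and> (\<forall>q\<in>U. 0 \<le> u q) \<and> ball x (C2 * \<tau>) \<inter> \<Omega> \<subseteq> U \<longrightarrow>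
         u x * \<phi> x ^ N \<le> u y * \<phi> y ^ N \<and> u y * \<phi> x ^ N \<le> u x * \<phi> y ^ N))"
    using climb[where 'a='a, OF assms(1,2)] by blast
  obtain c where c: "0 < c" "c < 1" and decay: "\<And>L \<kappa> \<Omega> (\<phi> :: 'a \<Rightarrow> real) f z r n m x.
    nice_domain L \<kappa> \<theta> \<Omega> \<phi> \<and> continuous_on (ball 0 1) f \<and> (\<forall>x\<in>ball 0 1 - \<Omega>. f x \<le> 0) \<and>
    (\<forall>x\<in>\<Omega>. 0 < f x \<longrightarrow> submean_at f x) \<and> z \<in> frontier \<Omega> \<and> 0 < r \<and> norm z + 5 ^ n * r < 1/2 \<and> 0 \<le> m \<and>
    (\<forall>x\<in>ball z (5 ^ n * r). f x \<le> m) \<and> x \<in> ball z r \<Longrightarrow> f x \<le> (1 - c) ^ n * m"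
    using boundary_decay[where 'a='a, OF assms(3)] by blast
  \<comment> \<open>\<open>Q\<close> is the loss in climbing from the level
    \<open>\<nu>' * r / 2\<close> above \<open>\<nu>' * r\<close>, during which
    \<open>\<phi>\<close> grows at most by the factor \<open>4 * C2\<close>. Since
    \<open>\<Theta> * a = 1\<close>, the bound \<open>m\<close> obtained after this loss is exactly
    the strong bound of the next scale.\<close>
  define Q where "Q = (4 * C2) ^ N"
  have Q: "1 \<le> Q" unfolding Q_def using C2 by (intro one_le_power) simp
  define \<Theta> where "\<Theta> = 2 * Q"
  define a where "a = 1 / (2 * Q)"
  have a: "0 < a" "a < 1" "\<Theta> * a = 1" using Q by (auto simp: a_def \<Theta>_def)
  obtain n where n: "(1 - c) ^ n < a" using small_power[of "1 - c" a] c a by auto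
  \<comment> \<open>The first bound keeps the climb inside the ball of radius \<open>r\<close>. The
    second one puts points with \<open>\<phi> \<le> \<nu>' * r\<close> so close to the frontier that
    \<open>n\<close> decays fit into the radius \<open>r / 4\<close>.\<close>
  define \<nu>' where "\<nu>' = min (1 / (4 * C2)) (\<kappa> / (8 * 5 ^ n))"
  have \<nu>': "0 < \<nu>'" "4 * C2 * \<nu>' \<le> 1" "5 ^ n * (8 * \<nu>') \<le> \<kappa>" using assms C2 by (auto simp: \<nu>'_def min_def field_simps)
  have "8 * \<nu>' \<le> 5 ^ n * (8 * \<nu>')" using \<nu>'(1) one_le_power[of "5::real" n] by simp
  then have \<nu>'\<kappa>: "8 * \<nu>' \<le> \<kappa>" using \<nu>'(3) by linarith
  define r0 where "r0 = R / 16"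
  have r0: "0 < r0" "r0 < 1/8" using R by (auto simp: r0_def)
  \<comment> \<open>The start of the iteration: where \<open>\<phi> > \<nu>' * r0\<close>, the lower
    bound for \<open>v\<close> gives \<open>M * v q \<ge> (\<Theta> + 1) * m0\<close>, while
    \<open>u \<le> m0\<close> there.\<close>
  define M where "M = (\<Theta> + 1) * C * C / (\<nu>' * r0) ^ K"
  have M: "0 < M" using \<nu>' r0 C Q by (auto simp: M_def \<Theta>_def intro!: divide_pos_pos mult_pos_pos)
  show ?thesis
  proof (rule exI[of _ R], rule exI[of _ \<nu>], rule exI[of _ "r0 / 2"], rule exI[of _ M], intro conjI \<nu> M allI impI)
    show "0 < r0 / 2" "r0 / 2 < R" "R \<le> 1" using R by (auto simp: r0_def)
    fix \<Omega> and \<phi> u v :: "'a \<Rightarrow> real" and P x :: 'a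
    assume *: "nice_domain L \<kappa> \<theta> \<Omega> \<phi> \<and> nonneg_solution \<Omega> u \<and> nonneg_solution \<Omega> v \<and>
      norm P < R \<and> \<nu> * R < \<phi> P \<and> u P = v P \<and> norm x < r0 / 2"
    then interpret nice_domain L \<kappa> \<theta> \<Omega> \<phi> by blast
    have u: "nonneg_solution \<Omega> u" and v: "nonneg_solution \<Omega> v" and P: "norm P < R" "\<nu> * R < \<phi> P" "u P = v P"
      and x: "norm x < r0 / 2" using * by auto
    have unn: "0 \<le> u q" "0 \<le> v q" if "norm q < 1" for q using u v that by (auto simp: nonneg_solution_def)
    have u0: "u q = 0" "v q = 0" if "norm q < 1" "q \<notin> \<Omega>" for q using u v that by (auto simp: nonneg_solution_def)
    have contu: "continuous_on (ball 0 1) u" "continuous_on (ball 0 1) v" using u v by (auto simp: nonneg_solution_def)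
    have uP: "0 \<le> u P" using P R by (intro unn) simp
    have x4: "norm x < R / 4" "norm x < 1" using x R by (auto simp: r0_def)
    have uC: "u q \<le> C * u P" if "norm q < R / 4" for q using carleson u P nice_domain_axioms that by blast
    have vC: "u P * \<phi> q ^ K \<le> C * v q" if "norm q < R / 4" "q \<in> \<Omega>" for q
      unfolding P(3) using carleson v P(1,2) nice_domain_axioms that by blast
    show "u x \<le> M * v x"
    proof (cases "u P = 0 \<or> x \<notin> \<Omega>")
      case True
      then have "u x \<le> 0" using uC[OF x4(1)] u0[OF x4(2)] by auto
      then show ?thesis using mult_nonneg_nonneg[OF less_imp_le[OF M] unn(2)[OF x4(2)]] by linarith
    next
      case False
      then have x\<Omega>: "x \<in> \<Omega>" by simp
      define m0 where "m0 = C * u P"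
      have m0: "0 < m0" using False uP C by (simp add: m0_def)
      define w where "w q = (0 + (-1) * u q) + M * v q" for q
      have mvw: "mean_value_on w \<Omega>" unfolding w_def
        using u v by (intro mean_value_on_add_mult mean_value_on_const) (auto simp: nonneg_solution_def)
      have contw: "continuous_on (ball 0 1) w" unfolding w_def using contu by (intro continuous_intros)
      have w0: "w q = 0" if "norm q < 1" "q \<notin> \<Omega>" for q using u0[OF that] by (simp add: w_def)
      have iter: "\<forall>q\<in>ball z (r0 / 2 ^ k). - (m0 * a ^ k) \<le> w q \<and> (\<nu>' * (r0 / 2 ^ k) < \<phi> q \<longrightarrow> \<Theta> * (m0 * a ^ k) \<le> w q)"
        if z: "z \<in> frontier \<Omega>" "norm z < r0" for z k
      proof (induction k)
        case 0
        show ?case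
        proof (intro ballI conjI impI)
          fix q assume "q \<in> ball z (r0 / 2 ^ 0)"
          then have "norm q < 2 * r0" using z norm_triangle_sub[of q z] by (simp add: dist_norm norm_minus_commute)
          then have q: "norm q < R / 4" "norm q < 1" using R by (auto simp: r0_def)
          have "0 \<le> M * v q" using M unn[OF q(2)] by simp
          then show "- (m0 * a ^ 0) \<le> w q" using uC[OF q(1)] by (simp add: w_def m0_def)
          assume "\<nu>' * (r0 / 2 ^ 0) < \<phi> q"
          then have \<phi>q: "\<nu>' * r0 < \<phi> q" by simp
          have \<nu>r: "0 < \<nu>' * r0" using \<nu>' r0 by simp
          then have "q \<in> \<Omega>" using pos_iff[OF q(2)] \<phi>q by linarith
          have "u P * (\<nu>' * r0) ^ K \<le> u P * \<phi> q ^ K" using \<phi>q \<nu>r uP by (intro mult_left_mono power_mono) auto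
          also have "\<dots> \<le> C * v q" using vC[OF q(1) \<open>q \<in> \<Omega>\<close>] .
          finally have "(\<Theta> + 1) * C / (\<nu>' * r0) ^ K * (u P * (\<nu>' * r0) ^ K) \<le> (\<Theta> + 1) * C / (\<nu>' * r0) ^ K * (C * v q)"
            using Q C \<nu>r by (intro mult_left_mono) (auto simp: \<Theta>_def)
          then have "(\<Theta> + 1) * m0 \<le> M * v q" using \<nu>r \<nu>' r0 by (simp add: M_def m0_def ac_simps)
          then show "\<Theta> * (m0 * a ^ 0) \<le> w q" using uC[OF q(1)] by (simp add: w_def m0_def algebra_simps)
        qed
      next
        case (Suc k)
        define r where "r = r0 / 2 ^ k"
        define m where "m = m0 * a ^ k"
        have r: "0 < r" "r \<le> r0" using r0 by (auto simp: r_def divide_le_eq_1 field_simps)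
        have m: "0 < m" using m0 a by (simp add: m_def)
        have IH: "- m \<le> w q" "\<nu>' * r < \<phi> q \<Longrightarrow> \<Theta> * m \<le> w q" if "q \<in> ball z r" for q
          using Suc.IH that by (auto simp: r_def m_def)
        have small: "norm q < 1/4" if "norm (q - z) < r" for q
          using that r z r0 norm_triangle_sub[of q z] by linarith
        have good: "m \<le> w q" if q: "norm (q - z) < r / 2" "\<nu>' * (r / 2) < \<phi> q" for q
        proof (cases "\<nu>' * r < \<phi> q")
          case True
          then have "\<Theta> * m \<le> w q" using q r by (intro IH(2)) (auto simp: dist_norm norm_minus_commute)
          moreover have "1 * m \<le> \<Theta> * m" using Q m by (intro mult_right_mono) (auto simp: \<Theta>_def)
          ultimately show ?thesis by linarith
        next
          case False
          define \<tau> where "\<tau> = 2 * \<nu>' * r"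
          have \<nu>r: "0 < \<nu>' * r" using \<nu>' r by simp
          have "4 * C2 * \<nu>' * r \<le> 1 * r" using \<nu>'(2) r by (intro mult_right_mono) auto
          then have C\<tau>: "C2 * \<tau> \<le> r / 2" by (simp add: \<tau>_def)
          have \<tau>: "\<phi> q \<le> \<tau>" using False \<nu>r by (simp add: \<tau>_def)
          have qn: "norm q < 1" using small[of q] q r by simp
          have q\<Omega>: "q \<in> \<Omega>" using pos_iff[OF qn] q(2) \<nu>r by simp
          have "norm q + C2 * \<tau> \<le> 1/4" using q C\<tau> r z r0 norm_triangle_sub[of q z] by linarith
          then obtain y where y: "norm (y - q) < C2 * \<tau>" "\<tau> \<le> \<phi> y" "\<phi> y \<le> C2 * \<tau>"
            and uy: "\<And>u U. mean_value_on u U \<and> (\<forall>q\<in>U. 0 \<le> u q) \<and> ball q (C2 * \<tau>) \<inter> \<Omega> \<subseteq> U \<Longrightarrow> u y * \<phi> q ^ N \<le> u q * \<phi> y ^ N"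
            using climb[of \<theta> \<Omega> \<phi> q \<tau>] nice_domain_axioms q\<Omega> \<tau> by blast
          have yz: "norm (y - z) < r" using y(1) C\<tau> q(1) norm_triangle_ineq[of "y - q" "q - z"] by simp
          have "\<nu>' * r < \<phi> y" using y(2) \<nu>r by (simp add: \<tau>_def)
          then have wy: "\<Theta> * m \<le> w y" using yz by (intro IH(2)) (auto simp: dist_norm norm_minus_commute)
          \<comment> \<open>\<open>w\<close> may change sign, so the climbing estimate is applied to
            \<open>w + m\<close>, which is nonnegative on \<open>\<Omega> \<inter> ball z r\<close>
            by the induction hypothesis.\<close>
          have "(w y + 1 * m) * \<phi> q ^ N \<le> (w q + 1 * m) * \<phi> y ^ N"
          proof (rule uy[of "\<lambda>y. w y + 1 * m" "\<Omega> \<inter> ball z r"], intro conjI ballI)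
            show "mean_value_on (\<lambda>y. w y + 1 * m) (\<Omega> \<inter> ball z r)"
              using mvw by (intro mean_value_on_add_mult mean_value_on_const) (auto intro: mean_value_on_subset)
            show "0 \<le> w p + 1 * m" if "p \<in> \<Omega> \<inter> ball z r" for p using IH(1)[of p] that by simp
            show "ball q (C2 * \<tau>) \<inter> \<Omega> \<subseteq> \<Omega> \<inter> ball z r"
            proof
              fix p assume p: "p \<in> ball q (C2 * \<tau>) \<inter> \<Omega>"
              then have "norm (p - z) < r" using C\<tau> q(1) norm_triangle_ineq[of "p - q" "q - z"] by (simp add: dist_norm norm_minus_commute)
              then show "p \<in> \<Omega> \<inter> ball z r" using p by (simp add: dist_norm norm_minus_commute)
            qed
          qed
          also have "\<dots> \<le> (w q + m) * (Q * \<phi> q ^ N)"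
          proof -
            have "\<phi> y \<le> (4 * C2) * \<phi> q"
            proof -
              have "\<phi> y \<le> 4 * C2 * (\<nu>' * (r / 2))" using y(3) by (simp add: \<tau>_def)
              also have "\<dots> \<le> 4 * C2 * \<phi> q" using q(2) C2 by (intro mult_left_mono) auto
              finally show ?thesis .
            qed
            then have "\<phi> y ^ N \<le> ((4 * C2) * \<phi> q) ^ N" using y(2) \<nu>r by (intro power_mono) (auto simp: \<tau>_def)
            moreover have "0 \<le> w q + m" using IH(1)[of q] q r by (simp add: dist_norm norm_minus_commute)
            ultimately show ?thesis by (auto simp: Q_def power_mult_distrib intro!: mult_left_mono)
          qed
          finally have "(w y + m) * \<phi> q ^ N \<le> (Q * (w q + m)) * \<phi> q ^ N" by (simp add: ac_simps)
          then have "w y + m \<le> Q * (w q + m)" using pos[OF q\<Omega>] by simp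
          then have "2 * Q * m \<le> Q * (w q + m)" using wy m by (simp add: \<Theta>_def)
          then have "Q * (2 * m) \<le> Q * (w q + m)" by (simp add: ac_simps)
          then have "2 * m \<le> w q + m" using Q by simp
          then show ?thesis by simp
        qed
        have weak: "- (m * a) \<le> w q" if q: "norm (q - z) < r / 2" for q
        proof (cases "q \<in> \<Omega> \<and> \<phi> q \<le> \<nu>' * r")
          case True
          then have q\<Omega>: "q \<in> \<Omega>" "\<phi> q \<le> \<nu>' * r" by auto
          have qn: "norm q < 1/4" using small[of q] q r by simp
          have "norm q < 1/2" using qn by simp
          from nearest_frontier[OF q\<Omega>(1) this] obtain z' where z': "z' \<in> frontier \<Omega>" "norm z' \<le> 2 * norm q" "\<kappa> * norm (q - z') \<le> \<phi> q"
            by blast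
          define s where "s = 2 * \<nu>' * r / \<kappa>"
          have s: "0 < s" using \<nu>' r assms by (simp add: s_def)
          have "5 ^ n * (8 * \<nu>') * r \<le> \<kappa> * r" using \<nu>'(3) r by (intro mult_right_mono) auto
          then have s5: "5 ^ n * s \<le> r / 4" using assms by (simp add: s_def field_simps)
          have "\<kappa> * norm (q - z') \<le> \<nu>' * r" using z'(3) q\<Omega> by linarith
          then have "norm (q - z') \<le> s / 2" using assms by (simp add: s_def field_simps)
          then have qz': "norm (q - z') < s" "norm (q - z') < r / 4"
          proof -
            assume *: "norm (q - z') \<le> s / 2"
            have "1 * s \<le> 5 ^ n * s" using s by (intro mult_right_mono) auto
            then show "norm (q - z') < s" "norm (q - z') < r / 4" using * s s5 by linarith+
          qed
          \<comment> \<open>The negative part of \<open>w\<close>: a subsolution that vanishes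
            outside \<open>\<Omega>\<close> and is at most \<open>m\<close> in
            \<open>ball z r\<close>. After \<open>n\<close> decays it has dropped below
            \<open>a * m\<close>.\<close>
          define f where "f p = max 0 (0 + (-1) * w p)" for p
          have "f q \<le> (1 - c) ^ n * m"
          proof (rule decay[of L \<kappa> \<Omega> \<phi> f z' s n m], intro conjI ballI impI)
            show "continuous_on (ball 0 1) f" unfolding f_def by (intro continuous_intros contw)
            show "f p \<le> 0" if "p \<in> ball 0 1 - \<Omega>" for p using w0[of p] that by (simp add: f_def)
            show "submean_at f p" if "p \<in> \<Omega>" "0 < f p" for p
            proof (rule submean_at_mean_value[OF open_dom that(1)])
              show "mean_value_on (\<lambda>p. 0 + (-1) * w p) \<Omega>" by (intro mean_value_on_add_mult mean_value_on_const mvw)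
              show "continuous_on \<Omega> f" unfolding f_def
                by (intro continuous_intros continuous_on_subset[OF contw dom_subset])
            qed (use that in \<open>auto simp: f_def\<close>)
            show "norm z' + 5 ^ n * s < 1/2" 
            proof -
              have "norm q < r / 2 + r0" using q z norm_triangle_sub[of q z] by linarith
              then have "2 * norm q < 2 * (r / 2 + r0)" by simp
              then have "norm z' + 5 ^ n * s < 2 * (r / 2 + r0) + r / 4"
                using z'(2) s5 by (intro add_less_le_mono) auto
              also have "\<dots> \<le> 1/2" using r(2) R by (simp add: r0_def)
              finally show ?thesis .
            qed
            show "f p \<le> m" if p: "p \<in> ball z' (5 ^ n * s)" for p
            proof -
              have "norm (p - z') < r / 4" using p s5 by (simp add: dist_norm norm_minus_commute)
              moreover have "norm (p - z) \<le> norm (p - z') + norm (z' - q) + norm (q - z)"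
                using norm_triangle_ineq[of "p - z'" "z' - q"] norm_triangle_ineq[of "p - q" "q - z"] by simp
              ultimately have "norm (p - z) < r" using qz' q by (simp add: norm_minus_commute)
              then show ?thesis using IH(1)[of p] m by (simp add: f_def dist_norm norm_minus_commute)
            qed
          qed (use nice_domain_axioms z' s m qz' in \<open>auto simp: dist_norm norm_minus_commute\<close>)
          also have "\<dots> \<le> a * m" using n m by (intro mult_right_mono) auto
          finally show ?thesis by (simp add: f_def mult.commute)
        next
          case False
          show ?thesis
          proof (cases "q \<in> \<Omega>")
            case True
            then have "\<nu>' * r < \<phi> q" using False by simp
            moreover have "0 < \<nu>' * r" using \<nu>' r by simp
            moreover have "\<nu>' * (r / 2) = \<nu>' * r / 2" by simp
            ultimately have "\<nu>' * (r / 2) < \<phi> q" by linarith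
            then have "m \<le> w q" using good q by blast
            then show ?thesis using m a mult_pos_pos[OF m a(1)] by linarith
          next
            case False
            then have "w q = 0" using small[of q] q r by (intro w0) auto
            then show ?thesis using mult_pos_pos[OF m a(1)] by simp
          qed
        qed
        have eq: "r0 / 2 ^ Suc k = r / 2" "m0 * a ^ Suc k = m * a" by (simp_all add: r_def m_def)
        have \<Theta>ma: "\<Theta> * (m * a) = m" using a(3) by (simp add: ac_simps)
        show ?case unfolding eq \<Theta>ma
        proof (intro ballI conjI impI)
          fix q assume "q \<in> ball z (r / 2)"
          then have "norm (q - z) < r / 2" by (simp add: dist_norm norm_minus_commute)
          then show "- (m * a) \<le> w q" "\<nu>' * (r / 2) < \<phi> q \<Longrightarrow> m \<le> w q" by (rule weak, rule good)
        qed
      qed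
      have "norm x < 1/2" using x r0 by simp
      from nearest_frontier[OF x\<Omega> this] obtain z where z: "z \<in> frontier \<Omega>" "norm z \<le> 2 * norm x" "norm (x - z) \<le> norm x"
        "0 < norm (x - z)" "\<kappa> * norm (x - z) \<le> \<phi> x" by blast
      have "norm (x - z) < r0" using z(3) x r0 by linarith
      then obtain k where k: "r0 / 2 ^ Suc k \<le> norm (x - z)" "norm (x - z) < r0 / 2 ^ k"
        using dyadic_scale[OF z(4)] by blast
      define r where "r = r0 / 2 ^ k"
      have r: "0 < r" "r / 2 \<le> norm (x - z)" "norm (x - z) < r" using k r0 by (auto simp: r_def)
      have "8 * \<nu>' * r \<le> \<kappa> * r" using \<nu>'\<kappa> r by (intro mult_right_mono) auto
      moreover have "\<kappa> * (r / 2) \<le> \<kappa> * norm (x - z)" using r assms by (intro mult_left_mono) auto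
      moreover have "0 < \<nu>' * r" using \<nu>' r by simp
      \<comment> \<open>\<open>r\<close> is the dyadic scale just above \<open>norm (x - z)\<close>,
        so \<open>\<phi> x \<ge> \<kappa> * (r / 2) \<ge> 4 * \<nu>' * r\<close>: at this scale
        \<open>x\<close> itself is a point where the strong bound holds.\<close>
      ultimately have "\<nu>' * r < \<phi> x" using z(5) by simp
      moreover have "norm z < r0" using z(2) x by linarith
      ultimately have "\<Theta> * (m0 * a ^ k) \<le> w x"
        using iter[OF z(1), of k] r(3) unfolding r_def[symmetric] by (simp add: dist_norm norm_minus_commute)
      moreover have "0 \<le> \<Theta> * (m0 * a ^ k)" using Q m0 a by (simp add: \<Theta>_def)
      ultimately show ?thesis by (simp add: w_def)
    qed
  qed
qed

section \<open>Exterior balls from the density conditions\<close>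

lemma measure_lebesgue_ball:
  fixes c :: "'a::euclidean_space"
  assumes "0 \<le> r"
  shows "measure lebesgue (ball c r) = unit_ball_vol (real DIM('a)) * r ^ DIM('a)"
  using content_ball[OF assms, of c] by (simp add: measure_completion)

text \<open>If every point of \<open>ball z (r / 2) - \<Omega>\<close> were within \<open>t r\<close> of \<open>\<Omega>\<close>, then near each of them the set
  \<open>{0 < \<phi> < 3 L t r}\<close> would contain a ball of radius comparable to \<open>t r\<close>. By Vitali's covering lemma these
  balls would have total measure comparable to that of the complement of \<open>\<Omega>\<close>, hence to \<open>r ^ d\<close>.\<close>

lemma exterior_ball_of_density:
  fixes L \<mu> \<Lambda> \<eta> :: real
  assumes "0 < L" "0 < \<mu>" "0 < \<Lambda>" "0 < \<eta>"
  shows "\<exists>\<theta>>0. \<theta> \<le> 1 \<and> (\<forall>\<Omega> (\<phi> :: 'a::euclidean_space \<Rightarrow> real) z r.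
    open \<Omega> \<and> L-lipschitz_on (ball 0 1) \<phi> \<and> (\<forall>x\<in>ball 0 1 - \<Omega>. \<phi> x = 0) \<and>
    (\<forall>x\<^sub>0\<in>frontier \<Omega> \<inter> ball 0 1. \<forall>r. 0 < r \<and> r < 1 - norm x\<^sub>0 \<longrightarrow>
       measure lebesgue (ball x\<^sub>0 r - \<Omega>) \<ge> \<mu> * measure lebesgue (ball x\<^sub>0 r)) \<and>
    (\<forall>x\<^sub>0\<in>frontier \<Omega> \<inter> ball 0 1. \<forall>r. 0 < r \<and> r < 1 - norm x\<^sub>0 \<longrightarrow>
       (\<forall>t>0. measure lebesgue ({x \<in> ball 0 1. 0 < \<phi> x \<and> \<phi> x < r * t} \<inter> ball x\<^sub>0 r)
                \<le> \<Lambda> * t * measure lebesgue (ball (0 :: 'a) r))) \<and>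
    (\<forall>x\<^sub>0\<in>frontier \<Omega> \<inter> ball 0 1. \<forall>r. 0 < r \<and> r < 1 - norm x\<^sub>0 \<longrightarrow> (SUP x\<in>ball x\<^sub>0 r. \<phi> x) \<ge> \<eta> * r) \<and>
    z \<in> frontier \<Omega> \<and> norm z < 1/2 \<and> 0 < r \<and> r \<le> 1/4 \<longrightarrow> (\<exists>c. ball c (\<theta> * r) \<subseteq> ball z r - \<Omega>))"
proof -
  define D where "D = DIM('a)"
  \<comment> \<open>Around a point with \<open>\<phi> > \<eta> * (t * r) / 2\<close> the Lipschitz
    bound keeps \<phi> positive in the ball of radius \<open>\<beta> * (t * r)\<close>.\<close>
  define \<beta> where "\<beta> = min 1 (\<eta> / (4 * L))"
  have \<beta>: "0 < \<beta>" "\<beta> \<le> 1" "4 * L * \<beta> \<le> \<eta>" using assms by (auto simp: \<beta>_def min_def field_simps)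
  \<comment> \<open>In \<open>\<beta> / 30\<close> the factor 15 is the radius
    \<open>3 * (t * r)\<close> times the Vitali factor 5, and the factor 2 comes from the radius
    \<open>r / 2\<close>. The remaining factors make the covering bound at most half of what the
    density of the complement demands. \<open>t \<le> 1/6\<close> keeps all balls in
    \<open>ball z r\<close>.\<close>
  define t where "t = min (1/6) (\<mu> * (\<beta> / 30) ^ D / (6 * L * \<Lambda>))"
  have t: "0 < t" "t \<le> 1/6" using assms \<beta> by (auto simp: t_def)
  have "t * (6 * L * \<Lambda>) \<le> \<mu> * (\<beta> / 30) ^ D / (6 * L * \<Lambda>) * (6 * L * \<Lambda>)"
    using assms by (intro mult_right_mono) (auto simp: t_def)
  then have t3: "2 * (\<Lambda> * (3 * L * t)) \<le> \<mu> * (\<beta> / 30) ^ D" using assms by (simp add: ac_simps)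
  show ?thesis
  proof (rule exI[of _ t], intro conjI allI impI, goal_cases)
    case (3 \<Omega> \<phi> z r)
    then show ?case
    proof (elim conjE, goal_cases)
      case 1
      note open\<Omega> = \<open>open \<Omega>\<close> and lip = \<open>L-lipschitz_on (ball 0 1) \<phi>\<close> and z = \<open>z \<in> frontier \<Omega>\<close> \<open>norm z < 1/2\<close>
        and r = \<open>0 < r\<close> \<open>r \<le> 1/4\<close>
      have zero: "\<phi> x = 0" if "norm x < 1" "x \<notin> \<Omega>" for x
        using \<open>\<forall>x\<in>ball 0 1 - \<Omega>. \<phi> x = 0\<close> that by simp
      have zb: "z \<in> frontier \<Omega> \<inter> ball 0 1" using z by simp
      have dens: "\<mu> * measure lebesgue (ball z (r / 2)) \<le> measure lebesgue (ball z (r / 2) - \<Omega>)"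
        using 1(4)[rule_format, OF zb, of "r / 2"] z r by simp
      define E where "E = {x \<in> ball 0 1. 0 < \<phi> x \<and> \<phi> x < r * (3 * L * t)} \<inter> ball z r"
      have E_le: "measure lebesgue E \<le> \<Lambda> * (3 * L * t) * measure lebesgue (ball (0 :: 'a) r)"
      proof -
        have "0 < r \<and> r < 1 - norm z" "0 < 3 * L * t" using z r assms t by auto
        then show ?thesis unfolding E_def by (rule 1(5)[rule_format, OF zb])
      qed
      have nondeg: "\<eta> * s \<le> (SUP x\<in>ball w s. \<phi> x)" if "w \<in> frontier \<Omega>" "0 < s" "s < 1 - norm w" for w s
        using 1(6)[rule_format, of w s] that by simp
      have lipD: "\<bar>\<phi> x - \<phi> y\<bar> \<le> L * norm (x - y)" if "norm x < 1" "norm y < 1" for x y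
        using lipschitz_onD[OF lip, of x y] that by (simp add: dist_norm)
      have tr: "0 < t * r" "t * r \<le> r / 6" using t r mult_right_mono[OF t(2), of r] by auto
      show "\<exists>c. ball c (t * r) \<subseteq> ball z r - \<Omega>"
      proof (rule ccontr)
        assume neg: "\<not> ?thesis"
        define A where "A = ball z (r / 2) - \<Omega>"
        \<comment> \<open>The ball of radius \<open>t * r\<close> around \<open>c\<close> meets
          \<open>\<Omega>\<close>, hence the frontier, and nondegeneracy there yields a point with a
          large value of \<phi>. Around it \<phi> is positive, but still below
          \<open>3 * L * t * r\<close> because the frontier is near.\<close>
        have near: "\<exists>p. norm (p - c) < 2 * (t * r) \<and> ball p (\<beta> * (t * r)) \<subseteq> E" if c: "c \<in> A" for c
        proof -
          have cz: "norm (c - z) < r / 2" "c \<notin> \<Omega>" using c by (auto simp: A_def dist_norm norm_minus_commute)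
          have in_r: "norm (q - z) < r" if "norm (q - c) < 3 * (t * r)" for q
            using norm_triangle_ineq[of "q - c" "c - z"] cz tr that by simp
          have in_1: "norm q < 3/4" if "norm (q - c) < 3 * (t * r)" for q
            using in_r[OF that] norm_triangle_sub[of q z] z r by linarith
          have "ball c (t * r) \<subseteq> ball z r"
          proof
            fix q assume "q \<in> ball c (t * r)"
            then have "norm (q - c) < 3 * (t * r)" using tr by (simp add: dist_norm norm_minus_commute)
            from in_r[OF this] show "q \<in> ball z r" by (simp add: dist_norm norm_minus_commute)
          qed
          then have "ball c (t * r) \<inter> \<Omega> \<noteq> {}" using neg by blast
          moreover have "c \<in> ball c (t * r)" using tr by simp
          then have "ball c (t * r) - \<Omega> \<noteq> {}" using cz by blast
          ultimately have "ball c (t * r) \<inter> frontier \<Omega> \<noteq> {}" by (intro connected_Int_frontier) auto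
          then obtain w where w: "w \<in> frontier \<Omega>" "w \<in> ball c (t * r)" by blast
          then have w: "w \<in> frontier \<Omega>" "norm (w - c) < t * r" by (simp_all add: dist_norm norm_minus_commute)
          have w1: "norm w < 3/4" using w tr by (intro in_1) simp
          have "w \<notin> \<Omega>" using w(1) open\<Omega> by (simp add: frontier_def interior_open)
          then have \<phi>w: "\<phi> w = 0" using zero w1 by simp
          have wq: "norm (q - c) < 2 * (t * r)" if "q \<in> ball w (t * r)" for q
            using that w(2) norm_triangle_ineq[of "q - w" "w - c"] by (simp add: dist_norm norm_minus_commute)
          have \<phi>_le: "\<phi> q \<le> L * norm (q - w)" if "norm q < 1" for q
            using lipD[of q w] that w1 \<phi>w by simp
          have "\<eta> * (t * r) \<le> (SUP x\<in>ball w (t * r). \<phi> x)"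
            using w1 tr r by (intro nondeg w tr) linarith
          moreover have "\<eta> * (t * r) / 2 < \<eta> * (t * r)" using mult_pos_pos[OF assms(4) tr(1)] by linarith
          ultimately have SUP: "\<eta> * (t * r) / 2 < (SUP x\<in>ball w (t * r). \<phi> x)" by linarith
          have bdd: "bdd_above (\<phi> ` ball w (t * r))"
          proof (rule bdd_aboveI2)
            fix q assume q: "q \<in> ball w (t * r)"
            have "norm q < 1" using in_1[of q] wq[OF q] tr by simp
            then have "\<phi> q \<le> L * norm (q - w)" by (rule \<phi>_le)
            also have "\<dots> \<le> L * (t * r)" using q assms by (intro mult_left_mono) (auto simp: dist_norm norm_minus_commute)
            finally show "\<phi> q \<le> L * (t * r)" .
          qed
          have "ball w (t * r) \<noteq> {}" using tr by simp
          from less_cSUP_iff[OF this bdd] SUP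
          obtain p where p: "p \<in> ball w (t * r)" "\<eta> * (t * r) / 2 < \<phi> p" by blast
          have "ball p (\<beta> * (t * r)) \<subseteq> E"
          proof
            fix q assume "q \<in> ball p (\<beta> * (t * r))"
            then have q: "norm (q - p) < \<beta> * (t * r)" by (simp add: dist_norm norm_minus_commute)
            have \<beta>tr: "\<beta> * (t * r) \<le> 1 * (t * r)" using \<beta> tr by (intro mult_right_mono) auto
            have qc: "norm (q - c) < 3 * (t * r)"
              using q \<beta>tr wq[OF p(1)] norm_triangle_ineq[of "q - p" "p - c"] by simp
            have pw: "norm (p - w) < t * r" using p(1) by (simp add: dist_norm norm_minus_commute)
            have n: "norm q < 1" "norm p < 1" using in_1[OF qc] in_1[of p] wq[OF p(1)] tr by simp_all
            have "norm (q - w) \<le> 2 * (t * r)"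
              using q \<beta>tr pw norm_triangle_ineq[of "q - p" "p - w"] by simp
            then have "L * norm (q - w) \<le> L * (2 * (t * r))" using assms by simp
            also have "\<dots> < r * (3 * L * t)" using mult_pos_pos[OF assms(1) tr(1)] by (simp add: ac_simps)
            finally have up: "\<phi> q < r * (3 * L * t)" using \<phi>_le[OF n(1)] by linarith
            have "\<phi> p - \<phi> q \<le> L * norm (p - q)" using lipD[OF n(2,1)] by simp
            also have "\<dots> \<le> L * (\<beta> * (t * r))" using q assms by (simp add: norm_minus_commute)
            also have "\<dots> = (4 * L * \<beta>) * (t * r) / 4" by simp
            also have "\<dots> \<le> \<eta> * (t * r) / 4" using \<beta>(3) tr by (intro divide_right_mono mult_right_mono) auto
            finally have "0 < \<phi> q" using p(2) mult_pos_pos[OF assms(4) tr(1)] by linarith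
            then show "q \<in> E" using up n in_r[OF qc] by (simp add: E_def dist_norm norm_minus_commute)
          qed
          then show ?thesis using wq[OF p(1)] by blast
        qed
        then obtain p where p: "\<And>c. c \<in> A \<Longrightarrow> norm (p c - c) < 2 * (t * r)" "\<And>c. c \<in> A \<Longrightarrow> ball (p c) (\<beta> * (t * r)) \<subseteq> E" by metis
        have cover: "A \<subseteq> (\<Union>i\<in>A. ball i (3 * (t * r)))" using tr by auto
        \<comment> \<open>Each selected ball of radius \<open>3 * (t * r)\<close> contains the ball
          that \<open>near\<close> attaches to its centre, as \<open>2 + \<beta> \<le> 3\<close>. So
          the attached balls are disjoint as well.\<close>
        obtain C where C: "C \<subseteq> A" "pairwise (\<lambda>i j. disjnt (ball i (3 * (t * r))) (ball j (3 * (t * r)))) C"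
          "A \<subseteq> (\<Union>i\<in>C. ball i (5 * (3 * (t * r))))"
        proof (rule Vitali_covering_lemma_balls[where S=A and K=A and a="\<lambda>i. i" and r="\<lambda>_. 3 * (t * r)" and B="3 * (t * r)"])
          show "0 < 3 * (t * r) \<and> 3 * (t * r) \<le> 3 * (t * r)" for i using tr by simp
        qed (rule cover, blast intro: that)
        define V where "V = unit_ball_vol (real D)"
        have V: "0 < V" by (simp add: V_def)
        have vol: "measure lebesgue (ball c s) = V * s ^ D" if "0 \<le> s" for c :: 'a and s
          using measure_lebesgue_ball[OF that, of c] by (simp add: V_def D_def del: measure_completion)
        define b where "b = V * (\<beta> * (t * r)) ^ D"
        have b: "0 < b" using V \<beta> tr by (simp add: b_def)
        have openE: "open E"
        proof -
          have "continuous_on (ball 0 1) \<phi>" using lip by (rule lipschitz_on_continuous_on)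
          from continuous_open_preimage[OF this open_ball open_greaterThanLessThan[of 0 "r * (3 * L * t)"]]
          have "open {x \<in> ball 0 1. 0 < \<phi> x \<and> \<phi> x < r * (3 * L * t)}" by (simp add: vimage_def Int_def)
          then show ?thesis unfolding E_def by (intro open_Int) auto
        qed
        have E: "E \<in> lmeasurable" using openE by (intro lmeasurable_open) (auto simp: E_def)
        have card_le: "real (card F) * b \<le> measure lebesgue E" if F: "finite F" "F \<subseteq> C" for F
        proof -
          have "real (card F) * b = (\<Sum>c\<in>F. measure lebesgue (ball (p c) (\<beta> * (t * r))))"
            using \<beta> tr by (simp add: vol b_def del: measure_completion)
          also have "\<dots> = measure lebesgue (\<Union>c\<in>F. ball (p c) (\<beta> * (t * r)))"
          proof (rule measure_finite_Union[symmetric])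
            show "disjoint_family_on (\<lambda>c. ball (p c) (\<beta> * (t * r))) F"
              unfolding disjoint_family_on_def
            proof (intro ballI impI)
              fix i j assume ij: "i \<in> F" "j \<in> F" "i \<noteq> j"
              have sub: "ball (p i) (\<beta> * (t * r)) \<subseteq> ball i (3 * (t * r))" if "i \<in> F" for i
              proof
                fix q assume q: "q \<in> ball (p i) (\<beta> * (t * r))"
                have "\<beta> * (t * r) \<le> 1 * (t * r)" using \<beta> tr by (intro mult_right_mono) auto
                moreover have "norm (p i - i) < 2 * (t * r)" using p(1) that F C by blast
                ultimately show "q \<in> ball i (3 * (t * r))"
                  using q norm_triangle_ineq[of "q - p i" "p i - i"] by (simp add: dist_norm norm_minus_commute)
              qed
              have "disjnt (ball i (3 * (t * r))) (ball j (3 * (t * r)))" using C(2) ij F by (auto simp: pairwise_def)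
              then show "ball (p i) (\<beta> * (t * r)) \<inter> ball (p j) (\<beta> * (t * r)) = {}"
                using sub[OF ij(1)] sub[OF ij(2)] by (auto simp: disjnt_def)
            qed
          qed (use F emeasure_lborel_ball_finite in \<open>auto simp: less_top\<close>)
          also have "\<dots> \<le> measure lebesgue E"
          proof (rule measure_mono_fmeasurable[OF _ _ E])
            show "(\<Union>c\<in>F. ball (p c) (\<beta> * (t * r))) \<subseteq> E" using F C(1) p(2) by blast
            show "(\<Union>c\<in>F. ball (p c) (\<beta> * (t * r))) \<in> sets lebesgue"
              using F by (intro sets.finite_UN) auto
          qed
          finally show ?thesis .
        qed
        \<comment> \<open>Each centre uses up the measure \<open>b\<close> inside \<open>E\<close>,
          whose measure is finite.\<close>
        have "finite C"
        proof (rule ccontr)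
          assume "infinite C"
          obtain N where N: "measure lebesgue E / b < real N" using reals_Archimedean2 by blast
          obtain F where F: "F \<subseteq> C" "finite F" "card F = N" using infinite_arbitrarily_large[OF \<open>infinite C\<close>] by blast
          show False using card_le[OF F(2,1)] N F(3) b by (simp add: field_simps)
        qed
        have "measure lebesgue A \<le> measure lebesgue (\<Union>i\<in>C. ball i (5 * (3 * (t * r))))"
        proof (rule measure_mono_fmeasurable[OF C(3)])
          show "A \<in> sets lebesgue" unfolding A_def using open\<Omega> by auto
          show "(\<Union>i\<in>C. ball i (5 * (3 * (t * r)))) \<in> lmeasurable"
            using \<open>finite C\<close> by (intro lmeasurable_open bounded_UN open_UN) auto
        qed
        also have "\<dots> \<le> (\<Sum>i\<in>C. measure lebesgue (ball i (5 * (3 * (t * r)))))"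
          using \<open>finite C\<close> by (intro measure_UNION_le) auto
        also have "\<dots> = real (card C) * (V * (5 * (3 * (t * r))) ^ D)" using tr by (simp add: vol del: measure_completion)
        also have "\<dots> = real (card C) * b * (15 / \<beta>) ^ D"
          using \<beta> by (simp add: b_def power_mult_distrib power_divide)
        also have "\<dots> \<le> measure lebesgue E * (15 / \<beta>) ^ D"
          using card_le[OF \<open>finite C\<close>] \<beta> by (intro mult_right_mono) auto
        also have "\<dots> \<le> (\<Lambda> * (3 * L * t) * (V * r ^ D)) * (15 / \<beta>) ^ D"
          using E_le \<beta> r by (intro mult_right_mono) (auto simp: vol simp del: measure_completion)
        finally have "\<mu> * (V * (r / 2) ^ D) \<le> (\<Lambda> * (3 * L * t) * (V * r ^ D)) * (15 / \<beta>) ^ D"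
          using dens r by (simp add: A_def vol del: measure_completion)
        also have "\<dots> \<le> (\<mu> * (\<beta> / 30) ^ D / 2 * (V * r ^ D)) * (15 / \<beta>) ^ D"
          using t3 V r \<beta> by (intro mult_right_mono) auto
        also have "\<dots> = \<mu> * (V * (r / 2) ^ D) / 2"
        proof -
          have "(\<beta> / 30) ^ D * (15 / \<beta>) ^ D = (1/2) ^ D" using \<beta> by (simp flip: power_mult_distrib)
          then have "(\<mu> * (\<beta> / 30) ^ D / 2 * (V * r ^ D)) * (15 / \<beta>) ^ D = \<mu> * (V * (r ^ D * (1/2) ^ D)) / 2"
            by (simp add: ac_simps)
          then show ?thesis by (simp flip: power_mult_distrib)
        qed
        finally have "\<mu> * (V * (r / 2) ^ D) \<le> \<mu> * (V * (r / 2) ^ D) / 2" .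
        moreover have "0 < \<mu> * (V * (r / 2) ^ D)" using assms V r by simp
        ultimately show False by linarith
      qed
    qed
  qed (use t in auto)
qed

theorem theorem1p3:
  fixes L \<kappa> \<mu> \<Lambda> \<eta> :: real
  assumes "L > 0" and "\<kappa> > 0" and "\<mu> > 0" and "\<Lambda> > 0" and "\<eta> > 0"
  shows "\<exists>M \<delta> \<rho> R :: real. M > 0 \<and> 0 < \<delta> \<and> \<delta> \<le> \<eta> \<and> 0 < \<rho> \<and> \<rho> < R \<and> R \<le> 1 \<and>
    (\<forall>(\<Omega> :: (real ^ 'n) set) (\<phi> :: real ^ 'n \<Rightarrow> real).
       open \<Omega> \<and> \<Omega> \<subseteq> ball 0 1 \<and> 0 \<in> frontier \<Omega> \<and>
       continuous_on (ball 0 1) \<phi> \<and>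
       (\<forall>x\<in>\<Omega>. \<phi> x > 0) \<and> (\<forall>x\<in>ball 0 1 - \<Omega>. \<phi> x = 0) \<and>
       L-lipschitz_on (ball 0 1) \<phi> \<and>
       (\<forall>x\<in>ball 0 (1/2). \<phi> x \<ge> \<kappa> * infdist x (ball 0 1 - \<Omega>)) \<and>
       distr_laplacian_nonneg_on \<phi> (ball 0 1) \<and>
       (\<forall>x\<^sub>0\<in>frontier \<Omega> \<inter> ball 0 1. \<forall>r. 0 < r \<and> r < 1 - norm x\<^sub>0 \<longrightarrow>
          measure lebesgue (ball x\<^sub>0 r - \<Omega>) \<ge> \<mu> * measure lebesgue (ball x\<^sub>0 r)) \<and>
       (\<forall>x\<^sub>0\<in>frontier \<Omega> \<inter> ball 0 1. \<forall>r. 0 < r \<and> r < 1 - norm x\<^sub>0 \<longrightarrow>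
          (\<forall>t>0. measure lebesgue ({x \<in> ball 0 1. 0 < \<phi> x \<and> \<phi> x < r * t} \<inter> ball x\<^sub>0 r)
                   \<le> \<Lambda> * t * measure lebesgue (ball (0 :: real ^ 'n) r))) \<and>
       (\<forall>x\<^sub>0\<in>frontier \<Omega> \<inter> ball 0 1. \<forall>r. 0 < r \<and> r < 1 - norm x\<^sub>0 \<longrightarrow>
          (SUP x\<in>ball x\<^sub>0 r. \<phi> x) \<ge> \<eta> * r)
       \<longrightarrow>
       (\<forall>u v :: real ^ 'n \<Rightarrow> real.
          continuous_on (ball 0 1) u \<and> continuous_on (ball 0 1) v \<and>
          (\<forall>x\<in>ball 0 1. u x \<ge> 0) \<and> (\<forall>x\<in>ball 0 1. v x \<ge> 0) \<and>
          harmonic_on u (\<Omega> \<inter> ball 0 1) \<and> harmonic_on v (\<Omega> \<inter> ball 0 1) \<and>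
          (\<forall>x\<in>ball 0 1 - \<Omega>. u x = 0) \<and> (\<forall>x\<in>ball 0 1 - \<Omega>. v x = 0) \<and>
          (\<exists>P\<in>ball 0 R \<inter> {x \<in> ball 0 1. \<phi> x > \<delta> * R}. u P = v P)
          \<longrightarrow> (\<forall>x\<in>ball 0 \<rho>. 1 / M * v x \<le> u x \<and> u x \<le> M * v x)))"
proof -
  obtain \<theta> where \<theta>: "0 < \<theta>" "\<theta> \<le> 1" and exterior: "\<And>\<Omega> (\<phi> :: real ^ 'n \<Rightarrow> real) z r.
    open \<Omega> \<and> L-lipschitz_on (ball 0 1) \<phi> \<and> (\<forall>x\<in>ball 0 1 - \<Omega>. \<phi> x = 0) \<and>
    (\<forall>x\<^sub>0\<in>frontier \<Omega> \<inter> ball 0 1. \<forall>r. 0 < r \<and> r < 1 - norm x\<^sub>0 \<longrightarrow>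
       measure lebesgue (ball x\<^sub>0 r - \<Omega>) \<ge> \<mu> * measure lebesgue (ball x\<^sub>0 r)) \<and>
    (\<forall>x\<^sub>0\<in>frontier \<Omega> \<inter> ball 0 1. \<forall>r. 0 < r \<and> r < 1 - norm x\<^sub>0 \<longrightarrow>
       (\<forall>t>0. measure lebesgue ({x \<in> ball 0 1. 0 < \<phi> x \<and> \<phi> x < r * t} \<inter> ball x\<^sub>0 r)
                \<le> \<Lambda> * t * measure lebesgue (ball (0 :: real ^ 'n) r))) \<and>
    (\<forall>x\<^sub>0\<in>frontier \<Omega> \<inter> ball 0 1. \<forall>r. 0 < r \<and> r < 1 - norm x\<^sub>0 \<longrightarrow> (SUP x\<in>ball x\<^sub>0 r. \<phi> x) \<ge> \<eta> * r) \<and>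
    z \<in> frontier \<Omega> \<and> norm z < 1/2 \<and> 0 < r \<and> r \<le> 1/4 \<Longrightarrow> \<exists>c. ball c (\<theta> * r) \<subseteq> ball z r - \<Omega>"
    using exterior_ball_of_density[where 'a="real ^ 'n", OF assms(1,3-5)] by blast
  \<comment> \<open>\<open>\<nu>\<close> becomes the \<delta> of the statement. The constants \<mu>
    and \<Lambda> act through \<open>\<theta>\<close>.\<close>
  obtain R \<nu> \<rho> M where \<rho>: "0 < \<rho>" "\<rho> < R" "R \<le> 1" and \<nu>: "0 < \<nu>" "\<nu> \<le> \<eta>" and M: "0 < M"
    and compare: "\<And>\<Omega> (\<phi> :: real ^ 'n \<Rightarrow> real) u v P x. nice_domain L \<kappa> \<theta> \<Omega> \<phi> \<and> nonneg_solution \<Omega> u \<and> nonneg_solution \<Omega> v \<and>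
      norm P < R \<and> \<nu> * R < \<phi> P \<and> u P = v P \<and> norm x < \<rho> \<Longrightarrow> u x \<le> M * v x"
    using one_sided_comparison[where 'a="real ^ 'n", OF assms(1,2) \<theta> assms(5)] by blast
  show ?thesis
  proof (rule exI[of _ M], rule exI[of _ \<nu>], rule exI[of _ \<rho>], rule exI[of _ R], intro conjI M \<nu> \<rho> allI impI, elim conjE, goal_cases)
    case (1 \<Omega> \<phi> u v)
    note open\<Omega> = \<open>open \<Omega>\<close> and sub = \<open>\<Omega> \<subseteq> ball 0 1\<close> and cont = \<open>continuous_on (ball 0 1) \<phi>\<close>
      and lap = \<open>distr_laplacian_nonneg_on \<phi> (ball 0 1)\<close>
    have nice: "nice_domain L \<kappa> \<theta> \<Omega> \<phi>"
    proof
      show "submean_at \<phi> x" if "x \<in> \<Omega>" for x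
      proof -
        have x: "norm x < 1" using that sub by auto
        have "\<phi> x \<le> avg \<phi> x T" if T: "0 < T" "T < (1 - norm x) / real DIM(real ^ 'n)" for T
        proof (rule le_avg_distr[OF open_ball cont lap T(1)])
          have "T * real DIM(real ^ 'n) < 1 - norm x" using T by (simp add: field_simps)
          then show "cball x (T * real DIM(real ^ 'n)) \<subseteq> ball 0 1" by (simp add: cball_subset_ball_iff)
        qed
        moreover have "0 < (1 - norm x) / real DIM(real ^ 'n)" using x by simp
        ultimately show ?thesis unfolding submean_at_def by blast
      qed
      show "\<exists>c. ball c (\<theta> * r) \<subseteq> ball z r - \<Omega>" if "z \<in> frontier \<Omega>" "norm z < 1/2" "0 < r" "r \<le> 1/4" for z r
        by (rule exterior[of \<Omega> \<phi>]) (intro conjI; fact)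
      show "L-lipschitz_on (ball 0 1) \<phi>" "0 \<in> frontier \<Omega>" by fact+
      show "0 < \<phi> x" if "x \<in> \<Omega>" for x using \<open>\<forall>x\<in>\<Omega>. 0 < \<phi> x\<close> that by blast
      show "\<phi> x = 0" if "x \<in> ball 0 1" "x \<notin> \<Omega>" for x using \<open>\<forall>x\<in>ball 0 1 - \<Omega>. \<phi> x = 0\<close> that by blast
      show "\<kappa> * infdist x (ball 0 1 - \<Omega>) \<le> \<phi> x" if "x \<in> ball 0 (1/2)" for x
        using \<open>\<forall>x\<in>ball 0 (1/2). \<kappa> * infdist x (ball 0 1 - \<Omega>) \<le> \<phi> x\<close> that by blast
    qed (use assms \<theta> open\<Omega> sub in auto)
    have "\<Omega> \<inter> ball 0 1 = \<Omega>" using sub by blast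
    then have mv: "mean_value_on u \<Omega>" "mean_value_on v \<Omega>"
      using mean_value_on_harmonic[OF open\<Omega>] \<open>harmonic_on u (\<Omega> \<inter> ball 0 1)\<close> \<open>harmonic_on v (\<Omega> \<inter> ball 0 1)\<close> by simp_all
    have sol: "nonneg_solution \<Omega> u" "nonneg_solution \<Omega> v" unfolding nonneg_solution_def by (intro conjI; fact)+
    obtain P where P: "norm P < R" "\<nu> * R < \<phi> P" "u P = v P"
      using \<open>\<exists>P\<in>ball 0 R \<inter> {x \<in> ball 0 1. \<nu> * R < \<phi> x}. u P = v P\<close> by auto
    show ?case
    proof
      fix x :: "real ^ 'n" assume "x \<in> ball 0 \<rho>"
      then have "norm x < \<rho>" by simp
      \<comment> \<open>The hypotheses on \<open>u\<close> and \<open>v\<close>, including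
        \<open>u P = v P\<close>, are symmetric, so the one-sided comparison applies in both
        orders.\<close>
      then have "u x \<le> M * v x" "v x \<le> M * u x"
        using compare[of \<Omega> \<phi> u v P x] compare[of \<Omega> \<phi> v u P x] nice sol P by auto
      then show "1 / M * v x \<le> u x \<and> u x \<le> M * v x" using M by (simp add: field_simps)
    qed
  qed
qed

end
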